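(* Let $n\ge1$, let $\Omega\subset\mathbb{H}^{n+1}$ be a smooth uniformly h-convex bounded domain, and for $\rho\ge0$ let $\Omega_\rho=\{X\in\mathbb{H}^{n+1}:d_{\mathbb{H}^{n+1}}(X,\Omega)\le\rho\}$. Then $$\begin{aligned}\mathrm{Vol}_w(\Omega_\rho)-\mathrm{Vol}_w(\Omega)=&\sum_{k=0}^n\left(\int_{\partial\Omega}\cosh r\,\sigma_k(\tilde\kappa)\,d\mu\right)\int_0^\rho e^{(n-k+1)t}\sinh^kt\,dt\\&-\sum_{k=0}^n\left(\int_{\partial\Omega}(\cosh r-\tilde u)\,\sigma_k(\tilde\kappa)\,d\mu\right)\int_0^\rho e^{(n-k)t}\sinh^{k+1}t\,dt .\end{aligned}$$ Equivalently, $$\mathrm{Vol}_w(\Omega_\rho)=\mathrm{Vol}_w(\Omega)\,e^{(n+1)\rho}+\sum_{k=0}^n\frac1{k+1}\left(\int_{\partial\Omega}(\cosh r-\tilde u)\,\sigma_k(\tilde\kappa)\,d\mu\right)e^{(n-k)\rho}\sinh^{k+1}\rho .$$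
   Context: $\mathbb{H}^{n+1}$ is hyperbolic space of curvature $-1$ with a fixed origin; $r$ is the distance to the origin, and $\mathrm{Vol}_w(\Omega)=\int_\Omega\cosh r\,dv$. On $\partial\Omega$ with outward unit normal $\nu$ and area element $d\mu$: $\tilde u=\langle V,\nu\rangle$ with $V=\sinh r\,\partial_r$; $\kappa_i$ are the principal curvatures (positive for geodesic spheres), $\tilde\kappa_i=\kappa_i-1$; $\sigma_k$ is the $k$-th elementary symmetric function, $\sigma_0=1$. A smooth bounded domain (compact, connected, nonempty interior, smooth boundary) is uniformly h-convex if for some $\delta>0$ all $\kappa_i>1+\delta$ on its boundary. *)

theory Defs
  imports "HOL-Analysis.Analysis"
begin

section \<open>Smooth maps on open sets\<close>

fun higher_differentiable_on ::
    "'a set \<Rightarrow> ('a::real_normed_vector \<Rightarrow> 'b::real_normed_vector) \<Rightarrow> nat \<Rightarrow> bool" where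
  "higher_differentiable_on U f 0 \<longleftrightarrow> continuous_on U f"
| "higher_differentiable_on U f (Suc m) \<longleftrightarrow>
     (\<forall>x\<in>U. f differentiable (at x)) \<and>
     (\<forall>v. higher_differentiable_on U (\<lambda>x. frechet_derivative f (at x) v) m)"

definition smooth_on ::
    "'a set \<Rightarrow> ('a::real_normed_vector \<Rightarrow> 'b::real_normed_vector) \<Rightarrow> bool" where
  "smooth_on U f \<longleftrightarrow> (\<forall>m. higher_differentiable_on U f m)"


section \<open>The hyperboloid model of hyperbolic space\<close>

text \<open>
  A point of Minkowski space is written \<open>(x, t)\<close> with \<open>t\<close> the time coordinate.
  Hyperbolic space of dimension \<open>CARD('m)\<close> is the upper sheet of the hyperboloid,
  with the Riemannian metric induced by the Lorentz form.
  Its tangent space at \<open>p\<close> is the Lorentz-orthogonal complement of \<open>p\<close>.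
\<close>

type_synonym 'm minkowski = "(real^'m) \<times> real"

definition lorentz :: "'m::finite minkowski \<Rightarrow> 'm minkowski \<Rightarrow> real" where
  "lorentz X Y = fst X \<bullet> fst Y - snd X * snd Y"

definition hyperbolic_space :: "'m::finite minkowski set" where
  "hyperbolic_space = {X. lorentz X X = -1 \<and> snd X > 0}"

definition hyp_origin :: "'m::finite minkowski" where
  "hyp_origin = (0, 1)"

definition hyp_dist :: "'m::finite minkowski \<Rightarrow> 'm minkowski \<Rightarrow> real" where
  "hyp_dist X Y = arcosh (- lorentz X Y)"

definition hyp_radius :: "'m::finite minkowski \<Rightarrow> real" where
  "hyp_radius X = hyp_dist hyp_origin X"

text \<open>The point at distance \<open>t\<close> on the geodesic leaving \<open>p\<close> with unit velocity \<open>v\<close>.\<close>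

definition hyp_geodesic :: "'m::finite minkowski \<Rightarrow> 'm minkowski \<Rightarrow> real \<Rightarrow> 'm minkowski" where
  "hyp_geodesic p v t = cosh t *\<^sub>R p + sinh t *\<^sub>R v"

text \<open>
  The field \<open>\<partial>\<^sub>r\<close> is the velocity of the radial geodesics
  \<open>s \<mapsto> (sinh s *\<^sub>R \<theta>, cosh s)\<close>, where \<open>\<theta>\<close> is a Euclidean unit vector.
  At the origin its value does not matter, because \<open>V\<close> vanishes there.
\<close>

definition radial_unit :: "'m::finite minkowski \<Rightarrow> 'm minkowski" where
  "radial_unit X = (cosh (hyp_radius X) *\<^sub>R sgn (fst X), sinh (hyp_radius X))"

definition radial_field :: "'m::finite minkowski \<Rightarrow> 'm minkowski" where
  "radial_field X = sinh (hyp_radius X) *\<^sub>R radial_unit X"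

text \<open>The closed \<open>\<rho>\<close>-neighbourhood; it is meant for nonempty \<open>\<Omega>\<close>.\<close>

definition hyp_parallel_set :: "'m::finite minkowski set \<Rightarrow> real \<Rightarrow> 'm minkowski set" where
  "hyp_parallel_set \<Omega> \<rho> = {X \<in> hyperbolic_space. (INF Y\<in>\<Omega>. hyp_dist X Y) \<le> \<rho>}"


section \<open>Weighted volume\<close>

text \<open>Determinant of the matrix of the induced metric in the parametrization \<open>\<phi>\<close>.\<close>

definition gram_det :: "(real^'d::finite \<Rightarrow> 'm::finite minkowski) \<Rightarrow> real^'d \<Rightarrow> real" where
  "gram_det \<phi> x =
     det ((\<chi> i j. lorentz (frechet_derivative \<phi> (at x) (axis i 1))
                           (frechet_derivative \<phi> (at x) (axis j 1))) :: real^'d^'d)"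

text \<open>A global parametrization of hyperbolic space.\<close>

definition hyp_lift :: "real^'m::finite \<Rightarrow> 'm minkowski" where
  "hyp_lift x = (x, sqrt (1 + x \<bullet> x))"

definition hyp_volume :: "'m::finite minkowski measure" where
  "hyp_volume = distr (density lborel (\<lambda>x. ennreal (sqrt (gram_det hyp_lift x)))) borel hyp_lift"

definition Vol_w :: "'m::finite minkowski set \<Rightarrow> real" where
  "Vol_w \<Omega> = (LINT X:\<Omega>|hyp_volume. cosh (hyp_radius X))"


section \<open>Smooth bounded domains\<close>

definition hyp_frontier :: "'m::finite minkowski set \<Rightarrow> 'm minkowski set" where
  "hyp_frontier \<Omega> = top_of_set hyperbolic_space frontier_of \<Omega>"

text \<open>
  Near each boundary point, the set is a sublevel set of a smooth function
  whose differential does not vanish on the tangent spaces of hyperbolic space.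
\<close>

definition smooth_boundary :: "'m::finite minkowski set \<Rightarrow> bool" where
  "smooth_boundary \<Omega> \<longleftrightarrow>
     (\<forall>p \<in> hyp_frontier \<Omega>. \<exists>W (f :: 'm minkowski \<Rightarrow> real).
        open W \<and> p \<in> W \<and> smooth_on W f \<and>
        \<Omega> \<inter> W = {X \<in> hyperbolic_space \<inter> W. f X \<le> 0} \<and> f p = 0 \<and>
        (\<forall>X \<in> hyperbolic_space \<inter> W.
           \<exists>v. lorentz X v = 0 \<and> frechet_derivative f (at X) v \<noteq> 0))"

definition smooth_bounded_domain :: "'m::finite minkowski set \<Rightarrow> bool" where
  "smooth_bounded_domain \<Omega> \<longleftrightarrow>
     \<Omega> \<subseteq> hyperbolic_space \<and> compact \<Omega> \<and> connected \<Omega> \<and>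
     top_of_set hyperbolic_space interior_of \<Omega> \<noteq> {} \<and> smooth_boundary \<Omega>"


section \<open>Geometry of the boundary\<close>

definition tangent_space :: "'a::real_normed_vector set \<Rightarrow> 'a \<Rightarrow> 'a set" where
  "tangent_space S p =
     {v. \<exists>\<gamma> \<epsilon>. \<epsilon> > 0 \<and> smooth_on {-\<epsilon><..<\<epsilon>} \<gamma> \<and> \<gamma> ` {-\<epsilon><..<\<epsilon>} \<subseteq> S \<and> \<gamma> 0 = p \<and>
           (\<gamma> has_vector_derivative v) (at (0::real))}"

definition outward_normal :: "'m::finite minkowski set \<Rightarrow> 'm minkowski \<Rightarrow> 'm minkowski" where
  "outward_normal \<Omega> p =
     (THE \<nu>. lorentz p \<nu> = 0 \<and> lorentz \<nu> \<nu> = 1 \<and>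
        (\<forall>v \<in> tangent_space (hyp_frontier \<Omega>) p. lorentz v \<nu> = 0) \<and>
        (\<forall>\<^sub>F t in at_right 0. hyp_geodesic p \<nu> t \<notin> \<Omega>))"

definition support_fun :: "'m::finite minkowski set \<Rightarrow> 'm minkowski \<Rightarrow> real" where
  "support_fun \<Omega> p = lorentz (radial_field p) (outward_normal \<Omega> p)"

text \<open>
  The shape operator \<open>v \<mapsto> \<nabla>\<^sub>v \<nu>\<close>, for \<open>v\<close> tangent to the boundary.
  The Levi-Civita connection of the hyperboloid is the flat derivative \<open>D\<close>
  followed by the Lorentz-orthogonal projection to the tangent space at \<open>p\<close>.
  A derivative within the boundary is determined only on vectors tangent to the boundary,
  and the operator is used only there.
  The sign makes the principal curvatures of geodesic spheres positive.
\<close>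

definition shape_operator ::
    "'m::finite minkowski set \<Rightarrow> 'm minkowski \<Rightarrow> 'm minkowski \<Rightarrow> 'm minkowski" where
  "shape_operator \<Omega> p v =
     (let D = frechet_derivative (outward_normal \<Omega>) (at p within hyp_frontier \<Omega>) v
      in D + lorentz D p *\<^sub>R p)"

text \<open>
  From here on hyperbolic space has dimension \<open>CARD('n option) = CARD('n) + 1\<close> and
  the boundary has dimension \<open>CARD('n)\<close>.
  Principal curvatures are the eigenvalues of the shape operator for an orthonormal basis
  of tangent vectors. They are unique up to a permutation of the index type,
  and only permutation-invariant expressions in them are used.
\<close>

definition principal_curvatures ::
    "('n::finite option) minkowski set \<Rightarrow> ('n option) minkowski \<Rightarrow> 'n \<Rightarrow> real" where
  "principal_curvatures \<Omega> p =
     (SOME \<kappa>. \<exists>e :: 'n \<Rightarrow> ('n option) minkowski.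
        (\<forall>i. e i \<in> tangent_space (hyp_frontier \<Omega>) p) \<and>
        (\<forall>i j. lorentz (e i) (e j) = (if i = j then 1 else 0)) \<and>
        (\<forall>i. shape_operator \<Omega> p (e i) = \<kappa> i *\<^sub>R e i))"

definition shifted_curvatures ::
    "('n::finite option) minkowski set \<Rightarrow> ('n option) minkowski \<Rightarrow> 'n \<Rightarrow> real" where
  "shifted_curvatures \<Omega> p i = principal_curvatures \<Omega> p i - 1"

definition elem_sym :: "nat \<Rightarrow> ('n::finite \<Rightarrow> real) \<Rightarrow> real" where
  "elem_sym k x = (\<Sum>I | card I = k. \<Prod>i\<in>I. x i)"

definition uniformly_h_convex :: "('n::finite option) minkowski set \<Rightarrow> bool" where
  "uniformly_h_convex \<Omega> \<longleftrightarrow>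
     (\<exists>\<delta>>0. \<forall>p \<in> hyp_frontier \<Omega>. \<forall>i. principal_curvatures \<Omega> p i > 1 + \<delta>)"

definition local_parametrization ::
    "('n::finite option) minkowski set \<Rightarrow> (real^'n) set \<Rightarrow> (real^'n \<Rightarrow> ('n option) minkowski) \<Rightarrow> bool"
  where
  "local_parametrization S U \<phi> \<longleftrightarrow>
     open U \<and> smooth_on U \<phi> \<and> (\<forall>x\<in>U. inj (frechet_derivative \<phi> (at x))) \<and>
     openin (top_of_set S) (\<phi> ` U) \<and> (\<exists>\<psi>. homeomorphism U (\<phi> ` U) \<phi> \<psi>)"

text \<open>
  The Riemannian area of a smooth hypersurface is the unique Borel measure that is given by
  \<open>sqrt (det g) dx\<close> in every local parametrization.
\<close>

definition area_measure :: "('n::finite option) minkowski set \<Rightarrow> ('n option) minkowski measure" where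
  "area_measure S =
     (THE M. sets M = sets (restrict_space borel S) \<and>
        (\<forall>U \<phi>. local_parametrization S U \<phi> \<longrightarrow>
           (\<forall>A \<in> sets borel. A \<subseteq> U \<longrightarrow>
              emeasure M (\<phi> ` A) = (\<integral>\<^sup>+x\<in>A. ennreal (sqrt (gram_det \<phi> x)) \<partial>lborel))))"

end

theory Submission
  imports Defs
begin

text \<open>
  In the hyperboloid model \<open>cosh r\<close> is the time coordinate, so \<open>Vol_w\<close> is the Lebesgue measure of
  the projection to space, and \<open>cosh r - u\<close> is the time coordinate of the future null vector
  \<open>l = p - \<nu>\<close>, where \<open>u\<close> is the support function. The horoball supporting the domain
  at \<open>p\<close> is \<open>{X. - \<langle>X, l\<rangle> \<le> 1}\<close>. Because all curvatures exceed 1, the projection of the domain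
  along each null direction is locally strictly convex, hence convex, so the domain is the
  intersection of these horoballs. It follows that \<open>\<Omega>\<^sub>\<rho>\<close> is the intersection of the horoballs
  \<open>{X. - \<langle>X, l\<rangle> \<le> exp \<rho>}\<close>, and that a point \<open>X\<close> lies in the plane of \<open>p\<close> and \<open>\<nu>\<close> whenever
  \<open>p\<close> maximizes \<open>- \<langle>X, l\<rangle>\<close>.

  Consequently the complement of the projected domain in the projection of \<open>\<Omega>\<^sub>\<rho>\<close> is swept out
  injectively by the points \<open>cosh t p + sinh t \<nu>\<close> with \<open>0 < t \<le> \<rho>\<close>, and the complement of the
  projected domain rescaled by \<open>exp \<rho>\<close> by the points \<open>(exp \<rho> - s) p + s \<nu>\<close> with
  \<open>0 < s \<le> sinh \<rho>\<close>. The Jacobian of \<open>a p + b \<nu>\<close> is the time coordinate of \<open>b' p + a' \<nu>\<close> times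
  \<open>\<Prod>\<^sub>i (a + b \<kappa>\<^sub>i)\<close>, and expanding it in \<open>\<kappa>\<^sub>i - 1\<close> turns the two decompositions into the two
  formulas. No Minkowski formulas are needed.
\<close>

section \<open>Calculus of smooth maps\<close>

text \<open>Both formulas come from one convex set, the intersection of the half-spaces
  \<open>- lorentz X (\<l> q) \<le> exp \<rho>\<close> over all boundary points \<open>q\<close>.
  The unit hyperboloid cuts it in the parallel set, the hyperboloid of radius exp \<rho> in the
  dilated domain. Raising the time coordinate over a fixed spatial point only makes the inequalities
  harder, so the second slice projects into the first. Over a spatial point in between, the highest
  point of the set is exp \<rho> p - s l with l = p - \<nu>; its Lorentz square - exp \<rho> (exp
  \<rho> - 2 s) lies above - exp (2 \<rho>) and is at most -1, which means 0 < s \<le> sinh \<rho>.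
  Along such a null segment the coefficients of p and \<nu> have the constant sum exp \<rho>, so the
  density is a polynomial in s, and the integral of s^k brings the factor 1 / (k + 1). The obstacle
  is the passage from pointwise curvature to global position. Projection along l turns the
  horospheres centred at l into affine hyperplanes, so that a Euclidean local-to-global theorem for
  compact connected sets applies. Its strict form makes the foot point p unique.\<close>

lemma higher_differentiable_on_cong:
  assumes "open U" "\<And>x. x \<in> U \<Longrightarrow> f x = g x" "higher_differentiable_on U f m"
  shows "higher_differentiable_on U g m"
  using assms(2,3)
proof (induction m arbitrary: f g)
  case 0
  then show ?case
    using continuous_on_cong[of U U f g] by simp
next
  case (Suc m)
  have d: "g differentiable (at x)" "frechet_derivative g (at x) = frechet_derivative f (at x)"
    if "x \<in> U" for x
  proof -
    have "(f has_derivative frechet_derivative f (at x)) (at x)"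
      using Suc.prems that by (simp add: frechet_derivative_works)
    then have "(g has_derivative frechet_derivative f (at x)) (at x)"
      using has_derivative_transform_within_open assms(1) that Suc.prems(1) by blast
    then show "g differentiable (at x)" "frechet_derivative g (at x) = frechet_derivative f (at x)"
      by (auto simp: differentiable_def frechet_derivative_at[symmetric])
  qed
  have "higher_differentiable_on U (\<lambda>x. frechet_derivative g (at x) v) m" for v
    by (rule Suc.IH[of "\<lambda>x. frechet_derivative f (at x) v"]) (use Suc.prems(2) d in auto)
  with d show ?case by simp
qed

text \<open>The definition differentiates with \<open>frechet_derivative\<close>; this rule accepts
  any explicit derivative on an open set, and the closure properties below are inductions through
  it.\<close>

lemma higher_differentiable_on_SucI:
  assumes "open U" "\<And>x. x \<in> U \<Longrightarrow> (f has_derivative f' x) (at x)"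
    and "\<And>v. higher_differentiable_on U (\<lambda>x. f' x v) m"
  shows "higher_differentiable_on U f (Suc m)"
proof -
  have "f' x = frechet_derivative f (at x)" if "x \<in> U" for x
    using assms(2)[OF that] by (rule frechet_derivative_at)
  then have "higher_differentiable_on U (\<lambda>x. frechet_derivative f (at x) v) m" for v
    by (intro higher_differentiable_on_cong[OF assms(1) _ assms(3)[of v]]) simp
  with assms(2) show ?thesis
    by (auto simp: differentiable_def)
qed

lemma higher_differentiable_on_SucD:
  assumes "higher_differentiable_on U f (Suc m)"
  shows "x \<in> U \<Longrightarrow> (f has_derivative frechet_derivative f (at x)) (at x)"
    and "higher_differentiable_on U (\<lambda>x. frechet_derivative f (at x) v) m"
  using assms by (auto simp: frechet_derivative_works)

lemma higher_differentiable_on_subset: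
  "higher_differentiable_on U f m \<Longrightarrow> V \<subseteq> U \<Longrightarrow> higher_differentiable_on V f m"
  by (induction m arbitrary: f) (auto intro: continuous_on_subset)

lemma higher_differentiable_on_imp_continuous_on:
  "higher_differentiable_on U f m \<Longrightarrow> continuous_on U f"
  by (cases m) (auto intro!: differentiable_imp_continuous_on differentiable_at_imp_differentiable_on)

lemma higher_differentiable_on_lower:
  "higher_differentiable_on U f (Suc m) \<Longrightarrow> higher_differentiable_on U f m"
proof (induction m arbitrary: f)
  case 0
  then show ?case
    using higher_differentiable_on_imp_continuous_on[OF 0] by simp
next
  case (Suc m)
  have "higher_differentiable_on U (\<lambda>x. frechet_derivative f (at x) v) m" for v
    using Suc by auto
  moreover have "\<forall>x\<in>U. f differentiable at x"
    using Suc.prems by simp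
  ultimately show ?case by simp
qed

lemma higher_differentiable_on_const:
  "open U \<Longrightarrow> higher_differentiable_on U (\<lambda>x. c) m"
proof (induction m arbitrary: c)
  case (Suc m)
  show ?case
    by (rule higher_differentiable_on_SucI[where f' = "\<lambda>x v. 0"]) (use Suc in auto)
qed simp

lemma higher_differentiable_on_bounded_linear:
  assumes "open U" "bounded_linear f"
  shows "higher_differentiable_on U f m"
proof (cases m)
  case 0
  then show ?thesis
    using assms by (auto intro: linear_continuous_on)
next
  case (Suc k)
  show ?thesis unfolding Suc
    by (rule higher_differentiable_on_SucI[where f' = "\<lambda>x. f"])
      (use assms in \<open>auto intro: bounded_linear_imp_has_derivative higher_differentiable_on_const\<close>)
qed

lemma higher_differentiable_on_compose_bounded_linear:
  assumes "open U" "bounded_linear L" "higher_differentiable_on U f m"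
  shows "higher_differentiable_on U (\<lambda>x. L (f x)) m"
  using assms(3)
proof (induction m arbitrary: f)
  case 0
  then show ?case
    using assms(2) by (auto intro: bounded_linear.continuous_on)
next
  case (Suc m)
  show ?case
    by (rule higher_differentiable_on_SucI[where f' = "\<lambda>x v. L (frechet_derivative f (at x) v)"])
      (use assms higher_differentiable_on_SucD[OF Suc.prems] Suc.IH in
        \<open>auto intro: bounded_linear.has_derivative\<close>)
qed

lemma higher_differentiable_on_add:
  assumes "open U" "higher_differentiable_on U f m" "higher_differentiable_on U g m"
  shows "higher_differentiable_on U (\<lambda>x. f x + g x) m"
  using assms(2,3)
proof (induction m arbitrary: f g)
  case 0
  then show ?case by (auto intro: continuous_on_add)
next
  case (Suc m)
  show ?case
    by (rule higher_differentiable_on_SucI[where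
          f' = "\<lambda>x v. frechet_derivative f (at x) v + frechet_derivative g (at x) v"])
      (use assms higher_differentiable_on_SucD[OF Suc.prems(1)]
        higher_differentiable_on_SucD[OF Suc.prems(2)] Suc.IH in
        \<open>auto intro: has_derivative_add\<close>)
qed

text \<open>The product rule reproduces \<open>f\<close> and \<open>g\<close> themselves beside
  their derivatives, hence the descent by \<open>higher_differentiable_on_lower\<close>. Products,
  scalings, inner products and the Lorentz form are all instances.\<close>

lemma higher_differentiable_on_bilinear:
  assumes "open U" "bounded_bilinear B"
    and "higher_differentiable_on U f m" "higher_differentiable_on U g m"
  shows "higher_differentiable_on U (\<lambda>x. B (f x) (g x)) m"
  using assms(3,4)
proof (induction m arbitrary: f g)
  case 0
  then show ?case using assms(2) by (auto intro: bounded_bilinear.continuous_on)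
next
  case (Suc m)
  show ?case
  proof (rule higher_differentiable_on_SucI[where
          f' = "\<lambda>x v. B (f x) (frechet_derivative g (at x) v) + B (frechet_derivative f (at x) v) (g x)"])
    show "((\<lambda>x. B (f x) (g x)) has_derivative
        (\<lambda>v. B (f x) (frechet_derivative g (at x) v) + B (frechet_derivative f (at x) v) (g x))) (at x)"
      if "x \<in> U" for x
      using bounded_bilinear.FDERIV[OF assms(2) higher_differentiable_on_SucD(1)[OF Suc.prems(1) that]
          higher_differentiable_on_SucD(1)[OF Suc.prems(2) that]] .
    show "higher_differentiable_on U
        (\<lambda>x. B (f x) (frechet_derivative g (at x) v) + B (frechet_derivative f (at x) v) (g x)) m" for v
      by (intro higher_differentiable_on_add assms(1) Suc.IH higher_differentiable_on_lower[OF Suc.prems(1)]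
          higher_differentiable_on_lower[OF Suc.prems(2)] higher_differentiable_on_SucD(2)[OF Suc.prems(1)]
          higher_differentiable_on_SucD(2)[OF Suc.prems(2)])
  qed (rule assms)
qed

lemmas higher_differentiable_on_mult =
  higher_differentiable_on_bilinear[OF _ bounded_bilinear_mult]
lemmas higher_differentiable_on_scaleR =
  higher_differentiable_on_bilinear[OF _ bounded_bilinear_scaleR]
lemmas higher_differentiable_on_inner =
  higher_differentiable_on_bilinear[OF _ bounded_bilinear_inner]

lemma higher_differentiable_on_minus:
  "open U \<Longrightarrow> higher_differentiable_on U f m \<Longrightarrow> higher_differentiable_on U (\<lambda>x. - f x) m"
  by (rule higher_differentiable_on_compose_bounded_linear[OF _ bounded_linear_minus[OF bounded_linear_ident]])

lemma higher_differentiable_on_sum: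
  assumes "open U" "\<And>i. i \<in> I \<Longrightarrow> higher_differentiable_on U (f i) m"
  shows "higher_differentiable_on U (\<lambda>x. \<Sum>i\<in>I. f i x) m"
proof (cases "finite I")
  case True
  then show ?thesis
    using assms(2) by (induction I rule: finite_induct)
      (auto intro: higher_differentiable_on_add higher_differentiable_on_const assms(1))
qed (simp add: higher_differentiable_on_const assms(1))

text \<open>The derivative of 1/f is a product of 1/f, f' and 1/f, so order m for 1/f itself gives
  order m + 1.\<close>

lemma higher_differentiable_on_inverse:
  fixes f :: "'a::real_normed_vector \<Rightarrow> real"
  assumes "open U" "higher_differentiable_on U f m" "\<And>x. x \<in> U \<Longrightarrow> f x \<noteq> 0"
  shows "higher_differentiable_on U (\<lambda>x. inverse (f x)) m"
  using assms(2)
proof (induction m)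
  case 0
  then show ?case using assms(3) by (auto intro: continuous_on_inverse)
next
  case (Suc m)
  show ?case
  proof (rule higher_differentiable_on_SucI[where
          f' = "\<lambda>x v. - (inverse (f x) * frechet_derivative f (at x) v * inverse (f x))"])
    show "((\<lambda>x. inverse (f x)) has_derivative
        (\<lambda>v. - (inverse (f x) * frechet_derivative f (at x) v * inverse (f x)))) (at x)" if "x \<in> U" for x
      by (rule Deriv.has_derivative_inverse[OF assms(3)[OF that] higher_differentiable_on_SucD(1)[OF Suc.prems that]])
    show "higher_differentiable_on U
        (\<lambda>x. - (inverse (f x) * frechet_derivative f (at x) v * inverse (f x))) m" for v
      by (intro higher_differentiable_on_minus higher_differentiable_on_mult assms(1) Suc.IH
          higher_differentiable_on_lower[OF Suc.prems] higher_differentiable_on_SucD(2)[OF Suc.prems])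
  qed (rule assms)
qed

lemma higher_differentiable_on_sqrt:
  fixes f :: "'a::real_normed_vector \<Rightarrow> real"
  assumes "open U" "higher_differentiable_on U f m" "\<And>x. x \<in> U \<Longrightarrow> f x > 0"
  shows "higher_differentiable_on U (\<lambda>x. sqrt (f x)) m"
  using assms(2)
proof (induction m)
  case 0
  then show ?case by (auto intro: continuous_on_real_sqrt)
next
  case (Suc m)
  have pos: "f x > 0" "sqrt (f x) \<noteq> 0" if "x \<in> U" for x
    using assms(3)[OF that] by auto
  show ?case
  proof (rule higher_differentiable_on_SucI[where
          f' = "\<lambda>x v. (1/2) * (frechet_derivative f (at x) v * inverse (sqrt (f x)))"])
    show "((\<lambda>x. sqrt (f x)) has_derivative
        (\<lambda>v. (1/2) * (frechet_derivative f (at x) v * inverse (sqrt (f x))))) (at x)" if "x \<in> U" for x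
      by (rule has_derivative_eq_rhs[OF has_derivative_real_sqrt[OF pos(1)[OF that]
              higher_differentiable_on_SucD(1)[OF Suc.prems that]]])
        (auto simp: divide_simps)
    show "higher_differentiable_on U
        (\<lambda>x. (1/2) * (frechet_derivative f (at x) v * inverse (sqrt (f x)))) m" for v
      by (intro higher_differentiable_on_mult higher_differentiable_on_inverse
          higher_differentiable_on_const assms(1) Suc.IH pos(2)
          higher_differentiable_on_lower[OF Suc.prems] higher_differentiable_on_SucD(2)[OF Suc.prems])
  qed (rule assms)
qed

text \<open>The definition fixes the direction of differentiation, while in the chain rule the
  direction G'(x) v moves with x. Expanding it in a basis leaves only derivatives of
  \<open>F\<close> in fixed directions.\<close>

lemma higher_differentiable_on_compose:
  fixes F :: "'b::euclidean_space \<Rightarrow> 'c::real_normed_vector"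
  assumes "open U" "open W" "G ` U \<subseteq> W"
    and "higher_differentiable_on W F m" "higher_differentiable_on U G m"
  shows "higher_differentiable_on U (\<lambda>x. F (G x)) m"
  using assms(4,5)
proof (induction m arbitrary: F)
  case 0
  then show ?case
    using assms(3) by (auto intro: continuous_on_compose2)
next
  case (Suc m)
  note F' = higher_differentiable_on_SucD[OF Suc.prems(1)]
  note G' = higher_differentiable_on_SucD[OF Suc.prems(2)]
  have expand: "frechet_derivative F (at (G x)) w
      = (\<Sum>b\<in>Basis. (w \<bullet> b) *\<^sub>R frechet_derivative F (at (G x)) b)" if "x \<in> U" for x w
  proof -
    have "linear (frechet_derivative F (at (G x)))"
      using F'(1)[of "G x"] assms(3) that has_derivative_linear by blast
    then have "frechet_derivative F (at (G x)) (\<Sum>b\<in>Basis. (w \<bullet> b) *\<^sub>R b)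
      = (\<Sum>b\<in>Basis. (w \<bullet> b) *\<^sub>R frechet_derivative F (at (G x)) b)"
      by (simp add: linear_sum linear_scale)
    then show ?thesis by (simp add: euclidean_representation)
  qed
  show ?case
  proof (rule higher_differentiable_on_SucI[where
          f' = "\<lambda>x v. \<Sum>b\<in>Basis. (frechet_derivative G (at x) v \<bullet> b) *\<^sub>R frechet_derivative F (at (G x)) b"])
    fix x assume "x \<in> U"
    have "((F \<circ> G) has_derivative frechet_derivative F (at (G x)) \<circ> frechet_derivative G (at x)) (at x)"
      using F'(1)[of "G x"] G'(1) assms(3) \<open>x \<in> U\<close> by (intro diff_chain_at) auto
    moreover have "frechet_derivative F (at (G x)) \<circ> frechet_derivative G (at x) =
      (\<lambda>v. \<Sum>b\<in>Basis. (frechet_derivative G (at x) v \<bullet> b) *\<^sub>R frechet_derivative F (at (G x)) b)"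
      by (rule ext) (simp add: expand[OF \<open>x \<in> U\<close>, symmetric])
    ultimately show "((\<lambda>x. F (G x)) has_derivative
       (\<lambda>v. \<Sum>b\<in>Basis. (frechet_derivative G (at x) v \<bullet> b) *\<^sub>R frechet_derivative F (at (G x)) b)) (at x)"
      by (simp add: o_def)
  next
    show "higher_differentiable_on U (\<lambda>x. \<Sum>b\<in>Basis.
        (frechet_derivative G (at x) v \<bullet> b) *\<^sub>R frechet_derivative F (at (G x)) b) m" for v
      by (intro higher_differentiable_on_sum higher_differentiable_on_scaleR
          higher_differentiable_on_inner higher_differentiable_on_const assms(1)
          G'(2) Suc.IH F'(2) higher_differentiable_on_lower[OF Suc.prems(2)])
  qed (rule assms)
qed

lemma higher_differentiable_on_Pair:
  assumes "open U" "higher_differentiable_on U f m" "higher_differentiable_on U g m"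
  shows "higher_differentiable_on U (\<lambda>x. (f x, g x)) m"
proof -
  have 1: "bounded_linear (\<lambda>a. (a, 0))" "bounded_linear (\<lambda>a. (0, a))"
    by (auto intro!: bounded_linear_Pair bounded_linear_ident bounded_linear_zero)
  show ?thesis
    using higher_differentiable_on_add[OF assms(1)
        higher_differentiable_on_compose_bounded_linear[OF assms(1) 1(1) assms(2)]
        higher_differentiable_on_compose_bounded_linear[OF assms(1) 1(2) assms(3)]]
    by simp
qed

lemma higher_differentiable_on_vec:
  fixes f :: "'i::finite \<Rightarrow> 'a::real_normed_vector \<Rightarrow> real"
  assumes "open U" "\<And>i. higher_differentiable_on U (f i) m"
  shows "higher_differentiable_on U (\<lambda>x. \<chi> i. f i x) m"
proof -
  have "(\<lambda>x. \<chi> i. f i x) = (\<lambda>x. \<Sum>i\<in>UNIV. f i x *\<^sub>R axis i 1)"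
    by (auto simp: vec_eq_iff axis_def if_distrib cong: if_cong)
  then show ?thesis
    by (auto intro!: higher_differentiable_on_sum higher_differentiable_on_scaleR
        higher_differentiable_on_const assms)
qed

section \<open>Symmetry of second derivatives\<close>

lemma second_difference_mean_value:
  fixes f :: "'a::euclidean_space \<Rightarrow> real"
  assumes "ball x e \<subseteq> U" "higher_differentiable_on U f 2"
    and h: "h > 0" "h * (norm v + norm w) < e"
  obtains s t where "0 < s" "s < h" "0 < t" "t < h"
    "f (x + h *\<^sub>R v + h *\<^sub>R w) - f (x + h *\<^sub>R v) - f (x + h *\<^sub>R w) + f x
      = h * h * frechet_derivative (\<lambda>y. frechet_derivative f (at y) v) (at (x + s *\<^sub>R v + t *\<^sub>R w)) w"
proof -
  have D: "higher_differentiable_on U f (Suc (Suc 0))"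
    using assms(2) by (simp add: numeral_2_eq_2)
  note f1 = higher_differentiable_on_SucD(1)[OF D]
  note f2 = higher_differentiable_on_SucD(1)[OF higher_differentiable_on_SucD(2)[OF D]]
  have inU: "x + s *\<^sub>R v + t *\<^sub>R w \<in> U" if "0 \<le> s" "s \<le> h" "0 \<le> t" "t \<le> h" for s t
  proof -
    have "norm (s *\<^sub>R v + t *\<^sub>R w) \<le> s * norm v + t * norm w"
      using that by (intro norm_triangle_le) simp
    also have "\<dots> \<le> h * norm v + h * norm w"
      using that by (intro add_mono mult_right_mono) auto
    also have "\<dots> < e" using h by (simp add: algebra_simps)
    finally have "x + s *\<^sub>R v + t *\<^sub>R w \<in> ball x e"
      by (metis add.assoc dist_0_norm dist_add_cancel add.right_neutral mem_ball)
    then show ?thesis using assms(1) by blast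
  qed
  \<comment> \<open>The second difference is the increment of \<open>g\<close> from 0 to
    \<open>h\<close>: the mean value theorem is applied to \<open>g\<close> in direction
    \<open>v\<close>, and then to the resulting derivative in direction \<open>w\<close>.\<close>
  define g where "g = (\<lambda>s. f (x + s *\<^sub>R v + h *\<^sub>R w) - f (x + s *\<^sub>R v))"
  have lin1: "frechet_derivative f (at y) (c *\<^sub>R a) = c * frechet_derivative f (at y) a"
    if "y \<in> U" for y c a
    using has_derivative_linear[OF f1[OF that]] by (simp add: linear_scale)
  have lin2: "frechet_derivative (\<lambda>y. frechet_derivative f (at y) b) (at y) (c *\<^sub>R a) =
      c * frechet_derivative (\<lambda>y. frechet_derivative f (at y) b) (at y) a"
    if "y \<in> U" for y c a b
    using has_derivative_linear[OF f2[OF that]] by (simp add: linear_scale)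
  have d1: "((\<lambda>s. f (x + s *\<^sub>R v + t *\<^sub>R w)) has_real_derivative
      frechet_derivative f (at (x + s *\<^sub>R v + t *\<^sub>R w)) v) (at s)"
    if "0 \<le> s" "s \<le> h" "0 \<le> t" "t \<le> h" for s t
  proof -
    have "((\<lambda>s. x + s *\<^sub>R v + t *\<^sub>R w) has_derivative (\<lambda>r. r *\<^sub>R v)) (at s)"
      by (auto intro!: derivative_eq_intros)
    from diff_chain_at[OF this f1[OF inU[OF that]]] show ?thesis
      by (simp add: has_field_derivative_def o_def lin1[OF inU[OF that]] mult_commute_abs)
  qed
  have d2: "((\<lambda>t. frechet_derivative f (at (x + s *\<^sub>R v + t *\<^sub>R w)) v) has_real_derivative
      frechet_derivative (\<lambda>y. frechet_derivative f (at y) v) (at (x + s *\<^sub>R v + t *\<^sub>R w)) w) (at t)"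
    if "0 \<le> s" "s \<le> h" "0 \<le> t" "t \<le> h" for s t
  proof -
    have "((\<lambda>t. x + s *\<^sub>R v + t *\<^sub>R w) has_derivative (\<lambda>r. r *\<^sub>R w)) (at t)"
      by (auto intro!: derivative_eq_intros)
    from diff_chain_at[OF this f2[OF inU[OF that]]] show ?thesis
      by (simp add: has_field_derivative_def o_def lin2[OF inU[OF that]] mult_commute_abs)
  qed
  have "\<exists>s>0. s < h \<and> g h - g 0 = (h - 0) *
      (frechet_derivative f (at (x + s *\<^sub>R v + h *\<^sub>R w)) v - frechet_derivative f (at (x + s *\<^sub>R v)) v)"
  proof (rule MVT2[OF h(1)])
    show "(g has_real_derivative frechet_derivative f (at (x + s *\<^sub>R v + h *\<^sub>R w)) v
        - frechet_derivative f (at (x + s *\<^sub>R v)) v) (at s)" if "0 \<le> s" "s \<le> h" for s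
      unfolding g_def using DERIV_diff[OF d1[of s h] d1[of s 0]] that h by simp
  qed
  then obtain s where s: "0 < s" "s < h" "g h - g 0 = h *
      (frechet_derivative f (at (x + s *\<^sub>R v + h *\<^sub>R w)) v - frechet_derivative f (at (x + s *\<^sub>R v + 0 *\<^sub>R w)) v)"
    by auto
  have "\<exists>t>0. t < h \<and> frechet_derivative f (at (x + s *\<^sub>R v + h *\<^sub>R w)) v
      - frechet_derivative f (at (x + s *\<^sub>R v + 0 *\<^sub>R w)) v = (h - 0) *
     frechet_derivative (\<lambda>y. frechet_derivative f (at y) v) (at (x + s *\<^sub>R v + t *\<^sub>R w)) w"
    by (rule MVT2[OF h(1)]) (use d2 s in auto)
  then obtain t where "0 < t" "t < h" "frechet_derivative f (at (x + s *\<^sub>R v + h *\<^sub>R w)) v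
      - frechet_derivative f (at (x + s *\<^sub>R v + 0 *\<^sub>R w)) v = h *
     frechet_derivative (\<lambda>y. frechet_derivative f (at y) v) (at (x + s *\<^sub>R v + t *\<^sub>R w)) w"
    by auto
  with s that show ?thesis
    by (auto simp: g_def algebra_simps)
qed

text \<open>The second difference divided by h^2 is symmetric in \<open>v\<close> and
  \<open>w\<close> and, by the mean value form, tends to either mixed derivative, as these are
  continuous at \<open>x\<close>.\<close>

lemma symmetric_second_derivative:
  fixes f :: "'a::euclidean_space \<Rightarrow> real"
  assumes "open U" "x \<in> U" "higher_differentiable_on U f 2"
  shows "frechet_derivative (\<lambda>y. frechet_derivative f (at y) v) (at x) w
       = frechet_derivative (\<lambda>y. frechet_derivative f (at y) w) (at x) v"
proof -
  define Q where "Q = (\<lambda>v w y. frechet_derivative (\<lambda>y. frechet_derivative f (at y) v) (at y) w)"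
  obtain e where e: "e > 0" "ball x e \<subseteq> U"
    using assms(1,2) openE by blast
  have D: "higher_differentiable_on U f (Suc (Suc 0))"
    using assms(3) by (simp add: numeral_2_eq_2)
  have cont: "continuous_on U (Q v w)" for v w
    using higher_differentiable_on_SucD(2)[OF higher_differentiable_on_SucD(2)[OF D]]
    by (simp add: Q_def)
  have ev: "\<forall>\<^sub>F n in sequentially. inverse (real (Suc n)) * (norm v + norm w) < e"
  proof -
    have "(\<lambda>n. inverse (real (Suc n)) * (norm v + norm w)) \<longlonglongrightarrow> 0 * (norm v + norm w)"
      by (intro tendsto_mult LIMSEQ_inverse_real_of_nat tendsto_const)
    then show ?thesis
      using e(1) by (auto dest: order_tendstoD)
  qed
  define \<Delta> where "\<Delta> = (\<lambda>h. f (x + h *\<^sub>R v + h *\<^sub>R w) - f (x + h *\<^sub>R v) - f (x + h *\<^sub>R w) + f x)"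
  define h where "h = (\<lambda>n. inverse (real (Suc n)))"
  have h0: "h n > 0" for n by (simp add: h_def)
  have hlim: "h \<longlonglongrightarrow> 0" unfolding h_def by (rule LIMSEQ_inverse_real_of_nat)
  have lim: "(\<lambda>n. D (h n) / (h n * h n)) \<longlonglongrightarrow> Q a b x"
    if a: "\<And>k. 0 < k \<Longrightarrow> k * (norm v + norm w) < e \<Longrightarrow>
      \<exists>s t. 0 < s \<and> s < k \<and> 0 < t \<and> t < k \<and> D k = k * k * Q a b (x + s *\<^sub>R a + t *\<^sub>R b)"
    for D :: "real \<Rightarrow> real" and a b
  proof -
    have "\<forall>\<^sub>F n in sequentially. \<exists>s t. 0 < s \<and> s < h n \<and> 0 < t \<and> t < h n \<and>
        D (h n) / (h n * h n) = Q a b (x + s *\<^sub>R a + t *\<^sub>R b)"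
    proof (rule eventually_mono[OF ev])
      fix n assume "inverse (real (Suc n)) * (norm v + norm w) < e"
      then obtain s t where "0 < s \<and> s < h n \<and> 0 < t \<and> t < h n \<and> D (h n) = h n * h n * Q a b (x + s *\<^sub>R a + t *\<^sub>R b)"
        using a[of "h n"] h0[of n] unfolding h_def by blast
      then show "\<exists>s t. 0 < s \<and> s < h n \<and> 0 < t \<and> t < h n \<and>
        D (h n) / (h n * h n) = Q a b (x + s *\<^sub>R a + t *\<^sub>R b)"
        using h0[of n] by (intro exI[of _ s] exI[of _ t]) auto
    qed
    then obtain N where N: "\<forall>n\<ge>N. \<exists>s t. 0 < s \<and> s < h n \<and> 0 < t \<and> t < h n \<and>
        D (h n) / (h n * h n) = Q a b (x + s *\<^sub>R a + t *\<^sub>R b)"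
      unfolding eventually_sequentially by blast
    then obtain s t where st: "\<And>n. n \<ge> N \<Longrightarrow> 0 < s n \<and> s n < h n \<and> 0 < t n \<and> t n < h n \<and>
        D (h n) / (h n * h n) = Q a b (x + s n *\<^sub>R a + t n *\<^sub>R b)"
      by metis
    have "s \<longlonglongrightarrow> 0"
      by (rule tendsto_sandwich[OF _ _ tendsto_const hlim])
        (use st in \<open>auto simp: eventually_sequentially intro!: exI[of _ N] less_imp_le\<close>)
    moreover have "t \<longlonglongrightarrow> 0"
      by (rule tendsto_sandwich[OF _ _ tendsto_const hlim])
        (use st in \<open>auto simp: eventually_sequentially intro!: exI[of _ N] less_imp_le\<close>)
    ultimately have "(\<lambda>n. x + s n *\<^sub>R a + t n *\<^sub>R b) \<longlonglongrightarrow> x + 0 *\<^sub>R a + 0 *\<^sub>R b"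
      by (intro tendsto_intros)
    moreover have "isCont (Q a b) x"
      using cont assms(1,2) continuous_on_eq_continuous_at by blast
    ultimately have "(\<lambda>n. Q a b (x + s n *\<^sub>R a + t n *\<^sub>R b)) \<longlonglongrightarrow> Q a b x"
      using isCont_tendsto_compose[of x "Q a b"] by simp
    then show ?thesis
      by (rule Lim_transform_eventually)
        (unfold eventually_sequentially, intro exI[of _ N], use st in auto)
  qed
  have 1: "(\<lambda>n. \<Delta> (h n) / (h n * h n)) \<longlonglongrightarrow> Q v w x"
  proof (rule lim)
    fix k :: real assume k: "0 < k" "k * (norm v + norm w) < e"
    show "\<exists>s t. 0 < s \<and> s < k \<and> 0 < t \<and> t < k \<and> \<Delta> k = k * k * Q v w (x + s *\<^sub>R v + t *\<^sub>R w)"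
      by (rule second_difference_mean_value[OF e(2) assms(3) k]) (auto simp: Q_def \<Delta>_def)
  qed
  have 2: "(\<lambda>n. \<Delta> (h n) / (h n * h n)) \<longlonglongrightarrow> Q w v x"
  proof (rule lim)
    fix k :: real assume k: "0 < k" "k * (norm v + norm w) < e"
    have k': "k * (norm w + norm v) < e" using k(2) by (simp add: add.commute)
    show "\<exists>s t. 0 < s \<and> s < k \<and> 0 < t \<and> t < k \<and> \<Delta> k = k * k * Q w v (x + s *\<^sub>R w + t *\<^sub>R v)"
      by (rule second_difference_mean_value[OF e(2) assms(3) k(1) k'])
        (force simp: Q_def \<Delta>_def algebra_simps)
  qed
  from LIMSEQ_unique[OF 1 2] show ?thesis by (simp add: Q_def)
qed

section \<open>Linear algebra\<close>

lemma quadratic_nonneg_linear_coeff_zero: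
  fixes b c :: real
  assumes "\<And>t. 2 * t * b + t^2 * c \<ge> 0"
  shows "b = 0"
proof (rule ccontr)
  assume "b \<noteq> 0"
  \<comment> \<open>\<open>k\<close> is positive and bounds \<open>c\<close> from above, so -b/k can
    replace the minimizer -b/c whatever the sign of \<open>c\<close>.\<close>
  define k where "k = \<bar>c\<bar> + 1"
  have k: "k > 0" "c \<le> k" by (auto simp: k_def)
  have "2 * (-b/k) * b + (-b/k)^2 * c = (b^2/k) * (c/k - 2)"
    using k by (simp add: field_simps power2_eq_square)
  moreover have "(b^2/k) * (c/k - 2) < 0"
    using k \<open>b \<noteq> 0\<close> by (intro mult_pos_neg) (auto simp: field_simps)
  ultimately show False using assms[of "-b/k"] by linarith
qed

text \<open>Spectral theorem for a form that is positive only on \<open>S\<close>, since the Lorentz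
  form is indefinite on the whole space. The Rayleigh quotient is maximized over the Euclidean unit
  sphere of \<open>S\<close>, which supplies compactness, and the induction continues on the
  \<open>B\<close>-complement of the maximizer.\<close>

lemma bilinear_form_orthonormal_eigenbasis:
  fixes S :: "'a::euclidean_space set" and B :: "'a \<Rightarrow> 'a \<Rightarrow> real" and A :: "'a \<Rightarrow> 'a"
  assumes "bilinear B" and sym: "\<And>x y. B x y = B y x"
    and "linear A"
    and "subspace S" "\<And>x. x \<in> S \<Longrightarrow> x \<noteq> 0 \<Longrightarrow> B x x > 0"
    and "\<And>x. x \<in> S \<Longrightarrow> A x \<in> S" "\<And>x y. x \<in> S \<Longrightarrow> y \<in> S \<Longrightarrow> B (A x) y = B x (A y)"
  shows "\<exists>E. finite E \<and> card E = dim S \<and> E \<subseteq> S \<and>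
    (\<forall>x\<in>E. \<forall>y\<in>E. B x y = (if x = y then 1 else 0)) \<and> (\<forall>x\<in>E. \<exists>k. A x = k *\<^sub>R x)"
  using assms(4-)
proof (induction "dim S" arbitrary: S)
  case 0
  then show ?case by (intro exI[of _ "{}"]) auto
next
  case (Suc d)
  note Badd = bilinear_ladd[OF assms(1)] bilinear_radd[OF assms(1)]
    bilinear_lmul[OF assms(1)] bilinear_rmul[OF assms(1)]
    bilinear_lsub[OF assms(1)] bilinear_rsub[OF assms(1)]
  note pos = Suc.prems(2) and inv = Suc.prems(3) and adj = Suc.prems(4)
  note sub = subspace_add[OF Suc.prems(1)] subspace_scale[OF Suc.prems(1)] subspace_diff[OF Suc.prems(1)]
  have linB: "B 0 y = 0" "B y 0 = 0" for y
    using bilinear_lzero[OF assms(1)] bilinear_rzero[OF assms(1)] by auto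
  define K where "K = S \<inter> sphere 0 1"
  have "compact K"
    unfolding K_def using closed_subspace[OF Suc.prems(1)] by (simp add: closed_Int_compact)
  have "S \<noteq> {0}" using Suc.hyps(2) by auto
  then obtain x0 where "x0 \<in> S" "x0 \<noteq> 0" using subspace_0[OF Suc.prems(1)] by auto
  then have "x0 /\<^sub>R norm x0 \<in> K" by (simp add: K_def sub)
  then have "K \<noteq> {}" by blast
  define R where "R = (\<lambda>x. B (A x) x / B x x)"
  have bB: "bounded_bilinear B"
    using assms(1) bilinear_conv_bounded_bilinear by blast
  have "bounded_linear A" using assms(3) linear_conv_bounded_linear by blast
  then have "continuous_on K R"
    unfolding R_def
    by (intro continuous_on_divide bounded_bilinear.continuous_on[OF bB] linear_continuous_on continuous_on_id)
      (use pos in \<open>force simp: K_def\<close>)+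
  then obtain x where x: "x \<in> K" "\<And>y. y \<in> K \<Longrightarrow> R y \<le> R x"
    using continuous_attains_sup[OF \<open>compact K\<close> \<open>K \<noteq> {}\<close>] by blast
  have xS: "x \<in> S" "x \<noteq> 0" using x(1) by (auto simp: K_def)
  define r where "r = R x"
  have max: "B (A y) y \<le> r * B y y" if "y \<in> S" for y
  proof (cases "y = 0")
    case True
    then show ?thesis using linear_0[OF assms(3)] by (simp add: linB)
  next
    case False
    then have "y /\<^sub>R norm y \<in> K" using that by (simp add: K_def sub)
    then have "R (y /\<^sub>R norm y) \<le> r" using x(2) by (simp add: r_def)
    moreover have "R (y /\<^sub>R norm y) = R y"
      using False by (simp add: R_def linear_scale[OF assms(3)] Badd divide_simps)
    ultimately have "R y \<le> r" by simp
    then show ?thesis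
      using pos[OF that False] unfolding R_def by (simp add: divide_le_eq)
  qed
  have eqx: "B (A x) x = r * B x x"
    using pos[OF xS] by (simp add: r_def R_def)
  \<comment> \<open>\<open>r * B y y - B (A y) y\<close> is nonnegative on \<open>S\<close> and zero
    at \<open>x\<close>, so its first variation at \<open>x\<close> vanishes. The vector r x - A x
    then lies in \<open>S\<close> and is orthogonal to \<open>S\<close>, hence zero by
    definiteness.\<close>
  have orth: "B (r *\<^sub>R x - A x) w = 0" if "w \<in> S" for w
  proof -
    have "2 * t * (r * B x w - B (A x) w) + t^2 * (r * B w w - B (A w) w) \<ge> 0" for t
    proof -
      have y: "x + t *\<^sub>R w \<in> S" using xS that by (simp add: sub)
      have "B (A w) x = B (A x) w"
        using adj[OF that xS(1)] by (simp add: sym)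
      then have "r * B (x + t *\<^sub>R w) (x + t *\<^sub>R w) - B (A (x + t *\<^sub>R w)) (x + t *\<^sub>R w)
        = 2 * t * (r * B x w - B (A x) w) + t^2 * (r * B w w - B (A w) w)"
        by (simp add: linear_add[OF assms(3)] linear_scale[OF assms(3)] Badd eqx sym[of w x]
            power2_eq_square algebra_simps)
      with max[OF y] show ?thesis by linarith
    qed
    then have "r * B x w - B (A x) w = 0"
      by (rule quadratic_nonneg_linear_coeff_zero)
    then show ?thesis by (simp add: Badd)
  qed
  have "r *\<^sub>R x - A x \<in> S" using xS inv by (simp add: sub)
  with orth[OF this] pos[OF this] have eig: "A x = r *\<^sub>R x" by force
  define S' where "S' = {w \<in> S. B x w = 0}"
  have "subspace S'"
    unfolding S'_def subspace_def using subspace_0[OF Suc.prems(1)] by (auto simp: sub Badd linB)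
  have "x \<notin> S'" using pos[OF xS] by (simp add: S'_def)
  have spn: "span (insert x S') = S"
  proof
    show "span (insert x S') \<subseteq> S"
      using Suc.prems(1) xS by (intro span_minimal) (auto simp: S'_def)
    show "S \<subseteq> span (insert x S')"
    proof
      fix w assume "w \<in> S"
      define c where "c = B x w / B x x"
      have "w - c *\<^sub>R x \<in> S'"
        using \<open>w \<in> S\<close> xS pos[OF xS] by (simp add: S'_def sub Badd c_def)
      then have "(w - c *\<^sub>R x) + c *\<^sub>R x \<in> span (insert x S')"
        by (intro span_add span_scale span_base) auto
      then show "w \<in> span (insert x S')" by simp
    qed
  qed
  have "x \<notin> span S'" using \<open>x \<notin> S'\<close> \<open>subspace S'\<close> by (metis span_eq_iff)
  then have "dim (insert x S') = dim S' + 1" by (simp add: dim_insert)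
  moreover have "dim (insert x S') = dim S" using spn by (metis dim_span)
  ultimately have "d = dim S'" using Suc.hyps(2) by simp
  have "A w \<in> S'" if "w \<in> S'" for w
  proof -
    have "B x (A w) = B (A x) w" using that xS adj by (simp add: S'_def)
    also have "\<dots> = 0" using that by (simp add: eig Badd S'_def)
    finally show ?thesis using that inv by (simp add: S'_def)
  qed
  from Suc.hyps(1)[OF \<open>d = dim S'\<close> \<open>subspace S'\<close> _ this] pos adj
  obtain E where E: "finite E" "card E = d" "E \<subseteq> S'"
    "\<forall>x\<in>E. \<forall>y\<in>E. B x y = (if x = y then 1 else 0)" "\<forall>x\<in>E. \<exists>k. A x = k *\<^sub>R x"
    unfolding S'_def \<open>d = dim S'\<close> by auto
  define e where "e = x /\<^sub>R sqrt (B x x)"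
  have e1: "B e e = 1" using pos[OF xS] by (simp add: e_def Badd field_simps)
  have e0: "B e y = 0" "B y e = 0" if "y \<in> E" for y
    using that E(3) sym[of y x] by (auto simp: S'_def e_def Badd)
  have "e \<notin> E" using e0 e1 by force
  moreover have "A e = r *\<^sub>R e"
    by (simp add: e_def linear_scale[OF assms(3)] eig)
  moreover have "e \<in> S" using xS by (simp add: e_def sub)
  ultimately show ?case
    using E e0 e1 Suc.hyps(2) by (intro exI[of _ "insert e E"]) (auto simp: S'_def)
qed

section \<open>Determinants of reindexed, block and rank one matrices\<close>

lemma sum_prod_permutes_reindex:
  fixes f :: "'a::finite \<Rightarrow> 'b::finite" and A :: "real^'b^'b"
  assumes "inj f"
  shows "(\<Sum>p | p permutes range f. of_int (sign p) * (\<Prod>i\<in>range f. A $ i $ p i))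
       = det (\<chi> i j. A $ f i $ f j)"
proof -
  have bij: "bij_betw f UNIV (range f)" using assms by (simp add: bij_betw_def)
  define g where "g = inv f"
  have gf: "g (f x) = x" for x using assms by (simp add: g_def)
  have bijg: "bij_betw g (range f) UNIV"
    using bij unfolding g_def by (metis bij_betw_inv_into)
  have fg: "f (g x) = x" if "x \<in> range f" for x using that gf by auto
  have "(\<Sum>p | p permutes range f. of_int (sign p) * (\<Prod>i\<in>range f. A $ i $ p i))
    = (\<Sum>p | p permutes (UNIV::'a set). of_int (sign p) * (\<Prod>i\<in>UNIV. A $ f i $ f (p i)))"
  proof (rule sum.reindex_bij_witness[of _ "map_permutation UNIV f" "map_permutation (range f) g"])
    fix p assume p: "p \<in> {p. p permutes range f}"
    show "map_permutation UNIV f (map_permutation (range f) g p) = p"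
      using map_permutation_compose_inv[OF bijg, of p f] p fg by auto
    show "map_permutation (range f) g p \<in> {p. p permutes UNIV}"
      using map_permutation_permutes[OF bijg] p by auto
    have s: "sign (map_permutation (range f) g p) = sign p"
      using bijg p by (intro sign_map_permutation) (auto simp: bij_betw_def)
    have "f (map_permutation (range f) g p i) = p (f i)" for i
    proof -
      have "map_permutation (range f) g p (g (f i)) = g (p (f i))"
        using bijg by (intro map_permutation_apply) (auto simp: bij_betw_def)
      moreover have "p (f i) \<in> range f" using p permutes_in_image by fastforce
      ultimately show ?thesis using fg gf by auto
    qed
    moreover have "(\<Prod>i\<in>range f. A $ i $ p i) = (\<Prod>i\<in>UNIV. A $ f i $ p (f i))"
      using assms by (simp add: prod.reindex)
    ultimately show "of_int (sign (map_permutation (range f) g p)) *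
        (\<Prod>i\<in>UNIV. A $ f i $ f (map_permutation (range f) g p i))
      = of_int (sign p) * (\<Prod>i\<in>range f. A $ i $ p i)"
      using s by simp
  next
    fix p assume p: "p \<in> {p. p permutes (UNIV::'a set)}"
    show "map_permutation (range f) g (map_permutation UNIV f p) = p"
      using map_permutation_compose_inv[OF bij, of p g] p gf by auto
    show "map_permutation UNIV f p \<in> {p. p permutes range f}"
      using map_permutation_permutes[OF bij] p by auto
  qed
  then show ?thesis by (simp add: det_def)
qed

lemma det_reindex_bij:
  fixes f :: "'a::finite \<Rightarrow> 'b::finite" and A :: "real^'b^'b"
  assumes "bij f"
  shows "det (\<chi> i j. A $ f i $ f j) = det A"
  using sum_prod_permutes_reindex[of f A] assms by (simp add: bij_def det_def)

text \<open>A permutation that moves \<open>None\<close> sends some \<open>Some j\<close> to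
  \<open>None\<close> and meets a zero entry; the others are permutations of the range of
  \<open>Some\<close>.\<close>

lemma det_option_block:
  fixes A :: "real^('n::finite option)^('n option)"
  assumes "\<And>i. A $ Some i $ None = 0"
  shows "det A = A $ None $ None * det (\<chi> i j. A $ Some i $ Some j)"
proof -
  have un: "UNIV = insert None (range Some)" by (auto simp: UNIV_option_conv)
  have z: "(\<Prod>i\<in>UNIV. A $ i $ p i) = 0" if p: "p permutes UNIV" "p None \<noteq> None" for p
  proof -
    obtain i where "p i = None" using permutes_surj[OF p(1)] by (metis surj_def)
    with p(2) obtain j where "p (Some j) = None" by (cases i) auto
    then have "A $ Some j $ p (Some j) = 0" using assms by simp
    then show ?thesis by (intro prod_zero finite bexI[of _ "Some j"] UNIV_I)
  qed
  have eq: "{p. p permutes (UNIV::'n option set) \<and> p None = None} = {p. p permutes range Some}"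
    unfolding permutes_def by (auto, metis not_None_eq rangeI)
  have "det A = (\<Sum>p | p permutes UNIV \<and> p None = None. of_int (sign p) * (\<Prod>i\<in>UNIV. A $ i $ p i))"
    unfolding det_def by (rule sum.mono_neutral_right) (use z in auto)
  also have "\<dots> = (\<Sum>p | p permutes range Some. of_int (sign p) * (\<Prod>i\<in>UNIV. A $ i $ p i))"
    by (simp only: eq)
  also have "\<dots> = (\<Sum>p | p permutes range Some. A $ None $ None *
      (of_int (sign p) * (\<Prod>i\<in>range Some. A $ i $ p i)))"
  proof (rule sum.cong[OF refl])
    fix p assume "p \<in> {p. p permutes range (Some::'n \<Rightarrow> 'n option)}"
    then have "p None = None" by (auto simp: permutes_def)
    then show "of_int (sign p) * (\<Prod>i\<in>UNIV. A $ i $ p i) =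
       A $ None $ None * (of_int (sign p) * (\<Prod>i\<in>range Some. A $ i $ p i))"
      unfolding un by (subst prod.insert) auto
  qed
  also have "\<dots> = A $ None $ None * det (\<chi> i j. A $ Some i $ Some j)"
    by (subst sum_distrib_left[symmetric], subst sum_prod_permutes_reindex) auto
  finally show ?thesis .
qed

text \<open>Conjugation by an orthogonal matrix whose \<open>k\<close>-th column is the direction of
  \<open>v\<close> makes the matrix diagonal, with all entries 1 except at the arbitrarily chosen
  index \<open>k\<close>.\<close>

lemma det_identity_plus_rank_one:
  fixes v :: "real^'n::finite"
  shows "det ((\<chi> i j. (if i = j then 1 else 0) + c * v $ i * v $ j) :: real^'n^'n) = 1 + c * (v \<bullet> v)"
proof (cases "v = 0")
  case True
  have "(\<chi> i j. (if i = j then 1 else 0) + c * v $ i * v $ j) = (mat 1 :: real^'n^'n)"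
    by (simp add: True mat_def)
  then show ?thesis by (simp add: True)
next
  case False
  obtain k :: 'n where True by blast
  obtain Q :: "real^'n^'n" where Q: "orthogonal_matrix Q" "Q *v axis k 1 = v /\<^sub>R norm v"
    using orthogonal_matrix_exists_basis[of "v /\<^sub>R norm v" k] False by auto
  define D :: "real^'n^'n" where "D = (\<chi> i j. if i = j then (if i = k then 1 + c * (v \<bullet> v) else 1) else 0)"
  have Qk: "Q $ i $ k = v $ i / norm v" for i
  proof -
    have "(Q *v axis k 1) $ i = Q $ i $ k"
      by (simp add: matrix_vector_mult_basis column_def)
    then show ?thesis using Q(2) by (simp add: divide_inverse mult.commute)
  qed
  have QQ: "Q ** transpose Q = mat 1" using Q(1) by (simp add: orthogonal_matrix_def)
  have QQ': "(\<Sum>l\<in>UNIV. Q $ i $ l * Q $ j $ l) = (if i = j then 1 else 0)" for i j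
    using arg_cong[OF QQ, of "\<lambda>M. M $ i $ j"] by (simp add: matrix_matrix_mult_def transpose_def mat_def)
  have entry: "(if i = j then 1 else 0) + c * v $ i * v $ j = (Q ** D ** transpose Q) $ i $ j" for i j
  proof -
    have "(Q ** D ** transpose Q) $ i $ j = (\<Sum>l\<in>UNIV. (Q ** D) $ i $ l * Q $ j $ l)"
      by (simp add: matrix_matrix_mult_def transpose_def)
    also have "\<dots> = (\<Sum>l\<in>UNIV. Q $ i $ l * Q $ j $ l + (if l = k then c * (v \<bullet> v) * Q $ i $ k * Q $ j $ k else 0))"
    proof (rule sum.cong[OF refl])
      fix l
      have "(Q ** D) $ i $ l = Q $ i $ l * (if l = k then 1 + c * (v \<bullet> v) else 1)"
        by (simp add: matrix_matrix_mult_def D_def if_distrib cong: if_cong)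
      then show "(Q ** D) $ i $ l * Q $ j $ l =
        Q $ i $ l * Q $ j $ l + (if l = k then c * (v \<bullet> v) * Q $ i $ k * Q $ j $ k else 0)"
        by (simp add: algebra_simps)
    qed
    also have "\<dots> = (if i = j then 1 else 0) + c * (v \<bullet> v) * Q $ i $ k * Q $ j $ k"
      by (simp add: sum.distrib QQ')
    also have "c * (v \<bullet> v) * Q $ i $ k * Q $ j $ k = c * v $ i * v $ j"
      using False by (simp add: Qk norm_eq_sqrt_inner divide_simps)
    finally show ?thesis by simp
  qed
  then have "(\<chi> i j. (if i = j then 1 else 0) + c * v $ i * v $ j) = Q ** D ** transpose Q"
    by (simp add: vec_eq_iff)
  moreover have "det D = 1 + c * (v \<bullet> v)"
    by (subst det_diagonal) (auto simp: D_def)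
  moreover have "det Q * det (transpose Q) = 1"
    using QQ by (metis det_I det_mul)
  ultimately show ?thesis
    by (simp add: det_mul algebra_simps)
qed

section \<open>Change of variables over arbitrary finite index types\<close>

text \<open>Such a map only renames coordinates, so preimages of boxes are boxes with the same side
  lengths. It serves to change the index type and to split off one coordinate.\<close>

lemma lborel_distr_basis_isomorphism:
  fixes f :: "'a::euclidean_space \<Rightarrow> 'b::euclidean_space"
  assumes "linear f" "bij_betw f Basis Basis"
  shows "distr lborel borel f = lborel"
proof (rule lborel_eqI[symmetric])
  have fB: "f b \<in> Basis" if "b \<in> Basis" for b using assms(2) that by (auto simp: bij_betw_def)
  have inner: "f x \<bullet> f b = x \<bullet> b" if "b \<in> Basis" for x b
  proof -
    have "f x = f (\<Sum>c\<in>Basis. (x \<bullet> c) *\<^sub>R c)" by (simp add: euclidean_representation)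
    also have "\<dots> = (\<Sum>c\<in>Basis. (x \<bullet> c) *\<^sub>R f c)"
      using assms(1) by (simp add: linear_sum linear_scale)
    finally have "f x \<bullet> f b = (\<Sum>c\<in>Basis. (x \<bullet> c) * (f c \<bullet> f b))" by (simp add: inner_sum_left)
    also have "\<dots> = (\<Sum>c\<in>Basis. if c = b then x \<bullet> c else 0)"
    proof (rule sum.cong[OF refl])
      fix c :: 'a assume "c \<in> Basis"
      then show "(x \<bullet> c) * (f c \<bullet> f b) = (if c = b then x \<bullet> c else 0)"
        using fB that assms(2) by (auto simp: inner_Basis bij_betw_def inj_on_def)
    qed
    finally show ?thesis using that by simp
  qed
  have meas: "f \<in> borel_measurable borel"
    using assms(1) by (intro borel_measurable_continuous_onI linear_continuous_on)
      (simp add: linear_conv_bounded_linear)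
  show "emeasure (distr lborel borel f) (box l u) = ennreal (\<Prod>b\<in>Basis. (u - l) \<bullet> b)"
    if "\<And>b. b \<in> Basis \<Longrightarrow> l \<bullet> b \<le> u \<bullet> b" for l u
  proof -
    define l' u' where "l' = (\<Sum>b\<in>Basis. (l \<bullet> f b) *\<^sub>R b)" and "u' = (\<Sum>b\<in>Basis. (u \<bullet> f b) *\<^sub>R b)"
    have im: "f ` Basis = Basis" using assms(2) by (simp add: bij_betw_def)
    have "f -` box l u = box l' u'"
      by (auto simp: box_def l'_def u'_def im[symmetric] inner)
    moreover have "emeasure lborel (box l' u') = (\<Prod>b\<in>Basis. (u' - l') \<bullet> b)"
      by (rule emeasure_lborel_box) (use that fB in \<open>auto simp: l'_def u'_def\<close>)
    moreover have "(\<Prod>b\<in>Basis. (u' - l') \<bullet> b) = (\<Prod>b\<in>Basis. (u - l) \<bullet> f b)"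
      by (rule prod.cong) (auto simp: l'_def u'_def inner_diff_left)
    moreover have "\<dots> = (\<Prod>b\<in>Basis. (u - l) \<bullet> b)"
      using prod.reindex_bij_betw[OF assms(2), of "\<lambda>b. (u - l) \<bullet> b"] by simp
    ultimately show ?thesis
      using meas by (simp add: emeasure_distr)
  qed
qed simp

text \<open>The library states the change of variables formula for well-ordered index types only.\<close>

typedef ('a::finite) ordered_index = "{..<CARD('a)}"
  by (rule exI[of _ 0]) (simp add: card_gt_0_iff)

instantiation ordered_index :: (finite) linorder
begin

definition "i \<le> j \<longleftrightarrow> Rep_ordered_index i \<le> Rep_ordered_index j"
definition "i < j \<longleftrightarrow> Rep_ordered_index i < Rep_ordered_index j"

instance
  by standard (auto simp: less_eq_ordered_index_def less_ordered_index_def Rep_ordered_index_inject)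

end

lemma ordered_index_UNIV:
  "bij_betw Rep_ordered_index (UNIV :: 'a::finite ordered_index set) {..<CARD('a)}"
  by (rule bij_betwI[where g = Abs_ordered_index])
    (use Rep_ordered_index Rep_ordered_index_inverse Abs_ordered_index_inverse in auto)

instance ordered_index :: (finite) finite
  by standard (use ordered_index_UNIV bij_betw_finite in blast)

instance ordered_index :: (finite) wellorder
proof
  fix P :: "'a ordered_index \<Rightarrow> bool" and a
  assume *: "\<And>x. (\<And>y. y < x \<Longrightarrow> P y) \<Longrightarrow> P x"
  show "P a"
  proof (induction a rule: measure_induct_rule[where f = Rep_ordered_index])
    case (less x)
    show ?case by (rule *) (simp add: less less_ordered_index_def)
  qed
qed

lemma ex_bij_ordered_index: "\<exists>f :: 'a::finite \<Rightarrow> 'a ordered_index. bij f"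
proof -
  have "card (UNIV :: 'a ordered_index set) = card (UNIV :: 'a set)"
    using bij_betw_same_card[OF ordered_index_UNIV] by simp
  then show ?thesis
    by (metis finite bij_betw_iff_card)
qed

text \<open>Boundedness makes the measure of the image finite, so that the real-valued change of
  variables formula can be turned into an extended one.\<close>

lemma emeasure_differentiable_image_ordered:
  fixes f :: "real^'m::{finite,wellorder} \<Rightarrow> real^'m::_"
  assumes A: "A \<in> sets borel" and fA: "f ` A \<in> sets borel" "bounded (f ` A)"
    and der: "\<And>x. x \<in> A \<Longrightarrow> (f has_derivative f' x) (at x)"
    and inj: "inj_on f A"
  shows "emeasure lborel (f ` A) = (\<integral>\<^sup>+x\<in>A. ennreal \<bar>det (matrix (f' x))\<bar> \<partial>lborel)"
proof -
  have leb: "A \<in> sets lebesgue" using A by simp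
  have "f ` A \<in> lmeasurable" using fA by (simp add: bounded_set_imp_lmeasurable)
  then have "((\<lambda>x. \<bar>det (matrix (f' x))\<bar>) has_integral measure lebesgue (f ` A)) A"
    using has_measure_differentiable_image[OF leb has_derivative_at_withinI[OF der] inj] by blast
  then have "(\<integral>\<^sup>+x\<in>A. ennreal \<bar>det (matrix (f' x))\<bar> \<partial>lborel) = ennreal (measure lebesgue (f ` A))"
    by (rule nn_integral_has_integral_lebesgue'[rotated]) auto
  moreover have "emeasure lebesgue (f ` A) = emeasure lborel (f ` A)"
    using fA(1) by (simp add: main_part_sets)
  ultimately show ?thesis
    using emeasure_eq_measure2[OF \<open>f ` A \<in> lmeasurable\<close>] by simp
qed

text \<open>\<open>f\<close> is conjugated by a renaming of coordinates \<open>R\<close>, which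
  preserves Lebesgue measure and, acting on rows and columns alike, the Jacobian
  determinant.\<close>

lemma emeasure_differentiable_image:
  fixes f :: "real^'m::finite \<Rightarrow> real^'m"
  assumes A: "A \<in> sets borel" and fA: "f ` A \<in> sets borel" "bounded (f ` A)"
    and der: "\<And>x. x \<in> A \<Longrightarrow> (f has_derivative f' x) (at x)"
    and inj: "inj_on f A"
    and meas: "(\<lambda>x. ennreal \<bar>det (matrix (f' x))\<bar> * indicator A x) \<in> borel_measurable borel"
  shows "emeasure lborel (f ` A) = (\<integral>\<^sup>+x\<in>A. ennreal \<bar>det (matrix (f' x))\<bar> \<partial>lborel)"
proof -
  obtain b :: "'m \<Rightarrow> 'm ordered_index" where b: "bij b" using ex_bij_ordered_index by blast
  define c where "c = inv b"
  have bc: "b (c j) = j" "c (b i) = i" for i j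
    using b by (auto simp: c_def bij_is_surj bij_is_inj surj_f_inv_f)
  define R :: "real^'m \<Rightarrow> real^'m ordered_index" where "R = (\<lambda>x. \<chi> j. x $ c j)"
  define R' :: "real^'m ordered_index \<Rightarrow> real^'m" where "R' = (\<lambda>y. \<chi> i. y $ b i)"
  have RR: "R (R' y) = y" "R' (R x) = x" for x y by (auto simp: R_def R'_def bc vec_eq_iff)
  have lin: "bounded_linear R" "bounded_linear R'"
    unfolding R_def R'_def linear_conv_bounded_linear[symmetric]
    by (auto intro!: linearI simp: vec_eq_iff)
  have R'axis: "R' (axis j r) = axis (c j) r" for j r
    using bc by (auto simp: R'_def axis_def vec_eq_iff)
  have "bij_betw R' Basis Basis"
  proof (rule bij_betwI[where g = R])
    show "R' \<in> Basis \<rightarrow> Basis" by (auto simp: Basis_vec_def R'axis)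
    show "R \<in> Basis \<rightarrow> Basis"
    proof -
      have "R (axis i r) = axis (b i) r" for i r
        using bc by (auto simp: R_def axis_def vec_eq_iff)
      then show ?thesis by (auto simp: Basis_vec_def)
    qed
  qed (auto simp: RR)
  then have distr: "distr lborel borel R' = lborel"
    using lin(2) by (intro lborel_distr_basis_isomorphism) (auto simp: linear_conv_bounded_linear)
  have measR: "R' \<in> borel_measurable borel" "R \<in> borel_measurable borel"
    using lin by (auto intro: borel_measurable_continuous_onI linear_continuous_on)
  have img: "R ` B = R' -` B" for B
    by (auto simp: RR) (metis RR(1) image_eqI)
  define g where "g = R \<circ> f \<circ> R'"
  define g' where "g' = (\<lambda>y. R \<circ> f' (R' y) \<circ> R')"
  have gimg: "g ` (R' -` A) = R' -` (f ` A)"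
    unfolding g_def img[symmetric] by (auto simp: RR image_image)
  have mat: "det (matrix (g' y)) = det (matrix (f' (R' y)))" for y
  proof -
    have "matrix (g' y) = (\<chi> i j. matrix (f' (R' y)) $ c i $ c j)"
      by (simp add: vec_eq_iff matrix_def g'_def R'axis) (simp add: R_def)
    moreover have "bij c" using b by (simp add: c_def bij_imp_bij_inv)
    ultimately show ?thesis using det_reindex_bij by metis
  qed
  have "emeasure lborel (g ` (R' -` A)) = (\<integral>\<^sup>+y\<in>R' -` A. ennreal \<bar>det (matrix (g' y))\<bar> \<partial>lborel)"
  proof (rule emeasure_differentiable_image_ordered)
    show "R' -` A \<in> sets borel" using measurable_sets_borel[OF measR(1) A] .
    show "g ` (R' -` A) \<in> sets borel" unfolding gimg using measurable_sets_borel[OF measR(1) fA(1)] .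
    show "bounded (g ` (R' -` A))" unfolding gimg unfolding img[symmetric]
      by (rule bounded_linear_image[OF fA(2) lin(1)])
    show "(g has_derivative g' y) (at y)" if "y \<in> R' -` A" for y
      unfolding g_def g'_def comp_assoc
      by (intro diff_chain_at bounded_linear_imp_has_derivative lin der) (use that in auto)
    show "inj_on g (R' -` A)"
      using inj unfolding inj_on_def g_def by (metis RR comp_apply vimageE)
  qed
  moreover have "emeasure lborel (g ` (R' -` A)) = emeasure lborel (f ` A)"
    unfolding gimg using fA(1) measR(1) by (subst distr[symmetric]) (simp add: emeasure_distr)
  moreover have "(\<integral>\<^sup>+x\<in>A. ennreal \<bar>det (matrix (f' x))\<bar> \<partial>lborel)
      = (\<integral>\<^sup>+x\<in>A. ennreal \<bar>det (matrix (f' x))\<bar> \<partial>distr lborel borel R')"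
    by (simp only: distr)
  moreover have "\<dots> = (\<integral>\<^sup>+y\<in>R' -` A. ennreal \<bar>det (matrix (g' y))\<bar> \<partial>lborel)"
    using meas measR(1) by (subst nn_integral_distr) (auto simp: mat indicator_def)
  ultimately show ?thesis by simp
qed

section \<open>The Lorentz form\<close>

lemma lorentz_sym: "lorentz X Y = lorentz Y X"
  by (simp add: lorentz_def inner_commute)

lemma lorentz_conv_inner: "lorentz X Y = (fst X, - snd X) \<bullet> Y"
  by (cases Y) (simp add: lorentz_def)

lemma bilinear_lorentz: "bilinear lorentz"
  by (auto simp: bilinear_def lorentz_def algebra_simps intro!: linearI)

lemmas bounded_bilinear_lorentz =
  bilinear_lorentz[unfolded bilinear_conv_bounded_bilinear]

lemmas lorentz_simps =
  bilinear_ladd[OF bilinear_lorentz] bilinear_radd[OF bilinear_lorentz]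
  bilinear_lsub[OF bilinear_lorentz] bilinear_rsub[OF bilinear_lorentz]
  bilinear_lneg[OF bilinear_lorentz] bilinear_rneg[OF bilinear_lorentz]
  bilinear_lzero[OF bilinear_lorentz] bilinear_rzero[OF bilinear_lorentz]
  bilinear_lmul[OF bilinear_lorentz, simplified] bilinear_rmul[OF bilinear_lorentz, simplified]

lemmas continuous_on_lorentz [continuous_intros] =
  bounded_bilinear.continuous_on[OF bounded_bilinear_lorentz]

lemma lorentz_sum_left: "lorentz (\<Sum>i\<in>I. f i) Y = (\<Sum>i\<in>I. lorentz (f i) Y)"
  by (induction I rule: infinite_finite_induct) (auto simp: lorentz_simps)

lemma lorentz_sum_right: "lorentz Y (\<Sum>i\<in>I. f i) = (\<Sum>i\<in>I. lorentz Y (f i))"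
  by (simp add: lorentz_sym[of Y] lorentz_sum_left)

lemma lorentz_nondegenerate:
  assumes "\<And>W. lorentz Z W = 0"
  shows "Z = 0"
proof -
  have "(fst Z, - snd Z) \<bullet> (fst Z, - snd Z) = 0"
    using assms[of "(fst Z, - snd Z)"] by (simp add: lorentz_conv_inner)
  then have "(fst Z, - snd Z) = 0" by (simp only: inner_eq_zero_iff)
  then show ?thesis by (simp add: prod_eq_iff)
qed

lemma hyperbolic_spaceD:
  assumes "X \<in> hyperbolic_space"
  shows "lorentz X X = -1" "snd X > 0" "snd X = sqrt (1 + fst X \<bullet> fst X)"
    "(snd X)\<^sup>2 = 1 + fst X \<bullet> fst X" "snd X \<ge> 1" "norm (fst X) < snd X"
proof -
  show 1: "lorentz X X = -1" "snd X > 0" using assms by (auto simp: hyperbolic_space_def)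
  show 2: "(snd X)\<^sup>2 = 1 + fst X \<bullet> fst X"
    using 1(1) by (simp add: lorentz_def power2_eq_square)
  show "snd X = sqrt (1 + fst X \<bullet> fst X)"
    using 1(2) unfolding 2[symmetric] by simp
  then show "snd X \<ge> 1" by simp
  have "(norm (fst X))\<^sup>2 < (snd X)\<^sup>2" unfolding 2 by (simp add: power2_norm_eq_inner)
  then show "norm (fst X) < snd X" using 1(2) by (simp add: power_less_imp_less_base)
qed

lemma hyp_lift_in: "hyp_lift x \<in> hyperbolic_space"
  by (auto simp: hyp_lift_def hyperbolic_space_def lorentz_def add_pos_nonneg)

lemma fst_hyp_lift [simp]: "fst (hyp_lift x) = x"
  by (simp add: hyp_lift_def)

lemma hyp_lift_fst: "X \<in> hyperbolic_space \<Longrightarrow> hyp_lift (fst X) = X"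
  using hyperbolic_spaceD(3)[of X] by (simp add: hyp_lift_def prod_eq_iff)

lemma continuous_on_hyp_lift: "continuous_on A hyp_lift"
  unfolding hyp_lift_def by (intro continuous_intros)

text \<open>The complement of a timelike vector is spacelike: tangency equates
  \<open>fst X \<bullet> fst v\<close> with \<open>snd X * snd v\<close>, and Cauchy-Schwarz is
  strict because the time component of \<open>X\<close> exceeds the length of its spatial
  part.\<close>

lemma tangent_vector_spacelike:
  assumes "X \<in> hyperbolic_space" "lorentz X v = 0"
  shows "(norm (fst v))\<^sup>2 \<le> (snd X)\<^sup>2 * lorentz v v" "lorentz v v \<ge> 0" "v \<noteq> 0 \<Longrightarrow> lorentz v v > 0"
proof -
  note X = hyperbolic_spaceD[OF assms(1)]
  have e: "fst X \<bullet> fst v = snd X * snd v" using assms(2) by (simp add: lorentz_def)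
  have "(snd X * snd v)\<^sup>2 \<le> (fst X \<bullet> fst X) * (fst v \<bullet> fst v)"
    unfolding e[symmetric] by (rule Cauchy_Schwarz_ineq)
  moreover have "(snd X)\<^sup>2 * lorentz v v = (1 + fst X \<bullet> fst X) * (fst v \<bullet> fst v) - (snd X * snd v)\<^sup>2"
    unfolding X(4)[symmetric] by (simp add: lorentz_def power2_eq_square algebra_simps)
  ultimately show 1: "(norm (fst v))\<^sup>2 \<le> (snd X)\<^sup>2 * lorentz v v"
    by (simp add: power2_norm_eq_inner algebra_simps)
  have p: "(snd X)\<^sup>2 > 0" using X(2) by simp
  have "0 \<le> (snd X)\<^sup>2 * lorentz v v" using 1 by (meson order_trans zero_le_power2)
  then show "lorentz v v \<ge> 0"
    using p by (simp add: zero_le_mult_iff)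
  show "lorentz v v > 0" if "v \<noteq> 0"
  proof (cases "fst v = 0")
    case True
    then have "snd v = 0" using e X(2) by simp
    with True that show ?thesis by (simp add: prod_eq_iff)
  next
    case False
    then have "0 < (snd X)\<^sup>2 * lorentz v v" using 1 by (smt (verit) zero_less_norm_iff zero_less_power)
    then show ?thesis using p by (simp add: zero_less_mult_iff)
  qed
qed

lemma tangent_vector_Cauchy_Schwarz:
  assumes "X \<in> hyperbolic_space" "lorentz X v = 0" "lorentz X w = 0"
  shows "(lorentz v w)\<^sup>2 \<le> lorentz v v * lorentz w w"
proof (cases "w = 0")
  case False
  then have w: "lorentz w w > 0" using tangent_vector_spacelike[OF assms(1,3)] by simp
  define c where "c = lorentz v w / lorentz w w"
  have "lorentz (v - c *\<^sub>R w) (v - c *\<^sub>R w) \<ge> 0"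
    by (rule tangent_vector_spacelike(2)[OF assms(1)]) (simp add: lorentz_simps assms)
  then have "lorentz v v - 2 * c * lorentz v w + c\<^sup>2 * lorentz w w \<ge> 0"
    by (simp add: lorentz_simps lorentz_sym[of w v] power2_eq_square algebra_simps)
  moreover have "c * lorentz w w = lorentz v w" using w by (simp add: c_def)
  ultimately have "lorentz v v - c * lorentz v w \<ge> 0"
    by (simp add: power2_eq_square mult.assoc)
  then have "(lorentz v v - c * lorentz v w) * lorentz w w \<ge> 0" using w by simp
  then show ?thesis using w by (simp add: c_def power2_eq_square algebra_simps)
qed (simp add: lorentz_simps)

lemma tangent_vector_abs_lorentz_le:
  assumes "X \<in> hyperbolic_space" "lorentz X v = 0" "lorentz X w = 0" "lorentz w w = 1"
  shows "\<bar>lorentz v w\<bar> \<le> sqrt (lorentz v v)"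
  using tangent_vector_Cauchy_Schwarz[OF assms(1-3)] assms(4)
  by (metis mult.right_neutral real_sqrt_abs real_sqrt_le_iff)

lemma lorentz_future_null:
  assumes "lorentz l l = 0" "snd l > 0"
  shows "norm (fst l) = snd l"
  using assms by (simp add: lorentz_def norm_eq_sqrt_inner)

lemma lorentz_hyperbolic_null_neg:
  assumes "X \<in> hyperbolic_space" "lorentz l l = 0" "snd l > 0"
  shows "lorentz X l < 0"
proof -
  have "fst X \<bullet> fst l \<le> norm (fst X) * snd l"
    using norm_cauchy_schwarz[of "fst X" "fst l"] lorentz_future_null[OF assms(2,3)] by simp
  also have "\<dots> < snd X * snd l" using hyperbolic_spaceD(6)[OF assms(1)] assms(3) by simp
  finally show ?thesis by (simp add: lorentz_def)
qed

lemma lorentz_null_null_nonpos: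
  assumes "lorentz l l = 0" "snd l > 0" "lorentz m m = 0" "snd m > 0"
  shows "lorentz l m \<le> 0"
  using norm_cauchy_schwarz[of "fst l" "fst m"] lorentz_future_null[OF assms(1,2)]
    lorentz_future_null[OF assms(3,4)] by (simp add: lorentz_def)

lemma lorentz_hyperbolic_le:
  assumes "X \<in> hyperbolic_space" "Y \<in> hyperbolic_space"
  shows "lorentz X Y \<le> -1"
proof -
  have "fst X \<bullet> fst Y \<le> norm (fst X) * norm (fst Y)" by (rule norm_cauchy_schwarz)
  moreover have "1 + norm (fst X) * norm (fst Y) \<le> snd X * snd Y"
  proof (rule power2_le_imp_le)
    have "0 \<le> (norm (fst X) - norm (fst Y))\<^sup>2" by simp
    moreover have "(snd X * snd Y)\<^sup>2 = (1 + (norm (fst X))\<^sup>2) * (1 + (norm (fst Y))\<^sup>2)"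
      using hyperbolic_spaceD(4)[OF assms(1)] hyperbolic_spaceD(4)[OF assms(2)]
      by (simp add: power_mult_distrib power2_norm_eq_inner)
    ultimately show "(1 + norm (fst X) * norm (fst Y))\<^sup>2 \<le> (snd X * snd Y)\<^sup>2"
      by (simp add: power2_eq_square algebra_simps)
    show "0 \<le> snd X * snd Y" using hyperbolic_spaceD(2)[OF assms(1)] hyperbolic_spaceD(2)[OF assms(2)] by simp
  qed
  ultimately show ?thesis by (simp add: lorentz_def)
qed

text \<open>\<open>p - \<nu>\<close> is the null direction in which the geodesic leaving
  \<open>p\<close> along \<open>- \<nu>\<close> ends at infinity, scaled so that the horosphere
  through \<open>p\<close> is the level 1.\<close>

lemma horospherical_null:
  assumes "p \<in> hyperbolic_space" "lorentz p \<nu> = 0" "lorentz \<nu> \<nu> = 1"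
  shows "lorentz (p - \<nu>) (p - \<nu>) = 0" "snd (p - \<nu>) > 0" "lorentz p (p - \<nu>) = -1"
    "lorentz \<nu> (p - \<nu>) = -1" "\<bar>snd \<nu>\<bar> < snd p"
proof -
  note p = hyperbolic_spaceD[OF assms(1)]
  show "lorentz (p - \<nu>) (p - \<nu>) = 0" "lorentz p (p - \<nu>) = -1" "lorentz \<nu> (p - \<nu>) = -1"
    using p assms by (simp_all add: lorentz_simps lorentz_sym[of \<nu> p])
  have "(snd p * snd \<nu>)\<^sup>2 \<le> (fst p \<bullet> fst p) * (fst \<nu> \<bullet> fst \<nu>)"
    using Cauchy_Schwarz_ineq[of "fst p" "fst \<nu>"] assms(2) by (simp add: lorentz_def)
  also have "fst \<nu> \<bullet> fst \<nu> = 1 + (snd \<nu>)\<^sup>2" using assms(3) by (simp add: lorentz_def power2_eq_square)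
  also have "fst p \<bullet> fst p = (snd p)\<^sup>2 - 1" using p(4) by simp
  finally have "(snd \<nu>)\<^sup>2 < (snd p)\<^sup>2" by (simp add: power_mult_distrib algebra_simps)
  then show *: "\<bar>snd \<nu>\<bar> < snd p"
    using p(2) by (metis abs_of_pos power2_abs power_less_imp_less_base less_imp_le)
  then show "snd (p - \<nu>) > 0" by simp
qed

lemma cosh_hyp_radius:
  assumes "X \<in> hyperbolic_space"
  shows "cosh (hyp_radius X) = snd X"
  using hyperbolic_spaceD(5)[OF assms]
  by (simp add: hyp_radius_def hyp_dist_def hyp_origin_def lorentz_def cosh_arcosh_real)

text \<open>The radial field is the gradient of the time coordinate cosh r: it equals
  \<open>snd X\<close> times \<open>X\<close> minus the vector \<open>hyp_origin\<close>. Hence the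
  support function is the time component of the normal.\<close>

lemma lorentz_radial_field:
  assumes "X \<in> hyperbolic_space" "lorentz X v = 0"
  shows "lorentz (radial_field X) v = snd v"
proof -
  note X = hyperbolic_spaceD[OF assms(1)]
  have r0: "hyp_radius X \<ge> 0"
    using X(5) by (simp add: hyp_radius_def hyp_dist_def hyp_origin_def lorentz_def)
  have "(sinh (hyp_radius X))\<^sup>2 = (norm (fst X))\<^sup>2"
    using cosh_hyp_radius[OF assms(1)] X(4) by (simp add: sinh_square_eq power2_norm_eq_inner)
  then have s: "sinh (hyp_radius X) = norm (fst X)"
    using r0 by (simp add: power2_eq_iff_nonneg)
  have "radial_field X = (snd X *\<^sub>R fst X, fst X \<bullet> fst X)"
    by (cases "fst X = 0") (simp_all add: radial_field_def radial_unit_def s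
        cosh_hyp_radius[OF assms(1)] sgn_div_norm power2_norm_eq_inner[symmetric] power2_eq_square)
  then have "lorentz (radial_field X) v = snd X * (fst X \<bullet> fst v) - (fst X \<bullet> fst X) * snd v"
    by (simp add: lorentz_def)
  also have "fst X \<bullet> fst v = snd X * snd v" using assms(2) by (simp add: lorentz_def)
  also have "fst X \<bullet> fst X = (snd X)\<^sup>2 - 1" using X(4) by simp
  finally show ?thesis by (simp add: power2_eq_square algebra_simps)
qed

section \<open>Weighted volume is Lebesgue measure in the projection\<close>

lemma has_derivative_hyp_lift:
  "(hyp_lift has_derivative (\<lambda>v. (v, (x \<bullet> v) / sqrt (1 + x \<bullet> x)))) (at x)"
  unfolding hyp_lift_def
  by (rule derivative_eq_intros refl | simp add: add_pos_nonneg)+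
    (auto simp: inner_commute divide_simps)

lemma gram_det_hyp_lift: "gram_det hyp_lift (x :: real^'m::finite) = 1 / (1 + x \<bullet> x)"
proof -
  have pos: "1 + x \<bullet> x > 0" by (simp add: add_pos_nonneg)
  have "lorentz (frechet_derivative hyp_lift (at x) (axis i 1)) (frechet_derivative hyp_lift (at x) (axis j 1))
      = (if i = j then 1 else 0) + (- 1 / (1 + x \<bullet> x)) * x $ i * x $ j" for i j :: 'm
    using pos unfolding frechet_derivative_at[OF has_derivative_hyp_lift, symmetric]
    by (simp add: lorentz_def inner_axis divide_simps) (simp add: axis_def)
  then have "gram_det hyp_lift x = 1 + (- 1 / (1 + x \<bullet> x)) * (x \<bullet> x)"
    unfolding gram_det_def by (simp only: det_identity_plus_rank_one)
  also have "\<dots> = 1 / (1 + x \<bullet> x)" using pos by (simp add: field_simps)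
  finally show ?thesis .
qed

text \<open>The volume density of the graph is 1 / sqrt (1 + |x|^2) = 1 / cosh r, which the weight
  cancels exactly.\<close>

theorem Vol_w_eq_lebesgue_measure:
  fixes \<Omega> :: "'m::finite minkowski set"
  assumes "\<Omega> \<subseteq> hyperbolic_space" "\<Omega> \<in> sets borel"
  shows "Vol_w \<Omega> = measure lborel (fst ` \<Omega>)"
proof -
  have lift: "hyp_lift \<in> borel_measurable borel"
    by (intro borel_measurable_continuous_onI continuous_on_hyp_lift)
  have pre: "hyp_lift -` \<Omega> = fst ` \<Omega>"
    using assms(1) hyp_lift_fst by (auto simp: image_iff) (metis fst_hyp_lift subsetD)
  have mfst: "fst ` \<Omega> \<in> sets borel"
    using measurable_sets_borel[OF lift assms(2)] pre by simp
  have snd_m: "(\<lambda>X. indicator \<Omega> X * snd X) \<in> borel_measurable borel"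
    using assms(2) by (intro borel_measurable_times borel_measurable_indicator
        borel_measurable_continuous_onI continuous_intros) auto
  have dens: "(\<lambda>x :: real^'m. sqrt (gram_det hyp_lift x)) \<in> borel_measurable lborel"
    unfolding gram_det_hyp_lift by measurable
  have "Vol_w \<Omega> = (LINT X|hyp_volume. indicator \<Omega> X * snd X)"
    unfolding Vol_w_def set_lebesgue_integral_def using assms(1) cosh_hyp_radius
    by (intro Bochner_Integration.integral_cong) (auto simp: indicator_def)
  also have "\<dots> = (LINT x|density lborel (\<lambda>x. ennreal (sqrt (gram_det hyp_lift x))).
      indicator \<Omega> (hyp_lift x) * snd (hyp_lift x))"
    unfolding hyp_volume_def using lift snd_m by (subst integral_distr) auto
  also have "\<dots> = (LINT x|lborel. sqrt (gram_det hyp_lift x) *\<^sub>R (indicator \<Omega> (hyp_lift x) * snd (hyp_lift x)))"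
  proof (rule integral_density)
    have "(\<lambda>x. indicator \<Omega> (hyp_lift x) * snd (hyp_lift x)) \<in> borel_measurable borel"
      using measurable_compose[OF lift snd_m] .
    then show "(\<lambda>x. indicator \<Omega> (hyp_lift x) * snd (hyp_lift x)) \<in> borel_measurable lborel" by simp
  qed (use dens in \<open>auto simp: gram_det_hyp_lift add_nonneg_nonneg\<close>)
  also have "\<dots> = (LINT x|lborel. indicator (fst ` \<Omega>) x)"
  proof (rule Bochner_Integration.integral_cong[OF refl])
    fix x :: "real^'m"
    have "1 + x \<bullet> x > 0" by (simp add: add_pos_nonneg)
    then show "sqrt (gram_det hyp_lift x) *\<^sub>R (indicator \<Omega> (hyp_lift x) * snd (hyp_lift x)) = indicator (fst ` \<Omega>) x"
      by (auto simp: gram_det_hyp_lift hyp_lift_def real_sqrt_divide indicator_def pre[symmetric])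
  qed
  also have "\<dots> = measure lborel (fst ` \<Omega>)" using mfst by simp
  finally show ?thesis .
qed

section \<open>Adapted orthonormal frames\<close>

locale lorentz_frame =
  fixes p \<nu> :: "('n::finite option) minkowski" and e :: "'n \<Rightarrow> ('n option) minkowski"
  assumes p: "p \<in> hyperbolic_space"
    and p\<nu>: "lorentz p \<nu> = 0" and \<nu>\<nu>: "lorentz \<nu> \<nu> = 1"
    and pe: "\<And>i. lorentz p (e i) = 0" and \<nu>e: "\<And>i. lorentz \<nu> (e i) = 0"
    and ee: "\<And>i j. lorentz (e i) (e j) = (if i = j then 1 else 0)"
begin

lemmas frame_products = p\<nu> \<nu>\<nu> pe \<nu>e ee hyperbolic_spaceD(1)[OF p]
  p\<nu>[unfolded lorentz_sym[of p]] pe[unfolded lorentz_sym[of p]] \<nu>e[unfolded lorentz_sym[of \<nu>]]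

text \<open>The n + 2 vectors are independent because products with the frame recover the
  coefficients, so by dimension they span; a remainder orthogonal to all of them is orthogonal to
  everything.\<close>

lemma frame_expansion:
  "Y = (\<Sum>i\<in>UNIV. lorentz Y (e i) *\<^sub>R e i) + lorentz Y \<nu> *\<^sub>R \<nu> - lorentz Y p *\<^sub>R p"
proof -
  define \<Phi> :: "(real^'n) \<times> real \<times> real \<Rightarrow> ('n option) minkowski" where
    "\<Phi> = (\<lambda>(a, b, c). (\<Sum>i\<in>UNIV. (a $ i) *\<^sub>R e i) + b *\<^sub>R \<nu> + c *\<^sub>R p)"
  have lin: "linear \<Phi>"
    by (rule linearI)
      (auto simp: \<Phi>_def algebra_simps sum.distrib scaleR_sum_right split: prod.splits)
  have coeff: "lorentz (\<Phi> (a, b, c)) (e j) = a $ j" "lorentz (\<Phi> (a, b, c)) \<nu> = b"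
    "lorentz (\<Phi> (a, b, c)) p = - c" for a b c j
    by (simp_all add: \<Phi>_def lorentz_simps lorentz_sum_left frame_products if_distrib cong: if_cong)
  have "inj \<Phi>"
    by (rule injI) (metis coeff neg_equal_iff_equal prod_cases3 vec_eq_iff)
  then have "dim (\<Phi> ` UNIV) = dim (UNIV :: ((real^'n) \<times> real \<times> real) set)"
    using lin by (intro dim_image_eq) (auto simp: inj_on_subset)
  then have "dim (range \<Phi>) = DIM(('n option) minkowski)" by simp
  then have "range \<Phi> = UNIV"
    using dim_eq_full[of "range \<Phi>"] linear_subspace_image[OF lin subspace_UNIV] by (metis span_eq_iff)
  define Z where "Z = Y - ((\<Sum>i\<in>UNIV. lorentz Y (e i) *\<^sub>R e i) + lorentz Y \<nu> *\<^sub>R \<nu> - lorentz Y p *\<^sub>R p)"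
  have z: "lorentz Z (e j) = 0" "lorentz Z \<nu> = 0" "lorentz Z p = 0" for j
    by (simp_all add: Z_def lorentz_simps lorentz_sum_left frame_products if_distrib cong: if_cong)
  have "lorentz Z W = 0" for W
  proof -
    obtain a b c where "W = \<Phi> (a, b, c)" using \<open>range \<Phi> = UNIV\<close> by (metis UNIV_I imageE prod_cases3)
    then show ?thesis by (simp add: \<Phi>_def lorentz_simps lorentz_sum_right z)
  qed
  then have "Z = 0" by (rule lorentz_nondegenerate)
  then show ?thesis by (simp add: Z_def)
qed

text \<open>Parseval's identity for the unit time vector, whose product with any vector is minus the
  time component of that vector.\<close>

lemma snd_frame: "1 + (\<Sum>i\<in>UNIV. (snd (e i))\<^sup>2) = (snd p)\<^sup>2 - (snd \<nu>)\<^sup>2"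
proof -
  define Y :: "('n option) minkowski" where "Y = (0, 1)"
  have c: "lorentz Y W = - snd W" for W by (simp add: Y_def lorentz_def)
  have "lorentz Y Y = (\<Sum>i\<in>UNIV. lorentz Y (e i) * lorentz Y (e i)) + lorentz Y \<nu> * lorentz Y \<nu> - lorentz Y p * lorentz Y p"
    by (rule trans[OF arg_cong[OF frame_expansion, of "lorentz Y"]])
      (simp add: lorentz_simps lorentz_sum_right)
  then show ?thesis by (simp add: c power2_eq_square) (simp add: Y_def)
qed

text \<open>Both matrices are compared with the one whose last row is the projection of
  \<open>u *\<^sub>R \<nu> - \<nu>\<^sub>0 *\<^sub>R p\<close>: this vector has no time component, so that it is Euclidean-orthogonal
  to the projections of the \<open>e i\<close>.\<close>

lemma abs_det_frame:
  "\<bar>det (\<chi> i. case i of Some i \<Rightarrow> fst (e i) | None \<Rightarrow> fst (a *\<^sub>R p + b *\<^sub>R \<nu>))\<bar>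
    = \<bar>b * snd p + a * snd \<nu>\<bar>"
proof -
  define c where "c = snd p *\<^sub>R \<nu> - snd \<nu> *\<^sub>R p"
  define D where "D = (snd p)\<^sup>2 - (snd \<nu>)\<^sup>2"
  have "D > 0" unfolding D_def snd_frame[symmetric] by (simp add: add_pos_nonneg sum_nonneg)
  have fst_inner: "fst X \<bullet> fst Y = lorentz X Y + snd X * snd Y" for X Y :: "('n option) minkowski"
    by (simp add: lorentz_def)
  have c0: "snd c = 0" by (simp add: c_def)
  \<comment> \<open>Projecting to space adds the product of the time components, so the Gram matrix
    of the projected \<open>e i\<close> is a rank one perturbation of the identity.\<close>
  define \<tau> :: "real^'n" where "\<tau> = (\<chi> i. snd (e i))"
  have \<tau>: "1 + 1 * (\<tau> \<bullet> \<tau>) = D"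
    using snd_frame by (simp add: D_def \<tau>_def inner_vec_def power2_eq_square)
  define M where "M = (\<lambda>w :: ('n option) minkowski. (\<chi> i. case i of Some i \<Rightarrow> fst (e i) | None \<Rightarrow> fst w) :: real^'n option^'n option)"
  have ent: "(M w ** transpose (M c)) $ Some i $ Some j = (if i = j then 1 else 0) + 1 * \<tau> $ i * \<tau> $ j"
    "(M w ** transpose (M c)) $ Some i $ None = 0"
    "(M w ** transpose (M c)) $ None $ None = lorentz w c" for w i j
  proof -
    have gen: "(M w ** transpose (M c)) $ i $ j = M w $ i \<bullet> M c $ j" for i j
      by (simp add: matrix_matrix_mult_def transpose_def inner_vec_def)
    show "(M w ** transpose (M c)) $ Some i $ Some j = (if i = j then 1 else 0) + 1 * \<tau> $ i * \<tau> $ j"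
      unfolding gen by (simp add: M_def fst_inner frame_products \<tau>_def)
    show "(M w ** transpose (M c)) $ Some i $ None = 0"
      unfolding gen by (simp add: M_def fst_inner c0) (simp add: c_def lorentz_simps frame_products)
    show "(M w ** transpose (M c)) $ None $ None = lorentz w c"
      unfolding gen by (simp add: M_def fst_inner c0)
  qed
  have prod: "det (M w) * det (M c) = lorentz w c * D" for w
  proof -
    have "det (M w) * det (M c) = det (M w ** transpose (M c))"
      by (simp add: det_mul det_transpose)
    also have "\<dots> = lorentz w c * det ((\<chi> i j. (if i = j then 1 else 0) + 1 * \<tau> $ i * \<tau> $ j) :: real^'n^'n)"
      by (subst det_option_block) (simp_all only: ent)
    finally show ?thesis by (simp only: det_identity_plus_rank_one \<tau>)
  qed
  have "lorentz c c = D"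
    by (simp add: c_def lorentz_simps frame_products D_def power2_eq_square)
  then have "(det (M c))\<^sup>2 = D\<^sup>2" using prod[of c] by (simp add: power2_eq_square)
  then have "\<bar>det (M c)\<bar> = D" using \<open>D > 0\<close> by (metis abs_of_pos power2_eq_iff abs_minus_cancel)
  moreover have "lorentz (a *\<^sub>R p + b *\<^sub>R \<nu>) c = b * snd p + a * snd \<nu>"
    by (simp add: c_def lorentz_simps frame_products)
  ultimately have "\<bar>det (M (a *\<^sub>R p + b *\<^sub>R \<nu>))\<bar> * D = \<bar>b * snd p + a * snd \<nu>\<bar> * D"
    using prod[of "a *\<^sub>R p + b *\<^sub>R \<nu>"] \<open>D > 0\<close> by (metis abs_mult abs_of_pos)
  then have "\<bar>det (M (a *\<^sub>R p + b *\<^sub>R \<nu>))\<bar> = \<bar>b * snd p + a * snd \<nu>\<bar>" using \<open>D > 0\<close> by simp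
  then show ?thesis by (simp only: M_def)
qed

text \<open>The rows arise from the frame by the block matrix of C diag(k) and 1, while the Gram
  matrix of the \<open>g i\<close> is \<open>C\<close> times its transpose. Its determinant knows
  det C only up to sign, hence the absolute values.\<close>

lemma abs_det_tube:
  fixes C :: "real^'n^'n" and k :: "'n \<Rightarrow> real"
  assumes f: "\<And>i. f i = (\<Sum>j\<in>UNIV. (C $ i $ j * k j) *\<^sub>R e j)"
    and g: "\<And>i. g i = (\<Sum>j\<in>UNIV. C $ i $ j *\<^sub>R e j)"
  shows "\<bar>det (\<chi> i. case i of Some i \<Rightarrow> fst (f i) | None \<Rightarrow> fst (a *\<^sub>R p + b *\<^sub>R \<nu>))\<bar>
    = \<bar>b * snd p + a * snd \<nu>\<bar> * \<bar>\<Prod>i\<in>UNIV. k i\<bar> * sqrt (det (\<chi> i j. lorentz (g i) (g j)))"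
proof -
  define M :: "real^'n option^'n option" where
    "M = (\<chi> i. case i of Some i \<Rightarrow> fst (e i) | None \<Rightarrow> fst (a *\<^sub>R p + b *\<^sub>R \<nu>))"
  define N :: "real^'n option^'n option" where
    "N = (\<chi> i j. case i of Some i \<Rightarrow> (case j of Some j \<Rightarrow> C $ i $ j * k j | None \<Rightarrow> 0)
      | None \<Rightarrow> (case j of Some j \<Rightarrow> 0 | None \<Rightarrow> 1))"
  have un: "UNIV = insert None (range (Some :: 'n \<Rightarrow> 'n option))" by (auto simp: UNIV_option_conv)
  have sum_opt: "(\<Sum>l\<in>UNIV. h l) = h None + (\<Sum>l\<in>UNIV. h (Some l))" for h :: "'n option \<Rightarrow> real"
    unfolding un by (subst sum.insert) (auto simp: sum.reindex)
  have "(\<chi> i. case i of Some i \<Rightarrow> fst (f i) | None \<Rightarrow> fst (a *\<^sub>R p + b *\<^sub>R \<nu>)) = N ** M"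
  proof -
    have "(case i of Some i \<Rightarrow> fst (f i) | None \<Rightarrow> fst (a *\<^sub>R p + b *\<^sub>R \<nu>)) $ l = (N ** M) $ i $ l" for i l
      by (cases i) (simp_all add: matrix_matrix_mult_def sum_opt N_def M_def f fst_sum)
    then show ?thesis by (simp add: vec_eq_iff)
  qed
  moreover have "det N = det C * (\<Prod>i\<in>UNIV. k i)"
  proof -
    define K :: "real^'n^'n" where "K = (\<chi> i j. if i = j then k i else 0)"
    have "det N = det (\<chi> i j. N $ Some i $ Some j)"
      by (subst det_option_block) (auto simp: N_def)
    also have "(\<chi> i j. N $ Some i $ Some j) = C ** K"
      by (simp add: vec_eq_iff N_def matrix_matrix_mult_def K_def if_distrib cong: if_cong)
    also have "det \<dots> = det C * (\<Prod>i\<in>UNIV. k i)"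
      by (simp add: det_mul) (subst det_diagonal, auto simp: K_def)
    finally show ?thesis .
  qed
  moreover have "det (\<chi> i j. lorentz (g i) (g j)) = (det C)\<^sup>2"
  proof -
    have "(\<chi> i j. lorentz (g i) (g j)) = C ** transpose C"
      by (simp add: vec_eq_iff g lorentz_sum_left lorentz_sum_right lorentz_simps frame_products
          matrix_matrix_mult_def transpose_def if_distrib mult.commute cong: if_cong)
    then show ?thesis by (simp add: det_mul det_transpose power2_eq_square)
  qed
  ultimately show ?thesis
    using abs_det_frame[of a b] by (simp add: det_mul abs_mult M_def)
qed

end

text \<open>With the time component flipped by \<open>J\<close>, the vectors Lorentz-orthogonal to
  \<open>p\<close> and \<open>\<nu>\<close> are the Euclidean complement of \<open>J p\<close> and
  \<open>J \<nu>\<close>, hence of dimension n; the form is positive there, and the spectral theorem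
  applies.\<close>

lemma ex_lorentz_eigenframe:
  fixes p \<nu> :: "('n::finite option) minkowski"
  assumes p: "p \<in> hyperbolic_space" "lorentz p \<nu> = 0" "lorentz \<nu> \<nu> = 1"
    and A: "linear A" "\<And>v. lorentz p v = 0 \<Longrightarrow> lorentz \<nu> v = 0 \<Longrightarrow> lorentz p (A v) = 0 \<and> lorentz \<nu> (A v) = 0"
    "\<And>v w. lorentz p v = 0 \<Longrightarrow> lorentz \<nu> v = 0 \<Longrightarrow> lorentz p w = 0 \<Longrightarrow> lorentz \<nu> w = 0 \<Longrightarrow>
      lorentz (A v) w = lorentz v (A w)"
  shows "\<exists>e \<kappa>. lorentz_frame p \<nu> e \<and> (\<forall>i. A (e i) = \<kappa> i *\<^sub>R e i)"
proof -
  define J where "J = (\<lambda>X :: ('n option) minkowski. (fst X, - snd X))"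
  define T where "T = {v. lorentz p v = 0 \<and> lorentz \<nu> v = 0}"
  have sub: "subspace T" by (auto simp: subspace_def T_def lorentz_simps)
  have T: "T = {y \<in> UNIV. \<forall>x \<in> span {J p, J \<nu>}. orthogonal x y}"
  proof -
    have "(\<forall>x \<in> span {J p, J \<nu>}. orthogonal x y) \<longleftrightarrow> orthogonal (J p) y \<and> orthogonal (J \<nu>) y" for y
    proof (intro iffI ballI)
      fix x assume "orthogonal (J p) y \<and> orthogonal (J \<nu>) y" "x \<in> span {J p, J \<nu>}"
      then have "orthogonal y x"
        by (intro orthogonal_to_span[of x "{J p, J \<nu>}"]) (auto simp: orthogonal_commute)
      then show "orthogonal x y" by (simp add: orthogonal_commute)
    qed (auto simp: span_base)
    then show ?thesis by (simp add: T_def J_def orthogonal_def lorentz_conv_inner)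
  qed
  have indep: "J p \<notin> span {J \<nu>}" "J \<nu> \<noteq> 0"
  proof -
    show "J p \<notin> span {J \<nu>}"
    proof
      assume "J p \<in> span {J \<nu>}"
      then obtain c where "J p = c *\<^sub>R J \<nu>" unfolding span_singleton by blast
      then have "p = c *\<^sub>R \<nu>" by (simp add: J_def prod_eq_iff)
      then have "lorentz p p = c * c" by (simp add: lorentz_simps p(3))
      then show False using hyperbolic_spaceD(1)[OF p(1)] zero_le_square[of c] by linarith
    qed
    show "J \<nu> \<noteq> 0" using p(3) by (auto simp: J_def lorentz_def zero_prod_def)
  qed
  have "dim {J p, J \<nu>} = 2"
    using indep by (simp add: dim_insert span_empty)
  moreover have "dim T + dim (span {J p, J \<nu>}) = dim (UNIV :: ('n option) minkowski set)"
    unfolding T by (rule dim_subspace_orthogonal_to_vectors) auto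
  ultimately have dimT: "dim T = CARD('n)" by simp
  obtain E where E: "finite E" "card E = dim T" "E \<subseteq> T"
    "\<forall>x\<in>E. \<forall>y\<in>E. lorentz x y = (if x = y then 1 else 0)" "\<forall>x\<in>E. \<exists>k. A x = k *\<^sub>R x"
  proof -
    have "\<exists>E. finite E \<and> card E = dim T \<and> E \<subseteq> T \<and>
      (\<forall>x\<in>E. \<forall>y\<in>E. lorentz x y = (if x = y then 1 else 0)) \<and> (\<forall>x\<in>E. \<exists>k. A x = k *\<^sub>R x)"
      by (rule bilinear_form_orthonormal_eigenbasis[OF bilinear_lorentz lorentz_sym A(1) sub])
        (use tangent_vector_spacelike(3)[OF p(1)] A(2,3) in \<open>auto simp: T_def\<close>)
    then show ?thesis using that by blast
  qed
  obtain e where e: "bij_betw e (UNIV :: 'n set) E"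
    using E(1,2) dimT by (metis finite bij_betw_iff_card)
  have eE: "e i \<in> E" for i using e by (auto simp: bij_betw_def)
  have "\<forall>i. \<exists>k. A (e i) = k *\<^sub>R e i" using E(5) eE by blast
  then obtain \<kappa> where \<kappa>: "\<And>i. A (e i) = \<kappa> i *\<^sub>R e i" by metis
  have "lorentz_frame p \<nu> e"
  proof
    show "lorentz (e i) (e j) = (if i = j then 1 else 0)" for i j
      using E(4) eE e by (auto simp: bij_betw_def inj_on_def)
  qed (use E(3) eE p in \<open>auto simp: T_def\<close>)
  with \<kappa> show ?thesis by blast
qed

section \<open>Locally strictly convex compact sets are convex\<close>

lemma DERIV_zero_second_pos_increases:
  fixes \<phi> :: "real \<Rightarrow> real"
  assumes "d > 0" and der: "\<And>t. a \<le> t \<Longrightarrow> t < a + d \<Longrightarrow> (\<phi> has_real_derivative \<phi>' t) (at t)"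
    and "\<phi>' a = 0" and D: "(\<phi>' has_real_derivative D) (at a)" "D > 0"
  obtains r where "0 < r" "r \<le> d" "\<And>t. a < t \<Longrightarrow> t < a + r \<Longrightarrow> \<phi> t > \<phi> a"
proof -
  obtain s where s: "s > 0" "\<And>h. h > 0 \<Longrightarrow> h < s \<Longrightarrow> \<phi>' a < \<phi>' (a + h)"
    using DERIV_pos_inc_right[OF D] by blast
  show ?thesis
  proof
    show "0 < min s d" "min s d \<le> d" using s(1) assms(1) by auto
    fix t assume t: "a < t" "t < a + min s d"
    have "\<exists>z>a. z < t \<and> \<phi> t - \<phi> a = (t - a) * \<phi>' z"
      by (rule MVT2[OF t(1)]) (use der t in auto)
    then obtain z where z: "a < z" "z < t" "\<phi> t - \<phi> a = (t - a) * \<phi>' z" by blast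
    have "\<phi>' z > 0" using s(2)[of "z - a"] z t assms(3) by simp
    then show "\<phi> t > \<phi> a" using z t by (smt (verit) mult_pos_pos)
  qed
qed

text \<open>An interior positive maximum would be a critical point, where the assumed second
  derivative makes the function rise strictly to the right. This is quasi-convexity from information
  at critical points alone.\<close>

lemma nonpos_of_strictly_convex_critical_points:
  fixes \<phi> :: "real \<Rightarrow> real"
  assumes der: "\<And>t. 0 \<le> t \<Longrightarrow> t \<le> 1 \<Longrightarrow> (\<phi> has_real_derivative \<phi>' t) (at t)"
    and crit: "\<And>t. 0 < t \<Longrightarrow> t < 1 \<Longrightarrow> \<phi>' t = 0 \<Longrightarrow> \<exists>D>0. (\<phi>' has_real_derivative D) (at t)"
    and "\<phi> 0 \<le> 0" "\<phi> 1 \<le> 0" and t: "0 \<le> t" "t \<le> 1"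
  shows "\<phi> t \<le> 0"
proof (rule ccontr)
  assume "\<not> \<phi> t \<le> 0"
  have "continuous_on {0..1} \<phi>"
    by (rule continuous_at_imp_continuous_on) (auto intro: DERIV_isCont[OF der])
  then obtain m where m: "m \<in> {0..1}" "\<And>s. s \<in> {0..1} \<Longrightarrow> \<phi> s \<le> \<phi> m"
    using continuous_attains_sup[of "{0..1::real}" \<phi>] by auto
  have "\<phi> m > 0" using m(2)[of t] t \<open>\<not> \<phi> t \<le> 0\<close> by auto
  then have m01: "0 < m" "m < 1" using m(1) assms(3,4) by (auto simp: less_le)
  have "\<phi>' m = 0"
  proof (rule DERIV_local_max[OF der, of m "min m (1 - m)"])
    show "\<forall>y. \<bar>m - y\<bar> < min m (1 - m) \<longrightarrow> \<phi> y \<le> \<phi> m"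
      by (auto intro!: m(2))
  qed (use m01 in auto)
  with crit m01 obtain D where D: "D > 0" "(\<phi>' has_real_derivative D) (at m)" by blast
  obtain r where r: "0 < r" "r \<le> 1 - m" "\<And>t. m < t \<Longrightarrow> t < m + r \<Longrightarrow> \<phi> t > \<phi> m"
    by (rule DERIV_zero_second_pos_increases[of "1 - m" m \<phi> \<phi>' D])
      (use m01 der \<open>\<phi>' m = 0\<close> D in auto)
  have "\<phi> (m + r/2) > \<phi> m" using r(1) by (intro r(3)) auto
  moreover have "\<phi> (m + r/2) \<le> \<phi> m" using r(1,2) m01 by (intro m(2)) auto
  ultimately show False by simp
qed

text \<open>Strict quasi-convexity of \<open>F\<close> along lines. Positivity is asked only in
  directions that annihilate the differential, the form in which a curvature condition on the
  boundary arrives. It is asked at every point of \<open>W\<close>, because along a chord a maximum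
  of \<open>F\<close> has to be excluded where \<open>F\<close> is positive.\<close>

definition strictly_convex_defining ::
  "'a::euclidean_space set \<Rightarrow> 'a set \<Rightarrow> ('a \<Rightarrow> real) \<Rightarrow> ('a \<Rightarrow> 'a \<Rightarrow> real) \<Rightarrow> bool" where
  "strictly_convex_defining S W F F' \<longleftrightarrow> open W \<and> S \<inter> W = {x \<in> W. F x \<le> 0} \<and>
     (\<forall>x\<in>W. (F has_derivative F' x) (at x)) \<and>
     (\<forall>x\<in>W. \<forall>v. v \<noteq> 0 \<longrightarrow> F' x v = 0 \<longrightarrow>
        (\<exists>D>0. ((\<lambda>t. F' (x + t *\<^sub>R v) v) has_real_derivative D) (at 0)))"

lemma strictly_convex_defining_line:
  assumes "strictly_convex_defining S W F F'" "x + t *\<^sub>R v \<in> W"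
  shows "((\<lambda>t. F (x + t *\<^sub>R v)) has_real_derivative F' (x + t *\<^sub>R v) v) (at t)"
    and "v \<noteq> 0 \<Longrightarrow> F' (x + t *\<^sub>R v) v = 0 \<Longrightarrow>
      \<exists>D>0. ((\<lambda>t. F' (x + t *\<^sub>R v) v) has_real_derivative D) (at t)"
proof -
  have d: "(F has_derivative F' (x + t *\<^sub>R v)) (at (x + t *\<^sub>R v))"
    using assms by (simp add: strictly_convex_defining_def)
  have "((\<lambda>t. x + t *\<^sub>R v) has_derivative (\<lambda>r. r *\<^sub>R v)) (at t)"
    by (auto intro!: derivative_eq_intros)
  from diff_chain_at[OF this d]
  show "((\<lambda>t. F (x + t *\<^sub>R v)) has_real_derivative F' (x + t *\<^sub>R v) v) (at t)"
    by (simp add: has_field_derivative_def o_def linear_scale[OF has_derivative_linear[OF d]] mult_commute_abs)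
  show "\<exists>D>0. ((\<lambda>t. F' (x + t *\<^sub>R v) v) has_real_derivative D) (at t)"
    if v: "v \<noteq> 0" "F' (x + t *\<^sub>R v) v = 0"
  proof -
    obtain D where D: "D > 0" "((\<lambda>s. F' ((x + t *\<^sub>R v) + s *\<^sub>R v) v) has_real_derivative D) (at 0)"
      using assms(1)[unfolded strictly_convex_defining_def, THEN conjunct2, THEN conjunct2,
          THEN conjunct2, rule_format, OF assms(2) v] by blast
    have "(x + t *\<^sub>R v) + s *\<^sub>R v = x + (s + t) *\<^sub>R v" for s
      by (simp add: scaleR_add_left)
    then have "((\<lambda>s. F' (x + (s + t) *\<^sub>R v) v) has_real_derivative D) (at 0)"
      using D(2) by (simp only:)
    then have "((\<lambda>t. F' (x + t *\<^sub>R v) v) has_real_derivative D) (at t)"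
      using DERIV_shift[of "\<lambda>t. F' (x + t *\<^sub>R v) v" D 0 t] by simp
    with D(1) show ?thesis by blast
  qed
qed

text \<open>The derivative cannot be positive, since the segment stays in \<open>S\<close>; were it
  zero, the second-order condition would push \<open>F\<close> above zero.\<close>

lemma strictly_convex_defining_segment_start:
  assumes sd: "strictly_convex_defining S W F F'" "x \<in> W" "F x = 0" "v \<noteq> 0"
    and seg: "d > 0" "\<And>t. 0 \<le> t \<Longrightarrow> t < d \<Longrightarrow> x + t *\<^sub>R v \<in> S"
  shows "F' x v < 0"
proof -
  have "open W" using sd(1) by (simp add: strictly_convex_defining_def)
  then obtain e where e: "e > 0" "ball x e \<subseteq> W" using sd(2) openE by blast
  define d' where "d' = min d (e / norm v)"
  have d': "d' > 0" using e seg sd(4) by (simp add: d'_def)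
  have inW: "x + t *\<^sub>R v \<in> W" if "0 \<le> t" "t < d'" for t
  proof -
    have "norm (t *\<^sub>R v) < e" using that sd(4) by (simp add: d'_def pos_less_divide_eq)
    then have "x + t *\<^sub>R v \<in> ball x e" by (simp add: dist_norm)
    then show ?thesis using e(2) by blast
  qed
  have le: "F (x + t *\<^sub>R v) \<le> 0" if "0 \<le> t" "t < d'" for t
    using inW[OF that] seg(2)[of t] that sd(1) unfolding strictly_convex_defining_def d'_def by auto
  note line = strictly_convex_defining_line[OF sd(1)]
  have d0: "((\<lambda>t. F (x + t *\<^sub>R v)) has_real_derivative F' x v) (at 0)"
    using line(1)[of x 0 v] sd(2) by simp
  have "\<not> F' x v > 0"
  proof
    assume "F' x v > 0"
    from DERIV_pos_inc_right[OF d0 this] obtain s where s: "s > 0"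
      "\<And>h. h > 0 \<Longrightarrow> h < s \<Longrightarrow> F (x + 0 *\<^sub>R v) < F (x + (0 + h) *\<^sub>R v)" by auto
    define q where "q = min s d' / 2"
    have "0 < q" "q < s" "q < d'" using s(1) d' by (auto simp: q_def min_def)
    then show False using le[of q] s(2)[of q] sd(3) by simp
  qed
  moreover have "F' x v \<noteq> 0"
  proof
    assume z: "F' x v = 0"
    obtain D where D: "D > 0" "((\<lambda>t. F' (x + t *\<^sub>R v) v) has_real_derivative D) (at 0)"
      using line(2)[of x 0 v] sd z by auto
    obtain r where r: "0 < r" "r \<le> d'" "\<And>t. 0 < t \<Longrightarrow> t < 0 + r \<Longrightarrow> F (x + t *\<^sub>R v) > F (x + 0 *\<^sub>R v)"
      by (rule DERIV_zero_second_pos_increases[of d' 0 "\<lambda>t. F (x + t *\<^sub>R v)" "\<lambda>t. F' (x + t *\<^sub>R v) v" D])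
        (use d' inW line(1) z D in auto)
    have "F (x + (r/2) *\<^sub>R v) > F (x + 0 *\<^sub>R v)" using r(1) by (intro r(3)) auto
    moreover have "F (x + (r/2) *\<^sub>R v) \<le> 0" using r(1,2) by (intro le) auto
    ultimately show False using sd(3) by simp
  qed
  ultimately show ?thesis by simp
qed

locale locally_strictly_convex =
  fixes S :: "'a::euclidean_space set"
  assumes compact: "compact S" and connected: "connected S"
    and local_cases: "\<And>p. p \<in> S \<Longrightarrow> p \<notin> interior S \<Longrightarrow> \<exists>W F F'. p \<in> W \<and> strictly_convex_defining S W F F'"
begin

lemma locally_convex:
  assumes "p \<in> S"
  obtains e where "e > 0" "convex (S \<inter> ball p e)"
proof (cases "p \<in> interior S")
  case True
  then obtain e where "e > 0" "ball p e \<subseteq> S" by (meson mem_interior)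
  then have "S \<inter> ball p e = ball p e" by blast
  then show ?thesis using that \<open>e > 0\<close> by simp
next
  case False
  then obtain W F F' where W: "p \<in> W" and sd: "strictly_convex_defining S W F F'"
    using local_cases assms by blast
  have "open W" and SW: "S \<inter> W = {x \<in> W. F x \<le> 0}"
    using sd by (auto simp: strictly_convex_defining_def)
  then obtain e where e: "e > 0" "ball p e \<subseteq> W" using W openE by blast
  have "convex (S \<inter> ball p e)"
    unfolding convex_contains_segment
  proof (intro ballI subsetI)
    fix x y z assume xy: "x \<in> S \<inter> ball p e" "y \<in> S \<inter> ball p e" and "z \<in> closed_segment x y"
    then obtain t where t: "0 \<le> t" "t \<le> 1" "z = (1 - t) *\<^sub>R x + t *\<^sub>R y" by (auto simp: in_segment)
    have inb: "x + s *\<^sub>R (y - x) \<in> ball p e" if "0 \<le> s" "s \<le> 1" for s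
    proof -
      have "(1 - s) *\<^sub>R x + s *\<^sub>R y \<in> ball p e"
        using convex_ball[of p e] xy that unfolding convex_alt by blast
      then show ?thesis by (simp add: algebra_simps)
    qed
    have z: "z = x + t *\<^sub>R (y - x)" using t by (simp add: algebra_simps)
    have "F (x + t *\<^sub>R (y - x)) \<le> 0"
    proof (cases "x = y")
      case True
      then show ?thesis using xy e SW by auto
    next
      case False
      show ?thesis
      proof (rule nonpos_of_strictly_convex_critical_points[where
            \<phi> = "\<lambda>t. F (x + t *\<^sub>R (y - x))" and \<phi>' = "\<lambda>t. F' (x + t *\<^sub>R (y - x)) (y - x)"])
        fix s :: real assume "0 \<le> s" "s \<le> 1"
        then show "((\<lambda>t. F (x + t *\<^sub>R (y - x))) has_real_derivative F' (x + s *\<^sub>R (y - x)) (y - x)) (at s)"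
          using strictly_convex_defining_line(1)[OF sd] inb e(2) by blast
      next
        fix s :: real assume "0 < s" "s < 1" "F' (x + s *\<^sub>R (y - x)) (y - x) = 0"
        then show "\<exists>D>0. ((\<lambda>t. F' (x + t *\<^sub>R (y - x)) (y - x)) has_real_derivative D) (at s)"
          using strictly_convex_defining_line(2)[OF sd] inb[of s] e(2) False by auto
      qed (use xy e SW t in auto)
    qed
    then show "z \<in> S \<inter> ball p e" using inb[of t] t z e(2) SW by auto
  qed
  then show ?thesis using that e(1) by blast
qed

text \<open>At a boundary point inside the segment, the differential would be negative along both
  opposite directions of the segment.\<close>

lemma open_segment_interior:
  assumes "x \<noteq> y" "\<And>t. 0 \<le> t \<Longrightarrow> t \<le> 1 \<Longrightarrow> x + t *\<^sub>R (y - x) \<in> S" "0 < s" "s < 1"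
  shows "x + s *\<^sub>R (y - x) \<in> interior S"
proof (rule ccontr)
  define z where "z = x + s *\<^sub>R (y - x)"
  assume "x + s *\<^sub>R (y - x) \<notin> interior S"
  then have z: "z \<in> S" "z \<notin> interior S" using assms by (auto simp: z_def)
  then obtain W F F' where W: "z \<in> W" and sd: "strictly_convex_defining S W F F'"
    using local_cases by blast
  have "open W" and SW: "S \<inter> W = {x \<in> W. F x \<le> 0}" and der: "\<And>x. x \<in> W \<Longrightarrow> (F has_derivative F' x) (at x)"
    using sd by (auto simp: strictly_convex_defining_def)
  have "F z \<le> 0" using z W SW by blast
  moreover have "\<not> F z < 0"
  proof
    assume "F z < 0"
    have "continuous_on W F"
      using der \<open>open W\<close> by (meson continuous_on_eq_continuous_at has_derivative_continuous)
    then have "open {x \<in> W. F x < 0}"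
      using continuous_open_preimage[OF _ \<open>open W\<close> open_lessThan[of "0::real"], of F]
      by (simp add: vimage_def Int_def)
    moreover have "{x \<in> W. F x < 0} \<subseteq> {x \<in> W. F x \<le> 0}" by auto
    then have "{x \<in> W. F x < 0} \<subseteq> S" unfolding SW[symmetric] by blast
    moreover have "z \<in> {x \<in> W. F x < 0}" using W \<open>F z < 0\<close> by simp
    ultimately have "z \<in> interior S" by (meson interior_maximal subsetD)
    with z show False by blast
  qed
  ultimately have F0: "F z = 0" by simp
  have a: "F' z (y - x) < 0"
  proof (rule strictly_convex_defining_segment_start[OF sd W F0])
    show "z + t *\<^sub>R (y - x) \<in> S" if "0 \<le> t" "t < 1 - s" for t
      using assms(2)[of "s + t"] assms(3,4) that by (simp add: z_def algebra_simps)
  qed (use assms in auto)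
  have b: "F' z (x - y) < 0"
  proof (rule strictly_convex_defining_segment_start[OF sd W F0])
    show "z + t *\<^sub>R (x - y) \<in> S" if "0 \<le> t" "t < s" for t
      using assms(2)[of "s - t"] assms(3,4) that by (simp add: z_def algebra_simps)
  qed (use assms in auto)
  have "F' z (x - y) = - F' z (y - x)"
    using linear_neg[OF has_derivative_linear[OF der[OF W]], of "y - x"] by simp
  with a b show False by simp
qed

text \<open>Near the endpoints local convexity controls the nearby segments; the rest of the segment
  is a compact subset of the interior and survives a small perturbation.\<close>

lemma segments_open:
  assumes xy: "x \<in> S" "y \<in> S" "\<And>t. 0 \<le> t \<Longrightarrow> t \<le> 1 \<Longrightarrow> x + t *\<^sub>R (y - x) \<in> S"
  obtains e where "e > 0" "\<forall>x'\<in>S. \<forall>y'\<in>S. \<forall>t\<in>{0..1}. dist x' x < e \<longrightarrow> dist y' y < e \<longrightarrow>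
     x' + t *\<^sub>R (y' - x') \<in> S"
proof -
  obtain ex where ex: "ex > 0" "convex (S \<inter> ball x ex)" using locally_convex xy(1) by blast
  obtain ey where ey: "ey > 0" "convex (S \<inter> ball y ey)" using locally_convex xy(2) by blast
  have cvx: "a + t *\<^sub>R (b - a) \<in> C" if "convex C" "a \<in> C" "b \<in> C" "0 \<le> t" "t \<le> 1" for C :: "'a set" and a b t
    using that unfolding convex_alt by (simp add: algebra_simps)
  show ?thesis
  proof (cases "x = y")
    case True
    show ?thesis
    proof (rule that[OF ex(1)], intro ballI impI)
      fix x' y' and t :: real assume "x' \<in> S" "y' \<in> S" "dist x' x < ex" "dist y' y < ex" "t \<in> {0..1}"
      then show "x' + t *\<^sub>R (y' - x') \<in> S"
        using cvx[OF ex(2), of x' y' t] True by (auto simp: dist_commute)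
    qed
  next
    case False
    \<comment> \<open>Parameters below \<open>s\<close> and above \<open>1 - s\<close> cover pieces
      of length at most half the radii of the convex balls, which leaves room for the perturbation;
      the bound 1/2 keeps \<open>s\<close> from exceeding \<open>1 - s\<close>.\<close>
    define s where "s = min (1/2) (min ex ey / (2 * norm (y - x)))"
    have ny: "norm (y - x) > 0" using False by simp
    have s: "0 < s" "s \<le> 1/2" using ex ey ny by (auto simp: s_def)
    have "s \<le> min ex ey / (2 * norm (y - x))" by (simp add: s_def)
    then have "s * norm (y - x) \<le> min ex ey / 2" using ny by (simp add: field_simps)
    then have sn: "s * norm (y - x) < ex" "s * norm (y - x) < ey"
      using ex(1) ey(1) by linarith+
    define K where "K = (\<lambda>t. x + t *\<^sub>R (y - x)) ` {s..1-s}"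
    have "compact K" unfolding K_def by (intro compact_continuous_image continuous_intros) auto
    moreover have "K \<subseteq> interior S"
      unfolding K_def using open_segment_interior[OF False xy(3)] s(1) by auto
    ultimately obtain d where d: "d > 0" "(\<Union>k\<in>K. ball k d) \<subseteq> interior S"
      using compact_subset_open_imp_ball_epsilon_subset by (metis open_interior)
    define e where "e = min d (min (ex - s * norm (y - x)) (ey - s * norm (y - x)))"
    have e: "e > 0" "e \<le> d" "e \<le> ex - s * norm (y - x)" "e \<le> ey - s * norm (y - x)"
      using d sn by (auto simp: e_def)
    show ?thesis
    proof (rule that[OF e(1)], intro ballI impI)
      fix x' y' and t :: real
      assume x'y': "x' \<in> S" "y' \<in> S" "dist x' x < e" "dist y' y < e" and "t \<in> {0..1}"
      then have t: "0 \<le> t" "t \<le> 1" by auto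
      define m where "m = (\<lambda>t. x' + t *\<^sub>R (y' - x'))"
      have close: "dist (m t) (x + t *\<^sub>R (y - x)) < e" if "0 \<le> t" "t \<le> 1" for t
      proof -
        have "m t - (x + t *\<^sub>R (y - x)) = (1 - t) *\<^sub>R (x' - x) + t *\<^sub>R (y' - y)"
          by (simp add: m_def algebra_simps)
        then have "dist (m t) (x + t *\<^sub>R (y - x)) \<le> (1 - t) * dist x' x + t * dist y' y"
          using that by (metis abs_of_nonneg diff_ge_0_iff_ge dist_norm norm_scaleR norm_triangle_ineq)
        also have "\<dots> < e"
          by (rule convex_bound_lt) (use x'y' that in auto)
        finally show ?thesis .
      qed
      have mid: "m t \<in> S" if "s \<le> t" "t \<le> 1 - s" for t
      proof -
        have "m t \<in> ball (x + t *\<^sub>R (y - x)) d"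
          using close[of t] that s e(2) by (simp add: dist_commute)
        moreover have "x + t *\<^sub>R (y - x) \<in> K" using that by (auto simp: K_def)
        ultimately show ?thesis using d(2) interior_subset by blast
      qed
      consider "t < s" | "s \<le> t" "t \<le> 1 - s" | "t > 1 - s" by linarith
      then show "x' + t *\<^sub>R (y' - x') \<in> S"
      proof cases
        case 1
        \<comment> \<open>Up to \<open>s\<close> the new segment runs from \<open>x'\<close> to
          \<open>m s\<close>, which both lie in the convex set around \<open>x\<close>.\<close>
        have "dist (m s) x \<le> dist (m s) (x + s *\<^sub>R (y - x)) + dist (x + s *\<^sub>R (y - x)) x"
          by (rule dist_triangle)
        also have "dist (x + s *\<^sub>R (y - x)) x = s * norm (y - x)" using s by (simp add: dist_norm)
        finally have "dist (m s) x < ex" using close[of s] s e(3) by simp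
        then have ms: "m s \<in> S \<inter> ball x ex" using mid[of s] s by (simp add: dist_commute)
        have "x' \<in> S \<inter> ball x ex"
          using x'y' e(3) ny s by (auto simp: dist_commute intro: less_le_trans)
        then have "x' + (t / s) *\<^sub>R (m s - x') \<in> S \<inter> ball x ex"
          using 1 t s by (intro cvx[OF ex(2)] ms) auto
        moreover have "x' + (t / s) *\<^sub>R (m s - x') = x' + t *\<^sub>R (y' - x')"
          using s by (simp add: m_def)
        ultimately show ?thesis by simp
      next
        case 2
        then show ?thesis using mid by (simp add: m_def)
      next
        case 3
        have "dist (m (1-s)) y \<le> dist (m (1-s)) (x + (1-s) *\<^sub>R (y - x)) + dist (x + (1-s) *\<^sub>R (y - x)) y"
          by (rule dist_triangle)
        also have "x + (1-s) *\<^sub>R (y - x) = y - s *\<^sub>R (y - x)" by (simp add: algebra_simps)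
        also have "dist (y - s *\<^sub>R (y - x)) y = s * norm (y - x)" using s by (simp add: dist_norm)
        finally have "dist (m (1-s)) y < ey"
          using close[of "1-s"] s e(4) by (simp add: algebra_simps)
        then have ms: "m (1-s) \<in> S \<inter> ball y ey" using mid[of "1-s"] s by (simp add: dist_commute)
        have "y' \<in> S \<inter> ball y ey"
          using x'y' e(4) ny s by (auto simp: dist_commute intro: less_le_trans)
        then have "y' + ((1 - t) / s) *\<^sub>R (m (1-s) - y') \<in> S \<inter> ball y ey"
          using 3 t s by (intro cvx[OF ey(2)] ms) auto
        moreover have eq: "m (1-s) - y' = s *\<^sub>R (x' - y')" by (simp add: m_def algebra_simps)
        have "y' + ((1 - t) / s) *\<^sub>R (m (1-s) - y') = x' + t *\<^sub>R (y' - x')"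
        proof -
          have "((1 - t) / s) *\<^sub>R (s *\<^sub>R (x' - y')) = (1 - t) *\<^sub>R (x' - y')" using s by simp
          then show ?thesis unfolding eq by (simp add: algebra_simps)
        qed
        ultimately show ?thesis by simp
      qed
    qed
  qed
qed

text \<open>The Tietze-Nakajima argument: the pairs of points whose segment stays in
  \<open>S\<close> form a set that is closed, is open by \<open>segments_open\<close>, and contains
  the diagonal of the connected set \<open>S \<times> S\<close>.\<close>

theorem convex: "convex S"
proof (cases "S = {}")
  case False
  define P where "P = {q \<in> S \<times> S. \<forall>t\<in>{0..1}. fst q + t *\<^sub>R (snd q - fst q) \<in> S}"
  have "closed S" using compact by (rule compact_imp_closed)
  have Peq: "P = (S \<times> S) \<inter> (\<Inter>t\<in>{0..1}. (\<lambda>q. fst q + t *\<^sub>R (snd q - fst q)) -` S)"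
    by (auto simp: P_def)
  have "closed P"
    unfolding Peq by (intro closed_Int closed_Times \<open>closed S\<close> closed_INT ballI continuous_closed_vimage continuous_intros)
  then have cl: "closedin (top_of_set (S \<times> S)) P"
    by (rule closed_subset[rotated]) (auto simp: P_def)
  have op: "openin (top_of_set (S \<times> S)) P"
    unfolding openin_euclidean_subtopology_iff
  proof (intro conjI ballI)
    fix q assume "q \<in> P"
    then have q: "fst q \<in> S" "snd q \<in> S" "\<And>t. 0 \<le> t \<Longrightarrow> t \<le> 1 \<Longrightarrow> fst q + t *\<^sub>R (snd q - fst q) \<in> S"
      by (auto simp: P_def)
    obtain e where e: "e > 0" "\<forall>x'\<in>S. \<forall>y'\<in>S. \<forall>t\<in>{0..1}. dist x' (fst q) < e \<longrightarrow> dist y' (snd q) < e \<longrightarrow>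
       x' + t *\<^sub>R (y' - x') \<in> S"
      by (rule segments_open[OF q])
    show "\<exists>e>0. \<forall>q'\<in>S \<times> S. dist q' q < e \<longrightarrow> q' \<in> P"
    proof (intro exI[of _ e] conjI ballI impI e(1))
      fix q' assume "q' \<in> S \<times> S" "dist q' q < e"
      then show "q' \<in> P"
        using e(2)[THEN bspec, of "fst q'", THEN bspec, of "snd q'"] dist_fst_le[of q' q] dist_snd_le[of q' q]
        by (auto simp: P_def)
    qed
  qed (auto simp: P_def)
  have "connected (S \<times> S)" using connected by (simp add: connected_Times)
  with cl op have "P = {} \<or> P = S \<times> S" unfolding connected_clopen by blast
  moreover have "P \<noteq> {}"
  proof -
    obtain x where "x \<in> S" using False by blast
    then have "(x, x) \<in> P" by (simp add: P_def)
    then show ?thesis by blast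
  qed
  ultimately have P: "P = S \<times> S" by blast
  show ?thesis
    unfolding convex_alt
  proof (intro ballI allI impI)
    fix x y and t :: real assume "x \<in> S" "y \<in> S" "0 \<le> t \<and> t \<le> 1"
    then have "(x, y) \<in> P" "t \<in> {0..1}" using P by auto
    then have "x + t *\<^sub>R (y - x) \<in> S" by (auto simp: P_def)
    then show "(1 - t) *\<^sub>R x + t *\<^sub>R y \<in> S" by (simp add: algebra_simps)
  qed
qed simp

theorem support:
  assumes "strictly_convex_defining S W F F'" "p \<in> W" "F p = 0" "p \<in> S" "y \<in> S" "y \<noteq> p"
  shows "F' p (y - p) < 0"
proof (rule strictly_convex_defining_segment_start[OF assms(1-3)])
  show "p + t *\<^sub>R (y - p) \<in> S" if "0 \<le> t" "t < 1" for t
  proof -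
    have "(1 - t) *\<^sub>R p + t *\<^sub>R y \<in> S" using convex assms(4,5) that unfolding convex_alt by simp
    then show ?thesis by (simp add: algebra_simps)
  qed
qed (use assms(6) in auto)

end

text \<open>By compactness of the unit sphere, one neighbourhood of \<open>p\<close> keeps the
  positivity at \<open>p\<close> for all unit directions at once, and homogeneity passes from unit
  vectors to all vectors.\<close>

lemma strictly_convex_defining_nearby:
  fixes F :: "'a::euclidean_space \<Rightarrow> real"
  assumes "open W" "p \<in> W" "higher_differentiable_on W F 2" and S: "S \<inter> W = {x \<in> W. F x \<le> 0}"
    and pos: "\<And>v. v \<noteq> 0 \<Longrightarrow> frechet_derivative F (at p) v = 0 \<Longrightarrow>
      frechet_derivative (\<lambda>y. frechet_derivative F (at y) v) (at p) v > 0"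
  obtains W' where "p \<in> W'" "W' \<subseteq> W" "strictly_convex_defining S W' F (\<lambda>x. frechet_derivative F (at x))"
proof -
  have D: "higher_differentiable_on W F (Suc (Suc 0))"
    using assms(3) by (simp add: numeral_2_eq_2)
  note F1 = higher_differentiable_on_SucD[OF D]
  note F2 = higher_differentiable_on_SucD[OF F1(2)]
  define F' where "F' = (\<lambda>b x. frechet_derivative F (at x) b)"
  define F'' where "F'' = (\<lambda>b c x. frechet_derivative (F' b) (at x) c)"
  have d2: "(F' b has_derivative (\<lambda>c. F'' b c x)) (at x)" if "x \<in> W" for x b
    using F2(1)[OF that] by (simp add: F'_def F''_def)
  have e1: "F' v x = (\<Sum>b\<in>Basis. (v \<bullet> b) * F' b x)" if "x \<in> W" for x v
  proof -
    have "linear (frechet_derivative F (at x))" using F1(1)[OF that] by (rule has_derivative_linear)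
    then have "frechet_derivative F (at x) (\<Sum>b\<in>Basis. (v \<bullet> b) *\<^sub>R b) = (\<Sum>b\<in>Basis. (v \<bullet> b) * F' b x)"
      by (simp add: linear_sum linear_scale F'_def)
    then show ?thesis by (simp add: euclidean_representation F'_def)
  qed
  have e2: "F'' v w x = (\<Sum>b\<in>Basis. (v \<bullet> b) * (\<Sum>c\<in>Basis. (w \<bullet> c) * F'' b c x))" if "x \<in> W" for x v w
  proof -
    have "((\<lambda>y. \<Sum>b\<in>Basis. (v \<bullet> b) * F' b y) has_derivative (\<lambda>w. \<Sum>b\<in>Basis. (v \<bullet> b) * F'' b w x)) (at x)"
      by (intro has_derivative_sum has_derivative_mult_right d2 that)
    then have "(F' v has_derivative (\<lambda>w. \<Sum>b\<in>Basis. (v \<bullet> b) * F'' b w x)) (at x)"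
      by (rule has_derivative_transform_within_open[OF _ assms(1) that]) (simp add: e1[symmetric])
    then have "(\<lambda>w. F'' v w x) = (\<lambda>w. \<Sum>b\<in>Basis. (v \<bullet> b) * F'' b w x)"
      using d2[OF that] by (rule has_derivative_unique[rotated])
    then have "F'' v w x = (\<Sum>b\<in>Basis. (v \<bullet> b) * F'' b w x)" by metis
    also have "\<dots> = (\<Sum>b\<in>Basis. (v \<bullet> b) * (\<Sum>c\<in>Basis. (w \<bullet> c) * F'' b c x))"
    proof (rule sum.cong[OF refl])
      fix b :: 'a
      have "linear (\<lambda>c. F'' b c x)" using d2[OF that] by (rule has_derivative_linear)
      then have "F'' b (\<Sum>c\<in>Basis. (w \<bullet> c) *\<^sub>R c) x = (\<Sum>c\<in>Basis. (w \<bullet> c) * F'' b c x)"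
        using linear_sum[of "\<lambda>c. F'' b c x" "\<lambda>c. (w \<bullet> c) *\<^sub>R c" Basis]
        by (simp add: linear_scale[of "\<lambda>c. F'' b c x"])
      then show "(v \<bullet> b) * F'' b w x = (v \<bullet> b) * (\<Sum>c\<in>Basis. (w \<bullet> c) * F'' b c x)"
        by (simp add: euclidean_representation)
    qed
    finally show ?thesis .
  qed
  \<comment> \<open>First and second derivative as functions of point and direction jointly; the
    expansion in a basis is what makes their joint continuity visible.\<close>
  define G where "G = (\<lambda>q :: 'a \<times> 'a. \<Sum>b\<in>Basis. (snd q \<bullet> b) * F' b (fst q))"
  define H where "H = (\<lambda>q :: 'a \<times> 'a. \<Sum>b\<in>Basis. (snd q \<bullet> b) * (\<Sum>c\<in>Basis. (snd q \<bullet> c) * F'' b c (fst q)))"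
  have c1: "continuous_on W (F' b)" "continuous_on W (F'' b c)" for b c
    using higher_differentiable_on_imp_continuous_on[OF F1(2)[of b]]
      higher_differentiable_on_imp_continuous_on[OF F2(2)[of b c]]
    by (simp_all add: F'_def F''_def)
  have comp: "continuous_on (W \<times> UNIV) (\<lambda>q. f (fst q))" if "continuous_on W f" for f :: "'a \<Rightarrow> real"
    by (rule continuous_on_compose2[OF that]) (auto intro!: continuous_intros)
  have cG: "continuous_on (W \<times> UNIV) G" and cH: "continuous_on (W \<times> UNIV) H"
    unfolding G_def H_def by (intro continuous_intros comp c1)+
  \<comment> \<open>The implication from tangency to positivity, written as a disjunction of two
    open conditions: the direction is not tangent, or the second derivative is positive.\<close>
  define Q where "Q = (W \<times> UNIV) \<inter> G -` (- {0}) \<union> (W \<times> UNIV) \<inter> H -` {0<..}"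
  have "open Q"
    unfolding Q_def using assms(1)
    by (intro open_Un continuous_open_preimage cG cH open_Times open_greaterThan) auto
  moreover have "{p} \<times> sphere 0 1 \<subseteq> Q"
  proof
    fix q assume "q \<in> {p} \<times> sphere (0::'a) 1"
    then have "q = (p, snd q)" "norm (snd q) = 1" by (simp_all add: mem_Times_iff prod_eq_iff)
    then obtain v where v: "q = (p, v)" "v \<noteq> 0" by (metis norm_zero zero_neq_one)
    have "G q = frechet_derivative F (at p) v" using e1[OF assms(2), of v] by (simp add: G_def v F'_def)
    moreover have "H q = frechet_derivative (\<lambda>y. frechet_derivative F (at y) v) (at p) v"
      using e2[OF assms(2), of v v] by (simp add: H_def v F'_def F''_def)
    ultimately show "q \<in> Q" using pos[OF v(2)] assms(2) by (auto simp: Q_def v(1))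
  qed
  ultimately obtain U V where U: "open U" "p \<in> U" "sphere 0 1 \<subseteq> V" "U \<times> V \<subseteq> Q"
    using tube_lemma_right[of euclidean euclidean Q "sphere 0 1" p]
    by (auto simp: euclidean_product_topology)
  have conv: "\<exists>D>0. ((\<lambda>t. frechet_derivative F (at (x + t *\<^sub>R v)) v) has_real_derivative D) (at 0)"
    if x: "x \<in> U" "x \<in> W" and v: "v \<noteq> 0" "frechet_derivative F (at x) v = 0" for x v
  proof -
    define u where "u = v /\<^sub>R norm v"
    have vu: "v = norm v *\<^sub>R u" using v(1) by (simp add: u_def)
    have "u \<in> sphere 0 1" using v(1) by (simp add: u_def)
    then have "(x, u) \<in> Q" using U x(1) by blast
    have "frechet_derivative F (at x) v = G (x, v)" using e1[OF x(2), of v] by (simp add: F'_def G_def)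
    also have "\<dots> = norm v * G (x, u)"
      unfolding G_def by (subst vu) (simp add: sum_distrib_left mult.assoc)
    finally have "G (x, u) = 0" using v by simp
    then have "H (x, u) > 0" using \<open>(x, u) \<in> Q\<close> by (auto simp: Q_def)
    have "F'' v v x = H (x, v)" using e2[OF x(2), of v v] by (simp only: H_def fst_conv snd_conv)
    also have "\<dots> = norm v * (norm v * H (x, u))"
      unfolding H_def by (subst (1 2) vu) (simp add: sum_distrib_left mult_ac)
    finally have "F'' v v x > 0" using \<open>H (x, u) > 0\<close> v(1) by simp
    moreover have "((\<lambda>t. F' v (x + t *\<^sub>R v)) has_real_derivative F'' v v x) (at 0)"
    proof -
      have 1: "((\<lambda>t. x + t *\<^sub>R v) has_derivative (\<lambda>r. r *\<^sub>R v)) (at 0)"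
        by (auto intro!: derivative_eq_intros)
      have 2: "(F' v has_derivative (\<lambda>c. F'' v c x)) (at (x + 0 *\<^sub>R v))" using d2[OF x(2)] by simp
      from diff_chain_at[OF 1 2] show ?thesis
        by (simp add: has_field_derivative_def o_def mult_commute_abs
            linear_scale[OF has_derivative_linear[OF d2[OF x(2)]]])
    qed
    ultimately show ?thesis by (auto simp: F'_def)
  qed
  show ?thesis
  proof
    show "p \<in> U \<inter> W" "U \<inter> W \<subseteq> W" using U(2) assms(2) by auto
    show "strictly_convex_defining S (U \<inter> W) F (\<lambda>x. frechet_derivative F (at x))"
      unfolding strictly_convex_defining_def using U(1) assms(1) S F1(1) conv by auto
  qed
qed

section \<open>The implicit function theorem for smooth functions\<close>

text \<open>The inverse function theorem for (y, z) \<mapsto> (y, F (y, z)) yields a differentiable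
  \<open>h\<close>; its derivative is a quotient of partial derivatives of \<open>F\<close> on the
  graph, so each order of smoothness of \<open>h\<close> gives the next.\<close>

theorem implicit_function_smooth:
  fixes F :: "'a::euclidean_space \<times> real \<Rightarrow> real"
  assumes "open W" "(y0, z0) \<in> W" and smooth: "smooth_on W F" and "F (y0, z0) = 0"
    and nz: "frechet_derivative F (at (y0, z0)) (0, 1) \<noteq> 0"
  obtains U h N where "open U" "y0 \<in> U" "open N" "(y0, z0) \<in> N" "N \<subseteq> W" "smooth_on U h" "h y0 = z0"
    "{q \<in> N. F q = 0} = (\<lambda>y. (y, h y)) ` U"
proof -
  have hd: "higher_differentiable_on W F m" for m using smooth by (simp add: smooth_on_def)
  note F1 = higher_differentiable_on_SucD[OF hd]
  define F' where "F' = (\<lambda>q. frechet_derivative F (at q))"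
  have der: "(F has_derivative F' q) (at q)" if "q \<in> W" for q using F1(1)[OF that] by (simp add: F'_def)
  have lin: "linear (F' q)" if "q \<in> W" for q using der[OF that] by (rule has_derivative_linear)
  have hdF': "higher_differentiable_on W (\<lambda>q. F' q v) m" for v m
    using F1(2) by (simp add: F'_def)
  define f where "f = (\<lambda>q. (fst q, F q))"
  define L where "L = (\<lambda>q v. (fst v, F' q v))"
  have bl: "bounded_linear (L q)" if "q \<in> W" for q
    using has_derivative_bounded_linear[OF der[OF that]] unfolding L_def
    by (intro bounded_linear_Pair bounded_linear_fst)
  define f' where "f' = (\<lambda>q. Blinfun (L q))"
  have ap: "blinfun_apply (f' q) = L q" if "q \<in> W" for q
    using bl[OF that] by (simp add: f'_def bounded_linear_Blinfun_apply)
  have derf: "(f has_derivative blinfun_apply (f' q)) (at q)" if "q \<in> W" for q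
    unfolding ap[OF that] f_def L_def by (intro has_derivative_Pair derivative_intros der that)
  have contf: "continuous_on W f'"
  proof (rule continuous_on_blinfun_componentwise)
    fix i :: "'a \<times> real"
    have "continuous_on W (\<lambda>q. L q i)"
      unfolding L_def using hdF'[of i 0] by (intro continuous_intros) simp
    then show "continuous_on W (\<lambda>q. blinfun_apply (f' q) i)"
      by (rule continuous_on_eq) (simp add: ap)
  qed
  define c where "c = F' (y0, z0) (0, 1)"
  have "c \<noteq> 0" using nz by (simp add: c_def F'_def)
  \<comment> \<open>Inverse of the derivative at the base point, which is triangular with the
    nonzero entry \<open>c\<close>.\<close>
  define I where "I = (\<lambda>v :: 'a \<times> real. (fst v, (snd v - F' (y0, z0) (fst v, 0)) / c))"
  have blI: "bounded_linear I"
    unfolding I_def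
  proof (intro bounded_linear_Pair bounded_linear_fst)
    have "bounded_linear (\<lambda>v. F' (y0, z0) (fst v, 0))"
      by (rule bounded_linear_compose[OF has_derivative_bounded_linear[OF der[OF assms(2)]]])
        (intro bounded_linear_Pair bounded_linear_fst bounded_linear_zero)
    then show "bounded_linear (\<lambda>v :: 'a \<times> real. (snd v - F' (y0, z0) (fst v, 0)) / c)"
      unfolding divide_inverse
      by (intro bounded_linear_mult_const bounded_linear_sub bounded_linear_snd)
  qed
  have split: "F' q (a, b) = F' q (a, 0) + b * F' q (0, 1)" if "q \<in> W" for q a b
    using linear_add[OF lin[OF that], of "(a, 0)" "b *\<^sub>R (0, 1)"] linear_scale[OF lin[OF that], of b "(0,1)"]
    by simp
  have inv: "Blinfun I o\<^sub>L f' (y0, z0) = id_blinfun"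
  proof (rule blinfun_eqI)
    fix v :: "'a \<times> real"
    have "I (L (y0, z0) v) = v"
      using split[OF assms(2), of "fst v" "snd v"] \<open>c \<noteq> 0\<close> by (simp add: I_def L_def c_def prod_eq_iff)
    then show "blinfun_apply (Blinfun I o\<^sub>L f' (y0, z0)) v = blinfun_apply id_blinfun v"
      by (simp add: ap[OF assms(2)] bounded_linear_Blinfun_apply[OF blI])
  qed
  obtain N V g g' where N: "open N" "N \<subseteq> W" "(y0, z0) \<in> N" and V: "open V" "f (y0, z0) \<in> V"
    and hom: "homeomorphism N V f g"
    and derg: "\<And>y. y \<in> V \<Longrightarrow> (g has_derivative (g' y)) (at y)"
    and g': "\<And>y. y \<in> V \<Longrightarrow> g' y = inv (blinfun_apply (f' (g y)))"
    and bij: "\<And>y. y \<in> V \<Longrightarrow> bij (blinfun_apply (f' (g y)))"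
    by (rule inverse_function_theorem[OF assms(1) derf contf assms(2) inv]) auto
  have gN: "g y \<in> N" "f (g y) = y" if "y \<in> V" for y using hom that by (auto simp: homeomorphism_def)
  have fV: "f q \<in> V" "g (f q) = q" if "q \<in> N" for q using hom that by (auto simp: homeomorphism_def)
  define U where "U = {y. (y, 0::real) \<in> V}"
  define h where "h = (\<lambda>y. snd (g (y, 0)))"
  have "open U"
  proof -
    have "U = (\<lambda>y. (y, 0)) -` V" by (auto simp: U_def)
    then show ?thesis using V(1) by (simp add: open_vimage continuous_intros)
  qed
  have gh: "g (y, 0) = (y, h y)" "(y, h y) \<in> N" "F (y, h y) = 0" if "y \<in> U" for y
  proof -
    have y: "(y, 0) \<in> V" using that by (simp add: U_def)
    have "fst (g (y, 0)) = y" "F (g (y, 0)) = 0" using gN(2)[OF y] by (auto simp: f_def)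
    then show 1: "g (y, 0) = (y, h y)" by (simp add: h_def prod_eq_iff)
    then show "(y, h y) \<in> N" "F (y, h y) = 0" using gN(1)[OF y] \<open>F (g (y, 0)) = 0\<close> by auto
  qed
  have nz: "F' (y, h y) (0, 1) \<noteq> 0" if "y \<in> U" for y
  proof
    have y: "(y, 0) \<in> V" "(y, h y) \<in> W" using that gh[OF that] N(2) by (auto simp: U_def)
    assume "F' (y, h y) (0, 1) = 0"
    then have "L (y, h y) (0, 1) = L (y, h y) 0"
      using linear_0[OF lin[OF y(2)]] by (simp add: L_def zero_prod_def)
    moreover have "inj (L (y, h y))" using bij[OF y(1)] ap[OF y(2)] gh(1)[OF that] by (simp add: bij_def)
    ultimately have "(0, 1) = (0 :: 'a \<times> real)" by (meson injD)
    then show False by (simp add: zero_prod_def)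
  qed
  have derh: "(h has_derivative (\<lambda>v. - (F' (y, h y) (v, 0) * inverse (F' (y, h y) (0, 1))))) (at y)"
    if "y \<in> U" for y
  proof -
    have y: "(y, 0) \<in> V" "(y, h y) \<in> W" using that gh[OF that] N(2) by (auto simp: U_def)
    have 1: "((\<lambda>y. (y, 0::real)) has_derivative (\<lambda>v. (v, 0))) (at y)"
      by (intro has_derivative_Pair has_derivative_ident has_derivative_const)
    have 2: "(h has_derivative (\<lambda>v. snd (g' (y, 0) (v, 0)))) (at y)"
      unfolding h_def
      using has_derivative_snd[OF diff_chain_at[OF 1 derg[OF y(1)]]] by (simp add: o_def)
    have "g' (y, 0) (v, 0) = (v, - (F' (y, h y) (v, 0) * inverse (F' (y, h y) (0, 1))))" (is "_ = ?w") for v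
    proof -
      have e: "blinfun_apply (f' (g (y, 0))) = L (y, h y)" using ap[OF y(2)] gh(1)[OF that] by simp
      have "L (y, h y) ?w = (v, 0)"
        using split[OF y(2), of v "- (F' (y, h y) (v, 0) * inverse (F' (y, h y) (0, 1)))"] nz[OF that]
        by (simp add: L_def)
      moreover have "inj (L (y, h y))" using bij[OF y(1)] e by (simp add: bij_def)
      ultimately show ?thesis unfolding g'[OF y(1)] e by (metis inv_f_f)
    qed
    with 2 show ?thesis by simp
  qed
  have hdh: "higher_differentiable_on U h m" for m
  proof (induction m)
    case 0
    then show ?case
      using has_derivative_continuous_on[OF has_derivative_at_withinI[OF derh]] by simp
  next
    case (Suc m)
    have "higher_differentiable_on U (\<lambda>y. y) m"
      using higher_differentiable_on_bounded_linear[OF \<open>open U\<close> bounded_linear_ident] .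
    then have G: "higher_differentiable_on U (\<lambda>y. (y, h y)) m"
      by (intro higher_differentiable_on_Pair \<open>open U\<close> Suc)
    have im: "(\<lambda>y. (y, h y)) ` U \<subseteq> W" using gh(2) N(2) by blast
    have F'c: "higher_differentiable_on U (\<lambda>y. F' (y, h y) w) m" for w
      using higher_differentiable_on_compose[OF \<open>open U\<close> assms(1) im hdF' G] by simp
    show ?case
      by (rule higher_differentiable_on_SucI[OF \<open>open U\<close> derh], assumption)
        (intro higher_differentiable_on_minus higher_differentiable_on_mult
          higher_differentiable_on_inverse \<open>open U\<close> F'c nz)
  qed
  have graph: "{q \<in> N. F q = 0} = (\<lambda>y. (y, h y)) ` U"
  proof (intro equalityI subsetI)
    fix q assume q: "q \<in> {q \<in> N. F q = 0}"
    then have f: "f q = (fst q, 0)" by (simp add: f_def)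
    then have "fst q \<in> U" using fV(1)[of q] q by (simp add: U_def)
    moreover have "g (fst q, 0) = q" using fV(2)[of q] q f by simp
    then have "q = (fst q, h (fst q))" by (simp add: h_def)
    ultimately show "q \<in> (\<lambda>y. (y, h y)) ` U" by blast
  qed (use gh in auto)
  have "f (y0, z0) = (y0, 0)" using assms(4) by (simp add: f_def)
  then have y0: "y0 \<in> U" "h y0 = z0" using V(2) fV(2)[OF N(3)] by (simp_all add: U_def h_def)
  have "smooth_on U h" using hdh by (simp add: smooth_on_def)
  from that[OF \<open>open U\<close> y0(1) N(1) N(3) N(2) this y0(2) graph] show ?thesis .
qed

section \<open>The boundary of a smooth domain\<close>

lemma hyp_geodesic_in:
  assumes "p \<in> hyperbolic_space" "lorentz p \<nu> = 0" "lorentz \<nu> \<nu> = 1"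
  shows "hyp_geodesic p \<nu> t \<in> hyperbolic_space"
proof -
  note p = hyperbolic_spaceD[OF assms(1)]
  have "lorentz (hyp_geodesic p \<nu> t) (hyp_geodesic p \<nu> t) = (sinh t)\<^sup>2 - (cosh t)\<^sup>2"
    using assms p(1) by (simp add: hyp_geodesic_def lorentz_simps lorentz_sym[of \<nu> p] power2_eq_square)
  then have 1: "lorentz (hyp_geodesic p \<nu> t) (hyp_geodesic p \<nu> t) = -1"
    by (simp add: cosh_square_eq)
  have "\<bar>sinh t * snd \<nu>\<bar> \<le> cosh t * \<bar>snd \<nu>\<bar>"
  proof -
    have "\<bar>sinh t\<bar> \<le> \<bar>cosh t\<bar>" unfolding abs_le_square_iff by (simp add: cosh_square_eq)
    then show ?thesis unfolding abs_mult by (intro mult_right_mono) auto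
  qed
  also have "\<dots> < cosh t * snd p"
    using horospherical_null(5)[OF assms] by (intro mult_strict_left_mono) auto
  finally have "snd (hyp_geodesic p \<nu> t) > 0" by (simp add: hyp_geodesic_def)
  with 1 show ?thesis by (simp add: hyperbolic_space_def)
qed

lemma hyp_lift_smooth:
  fixes U :: "(real^'m::finite) set"
  assumes "open U"
  shows "higher_differentiable_on U hyp_lift m"
proof -
  have id: "higher_differentiable_on U (\<lambda>x :: real^'m. x) m"
    using higher_differentiable_on_bounded_linear[OF assms bounded_linear_ident] .
  show ?thesis
    unfolding hyp_lift_def
    by (intro higher_differentiable_on_Pair higher_differentiable_on_sqrt higher_differentiable_on_add
        higher_differentiable_on_inner higher_differentiable_on_const id assms)
      (simp add: add_pos_nonneg)
qed

lemma has_derivative_hyp_lift_tangent: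
  assumes "X \<in> hyperbolic_space" "lorentz X v = 0"
  shows "((\<lambda>t. hyp_lift (fst X + t *\<^sub>R fst v)) has_vector_derivative v) (at 0)"
proof -
  have "((\<lambda>t. fst X + t *\<^sub>R fst v) has_derivative (\<lambda>r. r *\<^sub>R fst v)) (at 0)"
    by (auto intro!: derivative_eq_intros)
  from diff_chain_at[OF this has_derivative_hyp_lift]
  have "((\<lambda>t. hyp_lift (fst X + t *\<^sub>R fst v)) has_derivative
      (\<lambda>r. (r *\<^sub>R fst v, (fst X \<bullet> (r *\<^sub>R fst v)) / sqrt (1 + fst X \<bullet> fst X)))) (at 0)"
    by (simp add: o_def)
  moreover have "(fst X \<bullet> fst v) / sqrt (1 + fst X \<bullet> fst X) = snd v"
    using assms hyperbolic_spaceD(2,3)[OF assms(1)] by (simp add: lorentz_def)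
  then have "(fst X \<bullet> (r *\<^sub>R fst v)) / sqrt (1 + fst X \<bullet> fst X) = r * snd v" for r
    by (metis inner_scaleR_right times_divide_eq_right)
  ultimately show ?thesis by (simp add: has_vector_derivative_def scaleR_prod_def)
qed

lemma closed_hyperbolic_space: "closed (hyperbolic_space :: 'm::finite minkowski set)"
proof -
  \<comment> \<open>Weakening the strict inequality adds no point: at time 0 the Lorentz square is
    nonnegative.\<close>
  have "hyperbolic_space = {X :: 'm minkowski. lorentz X X = -1 \<and> snd X \<ge> 0}"
    by (auto simp: hyperbolic_space_def lorentz_def less_le)
      (metis inner_ge_zero neg_0_le_iff_le not_one_le_zero)
  moreover have "closed \<dots>"
    by (intro closed_Collect_conj closed_Collect_eq closed_Collect_le continuous_intros)
  ultimately show ?thesis by simp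
qed

locale hyperbolic_domain =
  fixes \<Omega> :: "'m::finite minkowski set"
  assumes sub: "\<Omega> \<subseteq> hyperbolic_space" and cpt: "compact \<Omega>"
begin

lemma in_frontier_iff:
  "X \<in> hyp_frontier \<Omega> \<longleftrightarrow> X \<in> \<Omega> \<and> (\<forall>T. open T \<longrightarrow> X \<in> T \<longrightarrow> \<not> T \<inter> hyperbolic_space \<subseteq> \<Omega>)"
proof -
  have "closedin (top_of_set hyperbolic_space) \<Omega>"
    using sub cpt by (simp add: closed_subset compact_imp_closed)
  then have "hyp_frontier \<Omega> = \<Omega> - (top_of_set hyperbolic_space interior_of \<Omega>)"
    by (simp add: hyp_frontier_def frontier_of_def closure_of_eq[symmetric])
  moreover have "X \<in> (top_of_set hyperbolic_space interior_of \<Omega>) \<longleftrightarrow>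
      (\<exists>T. open T \<and> X \<in> T \<inter> hyperbolic_space \<and> T \<inter> hyperbolic_space \<subseteq> \<Omega>)"
    unfolding interior_of_def openin_open by (auto simp: Int_commute)
  ultimately show ?thesis using sub by blast
qed

lemma frontier_subset: "hyp_frontier \<Omega> \<subseteq> \<Omega>"
  using in_frontier_iff by blast

lemma compact_frontier: "compact (hyp_frontier \<Omega>)"
proof -
  have "hyp_frontier \<Omega> = \<Omega> - (\<Union>{T. open T \<and> T \<inter> hyperbolic_space \<subseteq> \<Omega>})"
    using in_frontier_iff by blast
  moreover have "open (\<Union>{T. open T \<and> T \<inter> hyperbolic_space \<subseteq> \<Omega>})" by auto
  ultimately show ?thesis using cpt by (simp add: compact_diff)
qed

end

section \<open>Lorentz gradients and the unit normal of a level set\<close>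

definition lorentz_gradient :: "('m::finite minkowski \<Rightarrow> real) \<Rightarrow> 'm minkowski \<Rightarrow> 'm minkowski" where
  "lorentz_gradient f X =
    (\<chi> i. frechet_derivative f (at X) (axis i 1, 0), - frechet_derivative f (at X) (0, 1))"

lemma lorentz_gradient:
  assumes "f differentiable (at X)"
  shows "lorentz (lorentz_gradient f X) v = frechet_derivative f (at X) v"
proof -
  have lin: "linear (frechet_derivative f (at X))" using assms by (rule linear_frechet_derivative)
  have v: "v = (\<Sum>i\<in>UNIV. (fst v $ i) *\<^sub>R (axis i 1, 0)) + snd v *\<^sub>R (0, 1)"
    by (simp add: prod_eq_iff fst_sum snd_sum vec_eq_iff axis_def if_distrib cong: if_cong)
  have "frechet_derivative f (at X) v = (\<Sum>i\<in>UNIV. fst v $ i * frechet_derivative f (at X) (axis i 1, 0))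
      + snd v * frechet_derivative f (at X) (0, 1)"
    using arg_cong[OF v, of "frechet_derivative f (at X)"]
    by (simp only: linear_add[OF lin] linear_sum[OF lin] linear_scale[OF lin] real_scaleR_def)
  then show ?thesis
    by (simp add: lorentz_def lorentz_gradient_def inner_vec_def mult.commute)
qed

text \<open>Projection along \<open>X\<close>, with a plus sign because points of the hyperboloid
  have Lorentz square -1. The formula also makes sense off the hyperboloid, so that it can be
  differentiated in Minkowski space.\<close>

definition tangential_gradient :: "('m::finite minkowski \<Rightarrow> real) \<Rightarrow> 'm minkowski \<Rightarrow> 'm minkowski" where
  "tangential_gradient f X = lorentz_gradient f X + lorentz (lorentz_gradient f X) X *\<^sub>R X"

text \<open>Extends the unit normal of the boundary to an open set of Minkowski space, where its
  derivative is an ordinary one.\<close>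

definition unit_gradient :: "('m::finite minkowski \<Rightarrow> real) \<Rightarrow> 'm minkowski \<Rightarrow> 'm minkowski" where
  "unit_gradient f X =
    inverse (sqrt (lorentz (tangential_gradient f X) (tangential_gradient f X))) *\<^sub>R tangential_gradient f X"

locale boundary_patch = hyperbolic_domain \<Omega> for \<Omega> :: "('n::finite option) minkowski set" +
  fixes W :: "('n option) minkowski set" and f :: "('n option) minkowski \<Rightarrow> real"
  assumes opW: "open W" and smooth: "smooth_on W f"
    and sublevel: "\<Omega> \<inter> W = {X \<in> hyperbolic_space \<inter> W. f X \<le> 0}"
    and nondeg: "\<And>X. X \<in> hyperbolic_space \<inter> W \<Longrightarrow> \<exists>v. lorentz X v = 0 \<and> frechet_derivative f (at X) v \<noteq> 0"
begin

abbreviation "g \<equiv> lorentz_gradient f"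
abbreviation "G \<equiv> tangential_gradient f"
abbreviation "N \<equiv> unit_gradient f"
text \<open>Open in Minkowski space and containing the part of the hyperboloid in \<open>W\<close>;
  here the normalization in \<open>N\<close> is smooth.\<close>

definition "W1 = {X \<in> W. lorentz (G X) (G X) > 0}"
definition "DN X = frechet_derivative N (at X)"

lemma hdf: "higher_differentiable_on W f m"
  using smooth by (simp add: smooth_on_def)

lemma f_diff: "X \<in> W \<Longrightarrow> f differentiable (at X)"
  using hdf[of "Suc 0"] by simp

lemma der_f: "X \<in> W \<Longrightarrow> (f has_derivative (\<lambda>v. lorentz (g X) v)) (at X)"
  using lorentz_gradient[OF f_diff] frechet_derivative_works[of f "at X"] f_diff
  by (metis (no_types, lifting) ext)

lemma cont_f: "continuous_on W f"
  using hdf[of 0] by simp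

lemma hd_g: "higher_differentiable_on W g m"
  unfolding lorentz_gradient_def
  by (intro higher_differentiable_on_Pair higher_differentiable_on_vec higher_differentiable_on_minus
      opW higher_differentiable_on_SucD(2)[OF hdf])

lemma hd_id: "open V \<Longrightarrow> higher_differentiable_on V (\<lambda>X. X) m"
  by (rule higher_differentiable_on_bounded_linear[OF _ bounded_linear_ident])

lemma hd_G: "higher_differentiable_on W G m"
  unfolding tangential_gradient_def
  by (intro higher_differentiable_on_add higher_differentiable_on_scaleR hd_id hd_g opW
      higher_differentiable_on_bilinear[OF _ bounded_bilinear_lorentz])

lemma hd_GG: "higher_differentiable_on W (\<lambda>X. lorentz (G X) (G X)) m"
  by (intro hd_G opW higher_differentiable_on_bilinear[OF _ bounded_bilinear_lorentz])

lemma opW1: "open W1"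
proof -
  have "W1 = W \<inter> (\<lambda>X. lorentz (G X) (G X)) -` {0<..}" by (auto simp: W1_def)
  then show ?thesis
    using continuous_open_preimage[OF higher_differentiable_on_imp_continuous_on[OF hd_GG] opW open_greaterThan]
    by simp
qed

lemma hd_N: "higher_differentiable_on W1 N m"
proof -
  have W1: "W1 \<subseteq> W" by (auto simp: W1_def)
  show ?thesis
    unfolding unit_gradient_def
    by (intro higher_differentiable_on_scaleR higher_differentiable_on_inverse higher_differentiable_on_sqrt
        opW1 higher_differentiable_on_subset[OF hd_GG W1] higher_differentiable_on_subset[OF hd_G W1])
      (auto simp: W1_def)
qed

lemma der_N: "X \<in> W1 \<Longrightarrow> (N has_derivative DN X) (at X)"
  using higher_differentiable_on_SucD(1)[OF hd_N] by (simp add: DN_def)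

lemma G_tangent: "X \<in> hyperbolic_space \<Longrightarrow> lorentz X (G X) = 0"
  using lorentz_sym[of X "g X"] by (simp add: tangential_gradient_def lorentz_simps hyperbolic_spaceD(1))

lemma lorentz_G: "lorentz X v = 0 \<Longrightarrow> lorentz (G X) v = lorentz (g X) v"
  by (simp add: tangential_gradient_def lorentz_simps)

lemma GG_pos: "X \<in> hyperbolic_space \<Longrightarrow> X \<in> W \<Longrightarrow> lorentz (G X) (G X) > 0"
proof -
  assume X: "X \<in> hyperbolic_space" "X \<in> W"
  then obtain v where "lorentz X v = 0" "frechet_derivative f (at X) v \<noteq> 0" using nondeg by blast
  then have "lorentz (G X) v \<noteq> 0" using lorentz_G lorentz_gradient[OF f_diff[OF X(2)]] by simp
  then have "G X \<noteq> 0" by (auto simp: lorentz_simps)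
  then show ?thesis using tangent_vector_spacelike(3)[OF X(1) G_tangent[OF X(1)]] by blast
qed

lemma inW1: "X \<in> hyperbolic_space \<Longrightarrow> X \<in> W \<Longrightarrow> X \<in> W1"
  using GG_pos by (simp add: W1_def)

lemma G_eq: "X \<in> W1 \<Longrightarrow> G X = sqrt (lorentz (G X) (G X)) *\<^sub>R N X"
  by (simp add: unit_gradient_def W1_def)

lemma NN: "X \<in> W1 \<Longrightarrow> lorentz (N X) (N X) = 1"
  by (simp add: unit_gradient_def W1_def lorentz_simps field_simps)

lemma N_tangent: "X \<in> hyperbolic_space \<Longrightarrow> lorentz X (N X) = 0"
  by (simp add: unit_gradient_def lorentz_simps G_tangent)

lemma lorentz_N: "X \<in> W1 \<Longrightarrow> lorentz X v = 0 \<Longrightarrow>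
    lorentz (g X) v = sqrt (lorentz (G X) (G X)) * lorentz (N X) v"
  using lorentz_G[of X v] arg_cong[OF G_eq, of X "\<lambda>Z. lorentz Z v"] by (simp add: lorentz_simps)

lemma sublevel_curve:
  assumes X: "X \<in> W" "f X = 0" and c: "(c has_vector_derivative v) (at 0)" "c 0 = X"
    "\<And>t. c t \<in> hyperbolic_space"
  shows "lorentz (g X) v > 0 \<Longrightarrow> \<forall>\<^sub>F t in at_right (0::real). c t \<notin> \<Omega>"
    and "lorentz (g X) v < 0 \<Longrightarrow> \<forall>\<^sub>F t in at_right 0. c t \<in> \<Omega>"
proof -
  have "(f \<circ> c has_derivative (\<lambda>w. lorentz (g X) w) \<circ> (\<lambda>r. r *\<^sub>R v)) (at 0)"
    using c(1,2) der_f[OF X(1)] by (intro diff_chain_at) (auto simp: has_vector_derivative_def)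
  then have d: "((\<lambda>t. f (c t)) has_real_derivative lorentz (g X) v) (at 0)"
    by (simp add: has_field_derivative_def o_def lorentz_simps mult_commute_abs)
  have "continuous (at 0) c" using c(1) has_vector_derivative_continuous by blast
  then have "(c \<longlongrightarrow> X) (at 0)" using c(2) by (simp add: continuous_at)
  then have "\<forall>\<^sub>F t in at 0. c t \<in> W" using opW X(1) by (rule topological_tendstoD)
  then have inW: "\<forall>\<^sub>F t in at_right 0. c t \<in> W"
    by (rule filter_leD[rotated]) (simp add: at_le)
  show "\<forall>\<^sub>F t in at_right 0. c t \<notin> \<Omega>" if pos: "lorentz (g X) v > 0"
  proof -
    obtain r where r: "r > 0" "\<And>h. h > 0 \<Longrightarrow> h < r \<Longrightarrow> f (c 0) < f (c (0 + h))"
      using DERIV_pos_inc_right[OF d pos] by blast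
    have "\<forall>\<^sub>F t in at_right 0. f (c t) > 0"
      unfolding eventually_at_right_field using r c(2) X(2) by (intro exI[of _ r]) auto
    with inW show ?thesis
      by eventually_elim (use sublevel in force)
  qed
  show "\<forall>\<^sub>F t in at_right 0. c t \<in> \<Omega>" if neg: "lorentz (g X) v < 0"
  proof -
    obtain r where r: "r > 0" "\<And>h. h > 0 \<Longrightarrow> h < r \<Longrightarrow> f (c 0) > f (c (0 + h))"
      using DERIV_neg_dec_right[OF d neg] by blast
    have "\<forall>\<^sub>F t in at_right 0. f (c t) < 0"
      unfolding eventually_at_right_field using r c(2) X(2) by (intro exI[of _ r]) auto
    with inW show ?thesis
    proof eventually_elim
      case (elim t)
      then have "c t \<in> {X \<in> hyperbolic_space \<inter> W. f X \<le> 0}" using c(3) by simp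
      then show ?case unfolding sublevel[symmetric] by blast
    qed
  qed
qed

text \<open>A point with negative \<open>f\<close> is relatively interior by continuity; at a zero
  of \<open>f\<close> the curve with velocity \<open>G\<close> leaves the set, because the
  differential is nondegenerate there.\<close>

lemma frontier_patch: "hyp_frontier \<Omega> \<inter> W = {X \<in> hyperbolic_space \<inter> W. f X = 0}"
proof (intro equalityI subsetI)
  fix X assume X: "X \<in> hyp_frontier \<Omega> \<inter> W"
  then have XO: "X \<in> \<Omega> \<inter> W" using frontier_subset by blast
  then have X2: "X \<in> hyperbolic_space" "X \<in> W" "f X \<le> 0" unfolding sublevel by auto
  have "\<not> f X < 0"
  proof
    assume "f X < 0"
    define T where "T = W \<inter> f -` {..<0}"
    have "open T" unfolding T_def by (intro continuous_open_preimage cont_f opW open_lessThan)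
    moreover have "T \<inter> hyperbolic_space \<subseteq> {X \<in> hyperbolic_space \<inter> W. f X \<le> 0}" by (auto simp: T_def)
    then have "T \<inter> hyperbolic_space \<subseteq> \<Omega>" unfolding sublevel[symmetric] by blast
    moreover have "X \<in> T" using X2 \<open>f X < 0\<close> by (simp add: T_def)
    ultimately show False using X in_frontier_iff by blast
  qed
  then show "X \<in> {X \<in> hyperbolic_space \<inter> W. f X = 0}" using X2 by simp
next
  fix X assume "X \<in> {X \<in> hyperbolic_space \<inter> W. f X = 0}"
  then have X: "X \<in> hyperbolic_space" "X \<in> W" "f X = 0" by auto
  have "X \<in> {X \<in> hyperbolic_space \<inter> W. f X \<le> 0}" using X by simp
  then have "X \<in> \<Omega>" unfolding sublevel[symmetric] by blast
  moreover have "\<not> T \<inter> hyperbolic_space \<subseteq> \<Omega>" if "open T" "X \<in> T" for T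
  proof
    assume T: "T \<inter> hyperbolic_space \<subseteq> \<Omega>"
    define c where "c = (\<lambda>t. hyp_lift (fst X + t *\<^sub>R fst (G X)))"
    have c: "(c has_vector_derivative G X) (at 0)" "c 0 = X" "c t \<in> hyperbolic_space" for t
      unfolding c_def using has_derivative_hyp_lift_tangent[OF X(1) G_tangent[OF X(1)]]
      by (auto simp: hyp_lift_fst X(1) hyp_lift_in)
    have "lorentz (g X) (G X) > 0"
      using GG_pos[OF X(1,2)] lorentz_G[OF G_tangent[OF X(1)]] by simp
    from sublevel_curve(1)[OF X(2,3) c this] have "\<forall>\<^sub>F t in at_right 0. c t \<notin> \<Omega>" .
    moreover have "\<forall>\<^sub>F t in at_right 0. c t \<in> T"
    proof -
      have "(c \<longlongrightarrow> X) (at 0)" using has_vector_derivative_continuous[OF c(1)] c(2) by (simp add: continuous_at)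
      then have "\<forall>\<^sub>F t in at 0. c t \<in> T" using that by (rule topological_tendstoD)
      then show ?thesis by (rule filter_leD[rotated]) (simp add: at_le)
    qed
    ultimately have "\<forall>\<^sub>F t in at_right (0::real). False"
      by eventually_elim (use T c(3) in blast)
    then show False by simp
  qed
  ultimately show "X \<in> hyp_frontier \<Omega> \<inter> W" using in_frontier_iff X(2) by blast
qed

text \<open>In the global graph coordinates the defining function has some nonzero partial
  derivative, and that coordinate becomes the dependent variable of the implicit function theorem.
  The inverse of the chart is the restriction of a linear map, which gives the homeomorphism and the
  injectivity of the differential together.\<close>

lemma ex_local_parametrization:
  assumes "p \<in> hyp_frontier \<Omega>" "p \<in> W"
  obtains U \<phi> y where "local_parametrization (hyp_frontier \<Omega>) U \<phi>" "y \<in> U" "\<phi> y = p"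
proof -
  have p: "p \<in> hyperbolic_space" "f p = 0" using assms frontier_patch by blast+
  define x0 where "x0 = fst p"
  have lx0: "hyp_lift x0 = p" using hyp_lift_fst[OF p(1)] by (simp add: x0_def)
  have op0: "open (hyp_lift -` W)"
    by (intro open_vimage opW continuous_on_hyp_lift)
  define F0 where "F0 = (\<lambda>x. f (hyp_lift x))"
  have hdF0: "higher_differentiable_on (hyp_lift -` W) F0 m" for m
    unfolding F0_def by (rule higher_differentiable_on_compose[OF op0 opW _ hdf hyp_lift_smooth[OF op0]]) auto
  have x0W: "x0 \<in> hyp_lift -` W" using lx0 assms(2) by simp
  have derF0: "(F0 has_derivative frechet_derivative F0 (at x)) (at x)" if "x \<in> hyp_lift -` W" for x
    using higher_differentiable_on_SucD(1)[OF hdF0 that] .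
  have lin0: "linear (frechet_derivative F0 (at x0))" using derF0[OF x0W] by (rule has_derivative_linear)
  have "frechet_derivative F0 (at x0) (fst (G p)) \<noteq> 0"
  proof -
    have "(F0 has_derivative (\<lambda>w. lorentz (g p) w) \<circ> (\<lambda>v. (v, (x0 \<bullet> v) / sqrt (1 + x0 \<bullet> x0)))) (at x0)"
      unfolding F0_def using diff_chain_at[OF has_derivative_hyp_lift, of f "\<lambda>w. lorentz (g p) w" x0]
        der_f[OF assms(2)] lx0 by (simp add: o_def)
    then have "frechet_derivative F0 (at x0) (fst (G p)) = lorentz (g p) (fst (G p), (x0 \<bullet> fst (G p)) / sqrt (1 + x0 \<bullet> x0))"
      using frechet_derivative_at by (metis (no_types, lifting) comp_apply)
    also have "(x0 \<bullet> fst (G p)) / sqrt (1 + x0 \<bullet> x0) = snd (G p)"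
      using G_tangent[OF p(1)] hyperbolic_spaceD(2,3)[OF p(1)] by (simp add: lorentz_def x0_def)
    finally show ?thesis
      using GG_pos[OF p(1) assms(2)] lorentz_G[OF G_tangent[OF p(1)]] by simp
  qed
  moreover have "fst (G p) = (\<Sum>k\<in>UNIV. (fst (G p) $ k) *\<^sub>R axis k 1)"
    by (simp add: vec_eq_iff axis_def if_distrib cong: if_cong)
  ultimately have "\<exists>k. frechet_derivative F0 (at x0) (axis k 1) \<noteq> 0"
    using linear_sum[OF lin0] linear_scale[OF lin0]
    by (metis (no_types, lifting) scaleR_zero_right sum.neutral)
  then obtain k where k: "frechet_derivative F0 (at x0) (axis k 1) \<noteq> 0" ..
  \<comment> \<open>Exchanges the coordinate \<open>k\<close> with the extra coordinate
    \<open>None\<close>, so that \<open>T\<close> puts the dependent variable in place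
    \<open>k\<close>.\<close>
  define \<pi> where "\<pi> = Transposition.transpose None k"
  have \<pi>\<pi>: "\<pi> (\<pi> j) = j" for j by (simp add: \<pi>_def)
  have \<pi>k: "\<pi> None = k" by (simp add: \<pi>_def)
  define T :: "(real^'n) \<times> real \<Rightarrow> real^'n option" where
    "T = (\<lambda>q. \<chi> j. case \<pi> j of None \<Rightarrow> snd q | Some i \<Rightarrow> fst q $ i)"
  define T' :: "real^'n option \<Rightarrow> (real^'n) \<times> real" where
    "T' = (\<lambda>x. (\<chi> i. x $ \<pi> (Some i), x $ k))"
  have T'T: "T' (T q) = q" for q
    using \<pi>k \<pi>\<pi> by (auto simp: T'_def T_def vec_eq_iff prod_eq_iff)
  have TT': "T (T' x) = x" for x
    using \<pi>k \<pi>\<pi> by (auto simp: T'_def T_def vec_eq_iff split: option.split) metis+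
  have blT: "bounded_linear T"
    unfolding linear_conv_bounded_linear[symmetric]
    by (rule linearI) (auto simp: T_def vec_eq_iff split: option.split)
  have blT': "bounded_linear T'"
    unfolding linear_conv_bounded_linear[symmetric]
    by (rule linearI) (auto simp: T'_def vec_eq_iff)
  have contT: "continuous_on A T" "continuous_on B T'" for A B
    using blT blT' by (auto intro: linear_continuous_on)
  define V where "V = T -` (hyp_lift -` W)"
  have opV: "open V" unfolding V_def by (intro open_vimage op0 contT)
  define F where "F = (\<lambda>q. F0 (T q))"
  have hdF: "higher_differentiable_on V F m" for m
    unfolding F_def
    by (rule higher_differentiable_on_compose[OF opV op0 _ hdF0 higher_differentiable_on_bounded_linear[OF opV blT]])
      (auto simp: V_def)
  define q0 where "q0 = T' x0"
  have Tq0: "T q0 = x0" by (simp add: q0_def TT')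
  have "(F has_derivative frechet_derivative F0 (at x0) \<circ> T) (at q0)"
    unfolding F_def using diff_chain_at[OF bounded_linear_imp_has_derivative[OF blT], of F0 _ q0] derF0[OF x0W] Tq0
    by (simp add: o_def)
  then have "frechet_derivative F (at q0) (0, 1) = frechet_derivative F0 (at x0) (T (0, 1))"
    using frechet_derivative_at by (metis comp_apply)
  also have "T (0, 1) = axis k 1"
    using \<pi>k \<pi>\<pi> by (auto simp: T_def vec_eq_iff axis_def split: option.split) metis
  finally have nz: "frechet_derivative F (at (fst q0, snd q0)) (0, 1) \<noteq> 0" using k by simp
  have q0V: "(fst q0, snd q0) \<in> V" using Tq0 x0W by (simp add: V_def)
  have F0q: "F (fst q0, snd q0) = 0" using Tq0 lx0 p(2) by (simp add: F_def F0_def)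
  have smF: "smooth_on V F" using hdF by (simp add: smooth_on_def)
  obtain U h M where U: "open U" "fst q0 \<in> U" and M: "open M" "(fst q0, snd q0) \<in> M" "M \<subseteq> V"
    and h: "smooth_on U h" "h (fst q0) = snd q0" and graph: "{q \<in> M. F q = 0} = (\<lambda>y. (y, h y)) ` U"
    by (rule implicit_function_smooth[OF opV q0V smF F0q nz])
  define \<phi> where "\<phi> = (\<lambda>y. hyp_lift (T (y, h y)))"
  define \<psi> where "\<psi> = (\<lambda>X :: ('n option) minkowski. fst (T' (fst X)))"
  have \<psi>\<phi>: "\<psi> (\<phi> y) = y" for y by (simp add: \<psi>_def \<phi>_def T'T)
  have smy: "higher_differentiable_on U (\<lambda>y. T (y, h y)) m" for m
    using h(1) unfolding smooth_on_def
    by (intro higher_differentiable_on_compose_bounded_linear[OF U(1) blT] higher_differentiable_on_Pair U(1)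
        higher_differentiable_on_bounded_linear[OF U(1) bounded_linear_ident]) auto
  have sm\<phi>: "smooth_on U \<phi>"
    unfolding smooth_on_def \<phi>_def
    by (intro allI higher_differentiable_on_compose[OF U(1) open_UNIV subset_UNIV
          hyp_lift_smooth[OF open_UNIV] smy])
  have img: "\<phi> ` U = hyp_frontier \<Omega> \<inter> (\<lambda>X. T' (fst X)) -` M"
  proof (intro equalityI subsetI)
    fix X assume "X \<in> \<phi> ` U"
    then obtain y where y: "y \<in> U" "X = \<phi> y" by blast
    then have "(y, h y) \<in> {q \<in> M. F q = 0}" using graph by blast
    then have yM: "(y, h y) \<in> M" "F (y, h y) = 0" by auto
    then have "X \<in> {X \<in> hyperbolic_space \<inter> W. f X = 0}"
      using M(3) y(2) by (auto simp: V_def F_def F0_def \<phi>_def hyp_lift_in)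
    then have "X \<in> hyp_frontier \<Omega>" unfolding frontier_patch[symmetric] by blast
    then show "X \<in> hyp_frontier \<Omega> \<inter> (\<lambda>X. T' (fst X)) -` M" using yM y(2) by (simp add: \<phi>_def T'T)
  next
    fix X assume X: "X \<in> hyp_frontier \<Omega> \<inter> (\<lambda>X. T' (fst X)) -` M"
    define q where "q = T' (fst X)"
    have XH: "X \<in> hyperbolic_space" using X frontier_subset sub by blast
    have qX: "hyp_lift (T q) = X" using hyp_lift_fst[OF XH] by (simp add: q_def TT')
    have "q \<in> M" using X by (simp add: q_def)
    then have "X \<in> W" using M(3) qX by (auto simp: V_def)
    then have "f X = 0" using X frontier_patch by blast
    then have "q \<in> {q \<in> M. F q = 0}" using \<open>q \<in> M\<close> qX by (simp add: F_def F0_def)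
    then obtain y where "y \<in> U" "q = (y, h y)" unfolding graph by blast
    then show "X \<in> \<phi> ` U" using qX by (auto simp: \<phi>_def)
  qed
  have "local_parametrization (hyp_frontier \<Omega>) U \<phi>"
    unfolding local_parametrization_def
  proof (intro conjI ballI exI)
    show "open U" "smooth_on U \<phi>" by fact+
    show "inj (frechet_derivative \<phi> (at y))" if "y \<in> U" for y
    proof -
      have bl\<psi>: "bounded_linear \<psi>" unfolding \<psi>_def
        by (intro bounded_linear_fst_comp bounded_linear_compose[OF blT'] bounded_linear_fst)
      have d: "(\<phi> has_derivative frechet_derivative \<phi> (at y)) (at y)"
        using sm\<phi>[unfolded smooth_on_def, rule_format, of "Suc 0"] that
        by (rule higher_differentiable_on_SucD(1))
      have "(\<psi> \<circ> \<phi> has_derivative \<psi> \<circ> frechet_derivative \<phi> (at y)) (at y)"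
        by (intro diff_chain_at d bounded_linear_imp_has_derivative bl\<psi>)
      moreover have "\<psi> \<circ> \<phi> = (\<lambda>y. y)" by (auto simp: \<psi>\<phi>)
      ultimately have "\<psi> \<circ> frechet_derivative \<phi> (at y) = (\<lambda>v. v)"
        using has_derivative_unique[OF _ has_derivative_ident] by metis
      then show ?thesis by (metis comp_apply injI)
    qed
    show "openin (top_of_set (hyp_frontier \<Omega>)) (\<phi> ` U)"
      unfolding img openin_open using M(1)
      by (intro exI[of _ "(\<lambda>X. T' (fst X)) -` M"] conjI open_vimage refl)
        (auto intro!: continuous_on_compose2[OF contT(2)] continuous_intros)
    show "homeomorphism U (\<phi> ` U) \<phi> \<psi>"
    proof (rule homeomorphismI)
      show "continuous_on U \<phi>"
        using sm\<phi>[unfolded smooth_on_def, rule_format, of 0] by simp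
      show "continuous_on (\<phi> ` U) \<psi>" unfolding \<psi>_def
        by (intro continuous_on_fst continuous_on_compose2[OF contT(2)] continuous_intros) auto
    qed (auto simp: \<psi>\<phi>)
  qed
  moreover have "\<phi> (fst q0) = p" using h(2) Tq0 lx0 by (simp add: \<phi>_def)
  ultimately show ?thesis using that U(2) by blast
qed

end

section \<open>Tangent spaces, the outward normal and its derivative\<close>

lemma local_parametrization_derivative:
  assumes "local_parametrization S U \<phi>" "y \<in> U"
  shows "(\<phi> has_derivative frechet_derivative \<phi> (at y)) (at y)"
  using assms higher_differentiable_on_SucD(1)[of U \<phi> 0 y]
  by (metis local_parametrization_def smooth_on_def)

lemma range_parametrization_subset_tangent_space:
  assumes "local_parametrization S U \<phi>" "y \<in> U"
  shows "range (frechet_derivative \<phi> (at y)) \<subseteq> tangent_space S (\<phi> y)"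
proof
  fix v assume "v \<in> range (frechet_derivative \<phi> (at y))"
  then obtain \<xi> where v: "v = frechet_derivative \<phi> (at y) \<xi>" by blast
  have U: "open U" "smooth_on U \<phi>" and US: "\<phi> ` U \<subseteq> S"
    using assms(1) openin_imp_subset unfolding local_parametrization_def by blast+
  obtain d where d: "d > 0" "ball y d \<subseteq> U" using U(1) assms(2) openE by blast
  \<comment> \<open>Adding 1 avoids a division by zero when \<open>\<xi>\<close> vanishes.\<close>
  define \<epsilon> where "\<epsilon> = d / (norm \<xi> + 1)"
  have \<epsilon>: "\<epsilon> > 0" using d(1) by (simp add: \<epsilon>_def add_nonneg_pos)
  have inU: "y + t *\<^sub>R \<xi> \<in> U" if "t \<in> {-\<epsilon><..<\<epsilon>}" for t
  proof -
    have "norm (t *\<^sub>R \<xi>) \<le> \<bar>t\<bar> * (norm \<xi> + 1)" by (simp add: mult_left_mono)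
    also have "\<dots> < \<epsilon> * (norm \<xi> + 1)"
      using that by (intro mult_strict_right_mono) (auto simp: add_nonneg_pos)
    also have "norm \<xi> + 1 \<noteq> 0" using norm_ge_zero[of \<xi>] by linarith
    then have "\<epsilon> * (norm \<xi> + 1) = d" by (simp add: \<epsilon>_def)
    finally have "y + t *\<^sub>R \<xi> \<in> ball y d" by (simp add: dist_norm)
    then show ?thesis using d(2) by blast
  qed
  have op: "open {-\<epsilon><..<\<epsilon>}" by simp
  have "higher_differentiable_on {-\<epsilon><..<\<epsilon>} (\<lambda>t. \<phi> (y + t *\<^sub>R \<xi>)) m" for m
  proof (rule higher_differentiable_on_compose[OF op U(1)])
    show "(\<lambda>t. y + t *\<^sub>R \<xi>) ` {-\<epsilon><..<\<epsilon>} \<subseteq> U" using inU by blast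
    show "higher_differentiable_on U \<phi> m" using U(2) by (simp add: smooth_on_def)
    show "higher_differentiable_on {-\<epsilon><..<\<epsilon>} (\<lambda>t. y + t *\<^sub>R \<xi>) m"
      by (intro higher_differentiable_on_add higher_differentiable_on_const op
          higher_differentiable_on_bounded_linear bounded_linear_scaleR_left)
  qed
  then have sm: "smooth_on {-\<epsilon><..<\<epsilon>} (\<lambda>t. \<phi> (y + t *\<^sub>R \<xi>))" by (simp add: smooth_on_def)
  have "((\<lambda>t. y + t *\<^sub>R \<xi>) has_derivative (\<lambda>r. r *\<^sub>R \<xi>)) (at 0)"
    by (auto intro!: derivative_eq_intros)
  then have "(\<phi> \<circ> (\<lambda>t. y + t *\<^sub>R \<xi>) has_derivative frechet_derivative \<phi> (at y) \<circ> (\<lambda>r. r *\<^sub>R \<xi>)) (at 0)"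
    using local_parametrization_derivative[OF assms] by (intro diff_chain_at) auto
  then have "((\<lambda>t. \<phi> (y + t *\<^sub>R \<xi>)) has_vector_derivative v) (at 0)"
    using linear_scale[OF has_derivative_linear[OF local_parametrization_derivative[OF assms]]]
    by (simp add: has_vector_derivative_def o_def v)
  moreover have "(\<lambda>t. \<phi> (y + t *\<^sub>R \<xi>)) ` {-\<epsilon><..<\<epsilon>} \<subseteq> S" using inU US by blast
  ultimately show "v \<in> tangent_space S (\<phi> y)"
    unfolding tangent_space_def using \<epsilon> sm by (intro CollectI exI[of _ "\<lambda>t. \<phi> (y + t *\<^sub>R \<xi>)"] exI[of _ \<epsilon>]) simp
qed

context boundary_patch
begin

definition "T p = {v. lorentz p v = 0 \<and> lorentz (N p) v = 0}"
text \<open>Not the radius of a parallel set: the factor between \<open>G\<close> and the unit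
  normal.\<close>

definition "\<rho> X = sqrt (lorentz (G X) (G X))"

lemma subspace_T: "subspace (T p)"
  by (auto simp: subspace_def T_def lorentz_simps)

lemma in_frontier:
  assumes "p \<in> hyp_frontier \<Omega>" "p \<in> W"
  shows "p \<in> hyperbolic_space" "f p = 0" "p \<in> W1" "\<rho> p > 0"
    "lorentz p (N p) = 0" "lorentz (N p) (N p) = 1"
proof -
  show 1: "p \<in> hyperbolic_space" "f p = 0" using assms frontier_patch by blast+
  then show "p \<in> W1" using inW1 assms(2) by blast
  then show "\<rho> p > 0" "lorentz p (N p) = 0" "lorentz (N p) (N p) = 1"
    using NN N_tangent 1 by (auto simp: \<rho>_def W1_def)
qed

lemma frontier_curve_eventually:
  fixes \<gamma> :: "real \<Rightarrow> ('n option) minkowski"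
  assumes p: "p \<in> hyp_frontier \<Omega>" "p \<in> W"
    and \<gamma>: "\<epsilon> > 0" "\<gamma> ` {-\<epsilon><..<\<epsilon>} \<subseteq> hyp_frontier \<Omega>" "\<gamma> 0 = p" "(\<gamma> has_vector_derivative v) (at 0)"
  shows "\<forall>\<^sub>F t in nhds 0. \<gamma> t \<in> hyp_frontier \<Omega> \<and> \<gamma> t \<in> W"
proof -
  have "isCont \<gamma> 0" using \<gamma>(4) has_vector_derivative_continuous by blast
  then have "(\<gamma> \<longlongrightarrow> p) (nhds 0)" using \<gamma>(3) by (simp add: isCont_def tendsto_nhds_iff)
  then have "\<forall>\<^sub>F t in nhds 0. \<gamma> t \<in> W" using opW p(2) by (rule topological_tendstoD)
  moreover have "\<forall>\<^sub>F t in nhds 0. t \<in> {-\<epsilon><..<\<epsilon>}" using \<gamma>(1) by (intro eventually_nhds_in_open) auto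
  ultimately show ?thesis by eventually_elim (use \<gamma>(2) in blast)
qed

lemma tangent_space_subset:
  assumes p: "p \<in> hyp_frontier \<Omega>" "p \<in> W"
  shows "tangent_space (hyp_frontier \<Omega>) p \<subseteq> T p"
proof
  fix v assume "v \<in> tangent_space (hyp_frontier \<Omega>) p"
  then obtain \<gamma> \<epsilon> where \<gamma>: "\<epsilon> > 0" "\<gamma> ` {-\<epsilon><..<\<epsilon>} \<subseteq> hyp_frontier \<Omega>" "\<gamma> 0 = p"
    "(\<gamma> has_vector_derivative v) (at 0)" unfolding tangent_space_def by blast
  note ev = frontier_curve_eventually[OF p \<gamma>]
  have v: "(\<gamma> has_derivative (\<lambda>r. r *\<^sub>R v)) (at 0)" using \<gamma>(4) by (simp add: has_vector_derivative_def)
  have "(f \<circ> \<gamma> has_derivative (\<lambda>w. lorentz (g p) w) \<circ> (\<lambda>r. r *\<^sub>R v)) (at 0)"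
    using v \<gamma>(3) der_f[OF p(2)] by (intro diff_chain_at) auto
  then have "((\<lambda>t. f (\<gamma> t)) has_real_derivative lorentz (g p) v) (at 0)"
    by (simp add: has_field_derivative_def o_def lorentz_simps mult_commute_abs)
  moreover have "\<forall>\<^sub>F t in nhds 0. f (\<gamma> t) = 0"
    using ev by eventually_elim (use in_frontier in blast)
  ultimately have "((\<lambda>t. 0) has_real_derivative lorentz (g p) v) (at 0)"
    using DERIV_cong_ev[OF refl _ refl, of "\<lambda>t. f (\<gamma> t)" "\<lambda>t. 0" 0] by blast
  then have gv: "lorentz (g p) v = 0" using DERIV_unique[OF _ DERIV_const] by blast
  have "((\<lambda>t. lorentz (\<gamma> t) (\<gamma> t)) has_derivative (\<lambda>r. lorentz (\<gamma> 0) (r *\<^sub>R v) + lorentz (r *\<^sub>R v) (\<gamma> 0))) (at 0)"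
    by (rule bounded_bilinear.FDERIV[OF bounded_bilinear_lorentz v v])
  then have "((\<lambda>t. lorentz (\<gamma> t) (\<gamma> t)) has_real_derivative 2 * lorentz p v) (at 0)"
    by (simp add: has_field_derivative_def \<gamma>(3) lorentz_simps lorentz_sym[of v p] mult_commute_abs algebra_simps)
  moreover have "\<forall>\<^sub>F t in nhds 0. lorentz (\<gamma> t) (\<gamma> t) = -1"
    using ev by eventually_elim (use in_frontier hyperbolic_spaceD(1) in blast)
  ultimately have "((\<lambda>t. -1) has_real_derivative 2 * lorentz p v) (at 0)"
    using DERIV_cong_ev[OF refl _ refl, of "\<lambda>t. lorentz (\<gamma> t) (\<gamma> t)" "\<lambda>t. -1" 0] by blast
  then have pv: "lorentz p v = 0" using DERIV_unique[OF _ DERIV_const] by fastforce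
  have "\<rho> p * lorentz (N p) v = 0"
    using lorentz_N[OF in_frontier(3)[OF p] pv] gv by (simp add: \<rho>_def)
  then show "v \<in> T p" using pv in_frontier(4)[OF p] by (simp add: T_def)
qed

lemma dim_T:
  assumes p: "p \<in> hyp_frontier \<Omega>" "p \<in> W"
  shows "dim (T p) \<le> CARD('n)"
proof -
  note fr = in_frontier[OF p]
  \<comment> \<open>An eigenframe of the zero operator is just an orthonormal frame.\<close>
  obtain e \<kappa> where "lorentz_frame p (N p) e"
    using ex_lorentz_eigenframe[of p "N p" "\<lambda>v. 0"] fr by (auto simp: lorentz_simps linear_zero)
  then interpret lorentz_frame p "N p" e .
  have "T p \<subseteq> span (range e)"
  proof
    fix v assume "v \<in> T p"
    then have "lorentz v p = 0" "lorentz v (N p) = 0" by (auto simp: T_def lorentz_sym)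
    then have "v = (\<Sum>i\<in>UNIV. lorentz v (e i) *\<^sub>R e i)" using frame_expansion[of v] by simp
    also have "\<dots> \<in> span (range e)" by (intro span_sum span_scale span_base) auto
    finally show "v \<in> span (range e)" .
  qed
  then have "dim (T p) \<le> card (range e)" by (intro dim_le_card) auto
  also have "\<dots> \<le> CARD('n)" by (rule card_image_le) simp
  finally show ?thesis .
qed

text \<open>The image of the differential lies in the tangent space, and that in \<open>T\<close>;
  the first has dimension n and the last at most n.\<close>

lemma range_parametrization:
  assumes p: "\<phi> y \<in> W" and \<phi>: "local_parametrization (hyp_frontier \<Omega>) U \<phi>" "y \<in> U"
  shows "range (frechet_derivative \<phi> (at y)) = T (\<phi> y)"
    and "tangent_space (hyp_frontier \<Omega>) (\<phi> y) = T (\<phi> y)"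
proof -
  have "\<phi> ` U \<subseteq> hyp_frontier \<Omega>"
    using \<phi>(1) openin_imp_subset unfolding local_parametrization_def by blast
  then have pS: "\<phi> y \<in> hyp_frontier \<Omega>" using \<phi>(2) by blast
  have lin: "linear (frechet_derivative \<phi> (at y))"
    using local_parametrization_derivative[OF \<phi>] by (rule has_derivative_linear)
  have inj: "inj (frechet_derivative \<phi> (at y))" using \<phi> unfolding local_parametrization_def by blast
  have "dim (range (frechet_derivative \<phi> (at y))) = dim (UNIV :: (real^'n) set)"
    by (rule dim_image_eq[OF lin]) (simp add: inj)
  then have d: "dim (range (frechet_derivative \<phi> (at y))) = CARD('n)" by simp
  note sub1 = range_parametrization_subset_tangent_space[OF \<phi>]
  note sub2 = tangent_space_subset[OF pS p]
  show 1: "range (frechet_derivative \<phi> (at y)) = T (\<phi> y)"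
    by (rule subspace_dim_equal[OF linear_subspace_image[OF lin subspace_UNIV] subspace_T])
      (use sub1 sub2 dim_T[OF pS p] d in auto)
  show "tangent_space (hyp_frontier \<Omega>) (\<phi> y) = T (\<phi> y)" using 1 sub1 sub2 by blast
qed

lemma tangent_space_eq:
  assumes p: "p \<in> hyp_frontier \<Omega>" "p \<in> W"
  shows "tangent_space (hyp_frontier \<Omega>) p = T p"
proof -
  obtain U \<phi> y where "local_parametrization (hyp_frontier \<Omega>) U \<phi>" "y \<in> U" "\<phi> y = p"
    using ex_local_parametrization[OF p] .
  then show ?thesis using range_parametrization(2)[of \<phi> y U] p(2) by simp
qed

text \<open>A unit tangent vector orthogonal to \<open>T p\<close> is plus or minus
  \<open>N p\<close>; for minus, the geodesic would enter the set.\<close>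

lemma outward_normal_eq:
  assumes p: "p \<in> hyp_frontier \<Omega>" "p \<in> W"
  shows "outward_normal \<Omega> p = N p"
  unfolding outward_normal_def tangent_space_eq[OF p]
proof (rule the_equality)
  note fr = in_frontier[OF p]
  have geo: "(hyp_geodesic p v has_vector_derivative v) (at 0)" "hyp_geodesic p v 0 = p" for v
    unfolding hyp_geodesic_def has_vector_derivative_def
    by (auto intro!: derivative_eq_intros simp: algebra_simps)
  have gN: "lorentz (g p) v = \<rho> p * lorentz (N p) v" if "lorentz p v = 0" for v
    using lorentz_N[OF fr(3) that] by (simp add: \<rho>_def)
  have out: "\<forall>\<^sub>F t in at_right 0. hyp_geodesic p (N p) t \<notin> \<Omega>"
    by (rule sublevel_curve(1)[OF p(2) fr(2) geo hyp_geodesic_in[OF fr(1,5,6)]])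
      (use gN[OF fr(5)] fr(4,6) in simp)
  then show "lorentz p (N p) = 0 \<and> lorentz (N p) (N p) = 1 \<and> (\<forall>v\<in>T p. lorentz v (N p) = 0) \<and>
    (\<forall>\<^sub>F t in at_right 0. hyp_geodesic p (N p) t \<notin> \<Omega>)"
    using fr by (auto simp: T_def lorentz_sym)
  fix \<nu> assume \<nu>: "lorentz p \<nu> = 0 \<and> lorentz \<nu> \<nu> = 1 \<and> (\<forall>v\<in>T p. lorentz v \<nu> = 0) \<and>
    (\<forall>\<^sub>F t in at_right 0. hyp_geodesic p \<nu> t \<notin> \<Omega>)"
  define c where "c = lorentz \<nu> (N p)"
  define w where "w = \<nu> - c *\<^sub>R N p"
  have "w \<in> T p" using \<nu> fr by (simp add: w_def T_def lorentz_simps lorentz_sym[of "N p" \<nu>] c_def)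
  have "lorentz w \<nu> = 0" using \<nu> \<open>w \<in> T p\<close> by blast
  moreover have "lorentz w (N p) = 0" using \<open>w \<in> T p\<close> by (simp add: T_def lorentz_sym)
  ultimately have "lorentz w w = 0"
    using arg_cong[OF w_def, of "lorentz w"] by (simp add: lorentz_simps)
  then have "w = 0" using tangent_vector_spacelike(3)[OF fr(1), of w] \<open>w \<in> T p\<close> by (auto simp: T_def)
  then have \<nu>c: "\<nu> = c *\<^sub>R N p" by (simp add: w_def)
  then have "c * c = 1" using \<nu> fr(6) by (simp add: lorentz_simps)
  then have "c = 1 \<or> c = -1" by (simp add: square_eq_1_iff)
  moreover have "c \<noteq> -1"
  proof
    assume "c = -1"
    then have n: "\<nu> = - N p" using \<nu>c by simp
    have "\<forall>\<^sub>F t in at_right 0. hyp_geodesic p \<nu> t \<in> \<Omega>"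
      by (rule sublevel_curve(2)[OF p(2) fr(2) geo hyp_geodesic_in[OF fr(1)]])
        (use \<nu> gN[of \<nu>] fr(4,6) n in \<open>auto simp: lorentz_simps\<close>)
    moreover have "\<forall>\<^sub>F t in at_right 0. hyp_geodesic p \<nu> t \<notin> \<Omega>" using \<nu> by blast
    ultimately have "\<forall>\<^sub>F t in at_right (0::real). False" by eventually_elim auto
    then show False by simp
  qed
  ultimately show "\<nu> = N p" using \<nu>c by auto
qed

text \<open>A derivative within the boundary may be ambiguous off the tangent vectors, but any two
  agree on velocities of curves in the boundary, so the choice made by
  \<open>frechet_derivative\<close> does no harm.\<close>

lemma frechet_outward_normal:
  assumes p: "p \<in> hyp_frontier \<Omega>" "p \<in> W" and v: "v \<in> T p"
  shows "frechet_derivative (outward_normal \<Omega>) (at p within hyp_frontier \<Omega>) v = DN p v"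
proof -
  define S where "S = hyp_frontier \<Omega>"
  note fr = in_frontier[OF p]
  obtain r where r: "r > 0" "ball p r \<subseteq> W" using opW p(2) openE by blast
  have d1: "(outward_normal \<Omega> has_derivative DN p) (at p within S)"
  proof (rule has_derivative_transform_within[OF has_derivative_at_withinI[OF der_N[OF fr(3)]] r(1)])
    show "p \<in> S" using p by (simp add: S_def)
    show "N x = outward_normal \<Omega> x" if "x \<in> S" "dist x p < r" for x
      using outward_normal_eq[of x] that r(2) by (auto simp: S_def dist_commute)
  qed
  then have d2: "(outward_normal \<Omega> has_derivative frechet_derivative (outward_normal \<Omega>) (at p within S)) (at p within S)"
    using frechet_derivative_works differentiable_def by blast
  obtain \<gamma> \<epsilon> where \<gamma>: "\<epsilon> > 0" "\<gamma> ` {-\<epsilon><..<\<epsilon>} \<subseteq> S" "\<gamma> 0 = p" "(\<gamma> has_vector_derivative v) (at 0)"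
    using v unfolding tangent_space_eq[OF p, symmetric] tangent_space_def S_def by blast
  have a0: "at 0 within {-\<epsilon><..<\<epsilon>} = at 0" using \<gamma>(1) by (intro at_within_open) auto
  have comp: "(outward_normal \<Omega> \<circ> \<gamma> has_derivative D \<circ> (\<lambda>r. r *\<^sub>R v)) (at 0)"
    if "(outward_normal \<Omega> has_derivative D) (at p within S)" for D
  proof -
    have "(outward_normal \<Omega> \<circ> \<gamma> has_derivative D \<circ> (\<lambda>r. r *\<^sub>R v)) (at 0 within {-\<epsilon><..<\<epsilon>})"
    proof (rule diff_chain_within)
      show "(\<gamma> has_derivative (\<lambda>r. r *\<^sub>R v)) (at 0 within {-\<epsilon><..<\<epsilon>})"
        using \<gamma>(4) unfolding a0 has_vector_derivative_def .
      show "(outward_normal \<Omega> has_derivative D) (at (\<gamma> 0) within \<gamma> ` {-\<epsilon><..<\<epsilon>})"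
        unfolding \<gamma>(3) using that \<gamma>(2) by (rule has_derivative_subset)
    qed
    then show ?thesis unfolding a0 .
  qed
  have "DN p \<circ> (\<lambda>r. r *\<^sub>R v) = frechet_derivative (outward_normal \<Omega>) (at p within S) \<circ> (\<lambda>r. r *\<^sub>R v)"
    using has_derivative_unique[OF comp[OF d1] comp[OF d2]] .
  from fun_cong[OF this, of 1] show ?thesis by (simp add: S_def)
qed

lemma linear_DN: "X \<in> W1 \<Longrightarrow> linear (DN X)"
  using der_N by (rule has_derivative_linear)

text \<open>Orthogonality to \<open>N p\<close> comes from differentiating the unit length, which
  holds on an open set. Orthogonality to \<open>p\<close> comes from the tangency of
  \<open>N\<close>, which holds on the hyperboloid, hence the differentiation along a curve.\<close>

lemma DN_tangent:
  assumes p: "p \<in> hyp_frontier \<Omega>" "p \<in> W" and v: "v \<in> T p"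
  shows "DN p v \<in> T p"
proof -
  note fr = in_frontier[OF p]
  have "((\<lambda>X. lorentz (N X) (N X)) has_derivative (\<lambda>v. lorentz (N p) (DN p v) + lorentz (DN p v) (N p))) (at p)"
    by (rule bounded_bilinear.FDERIV[OF bounded_bilinear_lorentz der_N[OF fr(3)] der_N[OF fr(3)]])
  then have "((\<lambda>X. 1) has_derivative (\<lambda>v. lorentz (N p) (DN p v) + lorentz (DN p v) (N p))) (at p)"
    by (rule has_derivative_transform_within_open[OF _ opW1 fr(3)]) (rule NN)
  then have "(\<lambda>v. lorentz (N p) (DN p v) + lorentz (DN p v) (N p)) = (\<lambda>v. 0)"
    by (rule has_derivative_unique[OF _ has_derivative_const])
  from fun_cong[OF this, of v] have 1: "lorentz (N p) (DN p v) = 0"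
    using lorentz_sym[of "DN p v" "N p"] by simp
  obtain \<gamma> \<epsilon> where \<gamma>: "\<epsilon> > 0" "\<gamma> ` {-\<epsilon><..<\<epsilon>} \<subseteq> hyp_frontier \<Omega>" "\<gamma> 0 = p" "(\<gamma> has_vector_derivative v) (at 0)"
    using v unfolding tangent_space_eq[OF p, symmetric] tangent_space_def by blast
  have dv: "(\<gamma> has_derivative (\<lambda>r. r *\<^sub>R v)) (at 0)" using \<gamma>(4) by (simp add: has_vector_derivative_def)
  have dN: "(N \<circ> \<gamma> has_derivative DN p \<circ> (\<lambda>r. r *\<^sub>R v)) (at 0)"
    using dv der_N[OF fr(3)] \<gamma>(3) by (intro diff_chain_at) auto
  have "((\<lambda>t. lorentz (N (\<gamma> t)) (\<gamma> t)) has_real_derivative lorentz (N p) v + lorentz (DN p v) p) (at 0)"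
    unfolding has_field_derivative_def
    by (rule has_derivative_eq_rhs[OF bounded_bilinear.FDERIV[OF bounded_bilinear_lorentz dN dv, unfolded o_def]])
      (auto simp: \<gamma>(3) lorentz_simps linear_scale[OF linear_DN[OF fr(3)]] algebra_simps)
  moreover have "\<forall>\<^sub>F t in nhds 0. lorentz (N (\<gamma> t)) (\<gamma> t) = 0"
    using frontier_curve_eventually[OF p \<gamma>]
    by eventually_elim (metis in_frontier(1) N_tangent lorentz_sym)
  ultimately have "((\<lambda>t. 0) has_real_derivative lorentz (N p) v + lorentz (DN p v) p) (at 0)"
    using DERIV_cong_ev[OF refl _ refl, of "\<lambda>t. lorentz (N (\<gamma> t)) (\<gamma> t)" "\<lambda>t. 0" 0] by blast
  then have "lorentz (N p) v + lorentz (DN p v) p = 0" using DERIV_unique[OF _ DERIV_const] by blast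
  then have "lorentz p (DN p v) = 0" using v lorentz_sym[of p "DN p v"] by (simp add: T_def)
  with 1 show ?thesis by (simp add: T_def)
qed

section \<open>Second fundamental form and principal frames\<close>

abbreviation "Dg X \<equiv> frechet_derivative g (at X)"

lemma der_g: "X \<in> W \<Longrightarrow> (g has_derivative Dg X) (at X)"
  by (rule higher_differentiable_on_SucD(1)[OF hd_g])

lemma Dg_symmetric:
  assumes "X \<in> W"
  shows "lorentz (Dg X v) w = lorentz (Dg X w) v"
proof -
  have D: "frechet_derivative (\<lambda>y. frechet_derivative f (at y) w) (at X) v = lorentz (Dg X v) w" for v w
  proof -
    have "((\<lambda>y. lorentz (g y) w) has_derivative (\<lambda>v. lorentz (Dg X v) w)) (at X)"
      by (rule bounded_linear.has_derivative[OF bounded_bilinear.bounded_linear_left[OF bounded_bilinear_lorentz] der_g[OF assms]])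
    then have "((\<lambda>y. frechet_derivative f (at y) w) has_derivative (\<lambda>v. lorentz (Dg X v) w)) (at X)"
      by (rule has_derivative_transform_within_open[OF _ opW assms]) (simp add: lorentz_gradient f_diff)
    from frechet_derivative_at[OF this] show ?thesis by metis
  qed
  show ?thesis
    using symmetric_second_derivative[OF opW assms hdf, of w v] by (simp add: D)
qed

text \<open>\<open>G\<close> is differentiated twice, from its definition and as the product of
  \<open>\<rho>\<close> and \<open>N\<close>; pairing with a vector of \<open>T p\<close> removes
  the components along \<open>p\<close> and \<open>N p\<close>.\<close>

lemma second_fundamental_form:
  assumes p: "p \<in> hyp_frontier \<Omega>" "p \<in> W" and vw: "v \<in> T p" "w \<in> T p"
  shows "\<rho> p * lorentz (DN p v) w = lorentz (Dg p v) w + lorentz (g p) p * lorentz v w"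
proof -
  note fr = in_frontier[OF p]
  have W1W: "W1 \<subseteq> W" by (auto simp: W1_def)
  define D\<rho> where "D\<rho> = frechet_derivative \<rho> (at p)"
  have "higher_differentiable_on W1 \<rho> (Suc 0)"
    unfolding \<rho>_def
    by (rule higher_differentiable_on_sqrt[OF opW1 higher_differentiable_on_subset[OF hd_GG W1W]])
      (simp add: W1_def)
  then have d\<rho>: "(\<rho> has_derivative D\<rho>) (at p)"
    unfolding D\<rho>_def using fr(3) by (rule higher_differentiable_on_SucD(1))
  have "((\<lambda>X. \<rho> X *\<^sub>R N X) has_derivative (\<lambda>v. \<rho> p *\<^sub>R DN p v + D\<rho> v *\<^sub>R N p)) (at p)"
    by (rule has_derivative_scaleR[OF d\<rho> der_N[OF fr(3)]])
  then have 1: "(G has_derivative (\<lambda>v. \<rho> p *\<^sub>R DN p v + D\<rho> v *\<^sub>R N p)) (at p)"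
    by (rule has_derivative_transform_within_open[OF _ opW1 fr(3)]) (use G_eq in \<open>simp add: \<rho>_def\<close>)
  have 2: "(G has_derivative (\<lambda>v. Dg p v + (lorentz (g p) p *\<^sub>R v + (lorentz (g p) v + lorentz (Dg p v) p) *\<^sub>R p))) (at p)"
    unfolding tangential_gradient_def
    by (intro has_derivative_add der_g p has_derivative_scaleR has_derivative_ident
        bounded_bilinear.FDERIV[OF bounded_bilinear_lorentz])
  have "\<rho> p *\<^sub>R DN p v + D\<rho> v *\<^sub>R N p
      = Dg p v + (lorentz (g p) p *\<^sub>R v + (lorentz (g p) v + lorentz (Dg p v) p) *\<^sub>R p)"
    using fun_cong[OF has_derivative_unique[OF 1 2], of v] .
  from arg_cong[OF this, of "\<lambda>Z. lorentz Z w"] show ?thesis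
    using vw by (simp add: lorentz_simps T_def)
qed

text \<open>The curvatures are chosen by \<open>SOME\<close>; the eigenframe provides a witness, and
  the chosen values then come with a frame of their own, which is the one delivered.\<close>

lemma ex_principal_frame:
  assumes p: "p \<in> hyp_frontier \<Omega>" "p \<in> W"
  obtains e where "lorentz_frame p (N p) e"
    "\<And>i. DN p (e i) = principal_curvatures \<Omega> p i *\<^sub>R e i"
proof -
  note fr = in_frontier[OF p]
  have shape: "shape_operator \<Omega> p v = DN p v" if "v \<in> T p" for v
    using frechet_outward_normal[OF p that] DN_tangent[OF p that]
    by (simp add: shape_operator_def T_def lorentz_sym)
  have adj: "lorentz (DN p v) w = lorentz v (DN p w)" if "v \<in> T p" "w \<in> T p" for v w
  proof -
    have "\<rho> p * lorentz (DN p v) w = \<rho> p * lorentz (DN p w) v"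
      using second_fundamental_form[OF p that] second_fundamental_form[OF p that(2,1)]
        Dg_symmetric[OF p(2)] lorentz_sym[of v w] by simp
    then show ?thesis using fr(4) lorentz_sym[of v "DN p w"] by simp
  qed
  have "\<exists>e \<kappa>. lorentz_frame p (N p) e \<and> (\<forall>i. DN p (e i) = \<kappa> i *\<^sub>R e i)"
    using DN_tangent[OF p] adj
    by (intro ex_lorentz_eigenframe fr linear_DN) (auto simp: T_def)
  then obtain e \<kappa> where e: "lorentz_frame p (N p) e" "\<And>i. DN p (e i) = \<kappa> i *\<^sub>R e i" by blast
  define P where "P = (\<lambda>\<kappa>. \<exists>e :: 'n \<Rightarrow> ('n option) minkowski.
        (\<forall>i. e i \<in> tangent_space (hyp_frontier \<Omega>) p) \<and>
        (\<forall>i j. lorentz (e i) (e j) = (if i = j then 1 else 0)) \<and>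
        (\<forall>i. shape_operator \<Omega> p (e i) = \<kappa> i *\<^sub>R e i))"
  have eT: "e i \<in> T p" for i
    using lorentz_frame.pe[OF e(1)] lorentz_frame.\<nu>e[OF e(1)] by (simp add: T_def)
  have "P \<kappa>"
    unfolding P_def using e eT lorentz_frame.ee[OF e(1)] shape
    by (intro exI[of _ e]) (simp add: tangent_space_eq[OF p])
  then have "P (principal_curvatures \<Omega> p)"
    unfolding principal_curvatures_def P_def[symmetric] by (rule someI[of P])
  then obtain e' where e': "\<And>i. e' i \<in> T p" "\<And>i j. lorentz (e' i) (e' j) = (if i = j then 1 else 0)"
    "\<And>i. shape_operator \<Omega> p (e' i) = principal_curvatures \<Omega> p i *\<^sub>R e' i"
    unfolding P_def tangent_space_eq[OF p] by blast
  have "lorentz_frame p (N p) e'"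
    by standard (use fr e' in \<open>auto simp: T_def\<close>)
  then show ?thesis using that[of e'] e'(1,3) shape by simp
qed

end

section \<open>Global horospherical convexity\<close>

text \<open>
  For a null vector \<open>(m, 1)\<close>, projecting Minkowski space along it maps hyperbolic space onto a
  half-space. Segments of the half-space lift to curves \<open>c\<close> with \<open>c''\<close> proportional to \<open>(m, 1)\<close>,
  and a hypersurface with principal curvatures greater than one is locally strictly convex
  along them. So an h-convex domain has a convex projection in every null direction.
\<close>

definition horo_proj :: "real^'m::finite \<Rightarrow> 'm minkowski \<Rightarrow> real^'m" where
  "horo_proj m X = fst X - snd X *\<^sub>R m"

text \<open>For a Euclidean unit vector \<open>m\<close> and z \<bullet> m < 0 this is the only time
  t with (z + t m, t) on the hyperboloid, and it is positive.\<close>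

definition horo_time :: "real^'m::finite \<Rightarrow> real^'m \<Rightarrow> real" where
  "horo_time m z = (1 + z \<bullet> z) * inverse (- 2 * (z \<bullet> m))"

definition horo_lift :: "real^'m::finite \<Rightarrow> real^'m \<Rightarrow> 'm minkowski" where
  "horo_lift m z = (z + horo_time m z *\<^sub>R m, horo_time m z)"

lemma horo_proj_lift [simp]: "horo_proj m (horo_lift m z) = z"
  by (simp add: horo_proj_def horo_lift_def)

lemma bounded_linear_horo_proj: "bounded_linear (horo_proj m)"
  unfolding horo_proj_def
  by (intro bounded_linear_sub bounded_linear_fst bounded_linear_scaleR_const bounded_linear_snd)

lemma open_horo_halfspace: "open {z. z \<bullet> m < (0::real)}"
  by (intro open_Collect_less continuous_intros)

lemma horo_lift_in:
  assumes "m \<bullet> m = 1" "z \<bullet> m < 0"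
  shows "horo_lift m z \<in> hyperbolic_space"
proof -
  have t: "horo_time m z * (2 * (z \<bullet> m)) = - (1 + z \<bullet> z)"
    using assms(2) by (simp add: horo_time_def field_simps)
  have "lorentz (horo_lift m z) (horo_lift m z) = z \<bullet> z + horo_time m z * (2 * (z \<bullet> m))"
    using assms(1) by (simp add: horo_lift_def lorentz_def inner_add_left inner_add_right inner_commute algebra_simps)
  also have "\<dots> = -1" unfolding t by simp
  finally have "lorentz (horo_lift m z) (horo_lift m z) = -1" .
  moreover have "horo_time m z > 0"
    unfolding horo_time_def using assms(2)
    by (intro mult_pos_pos) (auto simp: add_pos_nonneg)
  ultimately show ?thesis by (simp add: hyperbolic_space_def horo_lift_def)
qed

lemma horo_proj_in:
  assumes "m \<bullet> m = 1" "X \<in> hyperbolic_space"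
  shows "horo_proj m X \<bullet> m < 0" "horo_lift m (horo_proj m X) = X"
proof -
  note X = hyperbolic_spaceD[OF assms(2)]
  have "norm m = 1" using assms(1) by (simp add: norm_eq_sqrt_inner)
  then have "fst X \<bullet> m < snd X"
    using norm_cauchy_schwarz[of "fst X" m] X(6) by simp
  then show 1: "horo_proj m X \<bullet> m < 0"
    using assms(1) by (simp add: horo_proj_def inner_diff_left)
  define d where "d = snd X - fst X \<bullet> m"
  have "d > 0" using \<open>fst X \<bullet> m < snd X\<close> by (simp add: d_def)
  have e1: "1 + horo_proj m X \<bullet> horo_proj m X = 2 * snd X * d"
    using X(4) assms(1)
    by (simp add: d_def horo_proj_def inner_diff_left inner_diff_right inner_commute power2_eq_square algebra_simps)
  have e2: "- 2 * (horo_proj m X \<bullet> m) = 2 * d"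
    using assms(1) by (simp add: d_def horo_proj_def inner_diff_left)
  have "horo_time m (horo_proj m X) = snd X"
    unfolding horo_time_def e1 e2 using \<open>d > 0\<close> by simp
  then show "horo_lift m (horo_proj m X) = X"
    by (simp add: horo_lift_def) (simp add: horo_proj_def)
qed

lemma horo_lift_smooth:
  assumes "open V" "\<And>z. z \<in> V \<Longrightarrow> z \<bullet> m < 0"
  shows "higher_differentiable_on V (horo_lift m) k"
proof -
  have id: "higher_differentiable_on V (\<lambda>z. z) k"
    by (rule higher_differentiable_on_bounded_linear[OF assms(1) bounded_linear_ident])
  have t: "higher_differentiable_on V (horo_time m) k"
    unfolding horo_time_def
    by (intro higher_differentiable_on_mult higher_differentiable_on_inverse higher_differentiable_on_add
        higher_differentiable_on_inner higher_differentiable_on_const id assms(1))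
      (use assms(2) in force)
  show ?thesis
    unfolding horo_lift_def
    by (intro higher_differentiable_on_Pair higher_differentiable_on_add higher_differentiable_on_scaleR
        higher_differentiable_on_const id t assms(1))
qed

lemma continuous_on_horo_lift: "continuous_on {z. z \<bullet> m < 0} (horo_lift m)"
  by (rule higher_differentiable_on_imp_continuous_on[OF horo_lift_smooth[OF open_horo_halfspace, where k = 0]])
    simp

section \<open>The curvature condition along null projections\<close>

context boundary_patch
begin

lemma second_fundamental_form_gt:
  assumes pS: "p \<in> hyp_frontier \<Omega>" "p \<in> W" and \<kappa>: "\<And>i. principal_curvatures \<Omega> p i > 1"
    and v: "v \<in> T p" "v \<noteq> 0"
  shows "lorentz (DN p v) v > lorentz v v"
proof -
  obtain e where e: "lorentz_frame p (N p) e"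
    "\<And>i. DN p (e i) = principal_curvatures \<Omega> p i *\<^sub>R e i"
    using ex_principal_frame[OF pS] by blast
  interpret lorentz_frame p "N p" e by (rule e(1))
  define c where "c = (\<lambda>i. lorentz v (e i))"
  have "lorentz v p = 0" "lorentz v (N p) = 0" using v by (auto simp: T_def lorentz_sym)
  then have ve: "v = (\<Sum>i\<in>UNIV. c i *\<^sub>R e i)" using frame_expansion[of v] by (simp add: c_def)
  note lin = linear_DN[OF in_frontier(3)[OF pS]]
  have "DN p v = (\<Sum>i\<in>UNIV. (c i * principal_curvatures \<Omega> p i) *\<^sub>R e i)"
    by (subst ve) (simp add: linear_sum[OF lin] linear_scale[OF lin] e(2))
  then have 1: "lorentz (DN p v) v = (\<Sum>i\<in>UNIV. principal_curvatures \<Omega> p i * (c i)\<^sup>2)"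
    by (simp add: lorentz_sum_left lorentz_simps c_def lorentz_sym[of v] power2_eq_square mult_ac)
  have 2: "lorentz v v = (\<Sum>i\<in>UNIV. (c i)\<^sup>2)"
    by (subst (2) ve) (simp add: lorentz_sum_right lorentz_simps c_def power2_eq_square)
  have "\<exists>j. c j \<noteq> 0" using ve v(2) by (metis (no_types, lifting) scaleR_eq_0_iff sum.neutral)
  then obtain j where "c j \<noteq> 0" ..
  have "(\<Sum>i\<in>UNIV. (c i)\<^sup>2) < (\<Sum>i\<in>UNIV. principal_curvatures \<Omega> p i * (c i)\<^sup>2)"
  proof (rule sum_strict_mono_ex1)
    show "\<forall>i\<in>UNIV. (c i)\<^sup>2 \<le> principal_curvatures \<Omega> p i * (c i)\<^sup>2"
      using mult_right_mono[OF less_imp_le[OF \<kappa>], of "(c i)\<^sup>2" for i] by simp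
    have "(c j)\<^sup>2 < principal_curvatures \<Omega> p j * (c j)\<^sup>2"
      using mult_strict_right_mono[OF \<kappa>[of j], of "(c j)\<^sup>2"] \<open>c j \<noteq> 0\<close> by simp
    then show "\<exists>j\<in>UNIV. (c j)\<^sup>2 < principal_curvatures \<Omega> p j * (c j)\<^sup>2" by blast
  qed auto
  then show ?thesis by (simp add: 1 2)
qed

context
  fixes m :: "real^'n option"
  assumes mm: "m \<bullet> m = 1"
begin

definition "V = {z. z \<bullet> m < 0} \<inter> horo_lift m -` W"
definition "F z = f (horo_lift m z)"
definition "L' z v = frechet_derivative (horo_lift m) (at z) v"

lemma opV: "open V"
  unfolding V_def
  by (rule continuous_open_preimage[OF continuous_on_horo_lift open_horo_halfspace opW])

lemma hd_L: "higher_differentiable_on V (horo_lift m) k"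
  by (rule horo_lift_smooth[OF opV]) (auto simp: V_def)

lemma der_L: "z \<in> V \<Longrightarrow> (horo_lift m has_derivative L' z) (at z)"
  using higher_differentiable_on_SucD(1)[OF hd_L] L'_def[abs_def] by simp

lemma hd_F: "higher_differentiable_on V F k"
  unfolding F_def by (rule higher_differentiable_on_compose[OF opV opW _ hdf hd_L]) (auto simp: V_def)

lemma F': "z \<in> V \<Longrightarrow> frechet_derivative F (at z) v = lorentz (g (horo_lift m z)) (L' z v)"
proof -
  assume z: "z \<in> V"
  then have "(F has_derivative (\<lambda>w. lorentz (g (horo_lift m z)) w) \<circ> L' z) (at z)"
    unfolding F_def using diff_chain_at[OF der_L[OF z] der_f] by (simp add: V_def o_def)
  from frechet_derivative_at[OF this] show ?thesis by (metis comp_apply)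
qed

lemma proj_L': "z \<in> V \<Longrightarrow> horo_proj m (L' z v) = v"
proof -
  assume z: "z \<in> V"
  have "(horo_proj m \<circ> horo_lift m has_derivative horo_proj m \<circ> L' z) (at z)"
    by (intro diff_chain_at der_L z bounded_linear_imp_has_derivative bounded_linear_horo_proj)
  moreover have "horo_proj m \<circ> horo_lift m = (\<lambda>z. z)" by auto
  ultimately have "horo_proj m \<circ> L' z = (\<lambda>v. v)" using has_derivative_unique[OF _ has_derivative_ident] by metis
  then show ?thesis by (metis comp_apply)
qed

lemma L'_tangent: "z \<in> V \<Longrightarrow> lorentz (horo_lift m z) (L' z v) = 0"
proof -
  assume z: "z \<in> V"
  have "((\<lambda>y. lorentz (horo_lift m y) (horo_lift m y)) has_derivative
      (\<lambda>v. lorentz (horo_lift m z) (L' z v) + lorentz (L' z v) (horo_lift m z))) (at z)"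
    by (rule bounded_bilinear.FDERIV[OF bounded_bilinear_lorentz der_L[OF z] der_L[OF z]])
  then have "((\<lambda>y. -1) has_derivative
      (\<lambda>v. lorentz (horo_lift m z) (L' z v) + lorentz (L' z v) (horo_lift m z))) (at z)"
    by (rule has_derivative_transform_within_open[OF _ opV z])
      (use horo_lift_in[OF mm] in \<open>auto simp: V_def hyperbolic_space_def\<close>)
  then have "(\<lambda>v. lorentz (horo_lift m z) (L' z v) + lorentz (L' z v) (horo_lift m z)) = (\<lambda>v. 0)"
    by (rule has_derivative_unique[OF _ has_derivative_const])
  from fun_cong[OF this, of v] show ?thesis
    using lorentz_sym[of "L' z v" "horo_lift m z"] by simp
qed

text \<open>Along the lifted line the second derivative is the Hessian of \<open>f\<close> on the
  velocity \<open>v0\<close> plus the gradient paired with the acceleration. The latter is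
  \<open>lorentz v0 v0\<close> times \<open>q - \<eta>\<close>, with \<open>\<eta>\<close> normal to
  the horosphere centred at \<open>M\<close>. So the boundary is compared with horospheres, whose
  curvatures are 1, and the product of the two unit normals is at most 1.\<close>

lemma horo_second_derivative_pos:
  assumes z: "z \<in> V" and p: "horo_lift m z \<in> hyp_frontier \<Omega>"
    and \<kappa>: "\<And>i. principal_curvatures \<Omega> (horo_lift m z) i > 1"
    and v: "v \<noteq> 0" "frechet_derivative F (at z) v = 0"
  shows "frechet_derivative (\<lambda>y. frechet_derivative F (at y) v) (at z) v > 0"
proof -
  define q where "q = horo_lift m z"
  have qW: "q \<in> W" "q \<in> hyp_frontier \<Omega>" using z p by (auto simp: V_def q_def)
  note fr = in_frontier[OF qW(2,1)]
  define M :: "('n option) minkowski" where "M = (m, 1)"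
  have MM: "lorentz M M = 0" "snd M > 0" using mm by (auto simp: M_def lorentz_def)
  define v0 where "v0 = L' z v"
  have v0: "lorentz q v0 = 0" "horo_proj m v0 = v"
    using L'_tangent[OF z] proj_L'[OF z] by (auto simp: q_def v0_def)
  have "v0 \<noteq> 0" using v0(2) v(1) by (auto simp: horo_proj_def)
  have "lorentz (g q) v0 = 0" using v(2) F'[OF z] by (simp add: q_def v0_def)
  then have "v0 \<in> T q" using v0(1) lorentz_N[OF fr(3) v0(1)] fr(4) by (simp add: T_def \<rho>_def)
  define D2 where "D2 = frechet_derivative (\<lambda>y. L' y v) (at z) v"
  have derL': "((\<lambda>y. L' y v) has_derivative frechet_derivative (\<lambda>y. L' y v) (at z)) (at z)"
    using higher_differentiable_on_SucD(1)[OF higher_differentiable_on_SucD(2)[OF hd_L] z] by (simp add: L'_def)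
  \<comment> \<open>The projected velocity is the constant \<open>v\<close>, so the acceleration
    projects to zero.\<close>
  have D2M: "D2 = snd D2 *\<^sub>R M"
  proof -
    have "(horo_proj m \<circ> (\<lambda>y. L' y v) has_derivative horo_proj m \<circ> frechet_derivative (\<lambda>y. L' y v) (at z)) (at z)"
      by (intro diff_chain_at derL' bounded_linear_imp_has_derivative bounded_linear_horo_proj)
    then have "((\<lambda>y. v) has_derivative horo_proj m \<circ> frechet_derivative (\<lambda>y. L' y v) (at z)) (at z)"
      by (rule has_derivative_transform_within_open[OF _ opV z]) (simp add: proj_L')
    then have "horo_proj m \<circ> frechet_derivative (\<lambda>y. L' y v) (at z) = (\<lambda>v. 0)"
      by (rule has_derivative_unique[OF _ has_derivative_const])
    then have "horo_proj m D2 = 0" by (metis comp_apply D2_def)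
    then show ?thesis by (simp add: horo_proj_def M_def prod_eq_iff)
  qed
  \<comment> \<open>Derivative of the tangency relation between position and velocity.\<close>
  have qD2: "lorentz q D2 = - lorentz v0 v0"
  proof -
    have "((\<lambda>y. lorentz (horo_lift m y) (L' y v)) has_derivative
      (\<lambda>w. lorentz (horo_lift m z) (frechet_derivative (\<lambda>y. L' y v) (at z) w) + lorentz (L' z w) (L' z v))) (at z)"
      by (rule bounded_bilinear.FDERIV[OF bounded_bilinear_lorentz der_L[OF z] derL'])
    then have "((\<lambda>y. 0) has_derivative
      (\<lambda>w. lorentz (horo_lift m z) (frechet_derivative (\<lambda>y. L' y v) (at z) w) + lorentz (L' z w) (L' z v))) (at z)"
      by (rule has_derivative_transform_within_open[OF _ opV z]) (simp add: L'_tangent)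
    then have "(\<lambda>w. lorentz (horo_lift m z) (frechet_derivative (\<lambda>y. L' y v) (at z) w) + lorentz (L' z w) (L' z v)) = (\<lambda>w. 0)"
      by (rule has_derivative_unique[OF _ has_derivative_const])
    from fun_cong[OF this, of v] show ?thesis by (simp add: q_def D2_def v0_def)
  qed
  have second: "frechet_derivative (\<lambda>y. frechet_derivative F (at y) v) (at z) v
      = lorentz (Dg q v0) v0 + lorentz (g q) D2"
  proof -
    have "(g \<circ> horo_lift m has_derivative Dg q \<circ> L' z) (at z)"
      using der_L[OF z] der_g[OF qW(1)] by (intro diff_chain_at) (auto simp: q_def)
    from bounded_bilinear.FDERIV[OF bounded_bilinear_lorentz this derL']
    have "((\<lambda>y. lorentz (g (horo_lift m y)) (L' y v)) has_derivative
      (\<lambda>w. lorentz (g q) (frechet_derivative (\<lambda>y. L' y v) (at z) w) + lorentz (Dg q (L' z w)) (L' z v))) (at z)"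
      by (simp add: q_def o_def)
    then have "((\<lambda>y. frechet_derivative F (at y) v) has_derivative
      (\<lambda>w. lorentz (g q) (frechet_derivative (\<lambda>y. L' y v) (at z) w) + lorentz (Dg q (L' z w)) (L' z v))) (at z)"
      by (rule has_derivative_transform_within_open[OF _ opV z]) (simp add: F')
    from fun_cong[OF frechet_derivative_at[OF this], of v] show ?thesis
      by (simp add: D2_def v0_def)
  qed
  have a: "lorentz q M < 0" by (rule lorentz_hyperbolic_null_neg[OF fr(1) MM])
  \<comment> \<open>Chosen so that \<open>q - \<eta>\<close> is a positive multiple of the null
    vector \<open>M\<close>: the outward unit normal at \<open>q\<close> of the horosphere centred
    at \<open>M\<close>.\<close>
  define \<eta> where "\<eta> = q + (1 / lorentz q M) *\<^sub>R M"
  have \<eta>: "lorentz q \<eta> = 0" "lorentz \<eta> \<eta> = 1"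
    using a MM(1) hyperbolic_spaceD(1)[OF fr(1)] by (simp_all add: \<eta>_def lorentz_simps lorentz_sym[of M q])
  have "snd D2 * lorentz q M = - lorentz v0 v0"
    using arg_cong[OF D2M, of "lorentz q"] qD2 by (simp add: lorentz_simps)
  then have d: "snd D2 = - lorentz v0 v0 / lorentz q M" using a by (simp add: field_simps)
  have "D2 = lorentz v0 v0 *\<^sub>R (q - \<eta>)"
    by (subst D2M) (simp add: d \<eta>_def)
  then have "lorentz (g q) D2 = lorentz v0 v0 * (lorentz (g q) q - \<rho> q * lorentz (N q) \<eta>)"
    using lorentz_N[OF fr(3) \<eta>(1)] by (simp add: lorentz_simps \<rho>_def)
  then have "frechet_derivative (\<lambda>y. frechet_derivative F (at y) v) (at z) v
    = \<rho> q * (lorentz (DN q v0) v0 - lorentz v0 v0 * lorentz (N q) \<eta>)"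
    using second second_fundamental_form[OF qW(2,1) \<open>v0 \<in> T q\<close> \<open>v0 \<in> T q\<close>]
    by (simp add: algebra_simps)
  also have "\<dots> > 0"
  proof (rule mult_pos_pos[OF fr(4)])
    have "lorentz (N q) \<eta> \<le> 1"
      using tangent_vector_abs_lorentz_le[OF fr(1,5) \<eta>] fr(6) by simp
    moreover have "lorentz v0 v0 \<ge> 0" by (rule tangent_vector_spacelike(2)[OF fr(1) v0(1)])
    ultimately have "lorentz v0 v0 * lorentz (N q) \<eta> \<le> lorentz v0 v0 * 1" by (rule mult_left_mono)
    moreover have "lorentz (DN q v0) v0 > lorentz v0 v0"
      using second_fundamental_form_gt[OF qW(2,1) _ \<open>v0 \<in> T q\<close> \<open>v0 \<noteq> 0\<close>] \<kappa> by (simp add: q_def)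
    ultimately show "0 < lorentz (DN q v0) v0 - lorentz v0 v0 * lorentz (N q) \<eta>" by simp
  qed
  finally show ?thesis .
qed

lemma horo_defining:
  assumes z: "z \<in> V" and p: "horo_lift m z \<in> hyp_frontier \<Omega>"
    and \<kappa>: "\<And>i. principal_curvatures \<Omega> (horo_lift m z) i > 1"
  obtains W' where "z \<in> W'" "W' \<subseteq> V"
    "strictly_convex_defining (horo_proj m ` \<Omega>) W' F (\<lambda>x. frechet_derivative F (at x))"
proof -
  have "horo_proj m ` \<Omega> \<inter> V = {y \<in> V. F y \<le> 0}"
  proof (intro equalityI subsetI)
    fix y assume y: "y \<in> horo_proj m ` \<Omega> \<inter> V"
    then obtain X where X: "X \<in> \<Omega>" "y = horo_proj m X" by blast
    then have L: "horo_lift m y = X" using horo_proj_in(2)[OF mm] sub by blast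
    then have "X \<in> \<Omega> \<inter> W" using X y by (auto simp: V_def)
    then have "f X \<le> 0" unfolding sublevel by blast
    then show "y \<in> {y \<in> V. F y \<le> 0}" using y L by (simp add: F_def)
  next
    fix y assume y: "y \<in> {y \<in> V. F y \<le> 0}"
    then have "horo_lift m y \<in> {X \<in> hyperbolic_space \<inter> W. f X \<le> 0}"
      using horo_lift_in[OF mm] by (auto simp: V_def F_def)
    then have "horo_lift m y \<in> \<Omega>" unfolding sublevel[symmetric] by blast
    then have "horo_proj m (horo_lift m y) \<in> horo_proj m ` \<Omega>" by blast
    then show "y \<in> horo_proj m ` \<Omega> \<inter> V" using y by simp
  qed
  then show ?thesis
    using strictly_convex_defining_nearby[OF opV z hd_F, of "horo_proj m ` \<Omega>"]
      horo_second_derivative_pos[OF z p \<kappa>] that by blast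
qed

text \<open>For the null direction of \<open>q - N q\<close> the kernel of the differential of
  \<open>F\<close> is the hyperplane orthogonal to \<open>m\<close>, tangent to the image of the
  horosphere through \<open>q\<close>; the computation settles the orientation.\<close>

lemma horo_support_derivative:
  assumes z: "z \<in> V" and p: "horo_lift m z \<in> hyp_frontier \<Omega>"
    and m: "fst (horo_lift m z - N (horo_lift m z)) = snd (horo_lift m z - N (horo_lift m z)) *\<^sub>R m"
    and neg: "frechet_derivative F (at z) v < 0"
  shows "m \<bullet> v > 0"
proof -
  define q where "q = horo_lift m z"
  have qW: "q \<in> W" "q \<in> hyp_frontier \<Omega>" using z p by (auto simp: V_def q_def)
  note fr = in_frontier[OF qW(2,1)]
  define s where "s = snd (q - N q)"
  have s: "s > 0" using horospherical_null(2)[OF fr(1,5,6)] by (simp add: s_def)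
  define v0 where "v0 = L' z v"
  have v0: "lorentz q v0 = 0" "horo_proj m v0 = v"
    using L'_tangent[OF z] proj_L'[OF z] by (auto simp: q_def v0_def)
  have "lorentz (g q) v0 < 0" using neg F'[OF z] by (simp add: q_def v0_def)
  then have "\<rho> q * lorentz (N q) v0 < 0" using lorentz_N[OF fr(3) v0(1)] by (simp add: \<rho>_def)
  then have "lorentz (N q) v0 < 0" using fr(4) by (simp add: mult_less_0_iff)
  then have "lorentz (q - N q) v0 > 0" using v0(1) by (simp add: lorentz_simps)
  moreover have "q - N q = (s *\<^sub>R m, s)" using m by (simp add: q_def[symmetric] s_def prod_eq_iff)
  moreover have "fst v0 = v + snd v0 *\<^sub>R m" using v0(2) by (auto simp: horo_proj_def)
  ultimately have "s * (m \<bullet> v) > 0"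
    using mm by (simp add: lorentz_def inner_add_right algebra_simps)
  then show ?thesis using s by (simp add: zero_less_mult_iff)
qed

end

end

section \<open>The horoballs that contain the domain\<close>

locale h_convex_domain = hyperbolic_domain \<Omega> for \<Omega> :: "('n::finite option) minkowski set" +
  assumes conn: "connected \<Omega>" and smooth_bd: "smooth_boundary \<Omega>"
    and curv: "\<And>p i. p \<in> hyp_frontier \<Omega> \<Longrightarrow> principal_curvatures \<Omega> p i > 1"
    and int_nonempty: "top_of_set hyperbolic_space interior_of \<Omega> \<noteq> {}"
begin

abbreviation "S \<equiv> hyp_frontier \<Omega>"
abbreviation "\<nu> \<equiv> outward_normal \<Omega>"

lemma ex_patch:
  assumes "p \<in> S"
  obtains W f where "boundary_patch \<Omega> W f" "p \<in> W" "f p = 0"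
proof -
  obtain W and f :: "('n option) minkowski \<Rightarrow> real" where W: "open W" "p \<in> W" "smooth_on W f"
      "\<Omega> \<inter> W = {X \<in> hyperbolic_space \<inter> W. f X \<le> 0}" "f p = 0"
      "\<forall>X \<in> hyperbolic_space \<inter> W. \<exists>v. lorentz X v = 0 \<and> frechet_derivative f (at X) v \<noteq> 0"
    using bspec[OF smooth_bd[unfolded smooth_boundary_def] assms] by blast
  have "boundary_patch \<Omega> W f"
    by (intro boundary_patch.intro boundary_patch_axioms.intro hyperbolic_domain_axioms W(1,3,4))
      (rule W(6)[rule_format])
  then show ?thesis using that[of W f] W(2,5) by simp
qed

lemma normal:
  assumes "p \<in> S"
  shows "p \<in> hyperbolic_space" "lorentz p (\<nu> p) = 0" "lorentz (\<nu> p) (\<nu> p) = 1"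
proof -
  obtain W f where W: "boundary_patch \<Omega> W f" "p \<in> W" "f p = 0" using ex_patch[OF assms] .
  interpret boundary_patch \<Omega> W f by (rule W(1))
  show "p \<in> hyperbolic_space" "lorentz p (\<nu> p) = 0" "lorentz (\<nu> p) (\<nu> p) = 1"
    using in_frontier[OF assms W(2)] outward_normal_eq[OF assms W(2)] by auto
qed

text \<open>Project along \<open>l\<close> itself. The image of the domain is convex and, apart from
  the image of \<open>q\<close>, strictly on one side of the supporting hyperplane there; this is a
  level of z \<mapsto> m \<bullet> z, which pulls back to the horofunction.\<close>

theorem horoconvex:
  assumes q: "q \<in> S" and X: "X \<in> \<Omega>" "X \<noteq> q"
  shows "- lorentz X (q - \<nu> q) < 1"
proof -
  note nq = normal[OF q]
  define l where "l = q - \<nu> q"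
  have l: "lorentz l l = 0" "snd l > 0" "lorentz q l = -1"
    using horospherical_null[OF nq] by (auto simp: l_def)
  define m where "m = fst l /\<^sub>R snd l"
  have fl: "fst l = snd l *\<^sub>R m" using l(2) by (simp add: m_def)
  have "norm m = 1" using lorentz_future_null[OF l(1,2)] l(2) by (simp add: m_def)
  then have mm: "m \<bullet> m = 1" by (simp add: norm_eq_1)
  define S' where "S' = horo_proj m ` \<Omega>"
  have defining: "\<exists>W f W'. boundary_patch \<Omega> W f \<and> f p = 0 \<and> horo_proj m p \<in> W' \<and> p \<in> W \<and>
      strictly_convex_defining S' W' (boundary_patch.F f m) (\<lambda>x. frechet_derivative (boundary_patch.F f m) (at x))"
    if p: "p \<in> S" for p
  proof -
    obtain W f where W: "boundary_patch \<Omega> W f" "p \<in> W" "f p = 0" using ex_patch[OF p] .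
    interpret boundary_patch \<Omega> W f by (rule W(1))
    have pH: "p \<in> hyperbolic_space" by (rule normal(1)[OF p])
    have L: "horo_lift m (horo_proj m p) = p" by (rule horo_proj_in(2)[OF mm pH])
    have z: "horo_proj m p \<in> V m"
      using horo_proj_in(1)[OF mm pH] L W(2) by (simp add: V_def[OF mm])
    obtain W' where "horo_proj m p \<in> W'" "strictly_convex_defining S' W' (F m) (\<lambda>x. frechet_derivative (F m) (at x))"
      using horo_defining[OF mm z] L p curv unfolding S'_def by metis
    then show ?thesis using W by blast
  qed
  have "continuous_on \<Omega> (horo_proj m)" using bounded_linear_horo_proj by (rule linear_continuous_on)
  interpret C: locally_strictly_convex S'
  proof
    show "compact S'" "connected S'"
      unfolding S'_def using \<open>continuous_on \<Omega> (horo_proj m)\<close> cpt conn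
      by (auto intro: compact_continuous_image connected_continuous_image)
    fix z assume z: "z \<in> S'" "z \<notin> interior S'"
    then obtain p where p: "p \<in> \<Omega>" "z = horo_proj m p" by (auto simp: S'_def)
    have pH: "p \<in> hyperbolic_space" using p sub by blast
    have L: "horo_lift m z = p" using horo_proj_in(2)[OF mm pH] p by simp
    \<comment> \<open>A relatively interior point of the domain would project to an interior point,
      since the projection has the continuous inverse \<open>horo_lift\<close> on a
      half-space.\<close>
    have "p \<in> S"
    proof (rule ccontr)
      assume "p \<notin> S"
      then obtain O' where O: "open O'" "p \<in> O'" "O' \<inter> hyperbolic_space \<subseteq> \<Omega>" using in_frontier_iff p(1) by blast
      define Z where "Z = {z. z \<bullet> m < 0} \<inter> horo_lift m -` O'"
      have "open Z" unfolding Z_def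
        by (rule continuous_open_preimage[OF continuous_on_horo_lift open_horo_halfspace O(1)])
      moreover have "Z \<subseteq> S'"
      proof
        fix y assume "y \<in> Z"
        then have "horo_lift m y \<in> \<Omega>" using O(3) horo_lift_in[OF mm] by (auto simp: Z_def)
        then have "horo_proj m (horo_lift m y) \<in> S'" unfolding S'_def by blast
        then show "y \<in> S'" by simp
      qed
      moreover have "z \<in> Z" using L O(2) horo_proj_in(1)[OF mm pH] p(2) by (simp add: Z_def)
      ultimately show False using z(2) by (meson interior_maximal subsetD)
    qed
    with defining p(2) show "\<exists>W F F'. z \<in> W \<and> strictly_convex_defining S' W F F'" by blast
  qed
  obtain W f W' where W: "boundary_patch \<Omega> W f" "f q = 0" "horo_proj m q \<in> W'" "q \<in> W"
    "strictly_convex_defining S' W' (boundary_patch.F f m) (\<lambda>x. frechet_derivative (boundary_patch.F f m) (at x))"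
    using defining[OF q] by blast
  interpret boundary_patch \<Omega> W f by (rule W(1))
  have L: "horo_lift m (horo_proj m q) = q" by (rule horo_proj_in(2)[OF mm nq(1)])
  have XH: "X \<in> hyperbolic_space" using X sub by blast
  have ne: "horo_proj m X \<noteq> horo_proj m q"
    using horo_proj_in(2)[OF mm XH] L X(2) by metis
  have inS': "horo_proj m q \<in> S'" "horo_proj m X \<in> S'" using q frontier_subset X by (auto simp: S'_def)
  have F0: "F m (horo_proj m q) = 0" using W(2) L by (simp add: F_def[OF mm])
  have neg: "frechet_derivative (F m) (at (horo_proj m q)) (horo_proj m X - horo_proj m q) < 0"
    by (rule C.support[OF W(5,3) F0 inS' ne])
  have z: "horo_proj m q \<in> V m"
    using horo_proj_in(1)[OF mm nq(1)] L W(4) by (simp add: V_def[OF mm])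
  have "m \<bullet> (horo_proj m X - horo_proj m q) > 0"
    by (rule horo_support_derivative[OF mm z _ _ neg])
      (use L q fl outward_normal_eq[OF q W(4)] in \<open>auto simp: l_def\<close>)
  then have "snd l * (m \<bullet> (horo_proj m X - horo_proj m q)) > 0" using l(2) by simp
  moreover have "snd l * (m \<bullet> horo_proj m Y) = lorentz Y l" for Y
    using mm fl by (simp add: horo_proj_def lorentz_def inner_diff_right inner_commute algebra_simps)
  ultimately show ?thesis using l(3) by (simp add: inner_diff_right right_diff_distrib l_def[symmetric])
qed

end

section \<open>Parallel sets as tubes\<close>

text \<open>The normal coincides with a smooth field only patch by patch, so its smoothness in a
  chart is assembled from neighbourhoods.\<close>

lemma higher_differentiable_on_local:
  assumes "\<And>x. x \<in> U \<Longrightarrow> \<exists>V. open V \<and> x \<in> V \<and> higher_differentiable_on V f m"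
  shows "higher_differentiable_on U f m"
  using assms
proof (induction m arbitrary: f)
  case 0
  have "isCont f x" if "x \<in> U" for x
    using 0[OF that] by (auto simp: continuous_on_eq_continuous_at)
  then show ?case by (simp add: continuous_at_imp_continuous_on)
next
  case (Suc m)
  have "f differentiable at x" if "x \<in> U" for x using Suc.prems[OF that] by auto
  moreover have "higher_differentiable_on U (\<lambda>x. frechet_derivative f (at x) v) m" for v
    by (rule Suc.IH) (use Suc.prems in fastforce)
  ultimately show ?case by simp
qed

lemma null_direction_decomposition:
  assumes "Y \<in> hyperbolic_space" "lorentz l l = 0" "snd l > 0"
  obtains \<eta> where "lorentz Y \<eta> = 0" "lorentz \<eta> \<eta> = 1" "l = (- lorentz Y l) *\<^sub>R (Y - \<eta>)"
proof
  have a: "lorentz Y l < 0" by (rule lorentz_hyperbolic_null_neg[OF assms])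
  define \<eta> where "\<eta> = Y + (1 / lorentz Y l) *\<^sub>R l"
  show "lorentz Y \<eta> = 0" "lorentz \<eta> \<eta> = 1"
    using a assms(2) hyperbolic_spaceD(1)[OF assms(1)] by (simp_all add: \<eta>_def lorentz_simps lorentz_sym[of l Y])
  show "l = (- lorentz Y l) *\<^sub>R (Y - \<eta>)" using a by (simp add: \<eta>_def)
qed

text \<open>Logarithms of horofunctions are 1-Lipschitz: \<open>X\<close> is cosh d times
  \<open>Y\<close> plus a tangent vector \<open>V\<close> of length sinh d, so the value at
  \<open>X\<close> is at most cosh d + sinh d times the value at \<open>Y\<close>.\<close>

lemma horofunction_Lipschitz:
  assumes X: "X \<in> hyperbolic_space" and Y: "Y \<in> hyperbolic_space" and l: "lorentz l l = 0" "snd l > 0"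
  shows "- lorentz X l \<le> exp (hyp_dist X Y) * (- lorentz Y l)"
proof -
  define d where "d = hyp_dist X Y"
  define a where "a = - lorentz Y l"
  have a: "a > 0" using lorentz_hyperbolic_null_neg[OF Y l] by (simp add: a_def)
  obtain \<eta> where \<eta>: "lorentz Y \<eta> = 0" "lorentz \<eta> \<eta> = 1" "l = a *\<^sub>R (Y - \<eta>)"
    using null_direction_decomposition[OF Y l] unfolding a_def by blast
  have XY: "- lorentz X Y \<ge> 1" using lorentz_hyperbolic_le[OF X Y] by simp
  have cd: "cosh d = - lorentz X Y" "d \<ge> 0" using XY by (simp_all add: d_def hyp_dist_def cosh_arcosh_real)
  define V where "V = X + lorentz X Y *\<^sub>R Y"
  have V: "lorentz Y V = 0" using hyperbolic_spaceD(1)[OF Y] lorentz_sym[of Y X] by (simp add: V_def lorentz_simps)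
  have "lorentz V V = (cosh d)\<^sup>2 - 1"
    using hyperbolic_spaceD(1)[OF X] hyperbolic_spaceD(1)[OF Y] lorentz_sym[of Y X]
    by (simp add: V_def lorentz_simps cd power2_eq_square)
  then have VV: "lorentz V V = (sinh d)\<^sup>2" by (simp add: sinh_square_eq)
  have "lorentz V \<eta> \<le> sinh d"
    using tangent_vector_abs_lorentz_le[OF Y V \<eta>(1,2)] cd(2) unfolding VV by simp
  then have "a * lorentz V \<eta> \<le> a * sinh d" using a by simp
  moreover have "- lorentz X l = cosh d * a + a * lorentz V \<eta>"
  proof -
    have "X = cosh d *\<^sub>R Y + V" by (simp add: V_def cd)
    then have "lorentz X l = cosh d * lorentz Y l + lorentz V l" by (metis lorentz_simps(1,9) )
    moreover have "lorentz V l = - a * lorentz V \<eta>"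
      by (subst \<eta>(3)) (simp add: lorentz_simps lorentz_sym[of V Y] V)
    ultimately show ?thesis by (simp add: a_def)
  qed
  moreover have "exp d = cosh d + sinh d" by (simp add: cosh_plus_sinh)
  ultimately show ?thesis by (simp add: d_def[symmetric] a_def[symmetric] algebra_simps)
qed

section \<open>Normals in charts, and horofunctions at the points of a tube\<close>

context h_convex_domain
begin

abbreviation "\<kappa> \<equiv> principal_curvatures \<Omega>"
abbreviation "\<l> p \<equiv> p - \<nu> p"

lemmas null = horospherical_null[OF normal]

lemma ex_chart:
  assumes "p \<in> S"
  obtains U \<phi> y where "local_parametrization S U \<phi>" "y \<in> U" "\<phi> y = p"
proof -
  obtain W f where W: "boundary_patch \<Omega> W f" "p \<in> W" using ex_patch[OF assms] by blast
  then show ?thesis using boundary_patch.ex_local_parametrization[OF W(1) assms W(2)] that by blast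
qed

lemma chart_subset: "local_parametrization S U \<phi> \<Longrightarrow> \<phi> ` U \<subseteq> S"
  unfolding local_parametrization_def using openin_imp_subset by blast

text \<open>The Weingarten map in a chart, with the local defining function eliminated:
  \<open>A\<close> is the derivative of the extended normal, diagonal in the principal
  frame.\<close>

lemma chart_normal:
  assumes \<phi>: "local_parametrization S U \<phi>" "y \<in> U"
  obtains e A where "lorentz_frame (\<phi> y) (\<nu> (\<phi> y)) e" "linear A" "\<forall>i. A (e i) = \<kappa> (\<phi> y) i *\<^sub>R e i"
    "((\<lambda>y. \<nu> (\<phi> y)) has_derivative (\<lambda>\<xi>. A (frechet_derivative \<phi> (at y) \<xi>))) (at y)"
    "range (frechet_derivative \<phi> (at y)) = {v. lorentz (\<phi> y) v = 0 \<and> lorentz (\<nu> (\<phi> y)) v = 0}"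
proof -
  have pS: "\<phi> y \<in> S" using chart_subset[OF \<phi>(1)] \<phi>(2) by blast
  obtain W f where W: "boundary_patch \<Omega> W f" "\<phi> y \<in> W" using ex_patch[OF pS] by blast
  interpret boundary_patch \<Omega> W f by (rule W(1))
  note fr = in_frontier[OF pS W(2)]
  have \<nu>N: "\<nu> (\<phi> y) = N (\<phi> y)" by (rule outward_normal_eq[OF pS W(2)])
  obtain e where e: "lorentz_frame (\<phi> y) (N (\<phi> y)) e" "\<And>i. DN (\<phi> y) (e i) = \<kappa> (\<phi> y) i *\<^sub>R e i"
    using ex_principal_frame[OF pS W(2)] by blast
  have U: "open U" using \<phi>(1) unfolding local_parametrization_def by blast
  note d\<phi> = local_parametrization_derivative[OF \<phi>]
  have "continuous_on U \<phi>" using \<phi>(1) unfolding local_parametrization_def homeomorphism_def by blast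
  then have op: "open (U \<inter> \<phi> -` W)" using U opW by (simp add: continuous_open_preimage)
  have "(N \<circ> \<phi> has_derivative DN (\<phi> y) \<circ> frechet_derivative \<phi> (at y)) (at y)"
    by (intro diff_chain_at d\<phi> der_N fr)
  then have "((\<lambda>y. \<nu> (\<phi> y)) has_derivative DN (\<phi> y) \<circ> frechet_derivative \<phi> (at y)) (at y)"
  proof (rule has_derivative_transform_within_open[OF _ op])
    show "y \<in> U \<inter> \<phi> -` W" using \<phi>(2) W(2) by simp
    show "(N \<circ> \<phi>) x = \<nu> (\<phi> x)" if "x \<in> U \<inter> \<phi> -` W" for x
      using outward_normal_eq[of "\<phi> x"] that chart_subset[OF \<phi>(1)] by auto
  qed
  then show ?thesis
    using that[of e "DN (\<phi> y)"] e linear_DN[OF fr(3)] range_parametrization(1)[OF W(2) \<phi>] \<nu>N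
    by (simp add: o_def T_def)
qed

lemma chart_normal_smooth:
  assumes \<phi>: "local_parametrization S U \<phi>"
  shows "higher_differentiable_on U (\<lambda>y. \<nu> (\<phi> y)) m"
proof (rule higher_differentiable_on_local)
  fix y assume y: "y \<in> U"
  have pS: "\<phi> y \<in> S" using chart_subset[OF \<phi>(1)] y by blast
  obtain W f where W: "boundary_patch \<Omega> W f" "\<phi> y \<in> W" using ex_patch[OF pS] by blast
  interpret boundary_patch \<Omega> W f by (rule W(1))
  have U: "open U" "smooth_on U \<phi>" using \<phi> unfolding local_parametrization_def by blast+
  then have hd\<phi>: "higher_differentiable_on U \<phi> m" by (simp add: smooth_on_def)
  define Z where "Z = U \<inter> \<phi> -` W1"
  have opZ: "open Z"
    unfolding Z_def using higher_differentiable_on_imp_continuous_on[OF hd\<phi>] U(1) opW1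
    by (rule continuous_open_preimage)
  have "higher_differentiable_on Z (\<lambda>y. N (\<phi> y)) m"
    by (rule higher_differentiable_on_compose[OF opZ opW1 _ hd_N higher_differentiable_on_subset[OF hd\<phi>]])
      (auto simp: Z_def)
  then have "higher_differentiable_on Z (\<lambda>y. \<nu> (\<phi> y)) m"
  proof (rule higher_differentiable_on_cong[OF opZ, rotated])
    show "N (\<phi> x) = \<nu> (\<phi> x)" if "x \<in> Z" for x
      using outward_normal_eq[of "\<phi> x"] that chart_subset[OF \<phi>(1)] by (auto simp: Z_def W1_def)
  qed
  moreover have "y \<in> Z" using y in_frontier(3)[OF pS W(2)] by (simp add: Z_def)
  ultimately show "\<exists>V. open V \<and> y \<in> V \<and> higher_differentiable_on V (\<lambda>y. \<nu> (\<phi> y)) m"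
    using opZ by blast
qed

lemma continuous_on_normal: "continuous_on S \<nu>"
  unfolding continuous_on_eq_continuous_within
proof
  fix p assume pS: "p \<in> S"
  obtain W f where W: "boundary_patch \<Omega> W f" "p \<in> W" using ex_patch[OF pS] by blast
  interpret boundary_patch \<Omega> W f by (rule W(1))
  have "continuous (at p) N" using der_N[OF in_frontier(3)[OF pS W(2)]] by (rule has_derivative_continuous)
  then have "continuous (at p within S) N" by (rule continuous_at_imp_continuous_within)
  moreover obtain r where r: "r > 0" "ball p r \<subseteq> W" using opW W(2) openE by blast
  ultimately show "continuous (at p within S) \<nu>"
  proof (intro continuous_transform_within[of p S N r \<nu>] pS)
    show "N x' = \<nu> x'" if "x' \<in> S" "dist x' p < r" for x'
      using outward_normal_eq[of x'] that r(2) by (auto simp: dist_commute)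
  qed
qed

text \<open>Without boundary the domain would be open and closed in hyperbolic space, hence
  everything, against compactness.\<close>

lemma S_nonempty: "S \<noteq> {}" and ex_interior: "\<exists>Y\<in>\<Omega>. Y \<notin> S"
proof -
  obtain Y where Y: "Y \<in> top_of_set hyperbolic_space interior_of \<Omega>" using int_nonempty by blast
  have "Y \<in> \<Omega>" by (rule subsetD[OF interior_of_subset Y])
  moreover have "Y \<notin> S" using Y by (simp add: hyp_frontier_def frontier_of_def)
  ultimately show ex: "\<exists>Y\<in>\<Omega>. Y \<notin> S" by blast
  show "S \<noteq> {}"
  proof
    assume "S = {}"
    define D where "D = hyp_lift -` \<Omega>"
    have "closed D" unfolding D_def
      using compact_imp_closed[OF cpt] by (intro closed_vimage continuous_on_hyp_lift)
    moreover have "open D"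
    proof (subst open_subopen, intro ballI)
      fix x assume "x \<in> D"
      then have "hyp_lift x \<in> \<Omega>" by (simp add: D_def)
      then obtain O' where O: "open O'" "hyp_lift x \<in> O'" "O' \<inter> hyperbolic_space \<subseteq> \<Omega>"
        using in_frontier_iff \<open>S = {}\<close> by blast
      have "open (hyp_lift -` O')" by (intro open_vimage O(1) continuous_on_hyp_lift)
      moreover have "hyp_lift -` O' \<subseteq> D" unfolding D_def using O(3) hyp_lift_in by blast
      ultimately show "\<exists>T. open T \<and> x \<in> T \<and> T \<subseteq> D" using O(2) by blast
    qed
    ultimately have "D = {} \<or> D = UNIV" using clopen by blast
    moreover have "fst Y \<in> D" using \<open>Y \<in> \<Omega>\<close> sub hyp_lift_fst[of Y] by (auto simp: D_def)
    then have "D \<noteq> {}" by blast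
    ultimately have "D = UNIV" by blast
    have "hyp_lift x \<in> \<Omega>" for x using \<open>D = UNIV\<close> by (auto simp: D_def)
    then have "UNIV \<subseteq> fst ` \<Omega>" by (metis fst_hyp_lift image_eqI subsetI)
    moreover have "bounded (fst ` \<Omega>)"
      by (rule bounded_linear_image[OF compact_imp_bounded[OF cpt] bounded_linear_fst])
    ultimately show False using bounded_subset not_bounded_UNIV by blast
  qed
qed

text \<open>The point is (a + b) p minus b times a null vector. Horofunctions are at most 1 on the
  domain, strictly away from their own base point, and future null vectors have nonpositive
  products. So \<open>p\<close> is the only boundary point whose horofunction is maximal
  there.\<close>

lemma horofunction_tube:
  assumes pq: "p \<in> S" "q \<in> S" and ab: "a + b > 0" "b \<ge> 0"
  shows "- lorentz (a *\<^sub>R p + b *\<^sub>R \<nu> p) (\<l> p) = a + b"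
    "- lorentz (a *\<^sub>R p + b *\<^sub>R \<nu> p) (\<l> q) \<le> a + b"
    "q \<noteq> p \<Longrightarrow> - lorentz (a *\<^sub>R p + b *\<^sub>R \<nu> p) (\<l> q) < a + b"
proof -
  have eq: "a *\<^sub>R p + b *\<^sub>R \<nu> p = (a + b) *\<^sub>R p - b *\<^sub>R \<l> p" by (simp add: algebra_simps)
  have lin: "lorentz ((a + b) *\<^sub>R p - b *\<^sub>R k) l = (a + b) * lorentz p l - b * lorentz k l" for k l
    by (simp add: lorentz_simps)
  show 1: "- lorentz (a *\<^sub>R p + b *\<^sub>R \<nu> p) (\<l> p) = a + b"
    unfolding eq lin using null(1,3)[OF pq(1) pq(1) pq(1)] by simp
  have "lorentz (\<l> p) (\<l> q) \<le> 0"
    using null[OF pq(1) pq(1) pq(1)] null[OF pq(2) pq(2) pq(2)] by (intro lorentz_null_null_nonpos)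
  then have n: "b * lorentz (\<l> p) (\<l> q) \<le> 0" using ab by (simp add: mult_nonneg_nonpos)
  have e: "- lorentz (a *\<^sub>R p + b *\<^sub>R \<nu> p) (\<l> q) = (a + b) * (- lorentz p (\<l> q)) + b * lorentz (\<l> p) (\<l> q)"
    unfolding eq lin by simp
  show 3: "- lorentz (a *\<^sub>R p + b *\<^sub>R \<nu> p) (\<l> q) < a + b" if "q \<noteq> p"
  proof -
    have "- lorentz p (\<l> q) < 1" using horoconvex[OF pq(2)] frontier_subset pq(1) that by blast
    then have "(a + b) * (- lorentz p (\<l> q)) < (a + b) * 1" using ab(1) by (rule mult_strict_left_mono)
    then show ?thesis using n e by simp
  qed
  show "- lorentz (a *\<^sub>R p + b *\<^sub>R \<nu> p) (\<l> q) \<le> a + b"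
    using 1 3 by (cases "q = p") auto
qed

lemma ex_horofunction_max:
  obtains p where "p \<in> S" "\<And>q. q \<in> S \<Longrightarrow> - lorentz Y (\<l> q) \<le> - lorentz Y (\<l> p)"
proof -
  have "continuous_on S (\<lambda>q. - lorentz Y (\<l> q))"
    by (intro continuous_intros continuous_on_normal)
  then show ?thesis
    using continuous_attains_sup[OF compact_frontier S_nonempty] that by blast
qed

text \<open>At a maximum the derivative \<open>(\<kappa>\<^sub>i - 1) \<langle>Y, e\<^sub>i\<rangle>\<close> of the horofunction vanishes.\<close>

lemma horofunction_critical:
  assumes p: "p \<in> S" and max: "\<And>q. q \<in> S \<Longrightarrow> - lorentz Y (\<l> q) \<le> - lorentz Y (\<l> p)"
  obtains a b where "Y = a *\<^sub>R p + b *\<^sub>R \<nu> p"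
proof -
  obtain U \<phi> y where \<phi>: "local_parametrization S U \<phi>" "y \<in> U" "\<phi> y = p" using ex_chart[OF p] .
  obtain e A where e: "lorentz_frame (\<phi> y) (\<nu> (\<phi> y)) e" and A: "linear A" "\<forall>i. A (e i) = \<kappa> (\<phi> y) i *\<^sub>R e i"
    "((\<lambda>y. \<nu> (\<phi> y)) has_derivative (\<lambda>\<xi>. A (frechet_derivative \<phi> (at y) \<xi>))) (at y)"
    "range (frechet_derivative \<phi> (at y)) = {v. lorentz (\<phi> y) v = 0 \<and> lorentz (\<nu> (\<phi> y)) v = 0}"
    using chart_normal[OF \<phi>(1,2)] by blast
  interpret F: lorentz_frame p "\<nu> p" e using e \<phi>(3) by simp
  define D where "D = frechet_derivative \<phi> (at y)"
  have d: "((\<lambda>y. lorentz Y (\<l> (\<phi> y))) has_derivative (\<lambda>\<xi>. lorentz Y (D \<xi> - A (D \<xi>)))) (at y)"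
    unfolding D_def
    by (rule bounded_linear.has_derivative[OF bounded_bilinear.bounded_linear_right[OF bounded_bilinear_lorentz]
          has_derivative_diff[OF local_parametrization_derivative[OF \<phi>(1,2)] A(3)]])
  have "open U" using \<phi>(1) unfolding local_parametrization_def by blast
  have "(\<lambda>\<xi>. lorentz Y (D \<xi> - A (D \<xi>))) = (\<lambda>\<xi>. 0)"
  proof (rule differential_zero_maxmin[OF \<phi>(2) \<open>open U\<close> d])
    show "(\<forall>x\<in>U. lorentz Y (\<l> (\<phi> x)) \<le> lorentz Y (\<l> (\<phi> y))) \<or> (\<forall>x\<in>U. lorentz Y (\<l> (\<phi> y)) \<le> lorentz Y (\<l> (\<phi> x)))"
      using max chart_subset[OF \<phi>(1)] \<phi>(3) by fastforce
  qed
  then have z: "lorentz Y (D \<xi> - A (D \<xi>)) = 0" for \<xi> by metis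
  have "lorentz Y (e i) = 0" for i
  proof -
    have "e i \<in> range D" unfolding D_def A(4) \<phi>(3) using F.pe F.\<nu>e by simp
    then obtain \<xi> where "e i = D \<xi>" by blast
    then have "lorentz Y (e i - A (e i)) = 0" using z by metis
    then have "(1 - \<kappa> p i) * lorentz Y (e i) = 0"
      using A(2) \<phi>(3) by (simp add: lorentz_simps algebra_simps)
    then show ?thesis using curv[OF p, of i] by simp
  qed
  then have "Y = (- lorentz Y p) *\<^sub>R p + lorentz Y (\<nu> p) *\<^sub>R \<nu> p"
    using F.frame_expansion[of Y] by simp
  then show ?thesis by (rule that)
qed

section \<open>The domain and its parallel sets as intersections of horoballs\<close>

lemma domain_horofunction:
  assumes "X \<in> \<Omega>" "q \<in> S"
  shows "- lorentz X (\<l> q) \<le> 1"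
  using horoconvex[OF assms(2,1)] null(3)[OF assms(2,2,2)] by (cases "X = q") auto

text \<open>If \<open>X\<close> were outside, the geodesic from an interior point \<open>Y\<close>
  would cross the boundary at some \<open>q\<close>. The chord contains a multiple of
  \<open>q\<close> by a factor at least 1, yet the horofunction of \<open>q\<close> averages along
  it a value below 1 at \<open>Y\<close> and one at most 1 at \<open>X\<close>.\<close>

lemma in_domain_iff:
  assumes X: "X \<in> hyperbolic_space"
  shows "X \<in> \<Omega> \<longleftrightarrow> (\<forall>q\<in>S. - lorentz X (\<l> q) \<le> 1)"
proof (intro iffI ballI)
  assume le: "\<forall>q\<in>S. - lorentz X (\<l> q) \<le> 1"
  show "X \<in> \<Omega>"
  proof (rule ccontr)
    assume XO: "X \<notin> \<Omega>"
    obtain Y where Y: "Y \<in> \<Omega>" "Y \<notin> S" using ex_interior by blast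
    have YH: "Y \<in> hyperbolic_space" using Y sub by blast
    define w where "w = (\<lambda>t. (1 - t) *\<^sub>R Y + t *\<^sub>R X)"
    \<comment> \<open>Lorentz length of the chord point, which scales it back to the hyperboloid; it
      is at least 1 by the reversed triangle inequality for timelike vectors.\<close>
    define s where "s = (\<lambda>t. sqrt (- lorentz (w t) (w t)))"
    have s1: "- lorentz (w t) (w t) \<ge> 1" if "0 \<le> t" "t \<le> 1" for t
    proof -
      have "lorentz (w t) (w t) = - (1-t)\<^sup>2 - t\<^sup>2 + 2 * (t * (1-t)) * lorentz Y X"
        using hyperbolic_spaceD(1)[OF X] hyperbolic_spaceD(1)[OF YH] lorentz_sym[of X Y]
        by (simp add: w_def lorentz_simps power2_eq_square algebra_simps)
      moreover have "t * (1-t) * lorentz Y X \<le> t * (1-t) * (-1)"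
        using lorentz_hyperbolic_le[OF YH X] that by (intro mult_left_mono) auto
      ultimately show ?thesis by (simp add: power2_eq_square algebra_simps)
    qed
    have s: "s t \<ge> 1" if "0 \<le> t" "t \<le> 1" for t using s1[OF that] by (simp add: s_def)
    have wH: "w t /\<^sub>R s t \<in> hyperbolic_space" if "0 \<le> t" "t \<le> 1" for t
    proof -
      have "(s t)\<^sup>2 = - lorentz (w t) (w t)" using s1[OF that] by (simp add: s_def)
      then have "lorentz (w t) (w t) = - (s t * s t)" by (simp add: power2_eq_square)
      then have "lorentz (w t /\<^sub>R s t) (w t /\<^sub>R s t) = -1"
        using s[OF that] by (simp add: lorentz_simps field_simps)
      moreover have "snd (w t) > 0"
      proof -
        have "(1 - t) * 1 + t * 1 \<le> (1 - t) * snd Y + t * snd X"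
          using hyperbolic_spaceD(5)[OF X] hyperbolic_spaceD(5)[OF YH] that
          by (intro add_mono mult_left_mono) auto
        then show ?thesis by (simp add: w_def)
      qed
      ultimately show ?thesis using s[OF that] by (simp add: hyperbolic_space_def)
    qed
    define C where "C = (\<lambda>t. w t /\<^sub>R s t) ` {0..1}"
    have "continuous_on {0..1} (\<lambda>t. w t /\<^sub>R s t)"
      unfolding w_def s_def
      by (intro continuous_intros) (use s1 in \<open>force simp: w_def\<close>)
    then have "connected C" unfolding C_def by (rule connected_continuous_image) simp
    have CH: "C \<subseteq> hyperbolic_space" using wH by (auto simp: C_def)
    have "C \<inter> S \<noteq> {}"
    proof
      assume empty: "C \<inter> S = {}"
      have "closedin (top_of_set C) (C \<inter> \<Omega>)"
        using compact_imp_closed[OF cpt] by (rule closedin_closed_Int)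
      moreover have "openin (top_of_set C) (C \<inter> \<Omega>)"
      proof (subst openin_subopen, intro ballI)
        fix Z assume Z: "Z \<in> C \<inter> \<Omega>"
        then obtain O' where O: "open O'" "Z \<in> O'" "O' \<inter> hyperbolic_space \<subseteq> \<Omega>"
          using in_frontier_iff empty by blast
        have "openin (top_of_set C) (C \<inter> O')" using O(1) by (rule openin_open_Int)
        moreover have "C \<inter> O' \<subseteq> C \<inter> \<Omega>" using O(3) CH by blast
        ultimately show "\<exists>T. openin (top_of_set C) T \<and> Z \<in> T \<and> T \<subseteq> C \<inter> \<Omega>" using Z O(2) by blast
      qed
      ultimately have "C \<inter> \<Omega> = {} \<or> C \<inter> \<Omega> = C" using \<open>connected C\<close> unfolding connected_clopen by blast
      moreover have "Y \<in> C"
      proof -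
        have "w 0 = Y" "s 0 = 1" using hyperbolic_spaceD(1)[OF YH] by (simp_all add: w_def s_def)
        then show ?thesis unfolding C_def by (intro image_eqI[of _ _ 0]) auto
      qed
      moreover have "X \<in> C"
      proof -
        have "w 1 = X" "s 1 = 1" using hyperbolic_spaceD(1)[OF X] by (simp_all add: w_def s_def)
        then show ?thesis unfolding C_def by (intro image_eqI[of _ _ 1]) auto
      qed
      ultimately show False using Y XO by blast
    qed
    then obtain t where t: "0 \<le> t" "t \<le> 1" "w t /\<^sub>R s t \<in> S" by (auto simp: C_def)
    define q where "q = w t /\<^sub>R s t"
    have q: "q \<in> S" using t by (simp add: q_def)
    have "t \<noteq> 1"
    proof
      assume "t = 1"
      then have "q = X" using hyperbolic_spaceD(1)[OF X] by (simp add: q_def w_def s_def)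
      then show False using q frontier_subset XO by blast
    qed
    have "q \<noteq> Y" using q Y by blast
    have "s t * 1 = - lorentz (s t *\<^sub>R q) (\<l> q)"
      using null(3)[OF q q q] by (simp add: lorentz_simps(9))
    also have "s t *\<^sub>R q = (1 - t) *\<^sub>R Y + t *\<^sub>R X" using s[OF t(1,2)] by (simp add: q_def w_def)
    also have "- lorentz \<dots> (\<l> q) = (1 - t) * (- lorentz Y (\<l> q)) + t * (- lorentz X (\<l> q))"
    proof -
      have "lorentz (c *\<^sub>R Y + d *\<^sub>R X) l = c * lorentz Y l + d * lorentz X l" for c d l
        by (simp add: lorentz_simps)
      then show ?thesis by simp
    qed
    also have "\<dots> < (1 - t) * 1 + t * 1"
    proof (rule add_less_le_mono)
      show "(1 - t) * (- lorentz Y (\<l> q)) < (1 - t) * 1"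
        using horoconvex[OF q Y(1)] \<open>q \<noteq> Y\<close> t \<open>t \<noteq> 1\<close> by (intro mult_strict_left_mono) auto
      show "t * (- lorentz X (\<l> q)) \<le> t * 1"
        using le q t by (intro mult_left_mono) auto
    qed
    finally show False using s[OF t(1,2)] by simp
  qed
qed (rule domain_horofunction)

text \<open>At a boundary point with maximal horofunction, \<open>X\<close> is a p + b \<nu>.
  Lorentz square -1 gives (a + b) (a - b) = 1 with a + b = exp t, which forces a = cosh t and b =
  sinh t.\<close>

lemma exterior_point:
  assumes X: "X \<in> hyperbolic_space" "X \<notin> \<Omega>"
  obtains p t where "p \<in> S" "t > 0" "X = cosh t *\<^sub>R p + sinh t *\<^sub>R \<nu> p" "- lorentz X (\<l> p) = exp t"
proof -
  obtain p where p: "p \<in> S" "\<And>q. q \<in> S \<Longrightarrow> - lorentz X (\<l> q) \<le> - lorentz X (\<l> p)"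
    using ex_horofunction_max[of X] by blast
  have gt: "- lorentz X (\<l> p) > 1" using in_domain_iff[OF X(1)] X(2) p(2) by force
  obtain a b where ab: "X = a *\<^sub>R p + b *\<^sub>R \<nu> p" using horofunction_critical[OF p] by blast
  note np = normal[OF p(1)]
  define t where "t = ln (- lorentz X (\<l> p))"
  have t: "t > 0" "exp t = - lorentz X (\<l> p)" using gt by (simp_all add: t_def)
  have "- lorentz X (\<l> p) = a + b"
    using null(3,4)[OF p(1) p(1) p(1)] arg_cong[OF ab, of "\<lambda>Z. lorentz Z (\<l> p)"]
    by (simp add: lorentz_simps(1,9))
  then have sum: "a + b = exp t" using t by simp
  have "lorentz X X = - (a * a) + b * b"
    using np hyperbolic_spaceD(1)[OF np(1)] lorentz_sym[of "\<nu> p" p] by (subst (1 2) ab) (simp add: lorentz_simps)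
  then have "(a + b) * (a - b) = 1" using hyperbolic_spaceD(1)[OF X(1)] by (simp add: algebra_simps)
  then have "exp t * (a - b) = 1" by (simp only: sum)
  then have "a - b = exp (-t)" by (simp add: exp_minus field_simps)
  with sum have "a = cosh t" "b = sinh t" by (simp_all add: cosh_def sinh_def)
  then show ?thesis using that[of p t] p(1) t ab by simp
qed

lemma parallel_set_bdd_below: "bdd_below ((\<lambda>Y. hyp_dist X Y) ` \<Omega>)" if "X \<in> hyperbolic_space"
proof (rule bdd_belowI[of _ 0])
  fix d assume "d \<in> hyp_dist X ` \<Omega>"
  then obtain Y where "Y \<in> \<Omega>" "d = hyp_dist X Y" by blast
  then show "0 \<le> d" using lorentz_hyperbolic_le[OF that, of Y] sub by (auto simp: hyp_dist_def)
qed

text \<open>Distance at most \<rho> bounds the horofunctions by the Lipschitz estimate; conversely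
  the foot point of an exterior \<open>X\<close> lies at distance t, with exp t among the bounded
  values.\<close>

lemma in_parallel_set_iff:
  assumes X: "X \<in> hyperbolic_space" and "\<rho> \<ge> 0"
  shows "X \<in> hyp_parallel_set \<Omega> \<rho> \<longleftrightarrow> (\<forall>q\<in>S. - lorentz X (\<l> q) \<le> exp \<rho>)"
proof (intro iffI ballI)
  fix q assume "X \<in> hyp_parallel_set \<Omega> \<rho>" and q: "q \<in> S"
  then have inf: "(INF Y\<in>\<Omega>. hyp_dist X Y) \<le> \<rho>" by (simp add: hyp_parallel_set_def)
  show "- lorentz X (\<l> q) \<le> exp \<rho>"
  proof (rule ccontr)
    assume "\<not> - lorentz X (\<l> q) \<le> exp \<rho>"
    then have gt: "- lorentz X (\<l> q) > exp \<rho>" by simp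
    \<comment> \<open>Strictly above \<open>\<rho>\<close>, so that the infimum yields a point of
      the domain closer than \<open>r\<close> without being attained.\<close>
    define r where "r = ln (- lorentz X (\<l> q))"
    have hpos: "- lorentz X (\<l> q) > 0" using gt by (meson exp_gt_zero less_trans)
    then have r: "exp r = - lorentz X (\<l> q)" by (simp add: r_def)
    then have "r > \<rho>" using gt by (metis exp_less_cancel_iff)
    then have "(INF Y\<in>\<Omega>. hyp_dist X Y) < r" using inf by simp
    then obtain Y where Y: "Y \<in> \<Omega>" "hyp_dist X Y < r"
      using ex_interior parallel_set_bdd_below[OF X] by (subst (asm) cInf_less_iff) auto
    have YH: "Y \<in> hyperbolic_space" using Y sub by blast
    have "- lorentz X (\<l> q) \<le> exp (hyp_dist X Y) * (- lorentz Y (\<l> q))"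
      by (rule horofunction_Lipschitz[OF X YH null(1,2)[OF q q q]])
    also have "\<dots> \<le> exp (hyp_dist X Y) * 1" using domain_horofunction[OF Y(1) q] by (intro mult_left_mono) auto
    also have "\<dots> < exp r" using Y(2) by simp
    finally show False using r by simp
  qed
next
  assume le: "\<forall>q\<in>S. - lorentz X (\<l> q) \<le> exp \<rho>"
  have "\<exists>Y\<in>\<Omega>. hyp_dist X Y \<le> \<rho>"
  proof (cases "X \<in> \<Omega>")
    case True
    then show ?thesis using hyperbolic_spaceD(1)[OF X] assms(2) by (intro bexI[of _ X]) (simp add: hyp_dist_def)
  next
    case False
    obtain p t where p: "p \<in> S" "t > 0" "X = cosh t *\<^sub>R p + sinh t *\<^sub>R \<nu> p" "- lorentz X (\<l> p) = exp t"
      using exterior_point[OF X False] .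
    have "exp t \<le> exp \<rho>" using le p(1,4) by metis
    then have "t \<le> \<rho>" by simp
    have "- lorentz X p = cosh t"
      using normal[OF p(1)] hyperbolic_spaceD(1)[OF normal(1)[OF p(1)]] lorentz_sym[of "\<nu> p" p]
      by (subst p(3)) (simp add: lorentz_simps)
    then have "hyp_dist X p = t" using p(2) by (simp add: hyp_dist_def arcosh_cosh_real)
    then show ?thesis using p(1) frontier_subset \<open>t \<le> \<rho>\<close> by blast
  qed
  then obtain Y where "Y \<in> \<Omega>" "hyp_dist X Y \<le> \<rho>" by blast
  then have "(INF Y\<in>\<Omega>. hyp_dist X Y) \<le> \<rho>"
    using cINF_lower[OF parallel_set_bdd_below[OF X]] order_trans by blast
  then show "X \<in> hyp_parallel_set \<Omega> \<rho>" using X by (simp add: hyp_parallel_set_def)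
qed

section \<open>The geodesic tube and the null tube\<close>

definition tube :: "(real \<Rightarrow> real) \<Rightarrow> (real \<Rightarrow> real) \<Rightarrow> ('n option) minkowski \<times> real \<Rightarrow> real^'n option" where
  "tube a b = (\<lambda>(p, s). fst (a s *\<^sub>R p + b s *\<^sub>R \<nu> p))"

lemma geodesic_tube_in:
  assumes "p \<in> S"
  shows "cosh t *\<^sub>R p + sinh t *\<^sub>R \<nu> p \<in> hyperbolic_space"
  using hyp_geodesic_in[OF normal[OF assms]] by (simp add: hyp_geodesic_def)

text \<open>The parameter is recovered from the largest horofunction value exp t, the foot point as
  the only maximizer.\<close>

lemma geodesic_tube_inj: "inj_on (tube cosh sinh) (S \<times> {0..})"
proof (rule inj_onI)
  fix z z' assume z: "z \<in> S \<times> {0..}" "z' \<in> S \<times> {0..}" "tube cosh sinh z = tube cosh sinh z'"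
  obtain p t q s where zz: "z = (p, t)" "z' = (q, s)" by (cases z, cases z')
  then have p: "p \<in> S" "t \<ge> 0" and q: "q \<in> S" "s \<ge> 0" and eq: "tube cosh sinh (p, t) = tube cosh sinh (q, s)"
    using z by simp_all
  define X where "X = cosh t *\<^sub>R p + sinh t *\<^sub>R \<nu> p"
  have XX: "X = cosh s *\<^sub>R q + sinh s *\<^sub>R \<nu> q"
    using arg_cong[OF eq[unfolded tube_def case_prod_conv], of hyp_lift]
    unfolding X_def hyp_lift_fst[OF geodesic_tube_in[OF p(1)]] hyp_lift_fst[OF geodesic_tube_in[OF q(1)]] .
  have cs: "cosh r + sinh r = exp r" for r :: real by (simp add: cosh_plus_sinh)
  have pos: "cosh t + sinh t > 0" "cosh s + sinh s > 0" "sinh t \<ge> 0" "sinh s \<ge> 0" using p q unfolding cs by simp_all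
  note 1 = horofunction_tube[OF p(1) p(1) pos(1,3)] horofunction_tube[OF p(1) q(1) pos(1,3)]
    horofunction_tube[OF q(1) q(1) pos(2,4)] horofunction_tube[OF q(1) p(1) pos(2,4)]
  have "exp t = exp s" using 1 unfolding X_def[symmetric] XX[symmetric] cs by linarith
  then have "t = s" by simp
  moreover have "p = q" using 1 \<open>exp t = exp s\<close> unfolding X_def[symmetric] XX[symmetric] cs by force
  ultimately show "z = z'" by (simp add: zz)
qed

theorem parallel_set_geodesic_tube:
  assumes "\<rho> \<ge> 0"
  shows "fst ` hyp_parallel_set \<Omega> \<rho> = fst ` \<Omega> \<union> tube cosh sinh ` (S \<times> {0<..\<rho>})"
    and "fst ` \<Omega> \<inter> tube cosh sinh ` (S \<times> {0<..\<rho>}) = {}"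
proof -
  have cs: "cosh r + sinh r = exp r" for r :: real by (simp add: cosh_plus_sinh)
  have ht: "- lorentz (cosh t *\<^sub>R p + sinh t *\<^sub>R \<nu> p) (\<l> p) = exp t"
    "- lorentz (cosh t *\<^sub>R p + sinh t *\<^sub>R \<nu> p) (\<l> q) \<le> exp t" if "p \<in> S" "q \<in> S" "t > 0" for p q t
    using horofunction_tube[OF that(1,2), of "cosh t" "sinh t"] that(3) unfolding cs by auto
  show "fst ` hyp_parallel_set \<Omega> \<rho> = fst ` \<Omega> \<union> tube cosh sinh ` (S \<times> {0<..\<rho>})"
  proof (intro equalityI subsetI)
    fix x assume "x \<in> fst ` hyp_parallel_set \<Omega> \<rho>"
    then obtain X where X: "X \<in> hyp_parallel_set \<Omega> \<rho>" "x = fst X" by blast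
    then have XH: "X \<in> hyperbolic_space" by (simp add: hyp_parallel_set_def)
    show "x \<in> fst ` \<Omega> \<union> tube cosh sinh ` (S \<times> {0<..\<rho>})"
    proof (cases "X \<in> \<Omega>")
      case False
      obtain p t where p: "p \<in> S" "t > 0" "X = cosh t *\<^sub>R p + sinh t *\<^sub>R \<nu> p" "- lorentz X (\<l> p) = exp t"
        using exterior_point[OF XH False] .
      have "exp t \<le> exp \<rho>" using in_parallel_set_iff[OF XH assms] X(1) p(1,4) by metis
      then have "(p, t) \<in> S \<times> {0<..\<rho>}" using p by simp
      moreover have "x = tube cosh sinh (p, t)" using p(3) X(2) by (simp add: tube_def)
      ultimately show ?thesis by blast
    qed (use X in blast)
  next
    fix x assume "x \<in> fst ` \<Omega> \<union> tube cosh sinh ` (S \<times> {0<..\<rho>})"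
    then show "x \<in> fst ` hyp_parallel_set \<Omega> \<rho>"
    proof
      assume "x \<in> fst ` \<Omega>"
      then obtain X where X: "X \<in> \<Omega>" "x = fst X" by blast
      have "- lorentz X (\<l> q) \<le> exp \<rho>" if "q \<in> S" for q
        using domain_horofunction[OF X(1) that] assms one_le_exp_iff[of \<rho>] by linarith
      then show ?thesis using X in_parallel_set_iff[OF _ assms] sub by blast
    next
      assume "x \<in> tube cosh sinh ` (S \<times> {0<..\<rho>})"
      then obtain p t where p: "p \<in> S" "0 < t" "t \<le> \<rho>" "x = fst (cosh t *\<^sub>R p + sinh t *\<^sub>R \<nu> p)"
        by (auto simp: tube_def)
      have "- lorentz (cosh t *\<^sub>R p + sinh t *\<^sub>R \<nu> p) (\<l> q) \<le> exp \<rho>" if "q \<in> S" for q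
        using ht(2)[OF p(1) that p(2)] p(3) exp_le_cancel_iff[of t \<rho>] by linarith
      then show ?thesis using p(4) in_parallel_set_iff[OF geodesic_tube_in[OF p(1)] assms] by blast
    qed
  qed
  show "fst ` \<Omega> \<inter> tube cosh sinh ` (S \<times> {0<..\<rho>}) = {}"
  proof (rule ccontr)
    assume "\<not> ?thesis"
    then obtain x where x: "x \<in> fst ` \<Omega>" "x \<in> tube cosh sinh ` (S \<times> {0<..\<rho>})" by blast
    from x(1) obtain X where X: "X \<in> \<Omega>" "x = fst X" by blast
    from x(2) obtain z where z: "z \<in> S \<times> {0<..\<rho>}" "x = tube cosh sinh z" by blast
    obtain p t where "z = (p, t)" by (cases z)
    then have p: "p \<in> S" "0 < t" "fst X = fst (cosh t *\<^sub>R p + sinh t *\<^sub>R \<nu> p)"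
      using z X(2) by (simp_all add: tube_def)
    have "X \<in> hyperbolic_space" using X sub by blast
    then have "X = cosh t *\<^sub>R p + sinh t *\<^sub>R \<nu> p"
      using p(3) hyp_lift_fst geodesic_tube_in[OF p(1)] by metis
    then have "exp t \<le> 1" using domain_horofunction[OF X(1) p(1)] ht(1)[OF p(1) p(1) p(2)] by simp
    then show False using p(2) by simp
  qed
qed

text \<open>The points do not lie on a common hyperboloid, so equal spatial parts do not at once
  give equal times. But both have the largest horofunction value exp \<rho>; evaluating at either
  foot point bounds the time difference from both sides.\<close>

lemma null_tube_inj:
  "inj_on (tube (\<lambda>s. exp \<rho> - s) (\<lambda>s. s)) (S \<times> {0..})"
proof (rule inj_onI)
  fix z z' assume z: "z \<in> S \<times> {0..}" "z' \<in> S \<times> {0..}"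
    "tube (\<lambda>s. exp \<rho> - s) (\<lambda>s. s) z = tube (\<lambda>s. exp \<rho> - s) (\<lambda>s. s) z'"
  obtain p t q s where zz: "z = (p, t)" "z' = (q, s)" by (cases z, cases z')
  then have p: "p \<in> S" "t \<ge> 0" and q: "q \<in> S" "s \<ge> 0"
    and eq: "tube (\<lambda>s. exp \<rho> - s) (\<lambda>s. s) (p, t) = tube (\<lambda>s. exp \<rho> - s) (\<lambda>s. s) (q, s)"
    using z by simp_all
  define X where "X = (exp \<rho> - t) *\<^sub>R p + t *\<^sub>R \<nu> p"
  define Y where "Y = (exp \<rho> - s) *\<^sub>R q + s *\<^sub>R \<nu> q"
  have fst: "fst X = fst Y" using eq by (simp add: X_def Y_def tube_def)
  have sum: "(exp \<rho> - r) + r = exp \<rho>" "(exp \<rho> - r) + r > 0" for r by simp_all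
  note 1 = horofunction_tube[OF p(1) p(1) sum(2) p(2)] horofunction_tube[OF p(1) q(1) sum(2) p(2)]
    horofunction_tube[OF q(1) q(1) sum(2) q(2)] horofunction_tube[OF q(1) p(1) sum(2) q(2)]
  note 2 = 1[unfolded X_def[symmetric] Y_def[symmetric] sum(1)]
  have diff: "lorentz X l - lorentz Y l = (snd Y - snd X) * snd l" for l
    using fst by (simp add: lorentz_def algebra_simps)
  have a: "(snd Y - snd X) * snd (\<l> p) \<le> 0" using 2 diff[of "\<l> p"] by linarith
  have b: "(snd Y - snd X) * snd (\<l> q) \<ge> 0" using 2 diff[of "\<l> q"] by linarith
  have "snd Y \<le> snd X" using a null(2)[OF p(1) p(1) p(1)] by (simp add: mult_le_0_iff)
  moreover have "snd Y \<ge> snd X" using b null(2)[OF q(1) q(1) q(1)] by (simp add: zero_le_mult_iff)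
  ultimately have "X = Y" using fst by (simp add: prod_eq_iff)
  then have "p = q" using 2 by force
  have "(t - s) *\<^sub>R \<l> p = 0"
    using \<open>X = Y\<close> unfolding X_def Y_def \<open>p = q\<close> by (simp add: algebra_simps)
  moreover have "\<l> p \<noteq> 0" using null(2)[OF p(1) p(1) p(1)] by auto
  ultimately show "z = z'" using \<open>p = q\<close> by (simp add: zz)
qed

text \<open>Over a spatial \<open>y\<close> take the largest time at which all inequalities with
  bound \<open>E\<close> hold. It is at least sqrt (1 + |y|^2) for the parallel set and at least
  sqrt (E^2 + |y|^2) for the dilated domain; in between, the point at that height lies on a null
  segment.\<close>

theorem parallel_set_null_tube:
  assumes "\<rho> \<ge> 0"
  shows "fst ` hyp_parallel_set \<Omega> \<rho> =
      (\<lambda>x. exp \<rho> *\<^sub>R x) ` fst ` \<Omega> \<union> tube (\<lambda>s. exp \<rho> - s) (\<lambda>s. s) ` (S \<times> {0<..sinh \<rho>})"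
    and "(\<lambda>x. exp \<rho> *\<^sub>R x) ` fst ` \<Omega> \<inter> tube (\<lambda>s. exp \<rho> - s) (\<lambda>s. s) ` (S \<times> {0<..sinh \<rho>}) = {}"
proof -
  define E where "E = exp \<rho>"
  have E: "E \<ge> 1" using assms by (simp add: E_def)
  \<comment> \<open>At s = sinh \<rho> the Lorentz square - E (E - 2 s) becomes -1: the null segment
    reaches the unit hyperboloid.\<close>
  have sh: "E - 2 * sinh \<rho> = 1 / E" by (simp add: E_def sinh_def exp_minus field_simps)
  have norm2: "lorentz ((E - s) *\<^sub>R p + s *\<^sub>R \<nu> p) ((E - s) *\<^sub>R p + s *\<^sub>R \<nu> p) = - (E * (E - 2 * s))"
    if "p \<in> S" for p s
    using normal[OF that] hyperbolic_spaceD(1)[OF normal(1)[OF that]] lorentz_sym[of "\<nu> p" p]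
    by (simp add: lorentz_simps algebra_simps)
  have time_mono: "- lorentz (y, t) (\<l> q) \<le> - lorentz (y, t') (\<l> q)" if "q \<in> S" "t \<le> t'" for y t t' q
    using null(2)[OF that(1) that(1) that(1)] that(2) by (simp add: lorentz_def mult_right_mono del: snd_diff)
  have time_strict: "- lorentz (y, t) (\<l> q) < - lorentz (y, t') (\<l> q)" if "q \<in> S" "t < t'" for y t t' q
    using null(2)[OF that(1) that(1) that(1)] that(2) by (simp add: lorentz_def mult_strict_right_mono del: snd_diff)
  have inP: "y \<in> fst ` hyp_parallel_set \<Omega> \<rho> \<longleftrightarrow> (\<forall>q\<in>S. - lorentz (y, sqrt (1 + y \<bullet> y)) (\<l> q) \<le> E)" for y
  proof -
    have "y \<in> fst ` hyp_parallel_set \<Omega> \<rho> \<longleftrightarrow> hyp_lift y \<in> hyp_parallel_set \<Omega> \<rho>"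
    proof
      assume "y \<in> fst ` hyp_parallel_set \<Omega> \<rho>"
      then obtain X where "X \<in> hyp_parallel_set \<Omega> \<rho>" "y = fst X" by blast
      then show "hyp_lift y \<in> hyp_parallel_set \<Omega> \<rho>" using hyp_lift_fst[of X] by (simp add: hyp_parallel_set_def)
    next
      assume "hyp_lift y \<in> hyp_parallel_set \<Omega> \<rho>"
      then have "fst (hyp_lift y) \<in> fst ` hyp_parallel_set \<Omega> \<rho>" by blast
      then show "y \<in> fst ` hyp_parallel_set \<Omega> \<rho>" by simp
    qed
    then show ?thesis
      using in_parallel_set_iff[OF hyp_lift_in assms, of y] by (simp add: hyp_lift_def E_def)
  qed
  have inD: "y \<in> (\<lambda>x. E *\<^sub>R x) ` fst ` \<Omega> \<longleftrightarrow> (\<forall>q\<in>S. - lorentz (y, sqrt (E\<^sup>2 + y \<bullet> y)) (\<l> q) \<le> E)" for y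
  proof -
    have 1: "y \<in> (\<lambda>x. E *\<^sub>R x) ` fst ` \<Omega> \<longleftrightarrow> hyp_lift (y /\<^sub>R E) \<in> \<Omega>"
    proof
      assume "y \<in> (\<lambda>x. E *\<^sub>R x) ` fst ` \<Omega>"
      then obtain X where X: "X \<in> \<Omega>" "y = E *\<^sub>R fst X" by blast
      then have "X \<in> hyperbolic_space" using sub by blast
      then have "hyp_lift (y /\<^sub>R E) = X" using E hyp_lift_fst[of X] X(2) by simp
      with X show "hyp_lift (y /\<^sub>R E) \<in> \<Omega>" by simp
    next
      assume "hyp_lift (y /\<^sub>R E) \<in> \<Omega>"
      then have "E *\<^sub>R fst (hyp_lift (y /\<^sub>R E)) \<in> (\<lambda>x. E *\<^sub>R x) ` fst ` \<Omega>" by blast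
      then show "y \<in> (\<lambda>x. E *\<^sub>R x) ` fst ` \<Omega>" using E by simp
    qed
    have "E * sqrt (1 + (y /\<^sub>R E) \<bullet> (y /\<^sub>R E)) = sqrt (E\<^sup>2 * (1 + (y /\<^sub>R E) \<bullet> (y /\<^sub>R E)))"
      using E by (simp add: real_sqrt_mult)
    also have "E\<^sup>2 * (1 + (y /\<^sub>R E) \<bullet> (y /\<^sub>R E)) = E\<^sup>2 + y \<bullet> y"
      using E by (simp add: field_simps power2_eq_square)
    finally have "(y, sqrt (E\<^sup>2 + y \<bullet> y)) = E *\<^sub>R hyp_lift (y /\<^sub>R E)"
      using E by (simp add: hyp_lift_def)
    then have "- lorentz (y, sqrt (E\<^sup>2 + y \<bullet> y)) l = E * (- lorentz (hyp_lift (y /\<^sub>R E)) l)" for l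
      by (simp add: lorentz_simps(9))
    then have "- lorentz (y, sqrt (E\<^sup>2 + y \<bullet> y)) l \<le> E \<longleftrightarrow> - lorentz (hyp_lift (y /\<^sub>R E)) l \<le> 1" for l
      using E by (metis mult.right_neutral mult_le_cancel_left_pos less_le_trans zero_less_one)
    then show ?thesis unfolding 1 in_domain_iff[OF hyp_lift_in] by simp
  qed
  have lift_time: "snd Y = sqrt (c + fst Y \<bullet> fst Y)" if "snd Y > 0" "lorentz Y Y = - c"
    for Y :: "('n option) minkowski" and c
  proof -
    have "(snd Y)\<^sup>2 = c + fst Y \<bullet> fst Y" using that(2) by (simp add: lorentz_def power2_eq_square)
    then show ?thesis using that(1) by (metis abs_of_pos real_sqrt_abs)
  qed
  have tube_time: "fst Y \<notin> (\<lambda>x. E *\<^sub>R x) ` fst ` \<Omega> \<and> fst Y \<in> fst ` hyp_parallel_set \<Omega> \<rho>"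
    if Yd: "Y = (E - s) *\<^sub>R p + s *\<^sub>R \<nu> p" and p: "p \<in> S" and s: "0 < s" "s \<le> sinh \<rho>" for Y p s
  proof -
    have sum: "(E - s) + s = E" "(E - s) + s > 0" using E by simp_all
    have hY: "- lorentz Y (\<l> p) = E" "\<And>q. q \<in> S \<Longrightarrow> - lorentz Y (\<l> q) \<le> E"
      using horofunction_tube(1)[OF p p sum(2)] horofunction_tube(2)[OF p _ sum(2)] s(1) unfolding Yd sum(1) by auto
    have E2s: "E - 2 * s \<ge> 1 / E" using s sh by linarith
    have "1 / E > 0" using E by simp
    have nE: "E * (E - 2 * s) \<ge> 1" using mult_left_mono[OF E2s, of E] E by simp
    have nE2: "E * (E - 2 * s) < E\<^sup>2" using E s by (simp add: power2_eq_square)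
    \<comment> \<open>The time coordinate can be read off from the Lorentz square only once it is
      known to be positive; this follows from the lower bound 1 / E for E - 2 s.\<close>
    have "snd Y = E * snd p - s * (snd p - snd (\<nu> p))" by (simp add: Yd algebra_simps)
    moreover have "s * (snd p - snd (\<nu> p)) \<le> s * (2 * snd p)"
      using null(5)[OF p p p] s by (intro mult_left_mono) auto
    moreover have "(E - 2 * s) * snd p > 0"
      using E2s \<open>1 / E > 0\<close> hyperbolic_spaceD(2)[OF normal(1)[OF p]] by (intro mult_pos_pos) linarith+
    ultimately have "snd Y > 0" by (simp add: algebra_simps)
    then have sY: "snd Y = sqrt (E * (E - 2 * s) + fst Y \<bullet> fst Y)"
      using norm2[OF p, of s] by (intro lift_time) (simp_all add: Yd)
    have t1: "sqrt (1 + fst Y \<bullet> fst Y) \<le> snd Y" unfolding sY using nE by simp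
    have t2: "snd Y < sqrt (E\<^sup>2 + fst Y \<bullet> fst Y)" unfolding sY using nE2 by simp
    have "- lorentz (fst Y, sqrt (1 + fst Y \<bullet> fst Y)) (\<l> q) \<le> E" if "q \<in> S" for q
      using time_mono[OF that t1, of "fst Y"] hY(2)[OF that] by simp
    moreover have "- lorentz (fst Y, sqrt (E\<^sup>2 + fst Y \<bullet> fst Y)) (\<l> p) > E"
      using time_strict[OF p t2, of "fst Y"] hY(1) by simp
    ultimately show ?thesis unfolding inP inD using p by force
  qed
  have tube_pt: "tube (\<lambda>s. E - s) (\<lambda>s. s) z \<notin> (\<lambda>x. E *\<^sub>R x) ` fst ` \<Omega> \<and>
      tube (\<lambda>s. E - s) (\<lambda>s. s) z \<in> fst ` hyp_parallel_set \<Omega> \<rho>" if "z \<in> S \<times> {0<..sinh \<rho>}" for z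
  proof -
    obtain p s where "z = (p, s)" by (cases z)
    then show ?thesis using tube_time[OF refl, of p s] that by (simp add: tube_def)
  qed
  show "(\<lambda>x. exp \<rho> *\<^sub>R x) ` fst ` \<Omega> \<inter> tube (\<lambda>s. exp \<rho> - s) (\<lambda>s. s) ` (S \<times> {0<..sinh \<rho>}) = {}"
    unfolding E_def[symmetric]
  proof (rule equals0I, elim IntE)
    fix y assume y: "y \<in> (\<lambda>x. E *\<^sub>R x) ` fst ` \<Omega>" "y \<in> tube (\<lambda>s. E - s) (\<lambda>s. s) ` (S \<times> {0<..sinh \<rho>})"
    from y(2) obtain z where "z \<in> S \<times> {0<..sinh \<rho>}" "y = tube (\<lambda>s. E - s) (\<lambda>s. s) z" by (rule imageE)
    then show False using tube_pt[of z] y(1) by simp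
  qed
  show "fst ` hyp_parallel_set \<Omega> \<rho> =
      (\<lambda>x. exp \<rho> *\<^sub>R x) ` fst ` \<Omega> \<union> tube (\<lambda>s. exp \<rho> - s) (\<lambda>s. s) ` (S \<times> {0<..sinh \<rho>})"
    unfolding E_def[symmetric]
  proof (intro equalityI subsetI)
    fix y assume y: "y \<in> fst ` hyp_parallel_set \<Omega> \<rho>"
    show "y \<in> (\<lambda>x. E *\<^sub>R x) ` fst ` \<Omega> \<union> tube (\<lambda>s. E - s) (\<lambda>s. s) ` (S \<times> {0<..sinh \<rho>})"
    proof (cases "y \<in> (\<lambda>x. E *\<^sub>R x) ` fst ` \<Omega>")
      case False
      \<comment> \<open>The time at which (y, t) reaches the boundary of the half-space of
        \<open>q\<close>; the minimum over \<open>q\<close> is the height of the intersection over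
        \<open>y\<close>.\<close>
      define \<tau> where "\<tau> = (\<lambda>q. (E + y \<bullet> fst (\<l> q)) / snd (\<l> q))"
      have cont: "continuous_on S \<tau>"
        unfolding \<tau>_def using null(2) by (intro continuous_intros continuous_on_normal) force
      obtain p where p: "p \<in> S" "\<And>q. q \<in> S \<Longrightarrow> \<tau> p \<le> \<tau> q"
        using continuous_attains_inf[OF compact_frontier S_nonempty cont] by blast
      have \<tau>: "- lorentz (y, t) (\<l> q) \<le> E \<longleftrightarrow> t \<le> \<tau> q" if "q \<in> S" for t q
        using null(2)[OF that that that] by (simp add: lorentz_def \<tau>_def pos_le_divide_eq del: snd_diff fst_diff) (simp add: algebra_simps del: snd_diff fst_diff)
      define Y where "Y = (y, \<tau> p)"
      have hYp: "- lorentz Y (\<l> p) = E"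
        using null(2)[OF p(1) p(1) p(1)] by (simp add: lorentz_def \<tau>_def Y_def del: snd_diff fst_diff)
      have max: "- lorentz Y (\<l> q) \<le> - lorentz Y (\<l> p)" if "q \<in> S" for q
        using \<tau>[OF that, of "\<tau> p"] p(2)[OF that] hYp by (simp add: Y_def)
      obtain a b where ab: "Y = a *\<^sub>R p + b *\<^sub>R \<nu> p" using horofunction_critical[OF p(1) max] by blast
      have "- lorentz Y (\<l> p) = a + b"
        using null(3,4)[OF p(1) p(1) p(1)] arg_cong[OF ab, of "\<lambda>Z. lorentz Z (\<l> p)"]
        by (simp add: lorentz_simps(1,9))
      then have "a = E - b" using hYp by simp
      then have Yb: "Y = (E - b) *\<^sub>R p + b *\<^sub>R \<nu> p" using ab by simp
      have t0: "sqrt (1 + y \<bullet> y) \<le> \<tau> p" using y \<tau>[OF p(1)] p(1) unfolding inP by blast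
      have t1: "\<tau> p < sqrt (E\<^sup>2 + y \<bullet> y)"
      proof (rule ccontr)
        assume "\<not> ?thesis"
        then have "- lorentz (y, sqrt (E\<^sup>2 + y \<bullet> y)) (\<l> q) \<le> E" if "q \<in> S" for q
          using \<tau>[OF that] p(2)[OF that] by auto
        then show False using False unfolding inD by blast
      qed
      have pos: "\<tau> p > 0" using t0 by (smt (verit) inner_ge_zero real_sqrt_gt_0_iff)
      have sq: "(\<tau> p)\<^sup>2 = E * (E - 2 * b) + y \<bullet> y"
        using norm2[OF p(1), of b] unfolding Yb[symmetric] by (simp add: Y_def lorentz_def power2_eq_square)
      have "1 + y \<bullet> y \<le> (\<tau> p)\<^sup>2" using power_mono[OF t0, of 2] by (simp add: add_nonneg_nonneg)
      then have "1 \<le> E * (E - 2 * b)" unfolding sq by simp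
      then have "1 / E \<le> E - 2 * b" using E by (simp add: divide_le_eq mult.commute)
      then have "b \<le> sinh \<rho>" using sh by linarith
      have "(\<tau> p)\<^sup>2 < E\<^sup>2 + y \<bullet> y" using power_strict_mono[OF t1, of 2] pos by (simp add: add_nonneg_nonneg)
      then have "E * b > 0" unfolding sq by (simp add: power2_eq_square algebra_simps)
      then have "b > 0" using E by (simp add: zero_less_mult_iff)
      have "y = tube (\<lambda>s. E - s) (\<lambda>s. s) (p, b)" using arg_cong[OF Yb, of fst] by (simp add: tube_def Y_def)
      then show ?thesis using p(1) \<open>b > 0\<close> \<open>b \<le> sinh \<rho>\<close>
        by (intro UnI2 image_eqI[of _ _ "(p, b)"]) auto
    qed blast
  next
    fix y assume "y \<in> (\<lambda>x. E *\<^sub>R x) ` fst ` \<Omega> \<union> tube (\<lambda>s. E - s) (\<lambda>s. s) ` (S \<times> {0<..sinh \<rho>})"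
    then show "y \<in> fst ` hyp_parallel_set \<Omega> \<rho>"
    proof
      assume y: "y \<in> (\<lambda>x. E *\<^sub>R x) ` fst ` \<Omega>"
      have "1 \<le> E\<^sup>2" using E by (simp add: power_le_one_iff one_le_power)
      then have "sqrt (1 + y \<bullet> y) \<le> sqrt (E\<^sup>2 + y \<bullet> y)" by simp
      then show ?thesis using y time_mono unfolding inP inD by (meson order_trans)
    next
      assume "y \<in> tube (\<lambda>s. E - s) (\<lambda>s. s) ` (S \<times> {0<..sinh \<rho>})"
      then obtain z where "z \<in> S \<times> {0<..sinh \<rho>}" "y = tube (\<lambda>s. E - s) (\<lambda>s. s) z" by (rule imageE)
      then show ?thesis using tube_pt[of z] by simp
    qed
  qed
qed

end

section \<open>Volume of tubes in a chart\<close>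

lemma borel_homeomorphic_image:
  fixes f :: "'a::topological_space \<Rightarrow> 'b::topological_space"
  assumes hom: "homeomorphism X Y f g" and "Y \<in> sets borel" and B: "B \<in> sets borel" "B \<subseteq> X"
  shows "f ` B \<in> sets borel"
proof -
  have "f ` B = g -` B \<inter> Y"
    using hom B(2) unfolding homeomorphism_def by (auto simp: image_iff)
  moreover have "g \<in> borel_measurable (restrict_space borel Y)"
    using hom by (intro borel_measurable_continuous_on_restrict) (simp add: homeomorphism_def)
  from measurable_sets[OF this B(1)] have "g -` B \<inter> Y \<in> sets (restrict_space borel Y)"
    by (simp add: space_restrict_space)
  ultimately show ?thesis
    using assms(2) by (simp add: sets_restrict_space_iff)
qed

text \<open>Chart coordinates and tube parameter in one vector, since the change of variables
  formula compares equal vector types; \<open>None\<close> carries the parameter.\<close>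

definition pair_vec :: "(real^'n::finite) \<times> real \<Rightarrow> real^'n option" where
  "pair_vec q = (\<chi> i. case i of Some i \<Rightarrow> fst q $ i | None \<Rightarrow> snd q)"

definition vec_pair :: "real^'n::finite option \<Rightarrow> (real^'n) \<times> real" where
  "vec_pair x = (\<chi> i. x $ Some i, x $ None)"

lemma pair_vec_inverse [simp]: "pair_vec (vec_pair x) = x" "vec_pair (pair_vec q) = q"
  by (auto simp: pair_vec_def vec_pair_def vec_eq_iff prod_eq_iff split: option.split)

lemma bounded_linear_pair_vec: "bounded_linear pair_vec"
  unfolding linear_conv_bounded_linear[symmetric]
  by (rule linearI) (auto simp: pair_vec_def vec_eq_iff split: option.split)

lemma bounded_linear_vec_pair: "bounded_linear vec_pair"
  unfolding linear_conv_bounded_linear[symmetric]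
  by (rule linearI) (auto simp: vec_pair_def vec_eq_iff)

lemma pair_vec_axis: "pair_vec (axis i r, 0) = axis (Some i) r" "pair_vec (0, r) = axis None r"
  by (auto simp: pair_vec_def axis_def vec_eq_iff split: option.split)

lemma distr_pair_vec: "distr lborel borel (pair_vec :: (real^'n::finite) \<times> real \<Rightarrow> _) = lborel"
proof (rule lborel_distr_basis_isomorphism)
  show "linear (pair_vec :: (real^'n) \<times> real \<Rightarrow> _)"
    using bounded_linear_pair_vec by (simp add: linear_conv_bounded_linear)
  show "bij_betw (pair_vec :: (real^'n) \<times> real \<Rightarrow> _) Basis Basis"
  proof (rule bij_betwI[where g = vec_pair])
    show "(pair_vec :: (real^'n) \<times> real \<Rightarrow> _) \<in> Basis \<rightarrow> Basis"
      by (auto simp: Basis_prod_def Basis_vec_def pair_vec_axis)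
    show "vec_pair \<in> Basis \<rightarrow> (Basis :: ((real^'n) \<times> real) set)"
    proof
      fix x :: "real^'n option" assume "x \<in> Basis"
      then obtain j where x: "x = axis j 1" by (auto simp: Basis_vec_def)
      show "vec_pair x \<in> Basis"
      proof (cases j)
        case None
        then have "x = pair_vec (0, 1)" using x by (simp add: pair_vec_axis)
        then show ?thesis by (simp add: Basis_prod_def)
      next
        case (Some i)
        then have "x = pair_vec (axis i 1, 0)" using x by (simp add: pair_vec_axis)
        moreover have "axis i (1::real) \<in> Basis" by (auto simp: Basis_vec_def)
        ultimately show ?thesis by (simp add: Basis_prod_def)
      qed
    qed
  qed auto
qed

lemma borel_measurable_linear_maps:
  "pair_vec \<in> borel_measurable borel" "vec_pair \<in> borel_measurable borel"
  using bounded_linear_pair_vec bounded_linear_vec_pair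
  by (auto intro: borel_measurable_continuous_onI linear_continuous_on)

lemma nn_integral_pair_vec:
  fixes F :: "real^'n::finite option \<Rightarrow> ennreal"
  assumes F: "F \<in> borel_measurable borel"
  shows "(\<integral>\<^sup>+x. F x \<partial>lborel) = (\<integral>\<^sup>+y. \<integral>\<^sup>+s. F (pair_vec (y, s)) \<partial>lborel \<partial>lborel)"
    and "(\<lambda>y. \<integral>\<^sup>+s. F (pair_vec (y, s)) \<partial>lborel) \<in> borel_measurable borel"
proof -
  have m: "(\<lambda>q. F (pair_vec q)) \<in> borel_measurable (lborel \<Otimes>\<^sub>M lborel)"
    unfolding lborel_prod using measurable_compose[OF borel_measurable_linear_maps(1) F] by simp
  have "(\<integral>\<^sup>+x. F x \<partial>lborel) = (\<integral>\<^sup>+q. F (pair_vec q) \<partial>lborel)"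
  proof -
    have "integral\<^sup>N (distr lborel borel pair_vec) F = (\<integral>\<^sup>+q. F (pair_vec q) \<partial>lborel)"
      by (rule nn_integral_distr) (use F borel_measurable_linear_maps(1) in simp_all)
    then show ?thesis by (simp only: distr_pair_vec)
  qed
  also have "\<dots> = integral\<^sup>N (lborel \<Otimes>\<^sub>M lborel) (\<lambda>q. F (pair_vec q))" by (simp add: lborel_prod)
  also have "\<dots> = (\<integral>\<^sup>+y. \<integral>\<^sup>+s. F (pair_vec (y, s)) \<partial>lborel \<partial>lborel)"
    by (rule lborel.nn_integral_fst[OF m, symmetric])
  finally show "(\<integral>\<^sup>+x. F x \<partial>lborel) = (\<integral>\<^sup>+y. \<integral>\<^sup>+s. F (pair_vec (y, s)) \<partial>lborel \<partial>lborel)" .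
  show "(\<lambda>y. \<integral>\<^sup>+s. F (pair_vec (y, s)) \<partial>lborel) \<in> borel_measurable borel"
    using lborel.borel_measurable_nn_integral_fst[OF m] by simp
qed

lemma continuous_on_det:
  fixes f :: "'a::topological_space \<Rightarrow> real^'n::finite^'n"
  assumes "\<And>i j. continuous_on A (\<lambda>x. f x $ i $ j)"
  shows "continuous_on A (\<lambda>x. det (f x))"
  unfolding det_def by (intro continuous_intros assms)

section \<open>Jacobian of a tube in a chart\<close>

context h_convex_domain
begin

abbreviation "chart_frame \<phi> y i \<equiv> frechet_derivative \<phi> (at y) (axis i 1)"
abbreviation "chart_normal_frame \<phi> y i \<equiv> frechet_derivative (\<lambda>y. \<nu> (\<phi> y)) (at y) (axis i 1)"

text \<open>Transposed Jacobian of the tube in (y, s), with the values of a, b and their derivatives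
  as free parameters: at other values the same matrix shows later that products of curvatures are
  continuous.\<close>

definition tube_matrix ::
  "(real^'n \<Rightarrow> ('n option) minkowski) \<Rightarrow> real \<Rightarrow> real \<Rightarrow> real \<Rightarrow> real \<Rightarrow> real^'n \<Rightarrow> real^'n option^'n option" where
  "tube_matrix \<phi> \<alpha> \<beta> \<alpha>' \<beta>' y = (\<chi> i. case i of
      Some i \<Rightarrow> fst (\<alpha> *\<^sub>R chart_frame \<phi> y i + \<beta> *\<^sub>R chart_normal_frame \<phi> y i)
    | None \<Rightarrow> fst (\<alpha>' *\<^sub>R \<phi> y + \<beta>' *\<^sub>R \<nu> (\<phi> y)))"

text \<open>The differential of the normal is diagonal in the principal frame, so
  \<open>abs_det_tube\<close> applies; the Gram determinant is the squared determinant of an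
  injective map.\<close>

lemma chart_jacobian:
  assumes \<phi>: "local_parametrization S U \<phi>" "y \<in> U"
  shows "\<bar>det (tube_matrix \<phi> \<alpha> \<beta> \<alpha>' \<beta>' y)\<bar> =
      \<bar>\<beta>' * snd (\<phi> y) + \<alpha>' * snd (\<nu> (\<phi> y))\<bar> * \<bar>\<Prod>i\<in>UNIV. \<alpha> + \<beta> * \<kappa> (\<phi> y) i\<bar> * sqrt (gram_det \<phi> y)"
    and "gram_det \<phi> y > 0"
proof -
  obtain e A where e: "lorentz_frame (\<phi> y) (\<nu> (\<phi> y)) e" and A: "linear A" "\<forall>i. A (e i) = \<kappa> (\<phi> y) i *\<^sub>R e i"
    "((\<lambda>y. \<nu> (\<phi> y)) has_derivative (\<lambda>\<xi>. A (frechet_derivative \<phi> (at y) \<xi>))) (at y)"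
    "range (frechet_derivative \<phi> (at y)) = {v. lorentz (\<phi> y) v = 0 \<and> lorentz (\<nu> (\<phi> y)) v = 0}"
    using chart_normal[OF \<phi>] by blast
  interpret F: lorentz_frame "\<phi> y" "\<nu> (\<phi> y)" e by (rule e)
  define D where "D = frechet_derivative \<phi> (at y)"
  have linD: "linear D" unfolding D_def using local_parametrization_derivative[OF \<phi>] by (rule has_derivative_linear)
  have injD: "inj D" unfolding D_def using \<phi> unfolding local_parametrization_def by blast
  define C :: "real^'n^'n" where "C = (\<chi> i j. lorentz (D (axis i 1)) (e j))"
  have DC: "D (axis i 1) = (\<Sum>j\<in>UNIV. C $ i $ j *\<^sub>R e j)" for i
  proof -
    have "D (axis i 1) \<in> {v. lorentz (\<phi> y) v = 0 \<and> lorentz (\<nu> (\<phi> y)) v = 0}"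
      unfolding A(4)[symmetric] D_def by blast
    then have "lorentz (D (axis i 1)) (\<phi> y) = 0" "lorentz (D (axis i 1)) (\<nu> (\<phi> y)) = 0"
      by (simp_all add: lorentz_sym)
    then show ?thesis using F.frame_expansion[of "D (axis i 1)"] by (simp add: C_def)
  qed
  have nf: "chart_normal_frame \<phi> y i = A (D (axis i 1))" for i
    using frechet_derivative_at[OF A(3)] by (metis D_def)
  have fi: "\<alpha> *\<^sub>R chart_frame \<phi> y i + \<beta> *\<^sub>R chart_normal_frame \<phi> y i
      = (\<Sum>j\<in>UNIV. (C $ i $ j * (\<alpha> + \<beta> * \<kappa> (\<phi> y) j)) *\<^sub>R e j)" for i
    unfolding nf D_def[symmetric] DC
    by (simp add: linear_sum[OF A(1)] linear_scale[OF A(1)] A(2) scaleR_sum_right sum.distrib[symmetric] algebra_simps)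
  have gram: "gram_det \<phi> y = det (\<chi> i j. lorentz (D (axis i 1)) (D (axis j 1)))"
    by (simp add: gram_det_def D_def)
  show "\<bar>det (tube_matrix \<phi> \<alpha> \<beta> \<alpha>' \<beta>' y)\<bar> =
      \<bar>\<beta>' * snd (\<phi> y) + \<alpha>' * snd (\<nu> (\<phi> y))\<bar> * \<bar>\<Prod>i\<in>UNIV. \<alpha> + \<beta> * \<kappa> (\<phi> y) i\<bar> * sqrt (gram_det \<phi> y)"
    unfolding tube_matrix_def gram by (rule F.abs_det_tube[OF fi DC])
  have "(\<chi> i j. lorentz (D (axis i 1)) (D (axis j 1))) = C ** transpose C"
    by (simp add: vec_eq_iff DC lorentz_sum_left lorentz_sum_right lorentz_simps F.ee
        matrix_matrix_mult_def transpose_def if_distrib mult.commute cong: if_cong)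
  then have g2: "gram_det \<phi> y = (det C)\<^sup>2" unfolding gram by (simp add: det_mul det_transpose power2_eq_square)
  have "inj ((*v) (transpose C))"
  proof (rule injI)
    fix u w :: "real^'n" assume eq: "transpose C *v u = transpose C *v w"
    have Dx: "D x = (\<Sum>j\<in>UNIV. ((transpose C *v x) $ j) *\<^sub>R e j)" for x
    proof -
      have "x = (\<Sum>i\<in>UNIV. x $ i *\<^sub>R axis i 1)"
        by (simp add: vec_eq_iff axis_def if_distrib cong: if_cong)
      then have "D x = (\<Sum>i\<in>UNIV. x $ i *\<^sub>R D (axis i 1))"
        by (metis (no_types, lifting) linear_scale[OF linD] linear_sum[OF linD] sum.cong)
      also have "\<dots> = (\<Sum>i\<in>UNIV. \<Sum>j\<in>UNIV. (x $ i * C $ i $ j) *\<^sub>R e j)"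
        by (simp add: DC scaleR_sum_right)
      also have "\<dots> = (\<Sum>j\<in>UNIV. \<Sum>i\<in>UNIV. (x $ i * C $ i $ j) *\<^sub>R e j)" by (rule sum.swap)
      finally show ?thesis
        by (simp add: matrix_vector_mult_def transpose_def scaleR_sum_left mult.commute)
    qed
    have "D u = D w" using Dx[of u] Dx[of w] eq by simp
    then show "u = w" using injD by (simp add: inj_eq)
  qed
  then have "det (transpose C) \<noteq> 0"
    by (metis invertible_det_nz invertible_left_inverse matrix_left_invertible_injective)
  then show "gram_det \<phi> y > 0" using g2 by (simp add: det_transpose)
qed

lemma continuous_on_tube_matrix:
  assumes \<phi>: "local_parametrization S U \<phi>"
    and c: "continuous_on X \<alpha>" "continuous_on X \<beta>" "continuous_on X \<alpha>'" "continuous_on X \<beta>'"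
    and y: "continuous_on X y" "y ` X \<subseteq> U"
  shows "continuous_on X (\<lambda>x. det (tube_matrix \<phi> (\<alpha> x) (\<beta> x) (\<alpha>' x) (\<beta>' x) (y x)))"
proof (rule continuous_on_det)
  have sm: "higher_differentiable_on U \<phi> m" for m
    using \<phi> unfolding local_parametrization_def smooth_on_def by blast
  have 1: "continuous_on X (\<lambda>x. \<phi> (y x))"
    by (rule continuous_on_compose2[OF higher_differentiable_on_imp_continuous_on[OF sm[of 0]] y])
  have 2: "continuous_on X (\<lambda>x. \<nu> (\<phi> (y x)))"
    by (rule continuous_on_compose2[OF higher_differentiable_on_imp_continuous_on[OF chart_normal_smooth[OF \<phi>, of 0]] y])
  have 3: "continuous_on X (\<lambda>x. chart_frame \<phi> (y x) k)" for k
    by (rule continuous_on_compose2[OF higher_differentiable_on_imp_continuous_on[OF higher_differentiable_on_SucD(2)[OF sm[of "Suc 0"]]] y])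
  have 4: "continuous_on X (\<lambda>x. chart_normal_frame \<phi> (y x) k)" for k
    by (rule continuous_on_compose2[OF higher_differentiable_on_imp_continuous_on[OF
            higher_differentiable_on_SucD(2)[OF chart_normal_smooth[OF \<phi>, of "Suc 0"]]] y])
  show "continuous_on X (\<lambda>x. tube_matrix \<phi> (\<alpha> x) (\<beta> x) (\<alpha>' x) (\<beta>' x) (y x) $ i $ j)" for i j
    by (cases i) (auto simp: tube_matrix_def intro!: continuous_intros c 1 2 3 4)
qed

end

section \<open>Tubes over the boundary and their volume in a chart\<close>

lemma (in h_convex_domain) S_borel: "S \<in> sets borel"
  using compact_frontier by (simp add: borel_compact)

locale tube_data = h_convex_domain \<Omega> for \<Omega> :: "('n::finite option) minkowski set" +
  fixes a b a' b' :: "real \<Rightarrow> real" and R :: real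
  assumes der_a: "\<And>s. (a has_real_derivative a' s) (at s)"
    and der_b: "\<And>s. (b has_real_derivative b' s) (at s)"
    and cont_a': "continuous_on UNIV a'" and cont_b': "continuous_on UNIV b'"
    and inj_tube: "inj_on (tube a b) (S \<times> {0..R})"
begin

lemma cont_ab: "continuous_on X a" "continuous_on X b"
  using der_a der_b by (meson DERIV_isCont continuous_at_imp_continuous_on)+

definition tube_density :: "('n option) minkowski \<Rightarrow> real \<Rightarrow> real" where
  "tube_density p s = \<bar>b' s * snd p + a' s * snd (\<nu> p)\<bar> * \<bar>\<Prod>i\<in>UNIV. a s + b s * \<kappa> p i\<bar>"

text \<open>Volume of the tube per unit of boundary area.\<close>

definition tube_weight :: "('n option) minkowski \<Rightarrow> ennreal" where
  "tube_weight p = (\<integral>\<^sup>+s\<in>{0<..R}. ennreal (tube_density p s) \<partial>lborel)"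

abbreviation "full_tube \<equiv> tube a b ` (S \<times> {0..R})"

lemma continuous_on_tube: "continuous_on (S \<times> X) (tube a b)"
proof -
  have 1: "continuous_on (S \<times> X) (\<lambda>z. \<nu> (fst z))"
    by (rule continuous_on_compose2[OF continuous_on_normal]) (auto intro!: continuous_intros)
  have 2: "continuous_on (S \<times> X) (\<lambda>z. a (snd z))" "continuous_on (S \<times> X) (\<lambda>z. b (snd z))"
    by (rule continuous_on_compose2[OF cont_ab(1)] continuous_on_compose2[OF cont_ab(2)];
      auto intro!: continuous_intros)+
  show ?thesis
    unfolding tube_def case_prod_unfold by (intro continuous_intros 1 2)
qed

lemma compact_S_interval: "compact (S \<times> {0..R})"
  by (intro compact_Times compact_frontier) simp

lemma compact_full_tube: "compact full_tube"
  by (intro compact_continuous_image continuous_on_tube compact_S_interval)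

lemma tube_homeomorphism: obtains h where "homeomorphism (S \<times> {0..R}) full_tube (tube a b) h"
  using homeomorphism_compact[OF compact_S_interval continuous_on_tube refl inj_tube] by blast

text \<open>The closed parameter range makes the tube map a homeomorphism on a compact set, so the
  images over the half-open range are Borel as well.\<close>

lemma tube_image_borel:
  assumes "B \<in> sets borel" "B \<subseteq> S"
  shows "tube a b ` (B \<times> {0<..R}) \<in> sets borel"
proof -
  obtain h where h: "homeomorphism (S \<times> {0..R}) full_tube (tube a b) h" using tube_homeomorphism .
  have "full_tube \<in> sets borel" using compact_full_tube by (simp add: borel_compact)
  moreover have "B \<times> {0<..R} \<in> sets borel"
    using assms(1) by (subst borel_prod[symmetric]) (intro pair_measureI, auto)
  ultimately show ?thesis
    by (rule borel_homeomorphic_image[OF h]) (use assms(2) in auto)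
qed

text \<open>Change of variables in (y, s) followed by Tonelli: the Jacobian splits into the tube
  density and the area density of the chart. Tonelli also delivers the measurability of their
  product integrated over \<open>s\<close>.\<close>

lemma chart_tube_emeasure:
  assumes \<phi>: "local_parametrization S U \<phi>" and A: "A \<in> sets borel" "A \<subseteq> U"
  shows "emeasure lborel (tube a b ` (\<phi> ` A \<times> {0<..R})) =
      (\<integral>\<^sup>+y\<in>A. tube_weight (\<phi> y) * ennreal (sqrt (gram_det \<phi> y)) \<partial>lborel)"
    and "(\<lambda>y. tube_weight (\<phi> y) * ennreal (sqrt (gram_det \<phi> y)) * indicator A y) \<in> borel_measurable borel"
    and "\<phi> ` A \<in> sets borel"
proof -
  have U: "open U" and sm: "higher_differentiable_on U \<phi> m" for m
    using \<phi> unfolding local_parametrization_def smooth_on_def by blast+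
  have \<phi>S: "\<phi> ` U \<subseteq> S" by (rule chart_subset[OF \<phi>])
  obtain \<psi> where \<psi>: "homeomorphism U (\<phi> ` U) \<phi> \<psi>"
    and op: "openin (top_of_set S) (\<phi> ` U)" using \<phi> unfolding local_parametrization_def by blast
  have \<phi>U: "\<phi> ` U \<in> sets borel"
    using op S_borel unfolding openin_open by (metis borel_open sets.Int)
  show \<phi>A: "\<phi> ` A \<in> sets borel" by (rule borel_homeomorphic_image[OF \<psi> \<phi>U A])
  define g where "g = (\<lambda>x. tube a b (\<phi> (fst (vec_pair x)), snd (vec_pair x)))"
  define X where "X = vec_pair -` (A \<times> {0<..R})"
  have "A \<times> {0<..R} \<in> sets borel"
    using A(1) by (subst borel_prod[symmetric]) (intro pair_measureI, auto)
  then have XB: "X \<in> sets borel"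
    unfolding X_def using measurable_sets_borel[OF borel_measurable_linear_maps(2)] by blast
  have X: "X = pair_vec ` (A \<times> {0<..R})"
  proof (intro equalityI subsetI)
    fix x assume "x \<in> X"
    then show "x \<in> pair_vec ` (A \<times> {0<..R})" unfolding X_def by (intro image_eqI[of _ _ "vec_pair x"]) simp_all
  qed (auto simp: X_def)
  have "\<phi> ` A \<times> {0<..R} = (\<lambda>q. (\<phi> (fst q), snd q)) ` (A \<times> {0<..R})" by force
  then have gX: "g ` X = tube a b ` (\<phi> ` A \<times> {0<..R})"
    unfolding X g_def by (simp add: image_image)
  define \<nu>\<phi> where "\<nu>\<phi> = (\<lambda>y. \<nu> (\<phi> y))"
  define g' where "g' = (\<lambda>x v. let y = fst (vec_pair x); s = snd (vec_pair x); \<xi> = fst (vec_pair v); r = snd (vec_pair v) in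
      fst (a s *\<^sub>R frechet_derivative \<phi> (at y) \<xi> + (r * a' s) *\<^sub>R \<phi> y
         + (b s *\<^sub>R frechet_derivative \<nu>\<phi> (at y) \<xi> + (r * b' s) *\<^sub>R \<nu>\<phi> y)))"
  have der: "(g has_derivative g' x) (at x)" if "x \<in> X" for x
  proof -
    define y s where "y = fst (vec_pair x)" and "s = snd (vec_pair x)"
    have yU: "y \<in> U" using that A(2) by (auto simp: X_def y_def)
    have vp: "(vec_pair has_derivative vec_pair) (at x)"
      by (rule bounded_linear_imp_has_derivative[OF bounded_linear_vec_pair])
    have d1: "((\<lambda>x. \<phi> (fst (vec_pair x))) has_derivative (\<lambda>v. frechet_derivative \<phi> (at y) (fst (vec_pair v)))) (at x)"
      using diff_chain_at[OF has_derivative_fst[OF vp], of \<phi>] local_parametrization_derivative[OF \<phi> yU]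
      by (simp add: o_def y_def)
    have "higher_differentiable_on U \<nu>\<phi> (Suc 0)" unfolding \<nu>\<phi>_def by (rule chart_normal_smooth[OF \<phi>])
    from higher_differentiable_on_SucD(1)[OF this yU]
    have d2: "((\<lambda>x. \<nu>\<phi> (fst (vec_pair x))) has_derivative (\<lambda>v. frechet_derivative \<nu>\<phi> (at y) (fst (vec_pair v)))) (at x)"
      using diff_chain_at[OF has_derivative_fst[OF vp], of \<nu>\<phi>] by (simp add: o_def y_def)
    have real_chain: "((\<lambda>x. f (snd (vec_pair x))) has_derivative (\<lambda>v. snd (vec_pair v) * f' s)) (at x)"
      if "\<And>s. (f has_real_derivative f' s) (at s)" for f f' :: "real \<Rightarrow> real"
    proof -
      have "(f has_derivative (\<lambda>r. r * f' s)) (at s)"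
        using that[of s] by (simp add: has_field_derivative_def mult_commute_abs)
      from diff_chain_at[OF has_derivative_snd[OF vp] this[unfolded s_def]] show ?thesis
        by (simp add: o_def s_def)
    qed
    have "((\<lambda>x. fst (a (snd (vec_pair x)) *\<^sub>R \<phi> (fst (vec_pair x)) + b (snd (vec_pair x)) *\<^sub>R \<nu>\<phi> (fst (vec_pair x))))
      has_derivative (\<lambda>v. fst ((a s *\<^sub>R frechet_derivative \<phi> (at y) (fst (vec_pair v)) + (snd (vec_pair v) * a' s) *\<^sub>R \<phi> y)
         + (b s *\<^sub>R frechet_derivative \<nu>\<phi> (at y) (fst (vec_pair v)) + (snd (vec_pair v) * b' s) *\<^sub>R \<nu>\<phi> y)))) (at x)"
      unfolding y_def s_def
      by (intro has_derivative_fst has_derivative_add has_derivative_scaleR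
          d1[unfolded y_def] d2[unfolded y_def] real_chain[OF der_a, unfolded s_def] real_chain[OF der_b, unfolded s_def])
    then show ?thesis by (simp add: g_def g'_def tube_def \<nu>\<phi>_def Let_def y_def s_def)
  qed
  have inj: "inj_on g X"
  proof (rule inj_onI)
    fix x x' assume x: "x \<in> X" "x' \<in> X" "g x = g x'"
    have "(\<phi> (fst (vec_pair z)), snd (vec_pair z)) \<in> S \<times> {0..R}" if "z \<in> X" for z
    proof -
      have "fst (vec_pair z) \<in> U" "snd (vec_pair z) \<in> {0<..R}" using that A(2) by (auto simp: X_def)
      then show ?thesis using \<phi>S by auto
    qed
    then have "(\<phi> (fst (vec_pair x)), snd (vec_pair x)) = (\<phi> (fst (vec_pair x')), snd (vec_pair x'))"
      using inj_tube x unfolding inj_on_def g_def by blast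
    moreover have "fst (vec_pair x) \<in> U" "fst (vec_pair x') \<in> U" using x A(2) by (auto simp: X_def)
    ultimately have "vec_pair x = vec_pair x'"
      using \<psi> unfolding homeomorphism_def by (metis Pair_inject prod_eqI)
    then show "x = x'" by (metis pair_vec_inverse(1))
  qed
  define T where "T = (\<lambda>x. tube_matrix \<phi> (a (snd (vec_pair x))) (b (snd (vec_pair x))) (a' (snd (vec_pair x))) (b' (snd (vec_pair x))) (fst (vec_pair x)))"
  have lin0: "frechet_derivative h (at y) 0 = 0" if "higher_differentiable_on U h (Suc 0)" "y \<in> U"
    for h :: "real^'n \<Rightarrow> ('n option) minkowski" and y
    using linear_0[OF has_derivative_linear[OF higher_differentiable_on_SucD(1)[OF that]]] .
  have mat: "det (matrix (g' x)) = det (T x)" if "x \<in> X" for x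
  proof -
    have yU: "fst (vec_pair x) \<in> U" using that A(2) by (auto simp: X_def)
    have z: "frechet_derivative \<phi> (at (fst (vec_pair x))) 0 = 0" "frechet_derivative \<nu>\<phi> (at (fst (vec_pair x))) 0 = 0"
      using lin0[OF sm yU] lin0[OF chart_normal_smooth[OF \<phi>] yU] by (simp_all add: \<nu>\<phi>_def)
    have ax: "vec_pair (axis (Some k) 1) = (axis k 1, 0)" "vec_pair (axis None 1) = (0, 1)" for k :: 'n
      by (metis pair_vec_axis pair_vec_inverse(2))+
    have "matrix (g' x) $ i $ j = T x $ j $ i" for i j
    proof (cases j)
      case None
      then show ?thesis by (simp add: matrix_def g'_def T_def tube_matrix_def ax z[unfolded \<nu>\<phi>_def] Let_def \<nu>\<phi>_def)
    next
      case (Some k)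
      then show ?thesis by (simp add: matrix_def g'_def T_def tube_matrix_def ax Let_def \<nu>\<phi>_def)
    qed
    then have "matrix (g' x) = transpose (T x)" by (simp add: vec_eq_iff transpose_def)
    then show ?thesis by (simp add: det_transpose)
  qed
  define d where "d = (\<lambda>x. ennreal \<bar>det (T x)\<bar> * indicator X x)"
  have dm: "d \<in> borel_measurable borel"
  proof -
    \<comment> \<open>The matrix is continuous over the open chart domain, so measurability is
      proved there and restricted to \<open>X\<close> afterwards.\<close>
    define XU where "XU = vec_pair -` (U \<times> UNIV)"
    have cvp: "continuous_on Z vec_pair" for Z using bounded_linear_vec_pair by (rule linear_continuous_on)
    have "open XU" unfolding XU_def by (intro open_vimage open_Times U cvp open_UNIV)
    have cc: "continuous_on XU (\<lambda>x. f (snd (vec_pair x)))" if "continuous_on UNIV f" for f :: "real \<Rightarrow> real"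
      by (rule continuous_on_compose2[OF that]) (auto intro!: continuous_intros cvp)
    have "continuous_on XU (\<lambda>x. \<bar>det (T x)\<bar>)"
      unfolding T_def by (intro continuous_intros continuous_on_tube_matrix[OF \<phi>] cc cont_ab cont_a' cont_b' cvp)
        (auto simp: XU_def)
    then have "(\<lambda>x. indicator XU x *\<^sub>R \<bar>det (T x)\<bar>) \<in> borel_measurable borel"
      using \<open>open XU\<close> by (intro borel_measurable_continuous_on_indicator) auto
    then have "(\<lambda>x. ennreal (indicator XU x *\<^sub>R \<bar>det (T x)\<bar>) * indicator X x) \<in> borel_measurable borel"
      using XB by (intro borel_measurable_times_ennreal measurable_compose[OF _ measurable_ennreal] borel_measurable_indicator)
    moreover have "X \<subseteq> XU" using A(2) by (auto simp: X_def XU_def)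
    then have "d = (\<lambda>x. ennreal (indicator XU x *\<^sub>R \<bar>det (T x)\<bar>) * indicator X x)"
      by (auto simp: d_def fun_eq_iff indicator_def)
    ultimately show ?thesis by simp
  qed
  have deq: "ennreal \<bar>det (matrix (g' x))\<bar> * indicator X x = d x" for x
    using mat by (simp add: d_def indicator_def)
  have "emeasure lborel (g ` X) = (\<integral>\<^sup>+x\<in>X. ennreal \<bar>det (matrix (g' x))\<bar> \<partial>lborel)"
  proof (rule emeasure_differentiable_image[OF XB _ _ der inj])
    show "g ` X \<in> sets borel" unfolding gX using tube_image_borel \<phi>A \<phi>S A(2) by (meson image_mono order_trans)
    have "g ` X \<subseteq> full_tube" unfolding gX using \<phi>S A(2) by (intro image_mono) auto
    then show "bounded (g ` X)" using compact_full_tube bounded_subset compact_imp_bounded by blast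
    show "(\<lambda>x. ennreal \<bar>det (matrix (g' x))\<bar> * indicator X x) \<in> borel_measurable borel"
      unfolding deq by (rule dm)
  qed
  also have "\<dots> = (\<integral>\<^sup>+y. \<integral>\<^sup>+s. d (pair_vec (y, s)) \<partial>lborel \<partial>lborel)"
    unfolding deq by (rule nn_integral_pair_vec(1)[OF dm])
  also have inner: "(\<lambda>y. \<integral>\<^sup>+s. d (pair_vec (y, s)) \<partial>lborel) =
      (\<lambda>y. tube_weight (\<phi> y) * ennreal (sqrt (gram_det \<phi> y)) * indicator A y)"
  proof
    fix y
    show "(\<integral>\<^sup>+s. d (pair_vec (y, s)) \<partial>lborel) = tube_weight (\<phi> y) * ennreal (sqrt (gram_det \<phi> y)) * indicator A y"
    proof (cases "y \<in> A")
      case True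
      then have yU: "y \<in> U" using A(2) by blast
      have cs: "continuous_on {0..R} (\<lambda>s. tube_density (\<phi> y) s)"
        unfolding tube_density_def
        by (intro continuous_intros cont_ab continuous_on_subset[OF cont_a'] continuous_on_subset[OF cont_b']) auto
      then have "continuous_on {0<..R} (\<lambda>s. tube_density (\<phi> y) s)" by (rule continuous_on_subset) auto
      then have "(\<lambda>s. indicator {0<..R} s *\<^sub>R tube_density (\<phi> y) s) \<in> borel_measurable borel"
        by (intro borel_measurable_continuous_on_indicator) auto
      then have "(\<lambda>s. ennreal (indicator {0<..R} s *\<^sub>R tube_density (\<phi> y) s)) \<in> borel_measurable borel"
        by (rule measurable_compose[OF _ measurable_ennreal])
      moreover have e: "ennreal (tube_density (\<phi> y) s) * indicator {0<..R} s = ennreal (indicator {0<..R} s *\<^sub>R tube_density (\<phi> y) s)" for s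
        by (simp add: indicator_def)
      ultimately have m: "(\<lambda>s. ennreal (tube_density (\<phi> y) s) * indicator {0<..R} s) \<in> borel_measurable lborel" by simp
      have "d (pair_vec (y, s)) = ennreal (tube_density (\<phi> y) s) * indicator {0<..R} s * ennreal (sqrt (gram_det \<phi> y))" for s
      proof -
        have "pair_vec (y, s) \<in> X \<longleftrightarrow> s \<in> {0<..R}" using True by (simp add: X_def)
        moreover have "\<bar>det (T (pair_vec (y, s)))\<bar> = tube_density (\<phi> y) s * sqrt (gram_det \<phi> y)"
          unfolding T_def by (simp add: chart_jacobian(1)[OF \<phi> yU] tube_density_def)
        moreover have "tube_density (\<phi> y) s \<ge> 0" by (simp add: tube_density_def)
        ultimately show ?thesis by (simp add: d_def ennreal_mult' indicator_def)
      qed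
      then show ?thesis using True m by (simp add: nn_integral_multc tube_weight_def)
    next
      case False
      then have "d (pair_vec (y, s)) = 0" for s by (simp add: d_def X_def indicator_def)
      then show ?thesis using False by simp
    qed
  qed
  finally show "emeasure lborel (tube a b ` (\<phi> ` A \<times> {0<..R})) =
      (\<integral>\<^sup>+y\<in>A. tube_weight (\<phi> y) * ennreal (sqrt (gram_det \<phi> y)) \<partial>lborel)"
    unfolding gX .
  show "(\<lambda>y. tube_weight (\<phi> y) * ennreal (sqrt (gram_det \<phi> y)) * indicator A y) \<in> borel_measurable borel"
    unfolding inner[symmetric] by (rule nn_integral_pair_vec(2)[OF dm])
qed

end

section \<open>The area measure of the boundary\<close>

lemma prod_elem_sym_expansion:
  fixes x :: "'n::finite \<Rightarrow> real"
  shows "(\<Prod>i\<in>UNIV. c + d * x i) = (\<Sum>k=0..CARD('n). c ^ (CARD('n) - k) * d ^ k * elem_sym k x)"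
proof -
  have "(\<Prod>i\<in>UNIV. d * x i + c) = (\<Sum>B\<in>Pow UNIV. (\<Prod>i\<in>B. d * x i) * (\<Prod>i\<in>UNIV - B. c))"
    by (rule prod_add) simp
  also have "\<dots> = (\<Sum>B\<in>Pow UNIV. c ^ (CARD('n) - card B) * d ^ card B * (\<Prod>i\<in>B. x i))"
    by (intro sum.cong refl) (simp add: prod.distrib card_Diff_subset mult_ac)
  also have "\<dots> = (\<Sum>k=0..CARD('n). \<Sum>B\<in>{B \<in> Pow UNIV. card B = k}. c ^ (CARD('n) - card B) * d ^ card B * (\<Prod>i\<in>B. x i))"
    by (rule sum.group[symmetric]) (auto simp: card_mono)
  also have "\<dots> = (\<Sum>k=0..CARD('n). c ^ (CARD('n) - k) * d ^ k * elem_sym k x)"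
    by (intro sum.cong refl) (simp add: elem_sym_def sum_distrib_left)
  finally show ?thesis by (simp add: add.commute)
qed

lemma elem_sym_nonneg: "(\<And>i. x i \<ge> 0) \<Longrightarrow> elem_sym k x \<ge> 0"
  unfolding elem_sym_def by (intro sum_nonneg prod_nonneg) auto

lemma elem_sym_0: "elem_sym 0 x = 1"
  by (simp add: elem_sym_def)

lemma elem_sym_greater:
  fixes x :: "'n::finite \<Rightarrow> real"
  assumes "k > CARD('n)"
  shows "elem_sym k x = 0"
proof -
  have "{I :: 'n set. card I = k} = {}" using assms card_mono[of "UNIV :: 'n set"] by (auto simp: not_le[symmetric])
  then show ?thesis by (simp add: elem_sym_def)
qed

text \<open>
  The numbering of the principal curvatures is chosen at each point separately, so that the
  single curvatures need not be measurable. Their symmetric functions are, as the coefficients of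
  a polynomial with measurable values.
\<close>

lemma measurable_elem_sym:
  fixes f :: "'a \<Rightarrow> 'n::finite \<Rightarrow> real"
  assumes "\<And>x. x \<ge> 0 \<Longrightarrow> (\<lambda>p. \<Prod>i\<in>UNIV. 1 + x * f p i) \<in> borel_measurable M"
  shows "(\<lambda>p. elem_sym k (f p)) \<in> borel_measurable M"
proof (induction k rule: less_induct)
  case (less k)
  define P where "P = (\<lambda>x p. \<Prod>i\<in>UNIV. 1 + x * f p i)"
  show ?case
  proof (cases "k > CARD('n)")
    case True
    then show ?thesis by (simp add: elem_sym_greater)
  next
    case False
    define h where "h = (\<lambda>m :: nat. 1 / real (Suc m))"
    \<comment> \<open>The polynomial at a small argument, without its terms of degree below
      \<open>k\<close>, divided by the \<open>k\<close>-th power: only the coefficient of degree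
      \<open>k\<close> survives in the limit.\<close>
    define g where "g = (\<lambda>m p. (P (h m) p - (\<Sum>j<k. h m ^ j * elem_sym j (f p))) / h m ^ k)"
    show ?thesis
    proof (rule borel_measurable_LIMSEQ_real[where u = g])
      show "g m \<in> borel_measurable M" for m
      proof -
        have "(\<lambda>p. P (h m) p) \<in> borel_measurable M" unfolding P_def by (rule assms) (simp add: h_def)
        moreover have "(\<lambda>p. \<Sum>j<k. h m ^ j * elem_sym j (f p)) \<in> borel_measurable M"
          by (intro borel_measurable_sum borel_measurable_times borel_measurable_const less) simp
        ultimately show ?thesis unfolding g_def by (intro borel_measurable_divide borel_measurable_diff borel_measurable_const)
      qed
      fix p
      have split: "{0..CARD('n)} = {..<k} \<union> {k..CARD('n)}" using False by auto
      have "g m p = (\<Sum>j=k..CARD('n). h m ^ (j - k) * elem_sym j (f p))" for m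
      proof -
        have hk: "h m ^ k \<noteq> 0" by (simp add: h_def)
        have "P (h m) p = (\<Sum>j=0..CARD('n). h m ^ j * elem_sym j (f p))"
          unfolding P_def by (simp add: prod_elem_sym_expansion)
        also have "\<dots> = (\<Sum>j<k. h m ^ j * elem_sym j (f p)) + (\<Sum>j=k..CARD('n). h m ^ j * elem_sym j (f p))"
          unfolding split by (rule sum.union_disjoint) auto
        finally have "g m p = (\<Sum>j=k..CARD('n). h m ^ j * elem_sym j (f p)) / h m ^ k" by (simp add: g_def)
        also have "\<dots> = (\<Sum>j=k..CARD('n). h m ^ (j - k) * elem_sym j (f p))"
          unfolding sum_divide_distrib
          by (intro sum.cong refl) (use hk in \<open>auto simp: power_diff\<close>)
        finally show ?thesis .
      qed
      moreover have "h \<longlonglongrightarrow> 0" unfolding h_def using LIMSEQ_inverse_real_of_nat by (simp add: inverse_eq_divide)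
      then have "(\<lambda>m. \<Sum>j=k..CARD('n). h m ^ (j - k) * elem_sym j (f p))
          \<longlonglongrightarrow> (\<Sum>j=k..CARD('n). 0 ^ (j - k) * elem_sym j (f p))"
        by (intro tendsto_intros)
      moreover have "(\<Sum>j=k..CARD('n). 0 ^ (j - k) * elem_sym j (f p)) = (\<Sum>j=k..CARD('n). if j = k then elem_sym k (f p) else 0)"
        by (intro sum.cong refl) (auto simp: power_0_left)
      ultimately show "(\<lambda>m. g m p) \<longlonglongrightarrow> elem_sym k (f p)" using False by simp
    qed
  qed
qed

section \<open>Charts and measures on the boundary\<close>

context h_convex_domain
begin

lemma chart_data:
  assumes "local_parametrization S U \<phi>"
  obtains \<psi> where "homeomorphism U (\<phi> ` U) \<phi> \<psi>" "open U" "\<phi> ` U \<in> sets borel" "\<phi> ` U \<subseteq> S"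
proof -
  obtain \<psi> where "homeomorphism U (\<phi> ` U) \<phi> \<psi>" "open U" "openin (top_of_set S) (\<phi> ` U)"
    using assms unfolding local_parametrization_def by blast
  moreover from this have "\<phi> ` U \<in> sets borel"
    using S_borel unfolding openin_open by (metis borel_open sets.Int)
  ultimately show ?thesis using that chart_subset[OF assms] by blast
qed

lemma chart_image_borel:
  assumes "local_parametrization S U \<phi>" "A \<in> sets borel" "A \<subseteq> U"
  shows "\<phi> ` A \<in> sets borel" "\<phi> ` A \<subseteq> S"
proof -
  obtain \<psi> where \<psi>: "homeomorphism U (\<phi> ` U) \<phi> \<psi>" "open U" "\<phi> ` U \<in> sets borel" "\<phi> ` U \<subseteq> S"
    using chart_data[OF assms(1)] .
  show "\<phi> ` A \<in> sets borel" by (rule borel_homeomorphic_image[OF \<psi>(1,3) assms(2,3)])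
  show "\<phi> ` A \<subseteq> S" using \<psi>(4) assms(3) by blast
qed

lemma chart_preimage_borel:
  assumes "local_parametrization S U \<phi>" "B \<in> sets borel" "B \<subseteq> \<phi> ` U"
  obtains A where "A \<in> sets borel" "A \<subseteq> U" "B = \<phi> ` A"
proof -
  obtain \<psi> where \<psi>: "homeomorphism U (\<phi> ` U) \<phi> \<psi>" "open U" "\<phi> ` U \<in> sets borel" "\<phi> ` U \<subseteq> S"
    using chart_data[OF assms(1)] .
  have "\<psi> ` B \<in> sets borel"
    by (rule borel_homeomorphic_image[OF homeomorphism_symD[OF \<psi>(1)]]) (use \<psi>(2) assms in auto)
  moreover have "\<psi> ` B \<subseteq> U"
    using image_mono[OF assms(3), of \<psi>] homeomorphism_image2[OF \<psi>(1)] by simp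
  moreover have "B = \<phi> ` \<psi> ` B"
  proof -
    have "\<phi> (\<psi> x) = x" if "x \<in> B" for x
      by (rule homeomorphism_apply2[OF \<psi>(1) subsetD[OF assms(3) that]])
    then show ?thesis by (force simp: image_image)
  qed
  ultimately show ?thesis using that by blast
qed

lemma finite_atlas:
  obtains F where "finite F" "\<forall>(U, \<phi>)\<in>F. local_parametrization S U \<phi>"
    "S \<subseteq> (\<Union>(U, \<phi>)\<in>F. \<phi> ` U)"
proof -
  have "\<forall>p\<in>S. \<exists>c. local_parametrization S (fst (fst c)) (snd (fst c)) \<and> open (snd c) \<and> p \<in> snd c \<and>
      S \<inter> snd c = snd (fst c) ` fst (fst c)"
  proof
    fix p assume "p \<in> S"
    obtain U \<phi> y where \<phi>: "local_parametrization S U \<phi>" "y \<in> U" "\<phi> y = p" using ex_chart[OF \<open>p \<in> S\<close>] .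
    then obtain O' where "open O'" "\<phi> ` U = S \<inter> O'" unfolding local_parametrization_def openin_open by blast
    with \<phi> show "\<exists>c. local_parametrization S (fst (fst c)) (snd (fst c)) \<and> open (snd c) \<and> p \<in> snd c \<and>
      S \<inter> snd c = snd (fst c) ` fst (fst c)"
      by (intro exI[of _ "((U, \<phi>), O')"]) auto
  qed
  then obtain c where c: "\<And>p. p \<in> S \<Longrightarrow> local_parametrization S (fst (fst (c p))) (snd (fst (c p)))"
    "\<And>p. p \<in> S \<Longrightarrow> open (snd (c p))" "\<And>p. p \<in> S \<Longrightarrow> p \<in> snd (c p)"
    "\<And>p. p \<in> S \<Longrightarrow> S \<inter> snd (c p) = snd (fst (c p)) ` fst (fst (c p))"
    by metis
  obtain P where P: "P \<subseteq> S" "finite P" "S \<subseteq> (\<Union>p\<in>P. snd (c p))"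
  proof (rule compactE_image[OF compact_frontier, of S "\<lambda>p. snd (c p)"])
    show "S \<subseteq> (\<Union>p\<in>S. snd (c p))" using c(3) by (intro subsetI UN_I)
  qed (use c(2) in simp_all)
  show ?thesis
  proof
    show "finite ((\<lambda>p. fst (c p)) ` P)" using P(2) by simp
    show "\<forall>(U, \<phi>)\<in>(\<lambda>p. fst (c p)) ` P. local_parametrization S U \<phi>"
      using c(1) P(1) by (auto simp: case_prod_unfold)
    show "S \<subseteq> (\<Union>(U, \<phi>)\<in>(\<lambda>p. fst (c p)) ` P. \<phi> ` U)"
    proof
      fix q assume "q \<in> S"
      then obtain p where p: "p \<in> P" "q \<in> snd (c p)" using P(3) by blast
      then have "q \<in> snd (fst (c p)) ` fst (fst (c p))" using c(4) P(1) \<open>q \<in> S\<close> by blast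
      then show "q \<in> (\<Union>(U, \<phi>)\<in>(\<lambda>p. fst (c p)) ` P. \<phi> ` U)"
        using p(1) by (intro UN_I[of "fst (c p)"]) (auto simp: case_prod_unfold)
    qed
  qed
qed

text \<open>Finitely many charts cover the boundary; a Borel set is cut by one chart at a time, and
  the part inside is the image of a Borel set of parameters.\<close>

lemma surface_measure_eqI:
  assumes M: "sets M1 = sets (restrict_space borel S)" "sets M2 = sets (restrict_space borel S)"
    and eq: "\<And>U \<phi> A. local_parametrization S U \<phi> \<Longrightarrow> A \<in> sets borel \<Longrightarrow> A \<subseteq> U \<Longrightarrow>
      emeasure M1 (\<phi> ` A) = emeasure M2 (\<phi> ` A)"
  shows "M1 = M2"
proof -
  have sets: "B \<in> sets (restrict_space borel S) \<longleftrightarrow> B \<subseteq> S \<and> B \<in> sets borel" for B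
    using S_borel by (simp add: sets_restrict_space_iff)
  obtain F where F: "finite F" "\<forall>(U, \<phi>)\<in>F. local_parametrization S U \<phi>"
    "S \<subseteq> (\<Union>(U, \<phi>)\<in>F. \<phi> ` U)" using finite_atlas .
  have "\<forall>B. B \<in> sets borel \<longrightarrow> B \<subseteq> S \<longrightarrow> B \<subseteq> (\<Union>(U, \<phi>)\<in>F. \<phi> ` U) \<longrightarrow> emeasure M1 B = emeasure M2 B"
    using F(1,2)
  proof (induction F rule: finite_induct)
    case (insert c F)
    obtain U \<phi> where c: "c = (U, \<phi>)" by (cases c)
    have \<phi>: "local_parametrization S U \<phi>" using insert.prems c by blast
    obtain \<psi> where "homeomorphism U (\<phi> ` U) \<phi> \<psi>" "open U" and U: "\<phi> ` U \<in> sets borel" "\<phi> ` U \<subseteq> S"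
      using chart_data[OF \<phi>] .
    show ?case
    proof (intro allI impI)
      fix B assume B: "B \<in> sets borel" "B \<subseteq> S" "B \<subseteq> (\<Union>(U, \<phi>)\<in>insert c F. \<phi> ` U)"
      define B1 B2 where "B1 = B \<inter> \<phi> ` U" and "B2 = B - \<phi> ` U"
      have b: "B1 \<in> sets borel" "B2 \<in> sets borel" "B1 \<subseteq> S" "B2 \<subseteq> S" "B1 \<inter> B2 = {}" "B = B1 \<union> B2"
        using B U by (auto simp: B1_def B2_def)
      have "B2 \<subseteq> (\<Union>(U, \<phi>)\<in>F. \<phi> ` U)" using B(3) by (auto simp: B2_def c)
      then have e2: "emeasure M1 B2 = emeasure M2 B2" using insert.IH insert.prems b by blast
      obtain A where "A \<in> sets borel" "A \<subseteq> U" "B1 = \<phi> ` A"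
        using chart_preimage_borel[OF \<phi> b(1)] by (auto simp: B1_def)
      then have e1: "emeasure M1 B1 = emeasure M2 B1" using eq[OF \<phi>] by blast
      have "emeasure M1 B = emeasure M1 B1 + emeasure M1 B2" "emeasure M2 B = emeasure M2 B1 + emeasure M2 B2"
        unfolding b(6) using b M by (simp_all add: plus_emeasure sets)
      then show "emeasure M1 B = emeasure M2 B" using e1 e2 by simp
    qed
  qed auto
  then show ?thesis
    using M F(3) by (intro measure_eqI) (auto simp: sets)
qed

text \<open>Stated for an arbitrary density \<open>k\<close>, so that it serves both the area and
  the tube measure, whose density has the weight as an additional factor. The measure is transported
  to the parameter domain by the inverse chart.\<close>

lemma surface_nn_integral:
  assumes M: "sets M = sets (restrict_space borel S)" and \<phi>: "local_parametrization S U \<phi>"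
    and k: "(\<lambda>y. k y * indicator U y) \<in> borel_measurable borel"
      "\<And>A. A \<in> sets borel \<Longrightarrow> A \<subseteq> U \<Longrightarrow> emeasure M (\<phi> ` A) = (\<integral>\<^sup>+y\<in>A. k y \<partial>lborel)"
    and h: "h \<in> borel_measurable (restrict_space borel S)" and A: "A \<in> sets borel" "A \<subseteq> U"
  shows "(\<integral>\<^sup>+p\<in>\<phi> ` A. h p \<partial>M) = (\<integral>\<^sup>+y\<in>A. h (\<phi> y) * k y \<partial>lborel)"
proof -
  have sets: "B \<in> sets M \<longleftrightarrow> B \<subseteq> S \<and> B \<in> sets borel" for B
    using S_borel M by (simp add: sets_restrict_space_iff)
  have space: "space M = S" using sets_eq_imp_space_eq[OF M] by (simp add: space_restrict_space)
  obtain \<psi> where \<psi>: "homeomorphism U (\<phi> ` U) \<phi> \<psi>" "open U" "\<phi> ` U \<in> sets borel" "\<phi> ` U \<subseteq> S"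
    using chart_data[OF \<phi>] .
  have UB: "U \<in> sets borel" using \<psi>(2) by simp
  have inv: "\<psi> (\<phi> y) = y" if "y \<in> U" for y using \<psi>(1) that unfolding homeomorphism_def by blast
  have inv2: "\<psi> p \<in> U" "\<phi> (\<psi> p) = p" if "p \<in> \<phi> ` U" for p
    using \<psi>(1) that unfolding homeomorphism_def by blast+
  define M' where "M' = restrict_space M (\<phi> ` U)"
  have \<phi>UM: "\<phi> ` U \<inter> space M \<in> sets M" using \<psi>(3,4) by (simp add: sets space Int_absorb2)
  have sets': "B \<in> sets M' \<longleftrightarrow> B \<subseteq> \<phi> ` U \<and> B \<in> sets borel" for B
    unfolding M'_def using \<phi>UM \<psi>(4) by (auto simp: sets_restrict_space_iff sets)
  have space': "space M' = \<phi> ` U" using \<psi>(4) by (auto simp: M'_def space_restrict_space space)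
  have sM': "sets M' = sets (restrict_space borel (\<phi> ` U))"
    using sets' \<psi>(3) by (auto simp: sets_restrict_space_iff)
  have m\<psi>: "\<psi> \<in> borel_measurable M'"
    unfolding measurable_cong_sets[OF sM' refl]
    by (rule borel_measurable_continuous_on_restrict) (use \<psi>(1) in \<open>simp add: homeomorphism_def\<close>)
  define N where "N = distr M' borel \<psi>"
  have N: "N = density lborel (\<lambda>y. k y * indicator U y)"
  proof (rule measure_eqI)
    fix B assume "B \<in> sets N"
    then have B: "B \<in> sets borel" by (simp add: N_def)
    have "emeasure N B = emeasure M' (\<psi> -` B \<inter> space M')"
      unfolding N_def by (rule emeasure_distr[OF m\<psi> B])
    also have "\<psi> -` B \<inter> space M' = \<phi> ` (B \<inter> U)"
      unfolding space' using inv inv2 by (auto simp: image_iff)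
    also have "emeasure M' (\<phi> ` (B \<inter> U)) = emeasure M (\<phi> ` (B \<inter> U))"
      unfolding M'_def by (rule emeasure_restrict_space[OF \<phi>UM]) auto
    also have "\<dots> = (\<integral>\<^sup>+y\<in>B \<inter> U. k y \<partial>lborel)" by (rule k(2)) (use B UB in auto)
    also have "\<dots> = (\<integral>\<^sup>+y\<in>B. (k y * indicator U y) \<partial>lborel)"
      by (intro nn_integral_cong) (simp add: indicator_def)
    also have "\<dots> = emeasure (density lborel (\<lambda>y. k y * indicator U y)) B"
      using k(1) B by (subst emeasure_density) auto
    finally show "emeasure N B = emeasure (density lborel (\<lambda>y. k y * indicator U y)) B" .
  qed (simp add: N_def)
  have "continuous_on U \<phi>" using \<psi>(1) by (simp add: homeomorphism_def)
  then have "\<phi> \<in> measurable (restrict_space borel U) (restrict_space borel S)"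
    using \<psi>(4) by (intro measurable_restrict_space2 borel_measurable_continuous_on_restrict) (auto simp: space_restrict_space)
  from measurable_compose[OF this h] have "(\<lambda>y. h (\<phi> y) * indicator U y) \<in> borel_measurable borel"
    using UB by (subst (asm) borel_measurable_restrict_space_iff_ennreal) auto
  then have m: "(\<lambda>y. h (\<phi> y) * indicator U y * indicator A y) \<in> borel_measurable borel"
    by (rule borel_measurable_times_ennreal[OF _ borel_measurable_indicator[OF A(1)]])
  have "(\<integral>\<^sup>+p\<in>\<phi> ` A. h p \<partial>M) = (\<integral>\<^sup>+p. h p * indicator (\<phi> ` A) p * indicator (\<phi> ` U) p \<partial>M)"
    using A(2) by (intro nn_integral_cong) (auto simp: indicator_def)
  also have "\<dots> = (\<integral>\<^sup>+p. h p * indicator (\<phi> ` A) p \<partial>M')"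
    unfolding M'_def by (rule nn_integral_restrict_space[OF \<phi>UM, symmetric])
  also have "\<dots> = (\<integral>\<^sup>+p. (\<lambda>y. h (\<phi> y) * indicator U y * indicator A y) (\<psi> p) \<partial>M')"
  proof (rule nn_integral_cong)
    fix p assume "p \<in> space M'"
    then have p: "p \<in> \<phi> ` U" by (simp add: space')
    have "p \<in> \<phi> ` A \<longleftrightarrow> \<psi> p \<in> A" using inv2[OF p] inv A(2) by (auto simp: image_iff) metis
    then show "h p * indicator (\<phi> ` A) p = (\<lambda>y. h (\<phi> y) * indicator U y * indicator A y) (\<psi> p)"
      using inv2[OF p] by (simp add: indicator_def)
  qed
  also have "\<dots> = (\<integral>\<^sup>+y. h (\<phi> y) * indicator U y * indicator A y \<partial>N)"
    unfolding N_def by (rule nn_integral_distr[OF m\<psi>, symmetric]) (use m in simp)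
  also have "\<dots> = (\<integral>\<^sup>+y. (k y * indicator U y) * (h (\<phi> y) * indicator U y * indicator A y) \<partial>lborel)"
    unfolding N by (rule nn_integral_density) (use k(1) m in simp_all)
  also have "\<dots> = (\<integral>\<^sup>+y\<in>A. h (\<phi> y) * k y \<partial>lborel)"
    using A(2) by (intro nn_integral_cong) (auto simp: indicator_def mult.commute)
  finally show ?thesis .
qed

definition is_area_measure :: "('n option) minkowski measure \<Rightarrow> bool" where
  "is_area_measure M \<longleftrightarrow> sets M = sets (restrict_space borel S) \<and>
     (\<forall>U \<phi>. local_parametrization S U \<phi> \<longrightarrow>
        (\<forall>A \<in> sets borel. A \<subseteq> U \<longrightarrow>
           emeasure M (\<phi> ` A) = (\<integral>\<^sup>+x\<in>A. ennreal (sqrt (gram_det \<phi> x)) \<partial>lborel)))"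

text \<open>\<open>area_measure\<close> is a definite description; uniqueness is
  \<open>surface_measure_eqI\<close>, so a single example makes it meaningful.\<close>

lemma is_area_measure_area_measure:
  assumes "is_area_measure M"
  shows "is_area_measure (area_measure S)"
proof -
  have "area_measure S = (THE M. is_area_measure M)"
    unfolding area_measure_def is_area_measure_def ..
  moreover have "is_area_measure (THE M. is_area_measure M)"
  proof (rule theI[of is_area_measure, OF assms])
    fix M' assume "is_area_measure M'"
    with assms show "M' = M"
      by (intro surface_measure_eqI) (simp_all add: is_area_measure_def)
  qed
  ultimately show ?thesis by simp
qed

section \<open>Measurability of the symmetric functions of the curvatures\<close>

lemma continuous_on_gram_det:
  assumes \<phi>: "local_parametrization S U \<phi>"
  shows "continuous_on U (gram_det \<phi>)"
proof -
  have sm: "higher_differentiable_on U \<phi> (Suc 0)"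
    using \<phi> unfolding local_parametrization_def smooth_on_def by blast
  have "continuous_on U (\<lambda>x. frechet_derivative \<phi> (at x) v)" for v
    using higher_differentiable_on_SucD(2)[OF sm] by simp
  then have "continuous_on U (\<lambda>x. gram_det \<phi> x)"
    unfolding gram_det_def by (intro continuous_on_det) (auto intro!: continuous_intros)
  then show ?thesis by simp
qed

lemma gap_pos: "p \<in> S \<Longrightarrow> snd p - snd (\<nu> p) > 0"
  using null(2)[of p] by simp

lemma shifted_pos: "p \<in> S \<Longrightarrow> shifted_curvatures \<Omega> p i > 0"
  using curv[of p i] by (simp add: shifted_curvatures_def)

text \<open>The product is read off from the determinant of \<open>tube_matrix\<close> at (1 - x, x,
  -1, 1), which is continuous in a chart: (1 - x) + x \<kappa> = 1 + x (\<kappa> - 1), and the two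
  remaining factors, the time component of p - \<nu> and the area density, do not vanish.\<close>

lemma continuous_on_shifted_product:
  assumes "x \<ge> 0"
  shows "continuous_on S (\<lambda>p. \<Prod>i\<in>UNIV. 1 + x * shifted_curvatures \<Omega> p i)"
  unfolding continuous_on_eq_continuous_within
proof
  define P where "P = (\<lambda>p. \<Prod>i\<in>UNIV. 1 + x * shifted_curvatures \<Omega> p i)"
  fix p assume pS: "p \<in> S"
  obtain U \<phi> y where \<phi>: "local_parametrization S U \<phi>" "y \<in> U" "\<phi> y = p" using ex_chart[OF pS] .
  obtain \<psi> where \<psi>: "homeomorphism U (\<phi> ` U) \<phi> \<psi>"
    using \<phi>(1) unfolding local_parametrization_def by blast
  define Q where "Q = (\<lambda>y. \<bar>det (tube_matrix \<phi> (1 - x) x (-1) 1 y)\<bar> / ((snd (\<phi> y) - snd (\<nu> (\<phi> y))) * sqrt (gram_det \<phi> y)))"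
  have gap: "snd (\<phi> y) - snd (\<nu> (\<phi> y)) > 0" if "y \<in> U" for y
    using gap_pos chart_subset[OF \<phi>(1)] that by blast
  have c\<phi>: "continuous_on U \<phi>" using \<psi> by (simp add: homeomorphism_def)
  have c\<nu>: "continuous_on U (\<lambda>y. \<nu> (\<phi> y))"
    using higher_differentiable_on_imp_continuous_on[OF chart_normal_smooth[OF \<phi>(1), of 0]] .
  have cm: "continuous_on U (\<lambda>y. det (tube_matrix \<phi> (1 - x) x (-1) 1 y))"
    by (rule continuous_on_tube_matrix[OF \<phi>(1)]) (auto intro: continuous_intros)
  have cQ: "continuous_on U Q"
    unfolding Q_def using gap chart_jacobian(2)[OF \<phi>(1)]
    by (intro continuous_intros cm c\<phi> c\<nu> continuous_on_gram_det[OF \<phi>(1)]) (auto simp: less_imp_neq[symmetric])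
  have "continuous_on (\<phi> ` U) (\<lambda>p. Q (\<psi> p))"
    by (rule continuous_on_compose2[OF cQ homeomorphism_cont2[OF \<psi>]])
      (simp add: homeomorphism_image2[OF \<psi>])
  moreover have "Q (\<psi> q) = P q" if "q \<in> \<phi> ` U" for q
  proof -
    have y: "\<psi> q \<in> U" "\<phi> (\<psi> q) = q" using \<psi> that unfolding homeomorphism_def by blast+
    have qS: "q \<in> S" using chart_subset[OF \<phi>(1)] that by blast
    have f: "(1 - x) + x * \<kappa> q i = 1 + x * shifted_curvatures \<Omega> q i" for i
      by (simp add: shifted_curvatures_def algebra_simps)
    have "P q \<ge> 0" unfolding P_def
      using mult_nonneg_nonneg[OF assms less_imp_le[OF shifted_pos[OF qS]]] by (intro prod_nonneg) simp
    then have "\<bar>\<Prod>i\<in>UNIV. 1 + x * shifted_curvatures \<Omega> q i\<bar> = P q"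
      unfolding P_def by (rule abs_of_nonneg)
    then have "\<bar>det (tube_matrix \<phi> (1 - x) x (-1) 1 (\<psi> q))\<bar> = (snd q - snd (\<nu> q)) * P q * sqrt (gram_det \<phi> (\<psi> q))"
      using chart_jacobian(1)[OF \<phi>(1) y(1), of "1 - x" x "-1" 1] gap_pos[OF qS] unfolding y(2) f
      by simp
    then show ?thesis using gap_pos[OF qS] chart_jacobian(2)[OF \<phi>(1) y(1)] unfolding Q_def y(2) by simp
  qed
  ultimately have "continuous_on (\<phi> ` U) P" by (rule continuous_on_eq)
  then have "continuous (at p within \<phi> ` U) P"
    using \<phi>(2,3) by (auto simp: continuous_on_eq_continuous_within)
  moreover obtain O' where O: "open O'" "\<phi> ` U = S \<inter> O'"
    using \<phi>(1) unfolding local_parametrization_def openin_open by blast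
  have "at p within \<phi> ` U = at p within S"
    by (rule at_within_nhd[of p O']) (use O \<phi>(2,3) in auto)
  ultimately show "continuous (at p within S) (\<lambda>p. \<Prod>i\<in>UNIV. 1 + x * shifted_curvatures \<Omega> p i)"
    by (simp add: P_def)
qed

lemma measurable_sigma: "(\<lambda>p. elem_sym k (shifted_curvatures \<Omega> p)) \<in> borel_measurable (restrict_space borel S)"
  by (intro measurable_elem_sym borel_measurable_continuous_on_restrict continuous_on_shifted_product)

lemma sigma_nonneg: "p \<in> S \<Longrightarrow> elem_sym k (shifted_curvatures \<Omega> p) \<ge> 0"
  by (intro elem_sym_nonneg less_imp_le shifted_pos)

lemma prod_curvatures:
  "(\<Prod>i\<in>UNIV. \<alpha> + \<beta> * \<kappa> p i)
    = (\<Sum>k=0..CARD('n). (\<alpha> + \<beta>) ^ (CARD('n) - k) * \<beta> ^ k * elem_sym k (shifted_curvatures \<Omega> p))"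
proof -
  have "\<alpha> + \<beta> * \<kappa> p i = (\<alpha> + \<beta>) + \<beta> * shifted_curvatures \<Omega> p i" for i
    by (simp add: shifted_curvatures_def algebra_simps)
  then show ?thesis by (simp only: prod_elem_sym_expansion)
qed

end

section \<open>Tube volume as an integral over the boundary\<close>

context tube_data
begin

text \<open>Push-forward of Lebesgue measure on the tube under the map to the foot point.\<close>

lemma ex_tube_measure:
  obtains M where "sets M = sets (restrict_space borel S)"
    "\<And>B. B \<in> sets borel \<Longrightarrow> B \<subseteq> S \<Longrightarrow> emeasure M B = emeasure lborel (tube a b ` (B \<times> {0<..R}))"
proof -
  obtain h where h: "homeomorphism (S \<times> {0..R}) full_tube (tube a b) h" using tube_homeomorphism .
  define T where "T = tube a b ` (S \<times> {0<..R})"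
  have TB: "T \<in> sets borel" unfolding T_def by (rule tube_image_borel[OF S_borel]) simp
  have Tf: "T \<subseteq> full_tube" unfolding T_def by (intro image_mono) auto
  have inv: "h (tube a b z) = z" if "z \<in> S \<times> {0..R}" for z using h that unfolding homeomorphism_def by blast
  define L where "L = restrict_space (lborel :: (real^'n option) measure) T"
  have "continuous_on T (\<lambda>x. fst (h x))"
    using h Tf unfolding homeomorphism_def by (intro continuous_on_fst) (auto intro: continuous_on_subset)
  then have "(\<lambda>x. fst (h x)) \<in> borel_measurable (restrict_space borel T)"
    by (rule borel_measurable_continuous_on_restrict)
  then have "(\<lambda>x. fst (h x)) \<in> measurable (restrict_space borel T) (restrict_space borel S)"
    by (intro measurable_restrict_space2) (auto simp: space_restrict_space T_def inv)
  moreover have sL: "sets L = sets (restrict_space borel T)" unfolding L_def by (rule sets_restrict_space_cong) simp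
  ultimately have m: "(\<lambda>x. fst (h x)) \<in> measurable L (restrict_space borel S)"
    by (simp only: measurable_cong_sets[OF sL refl])
  define M where "M = distr L (restrict_space borel S) (\<lambda>x. fst (h x))"
  show ?thesis
  proof
    show "sets M = sets (restrict_space borel S)" by (simp add: M_def)
    fix B assume B: "B \<in> sets borel" "B \<subseteq> S"
    then have "B \<in> sets (restrict_space borel S)" using S_borel by (simp add: sets_restrict_space_iff)
    then have "emeasure M B = emeasure L ((\<lambda>x. fst (h x)) -` B \<inter> space L)"
      unfolding M_def by (rule emeasure_distr[OF m])
    also have "(\<lambda>x. fst (h x)) -` B \<inter> space L = tube a b ` (B \<times> {0<..R})"
    proof (intro equalityI subsetI)
      fix x assume "x \<in> (\<lambda>x. fst (h x)) -` B \<inter> space L"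
      then have x: "fst (h x) \<in> B" "x \<in> T" by (auto simp: L_def space_restrict_space)
      then obtain z where z: "z \<in> S \<times> {0<..R}" "x = tube a b z" unfolding T_def by blast
      then have "h x = z" using inv[of z] by auto
      then have "z \<in> B \<times> {0<..R}" using x z by (auto simp: mem_Times_iff)
      then show "x \<in> tube a b ` (B \<times> {0<..R})" using z(2) by blast
    next
      fix x assume "x \<in> tube a b ` (B \<times> {0<..R})"
      then obtain z where z: "z \<in> B \<times> {0<..R}" "x = tube a b z" by blast
      then have z': "z \<in> S \<times> {0<..R}" "z \<in> S \<times> {0..R}" using B(2) by (auto simp: mem_Times_iff)
      then have "x \<in> T" "h x = z" using inv[OF z'(2)] z(2) by (auto simp: T_def)
      then show "x \<in> (\<lambda>x. fst (h x)) -` B \<inter> space L"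
        using z(1) by (auto simp: L_def space_restrict_space mem_Times_iff)
    qed
    also have "emeasure L (tube a b ` (B \<times> {0<..R})) = emeasure lborel (tube a b ` (B \<times> {0<..R}))"
      unfolding L_def by (rule emeasure_restrict_space) (use TB B(2) in \<open>auto simp: T_def\<close>)
    finally show "emeasure M B = emeasure lborel (tube a b ` (B \<times> {0<..R}))" .
  qed
qed

text \<open>
  The volume of the tube over \<open>B\<close> is a measure in \<open>B\<close>, and its density with respect to the area is
  known in every chart. Dividing by this density gives the area measure without gluing charts.
\<close>

lemma ex_is_area_measure:
  assumes w: "tube_weight \<in> borel_measurable (restrict_space borel S)"
    and pos: "\<And>p. p \<in> S \<Longrightarrow> tube_weight p \<noteq> 0 \<and> tube_weight p \<noteq> \<infinity>"
  shows "\<exists>M. is_area_measure M"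
proof -
  obtain M where M: "sets M = sets (restrict_space borel S)"
    "\<And>B. B \<in> sets borel \<Longrightarrow> B \<subseteq> S \<Longrightarrow> emeasure M B = emeasure lborel (tube a b ` (B \<times> {0<..R}))"
    using ex_tube_measure by blast
  have iw: "(\<lambda>p. inverse (tube_weight p)) \<in> borel_measurable (restrict_space borel S)"
    using w by measurable
  have "is_area_measure (density M (\<lambda>p. inverse (tube_weight p)))"
    unfolding is_area_measure_def
  proof (intro conjI allI impI ballI)
    show "sets (density M (\<lambda>p. inverse (tube_weight p))) = sets (restrict_space borel S)" using M(1) by simp
    fix U \<phi> A assume \<phi>: "local_parametrization S U \<phi>" and A: "A \<in> sets borel" "A \<subseteq> U"
    define k where "k = (\<lambda>y. tube_weight (\<phi> y) * ennreal (sqrt (gram_det \<phi> y)))"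
    have "open U" using \<phi> unfolding local_parametrization_def by blast
    then have U: "U \<in> sets borel" by simp
    have kU: "(\<lambda>y. k y * indicator U y) \<in> borel_measurable borel"
      unfolding k_def by (rule chart_tube_emeasure(2)[OF \<phi> U]) simp
    have kA: "emeasure M (\<phi> ` A) = (\<integral>\<^sup>+y\<in>A. k y \<partial>lborel)" if "A \<in> sets borel" "A \<subseteq> U" for A
      unfolding k_def using M(2) chart_image_borel[OF \<phi> that] chart_tube_emeasure(1)[OF \<phi> that] by simp
    have "emeasure (density M (\<lambda>p. inverse (tube_weight p))) (\<phi> ` A) = (\<integral>\<^sup>+p\<in>\<phi> ` A. inverse (tube_weight p) \<partial>M)"
    proof (rule emeasure_density)
      show "(\<lambda>p. inverse (tube_weight p)) \<in> borel_measurable M" using iw by (simp only: measurable_cong_sets[OF M(1) refl])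
      show "\<phi> ` A \<in> sets M" using chart_image_borel[OF \<phi> A] S_borel M(1) by (simp add: sets_restrict_space_iff)
    qed
    also have "\<dots> = (\<integral>\<^sup>+y\<in>A. inverse (tube_weight (\<phi> y)) * k y \<partial>lborel)"
      by (rule surface_nn_integral[OF M(1) \<phi> kU kA iw A])
    also have "\<dots> = (\<integral>\<^sup>+y\<in>A. ennreal (sqrt (gram_det \<phi> y)) \<partial>lborel)"
    proof (rule nn_integral_cong)
      fix y
      show "inverse (tube_weight (\<phi> y)) * k y * indicator A y = ennreal (sqrt (gram_det \<phi> y)) * indicator A y"
      proof (cases "y \<in> A")
        case True
        then have "\<phi> y \<in> S" using chart_image_borel(2)[OF \<phi> A] by blast
        then have "tube_weight (\<phi> y) \<noteq> 0" "tube_weight (\<phi> y) < \<infinity>" using pos by (auto simp: less_top)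
        then have "inverse (tube_weight (\<phi> y)) * tube_weight (\<phi> y) = 1"
          by (metis ennreal_divide_self infinity_ennreal_def divide_ennreal_def mult.commute)
        then show ?thesis by (simp add: k_def mult.assoc[symmetric])
      qed simp
    qed
    finally show "emeasure (density M (\<lambda>p. inverse (tube_weight p))) (\<phi> ` A)
      = (\<integral>\<^sup>+x\<in>A. ennreal (sqrt (gram_det \<phi> x)) \<partial>lborel)" .
  qed
  then show ?thesis by blast
qed

text \<open>The tube measure and the area with density \<open>tube_weight\<close> agree in every
  chart, hence as measures on the boundary.\<close>

theorem tube_volume:
  assumes w: "tube_weight \<in> borel_measurable (restrict_space borel S)" and area: "is_area_measure M"
  shows "emeasure lborel (tube a b ` (S \<times> {0<..R})) = (\<integral>\<^sup>+p. tube_weight p \<partial>M)"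
proof -
  obtain T where T: "sets T = sets (restrict_space borel S)"
    "\<And>B. B \<in> sets borel \<Longrightarrow> B \<subseteq> S \<Longrightarrow> emeasure T B = emeasure lborel (tube a b ` (B \<times> {0<..R}))"
    using ex_tube_measure by blast
  have M: "sets M = sets (restrict_space borel S)" using area by (simp add: is_area_measure_def)
  have wM: "tube_weight \<in> borel_measurable M" using w by (simp only: measurable_cong_sets[OF M refl])
  have "T = density M tube_weight"
  proof (rule surface_measure_eqI[OF T(1)])
    show "sets (density M tube_weight) = sets (restrict_space borel S)" using M by simp
    fix U \<phi> A assume \<phi>: "local_parametrization S U \<phi>" and A: "A \<in> sets borel" "A \<subseteq> U"
    define k where "k = (\<lambda>y. ennreal (sqrt (gram_det \<phi> y)))"
    have opU: "open U" using \<phi> unfolding local_parametrization_def by blast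
    have "continuous_on U (\<lambda>y. sqrt (gram_det \<phi> y))"
      by (intro continuous_intros continuous_on_gram_det \<phi>)
    then have "(\<lambda>y. indicator U y *\<^sub>R sqrt (gram_det \<phi> y)) \<in> borel_measurable borel"
      using opU by (intro borel_measurable_continuous_on_indicator) auto
    then have "(\<lambda>y. ennreal (indicator U y *\<^sub>R sqrt (gram_det \<phi> y))) \<in> borel_measurable borel"
      by (rule measurable_compose[OF _ measurable_ennreal])
    moreover have "k y * indicator U y = ennreal (indicator U y *\<^sub>R sqrt (gram_det \<phi> y))" for y
      by (simp add: k_def indicator_def)
    ultimately have kU: "(\<lambda>y. k y * indicator U y) \<in> borel_measurable borel" by simp
    have kA: "emeasure M (\<phi> ` A) = (\<integral>\<^sup>+y\<in>A. k y \<partial>lborel)" if "A \<in> sets borel" "A \<subseteq> U" for A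
      using area \<phi> that unfolding is_area_measure_def k_def by blast
    have "emeasure (density M tube_weight) (\<phi> ` A) = (\<integral>\<^sup>+p\<in>\<phi> ` A. tube_weight p \<partial>M)"
      by (rule emeasure_density[OF wM]) (use chart_image_borel[OF \<phi> A] S_borel M in \<open>simp add: sets_restrict_space_iff\<close>)
    also have "\<dots> = (\<integral>\<^sup>+y\<in>A. tube_weight (\<phi> y) * k y \<partial>lborel)"
      by (rule surface_nn_integral[OF M \<phi> kU kA w A])
    finally show "emeasure T (\<phi> ` A) = emeasure (density M tube_weight) (\<phi> ` A)"
      using T(2) chart_image_borel[OF \<phi> A] chart_tube_emeasure(1)[OF \<phi> A] by (simp add: k_def)
  qed
  then have "emeasure T S = (\<integral>\<^sup>+p\<in>S. tube_weight p \<partial>M)"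
    using wM M S_borel by (simp add: emeasure_density sets_restrict_space_iff)
  also have "\<dots> = (\<integral>\<^sup>+p. tube_weight p \<partial>M)"
    using sets_eq_imp_space_eq[OF M] by (intro nn_integral_cong) (simp add: space_restrict_space)
  finally show ?thesis using T(2)[OF S_borel] by simp
qed

end

section \<open>The weighted Steiner formulas\<close>

lemma nn_integral_Ioc_continuous:
  fixes f :: "real \<Rightarrow> real"
  assumes "continuous_on {0..R} f" "\<And>s. 0 \<le> s \<Longrightarrow> s \<le> R \<Longrightarrow> f s \<ge> 0"
  shows "(\<integral>\<^sup>+s\<in>{0<..R}. ennreal (f s) \<partial>lborel) = ennreal (integral {0..R} f)"
proof -
  have "(f has_integral integral {0..R} f) {0..R}"
    using assms(1) by (intro integrable_integral integrable_continuous_real)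
  moreover have "negligible {x \<in> {0..R} - {0<..R}. f x \<noteq> 0}" "negligible {x \<in> {0<..R} - {0..R}. f x \<noteq> 0}"
    by (auto intro: negligible_subset[of "{0}"])
  ultimately have "(f has_integral integral {0..R} f) {0<..R}"
    using has_integral_spike_set_eq by blast
  then show ?thesis
    by (rule nn_integral_has_integral_lebesgue'[rotated]) (use assms(2) in auto)
qed

lemma exp_power_diff:
  assumes "k \<le> n"
  shows "exp s ^ (n - k) = exp ((real n - real k) * s)"
  using assms by (simp add: exp_of_nat_mult[symmetric] of_nat_diff)

lemma measure_lborel_scale:
  fixes D :: "'a::euclidean_space set"
  assumes "compact D" "c > 0"
  shows "measure lborel ((\<lambda>x. c *\<^sub>R x) ` D) = c ^ DIM('a) * measure lborel D"
proof -
  have c: "compact ((\<lambda>x. c *\<^sub>R x) ` D)" by (rule compact_scaling[OF assms(1)])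
  have "emeasure lebesgue ((\<lambda>x. c *\<^sub>R x + 0) ` D) = ennreal (\<bar>c\<bar> ^ DIM('a)) * emeasure lebesgue D"
    using emeasure_lebesgue_affine[of c 0 D] by (simp add: add.commute)
  then have "measure lebesgue ((\<lambda>x. c *\<^sub>R x) ` D) = c ^ DIM('a) * measure lebesgue D"
    using assms(2) by (simp add: measure_def enn2real_mult)
  then show ?thesis
    using c assms(1) by (simp add: measure_completion borel_compact)
qed

context tube_data
begin

text \<open>The tube is bounded, so its volume is finite, and for a nonnegative weight a finite
  integral is integrability.\<close>

lemma measure_tube:
  assumes area: "is_area_measure M"
    and w: "\<And>p. p \<in> S \<Longrightarrow> tube_weight p = ennreal (w p)" "\<And>p. p \<in> S \<Longrightarrow> w p \<ge> 0"
    and mw: "w \<in> borel_measurable (restrict_space borel S)"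
  shows "measure lborel (tube a b ` (S \<times> {0<..R})) = (LINT p|M. w p)" "integrable M w"
proof -
  have sM: "sets M = sets (restrict_space borel S)" using area by (simp add: is_area_measure_def)
  have sp: "space M = S" using sets_eq_imp_space_eq[OF sM] by (simp add: space_restrict_space)
  have mM: "w \<in> borel_measurable M" using mw by (simp only: measurable_cong_sets[OF sM refl])
  have "tube_weight \<in> borel_measurable (restrict_space borel S)"
    by (subst measurable_cong[where g = "\<lambda>p. ennreal (w p)"])
      (use w mw in \<open>auto simp: space_restrict_space\<close>)
  then have "emeasure lborel (tube a b ` (S \<times> {0<..R})) = (\<integral>\<^sup>+p. tube_weight p \<partial>M)"
    using area by (rule tube_volume)
  also have "\<dots> = (\<integral>\<^sup>+p. ennreal (w p) \<partial>M)" using w sp by (intro nn_integral_cong) simp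
  finally have e: "emeasure lborel (tube a b ` (S \<times> {0<..R})) = (\<integral>\<^sup>+p. ennreal (w p) \<partial>M)" .
  have "tube a b ` (S \<times> {0<..R}) \<subseteq> full_tube" by (intro image_mono) auto
  then have "bounded (tube a b ` (S \<times> {0<..R}))"
    using compact_full_tube bounded_subset compact_imp_bounded by blast
  then have "emeasure lborel (tube a b ` (S \<times> {0<..R})) < \<infinity>"
    by (rule emeasure_bounded_finite)
  then have fin: "(\<integral>\<^sup>+p. ennreal (w p) \<partial>M) < \<infinity>" using e by simp
  have nn: "AE p in M. w p \<ge> 0" using w(2) sp by (intro AE_I2) simp
  show int: "integrable M w" by (rule integrableI_nonneg[OF mM nn fin])
  have "0 \<le> (LINT p|M. w p)" by (rule integral_nonneg_AE[OF nn])
  then show "measure lborel (tube a b ` (S \<times> {0<..R})) = (LINT p|M. w p)"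
    using nn_integral_eq_integral[OF int nn] e by (simp add: measure_def)
qed

end

section \<open>Integrals over the boundary and the two tube volumes\<close>

context h_convex_domain
begin

abbreviation "\<sigma> k p \<equiv> elem_sym k (shifted_curvatures \<Omega> p)"
abbreviation "gap p \<equiv> snd p - snd (\<nu> p)"

lemma measurable_weights:
  "(\<lambda>p. snd p * \<sigma> k p) \<in> borel_measurable (restrict_space borel S)"
  "(\<lambda>p. gap p * \<sigma> k p) \<in> borel_measurable (restrict_space borel S)"
proof -
  have 1: "continuous_on S (\<lambda>p. snd p)" and 2: "continuous_on S (\<lambda>p. gap p)"
    by (intro continuous_intros continuous_on_normal)+
  show "(\<lambda>p. snd p * \<sigma> k p) \<in> borel_measurable (restrict_space borel S)"
    by (rule borel_measurable_times[OF borel_measurable_continuous_on_restrict[OF 1] measurable_sigma])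
  show "(\<lambda>p. gap p * \<sigma> k p) \<in> borel_measurable (restrict_space borel S)"
    by (rule borel_measurable_times[OF borel_measurable_continuous_on_restrict[OF 2] measurable_sigma])
qed

lemma null_tube_data:
  "tube_data \<Omega> (\<lambda>s. exp \<rho> - s) (\<lambda>s. s) (\<lambda>s. -1) (\<lambda>s. 1) R"
proof
  show "inj_on (tube (\<lambda>s. exp \<rho> - s) (\<lambda>s. s)) (S \<times> {0..R})"
    by (rule inj_on_subset[OF null_tube_inj]) auto
qed (auto intro!: derivative_eq_intros continuous_intros)

text \<open>Closed form of the tube weight: each power s^k in the density contributes R^(k+1) /
  (k+1).\<close>

definition null_tube_weight :: "real \<Rightarrow> real \<Rightarrow> ('n option) minkowski \<Rightarrow> real" where
  "null_tube_weight \<rho> R p = (\<Sum>k=0..CARD('n).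
      1 / (real k + 1) * (exp ((real CARD('n) - real k) * \<rho>) * R ^ (k + 1)) * (gap p * \<sigma> k p))"

lemma null_tube_weight:
  assumes p: "p \<in> S" and "R \<ge> 0"
  shows "tube_data.tube_weight \<Omega> (\<lambda>s. exp \<rho> - s) (\<lambda>s. s) (\<lambda>s. -1) (\<lambda>s. 1) R p = ennreal (null_tube_weight \<rho> R p)"
proof -
  interpret T: tube_data \<Omega> "\<lambda>s. exp \<rho> - s" "\<lambda>s. s" "\<lambda>s. -1" "\<lambda>s. 1" R by (rule null_tube_data)
  \<comment> \<open>On a null segment a + b is the constant exp \<rho>, and the velocity is minus
    the null vector p - \<nu>, so only the powers of \<open>s\<close> vary.\<close>
  define f where "f = (\<lambda>s. \<Sum>k=0..CARD('n). (gap p * \<sigma> k p) * exp ((real CARD('n) - real k) * \<rho>) * s ^ k)"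
  have f0: "f s \<ge> 0" if "0 \<le> s" for s
    unfolding f_def using gap_pos[OF p] sigma_nonneg[OF p] that
    by (intro sum_nonneg mult_nonneg_nonneg) auto
  have dens: "T.tube_density p s = f s" if "0 \<le> s" for s
  proof -
    have "(\<Prod>i\<in>UNIV. (exp \<rho> - s) + s * \<kappa> p i) = (\<Sum>k=0..CARD('n). exp \<rho> ^ (CARD('n) - k) * s ^ k * \<sigma> k p)"
      by (simp add: prod_curvatures)
    then have "gap p * (\<Prod>i\<in>UNIV. (exp \<rho> - s) + s * \<kappa> p i) = f s"
      unfolding f_def by (simp add: sum_distrib_left exp_power_diff mult_ac cong: sum.cong_simp)
    then have "\<bar>gap p * (\<Prod>i\<in>UNIV. (exp \<rho> - s) + s * \<kappa> p i)\<bar> = f s" using f0[OF that] by simp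
    then show ?thesis by (simp add: T.tube_density_def abs_mult)
  qed
  have "T.tube_weight p = (\<integral>\<^sup>+s\<in>{0<..R}. ennreal (f s) \<partial>lborel)"
    unfolding T.tube_weight_def using dens by (intro nn_integral_cong) (auto simp: indicator_def)
  also have "\<dots> = ennreal (integral {0..R} f)"
    by (rule nn_integral_Ioc_continuous) (use f0 in \<open>auto simp: f_def intro!: continuous_intros\<close>)
  also have "integral {0..R} f = null_tube_weight \<rho> R p"
  proof -
    have "((\<lambda>s. s ^ k) has_integral (R ^ (k + 1) / real (k + 1) - 0 ^ (k + 1) / real (k + 1))) {0..R}" for k
    proof (rule fundamental_theorem_of_calculus[OF assms(2)])
      fix x :: real
      have "((\<lambda>s. s ^ (k + 1) / real (k + 1)) has_real_derivative (real (k + 1) * x ^ k) / real (k + 1)) (at x within {0..R})"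
        using DERIV_cdivide[OF DERIV_pow[of "k + 1" x "{0..R}"], of "real (k + 1)"] by simp
      then show "((\<lambda>s. s ^ (k + 1) / real (k + 1)) has_vector_derivative x ^ k) (at x within {0..R})"
        by (simp add: has_real_derivative_iff_has_vector_derivative del: of_nat_Suc of_nat_add)
    qed
    then have pw: "((\<lambda>s. s ^ k) has_integral R ^ (k + 1) / real (k + 1)) {0..R}" for k by simp
    have "((\<lambda>s. (gap p * \<sigma> k p) * exp ((real CARD('n) - real k) * \<rho>) * s ^ k) has_integral
        (gap p * \<sigma> k p) * exp ((real CARD('n) - real k) * \<rho>) * (R ^ (k + 1) / real (k + 1))) {0..R}" for k
      by (rule has_integral_mult_right[OF pw])
    then have "(f has_integral (\<Sum>k=0..CARD('n). (gap p * \<sigma> k p) * exp ((real CARD('n) - real k) * \<rho>) * (R ^ (k + 1) / real (k + 1)))) {0..R}"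
      unfolding f_def by (intro has_integral_sum) auto
    from integral_unique[OF this] show ?thesis
      by (simp add: null_tube_weight_def mult_ac add.commute)
  qed
  finally show ?thesis .
qed

lemma null_tube_weight_term_le:
  assumes p: "p \<in> S" and "R \<ge> 0" "k \<le> CARD('n)"
  shows "1 / (real k + 1) * (exp ((real CARD('n) - real k) * \<rho>) * R ^ (k + 1)) * (gap p * \<sigma> k p) \<le> null_tube_weight \<rho> R p"
    and "0 \<le> null_tube_weight \<rho> R p"
proof -
  have nn: "0 \<le> 1 / (real j + 1) * (exp ((real CARD('n) - real j) * \<rho>) * R ^ (j + 1)) * (gap p * \<sigma> j p)" for j
    using gap_pos[OF p] sigma_nonneg[OF p] assms(2) by (intro mult_nonneg_nonneg) auto
  show "1 / (real k + 1) * (exp ((real CARD('n) - real k) * \<rho>) * R ^ (k + 1)) * (gap p * \<sigma> k p) \<le> null_tube_weight \<rho> R p"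
    unfolding null_tube_weight_def by (rule member_le_sum) (use assms(3) nn in auto)
  show "0 \<le> null_tube_weight \<rho> R p"
    unfolding null_tube_weight_def by (intro sum_nonneg nn)
qed

lemma measurable_null_tube_weight: "null_tube_weight \<rho> R \<in> borel_measurable (restrict_space borel S)"
  unfolding null_tube_weight_def
  by (intro borel_measurable_sum borel_measurable_times[OF borel_measurable_const] measurable_weights)

text \<open>The null tube with \<rho> = 1 and length 1 serves as reference: its weight is finite,
  and positive because the summand with k = 0 is a positive multiple of the gap.\<close>

lemma area: "is_area_measure (area_measure S)"
proof -
  interpret T: tube_data \<Omega> "\<lambda>s. exp 1 - s" "\<lambda>s. s" "\<lambda>s. -1" "\<lambda>s. 1" 1 by (rule null_tube_data)
  have w: "T.tube_weight p = ennreal (null_tube_weight 1 1 p)" if "p \<in> S" for p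
    by (rule null_tube_weight[OF that]) simp
  have "null_tube_weight 1 1 p > 0" if "p \<in> S" for p
  proof -
    have "0 < 1 / (real 0 + 1) * (exp ((real CARD('n) - real 0) * 1) * 1 ^ (0 + 1)) * (gap p * \<sigma> 0 p)"
      using gap_pos[OF that] by (simp add: elem_sym_0)
    also have "\<dots> \<le> null_tube_weight 1 1 p" by (rule null_tube_weight_term_le(1)[OF that]) auto
    finally show ?thesis .
  qed
  moreover have "T.tube_weight \<in> borel_measurable (restrict_space borel S)"
    by (subst measurable_cong[where g = "\<lambda>p. ennreal (null_tube_weight 1 1 p)"])
      (use w measurable_null_tube_weight in \<open>auto simp: space_restrict_space\<close>)
  ultimately show ?thesis
    by (intro exE[OF T.ex_is_area_measure is_area_measure_area_measure]) (simp_all add: w ennreal_eq_0_iff not_le)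
qed

abbreviation "\<mu> \<equiv> area_measure S"

lemma space_area: "space \<mu> = S"
  using area sets_eq_imp_space_eq[of \<mu> "restrict_space borel S"]
  by (simp add: is_area_measure_def space_restrict_space)

lemma measurable_area: "borel_measurable \<mu> = borel_measurable (restrict_space borel S)"
  using area by (intro measurable_cong_sets) (simp_all add: is_area_measure_def)

text \<open>Up to a positive constant the integrand is one of the nonnegative summands of an
  integrable tube weight; for \<open>k\<close> beyond n it vanishes.\<close>

lemma integrable_gap_sigma: "integrable \<mu> (\<lambda>p. gap p * \<sigma> k p)"
proof (cases "k \<le> CARD('n)")
  case True
  interpret T: tube_data \<Omega> "\<lambda>s. exp 1 - s" "\<lambda>s. s" "\<lambda>s. -1" "\<lambda>s. 1" 1 by (rule null_tube_data)
  have int: "integrable \<mu> (null_tube_weight 1 1)"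
    by (rule T.measure_tube(2)[OF area null_tube_weight _ measurable_null_tube_weight])
      (use null_tube_weight_term_le(2)[of _ 1 0] in auto)
  define c where "c = 1 / (real k + 1) * (exp ((real CARD('n) - real k) * 1) * 1 ^ (k + 1))"
  have "c > 0" by (simp add: c_def)
  show ?thesis
  proof (rule Bochner_Integration.integrable_bound)
    show "integrable \<mu> (\<lambda>p. null_tube_weight 1 1 p / c)" using int by simp
    show "(\<lambda>p. gap p * \<sigma> k p) \<in> borel_measurable \<mu>" unfolding measurable_area by (rule measurable_weights)
    have "norm (gap p * \<sigma> k p) \<le> norm (null_tube_weight 1 1 p / c)" if "p \<in> S" for p
    proof -
      have "c * (gap p * \<sigma> k p) \<le> null_tube_weight 1 1 p"
        unfolding c_def by (rule null_tube_weight_term_le(1)[OF that _ True]) simp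
      then have "gap p * \<sigma> k p \<le> null_tube_weight 1 1 p / c" using \<open>c > 0\<close> by (simp add: pos_le_divide_eq mult.commute)
      moreover have "0 \<le> gap p * \<sigma> k p" using gap_pos[OF that] sigma_nonneg[OF that] by simp
      ultimately show ?thesis by (simp only: real_norm_def abs_of_nonneg)
    qed
    then show "AE p in \<mu>. norm (gap p * \<sigma> k p) \<le> norm (null_tube_weight 1 1 p / c)"
      by (intro AE_I2) (simp add: space_area)
  qed
qed (simp add: elem_sym_greater)

text \<open>On the compact boundary cosh r is at most a constant times the gap, which is continuous
  and positive.\<close>

lemma integrable_cosh_sigma: "integrable \<mu> (\<lambda>p. snd p * \<sigma> k p)"
proof -
  have "continuous_on S (\<lambda>p. snd p / gap p)"
    using gap_pos by (intro continuous_intros continuous_on_normal) force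
  then obtain q where q: "q \<in> S" "\<And>p. p \<in> S \<Longrightarrow> snd p / gap p \<le> snd q / gap q"
    using continuous_attains_sup[OF compact_frontier S_nonempty] by blast
  define K where "K = snd q / gap q"
  show ?thesis
  proof (rule Bochner_Integration.integrable_bound)
    show "integrable \<mu> (\<lambda>p. K * (gap p * \<sigma> k p))" using integrable_gap_sigma by simp
    show "(\<lambda>p. snd p * \<sigma> k p) \<in> borel_measurable \<mu>" unfolding measurable_area by (rule measurable_weights)
    have "norm (snd p * \<sigma> k p) \<le> norm (K * (gap p * \<sigma> k p))" if "p \<in> S" for p
    proof -
      have "snd p \<le> K * gap p" using q(2)[OF that] gap_pos[OF that] by (simp add: K_def pos_divide_le_eq)
      then have "snd p * \<sigma> k p \<le> (K * gap p) * \<sigma> k p" using sigma_nonneg[OF that] by (rule mult_right_mono)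
      moreover have "0 \<le> snd p * \<sigma> k p"
        using sigma_nonneg[OF that] hyperbolic_spaceD(2)[OF normal(1)[OF that]] by simp
      ultimately show ?thesis by (simp add: mult.assoc)
    qed
    then show "AE p in \<mu>. norm (snd p * \<sigma> k p) \<le> norm (K * (gap p * \<sigma> k p))"
      by (intro AE_I2) (simp add: space_area)
  qed
qed

lemma measure_null_tube:
  assumes "R \<ge> 0"
  shows "measure lborel (tube (\<lambda>s. exp \<rho> - s) (\<lambda>s. s) ` (S \<times> {0<..R})) =
    (\<Sum>k=0..CARD('n). 1 / (real k + 1) * (LINT p|\<mu>. gap p * \<sigma> k p) *
      (exp ((real CARD('n) - real k) * \<rho>) * R ^ (k + 1)))"
proof -
  interpret T: tube_data \<Omega> "\<lambda>s. exp \<rho> - s" "\<lambda>s. s" "\<lambda>s. -1" "\<lambda>s. 1" R by (rule null_tube_data)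
  have "measure lborel (tube (\<lambda>s. exp \<rho> - s) (\<lambda>s. s) ` (S \<times> {0<..R})) = (LINT p|\<mu>. null_tube_weight \<rho> R p)"
    by (rule T.measure_tube(1)[OF area null_tube_weight _ measurable_null_tube_weight])
      (use null_tube_weight_term_le(2)[of _ R 0] assms in auto)
  also have "\<dots> = (\<Sum>k=0..CARD('n). LINT p|\<mu>. 1 / (real k + 1) * (exp ((real CARD('n) - real k) * \<rho>) * R ^ (k + 1)) * (gap p * \<sigma> k p))"
    unfolding null_tube_weight_def
    by (rule Bochner_Integration.integral_sum) (intro integrable_mult_right integrable_gap_sigma)
  also have "\<dots> = (\<Sum>k=0..CARD('n). 1 / (real k + 1) * (LINT p|\<mu>. gap p * \<sigma> k p) *
      (exp ((real CARD('n) - real k) * \<rho>) * R ^ (k + 1)))"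
  proof (rule sum.cong[OF refl])
    fix k
    have "(LINT p|\<mu>. 1 / (real k + 1) * (exp ((real CARD('n) - real k) * \<rho>) * R ^ (k + 1)) * (gap p * \<sigma> k p))
      = 1 / (real k + 1) * (exp ((real CARD('n) - real k) * \<rho>) * R ^ (k + 1)) * (LINT p|\<mu>. gap p * \<sigma> k p)"
      by (rule integral_mult_right_zero)
    then show "(LINT p|\<mu>. 1 / (real k + 1) * (exp ((real CARD('n) - real k) * \<rho>) * R ^ (k + 1)) * (gap p * \<sigma> k p))
      = 1 / (real k + 1) * (LINT p|\<mu>. gap p * \<sigma> k p) * (exp ((real CARD('n) - real k) * \<rho>) * R ^ (k + 1))"
      by (simp only: mult_ac)
  qed
  finally show ?thesis .
qed

text \<open>The Jacobian density multiplied out: its time factor is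
  \<open>exp t * snd p - sinh t * gap p\<close>, and the product over the curvatures expands in
  powers of exp t = cosh t + sinh t and of sinh t.\<close>

definition geodesic_density :: "('n option) minkowski \<Rightarrow> real \<Rightarrow> real" where
  "geodesic_density p t = (\<Sum>k=0..CARD('n).
      (snd p * \<sigma> k p) * (exp ((real CARD('n) - real k + 1) * t) * sinh t ^ k)
    - (gap p * \<sigma> k p) * (exp ((real CARD('n) - real k) * t) * sinh t ^ (k + 1)))"

lemma geodesic_tube_data: "tube_data \<Omega> cosh sinh sinh cosh R"
proof
  show "inj_on (tube cosh sinh) (S \<times> {0..R})" by (rule inj_on_subset[OF geodesic_tube_inj]) auto
qed (auto intro!: derivative_eq_intros continuous_intros)

lemma geodesic_density:
  assumes p: "p \<in> S" and "t \<ge> 0"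
  shows "\<bar>cosh t * snd p + sinh t * snd (\<nu> p)\<bar> * \<bar>\<Prod>i\<in>UNIV. cosh t + sinh t * \<kappa> p i\<bar> = geodesic_density p t"
proof -
  have cs: "cosh t + sinh t = exp t" by (simp add: cosh_plus_sinh)
  have sh: "sinh t \<ge> 0" using assms(2) by simp
  define P where "P = (\<Prod>i\<in>UNIV. cosh t + sinh t * \<kappa> p i)"
  have P: "P = (\<Sum>k=0..CARD('n). exp t ^ (CARD('n) - k) * sinh t ^ k * \<sigma> k p)"
    unfolding P_def prod_curvatures cs ..
  have "P \<ge> 0" unfolding P using sh sigma_nonneg[OF p] by (intro sum_nonneg mult_nonneg_nonneg) auto
  moreover have "cosh t * snd p + sinh t * snd (\<nu> p) > 0"
    using hyperbolic_spaceD(2)[OF geodesic_tube_in[OF p, of t]] by simp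
  ultimately have 1: "\<bar>cosh t * snd p + sinh t * snd (\<nu> p)\<bar> * \<bar>P\<bar> = (cosh t * snd p + sinh t * snd (\<nu> p)) * P" by simp
  have 2: "cosh t * snd p + sinh t * snd (\<nu> p) = exp t * snd p - sinh t * gap p"
    unfolding cs[symmetric] by (simp add: algebra_simps)
  have 3: "(exp t * snd p - sinh t * gap p) * P = geodesic_density p t"
    unfolding P geodesic_density_def sum_distrib_left
  proof (rule sum.cong[OF refl])
    fix k assume "k \<in> {0..CARD('n)}"
    then have e: "exp t ^ (CARD('n) - k) = exp ((real CARD('n) - real k) * t)" by (intro exp_power_diff) simp
    have e1: "exp ((real CARD('n) - real k + 1) * t) = exp t * exp ((real CARD('n) - real k) * t)"
      by (simp add: exp_add[symmetric] algebra_simps)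
    show "(exp t * snd p - sinh t * gap p) * (exp t ^ (CARD('n) - k) * sinh t ^ k * \<sigma> k p) =
      (snd p * \<sigma> k p) * (exp ((real CARD('n) - real k + 1) * t) * sinh t ^ k)
      - (gap p * \<sigma> k p) * (exp ((real CARD('n) - real k) * t) * sinh t ^ (k + 1))"
      unfolding e e1 by (simp add: algebra_simps)
  qed
  show ?thesis unfolding P_def[symmetric] 1 unfolding 2 by (rule 3)
qed

lemma measure_geodesic_tube:
  assumes "R \<ge> 0"
  shows "measure lborel (tube cosh sinh ` (S \<times> {0<..R})) =
    (\<Sum>k=0..CARD('n). (LINT p|\<mu>. snd p * \<sigma> k p) *
      integral {0..R} (\<lambda>t. exp ((real CARD('n) - real k + 1) * t) * sinh t ^ k)) -
    (\<Sum>k=0..CARD('n). (LINT p|\<mu>. gap p * \<sigma> k p) *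
      integral {0..R} (\<lambda>t. exp ((real CARD('n) - real k) * t) * sinh t ^ (k + 1)))"
proof -
  interpret T: tube_data \<Omega> cosh sinh sinh cosh R by (rule geodesic_tube_data)
  define I where "I = (\<lambda>k. integral {0..R} (\<lambda>t. exp ((real CARD('n) - real k + 1) * t) * sinh t ^ k))"
  define J where "J = (\<lambda>k. integral {0..R} (\<lambda>t. exp ((real CARD('n) - real k) * t) * sinh t ^ (k + 1)))"
  have I: "((\<lambda>t. exp ((real CARD('n) - real k + 1) * t) * sinh t ^ k) has_integral I k) {0..R}" for k
    unfolding I_def by (intro integrable_integral integrable_continuous_real continuous_intros)
  have J: "((\<lambda>t. exp ((real CARD('n) - real k) * t) * sinh t ^ (k + 1)) has_integral J k) {0..R}" for k
    unfolding J_def by (intro integrable_integral integrable_continuous_real continuous_intros)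
  define w where "w = (\<lambda>p. \<Sum>k=0..CARD('n). (snd p * \<sigma> k p) * I k - (gap p * \<sigma> k p) * J k)"
  have wi: "integral {0..R} (geodesic_density p) = w p" for p
  proof -
    have "(geodesic_density p has_integral w p) {0..R}"
      unfolding geodesic_density_def w_def
      by (intro has_integral_sum has_integral_diff has_integral_mult_right I J) simp
    then show ?thesis by (rule integral_unique)
  qed
  have cont: "continuous_on {0..R} (geodesic_density p)" for p
    unfolding geodesic_density_def by (intro continuous_intros)
  have nn: "geodesic_density p t \<ge> 0" if "p \<in> S" "t \<ge> 0" for p t
    unfolding geodesic_density[OF that, symmetric] by simp
  have tw: "T.tube_weight p = ennreal (w p)" if p: "p \<in> S" for p
  proof -
    have "T.tube_weight p = (\<integral>\<^sup>+s\<in>{0<..R}. ennreal (geodesic_density p s) \<partial>lborel)"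
      unfolding T.tube_weight_def T.tube_density_def
      using geodesic_density[OF p] by (intro nn_integral_cong) (auto simp: indicator_def)
    also have "\<dots> = ennreal (w p)"
      unfolding wi[symmetric] by (rule nn_integral_Ioc_continuous[OF cont nn[OF p]])
    finally show ?thesis .
  qed
  have w0: "w p \<ge> 0" if "p \<in> S" for p
    unfolding wi[symmetric] by (rule integral_nonneg[OF integrable_continuous_real[OF cont] nn[OF that]]) simp
  have mw: "w \<in> borel_measurable (restrict_space borel S)"
    unfolding w_def
    by (intro borel_measurable_sum borel_measurable_diff borel_measurable_times[OF _ borel_measurable_const] measurable_weights)
  have "measure lborel (tube cosh sinh ` (S \<times> {0<..R})) = (LINT p|\<mu>. w p)"
    by (rule T.measure_tube(1)[OF area tw w0 mw])
  also have "\<dots> = (\<Sum>k=0..CARD('n). LINT p|\<mu>. (snd p * \<sigma> k p) * I k - (gap p * \<sigma> k p) * J k)"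
    unfolding w_def by (rule Bochner_Integration.integral_sum)
      (intro Bochner_Integration.integrable_diff integrable_mult_left integrable_gap_sigma integrable_cosh_sigma)
  also have "\<dots> = (\<Sum>k=0..CARD('n). (LINT p|\<mu>. snd p * \<sigma> k p) * I k - (LINT p|\<mu>. gap p * \<sigma> k p) * J k)"
  proof (rule sum.cong[OF refl])
    fix k
    have "(LINT p|\<mu>. (snd p * \<sigma> k p) * I k - (gap p * \<sigma> k p) * J k)
      = (LINT p|\<mu>. (snd p * \<sigma> k p) * I k) - (LINT p|\<mu>. (gap p * \<sigma> k p) * J k)"
      by (intro Bochner_Integration.integral_diff integrable_mult_left integrable_gap_sigma integrable_cosh_sigma)
    then show "(LINT p|\<mu>. (snd p * \<sigma> k p) * I k - (gap p * \<sigma> k p) * J k)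
      = (LINT p|\<mu>. snd p * \<sigma> k p) * I k - (LINT p|\<mu>. gap p * \<sigma> k p) * J k"
      by (simp only: integral_mult_left_zero)
  qed
  finally show ?thesis by (simp only: sum_subtractf I_def J_def)
qed

lemma compact_projection: "compact (fst ` \<Omega>)"
  by (rule compact_continuous_image[OF _ cpt]) (intro continuous_intros)

lemma parallel_set_borel:
  assumes "\<rho> \<ge> 0"
  shows "hyp_parallel_set \<Omega> \<rho> \<in> sets borel"
proof -
  have "hyp_parallel_set \<Omega> \<rho> = hyperbolic_space \<inter> (\<Inter>q\<in>S. {X. - lorentz X (\<l> q) \<le> exp \<rho>})"
  proof (intro equalityI subsetI)
    fix X assume X: "X \<in> hyp_parallel_set \<Omega> \<rho>"
    then have "X \<in> hyperbolic_space" by (simp add: hyp_parallel_set_def)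
    then show "X \<in> hyperbolic_space \<inter> (\<Inter>q\<in>S. {X. - lorentz X (\<l> q) \<le> exp \<rho>})"
      using in_parallel_set_iff[OF _ assms] X by simp
  qed (use in_parallel_set_iff[OF _ assms] in simp)
  moreover have "closed \<dots>"
    by (intro closed_Int closed_hyperbolic_space closed_INT ballI closed_Collect_le continuous_intros)
  ultimately show ?thesis by simp
qed

lemma finite_lborel: "emeasure lborel A \<noteq> \<infinity>" if "A \<subseteq> B" "compact B" for A B :: "(real^'n option) set"
  using emeasure_bounded_finite[OF bounded_subset[OF compact_imp_bounded[OF that(2)] that(1)]] by simp

theorem steiner_formulas:
  assumes "\<rho> \<ge> 0"
  shows "Vol_w (hyp_parallel_set \<Omega> \<rho>) - Vol_w \<Omega> =
      (\<Sum>k=0..CARD('n). (LINT p|\<mu>. snd p * \<sigma> k p) *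
        integral {0..\<rho>} (\<lambda>t. exp ((real CARD('n) - real k + 1) * t) * sinh t ^ k)) -
      (\<Sum>k=0..CARD('n). (LINT p|\<mu>. gap p * \<sigma> k p) *
        integral {0..\<rho>} (\<lambda>t. exp ((real CARD('n) - real k) * t) * sinh t ^ (k + 1)))"
    and "Vol_w (hyp_parallel_set \<Omega> \<rho>) = Vol_w \<Omega> * exp ((real CARD('n) + 1) * \<rho>) +
      (\<Sum>k=0..CARD('n). 1 / (real k + 1) * (LINT p|\<mu>. gap p * \<sigma> k p) *
        (exp ((real CARD('n) - real k) * \<rho>) * sinh \<rho> ^ (k + 1)))"
proof -
  have V: "Vol_w \<Omega> = measure lborel (fst ` \<Omega>)"
    by (rule Vol_w_eq_lebesgue_measure[OF sub]) (use cpt in \<open>simp add: borel_compact\<close>)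
  have P: "Vol_w (hyp_parallel_set \<Omega> \<rho>) = measure lborel (fst ` hyp_parallel_set \<Omega> \<rho>)"
    by (rule Vol_w_eq_lebesgue_measure[OF _ parallel_set_borel[OF assms]]) (auto simp: hyp_parallel_set_def)
  have D: "fst ` \<Omega> \<in> sets lborel" "emeasure lborel (fst ` \<Omega>) \<noteq> \<infinity>"
    using compact_projection finite_lborel[OF order_refl compact_projection] by (simp_all add: borel_compact)
  interpret T1: tube_data \<Omega> cosh sinh sinh cosh \<rho> by (rule geodesic_tube_data)
  have t1: "tube cosh sinh ` (S \<times> {0<..\<rho>}) \<in> sets lborel" "emeasure lborel (tube cosh sinh ` (S \<times> {0<..\<rho>})) \<noteq> \<infinity>"
    using T1.tube_image_borel[OF S_borel order_refl]
    by (simp, intro finite_lborel[OF _ T1.compact_full_tube] image_mono) auto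
  have "Vol_w (hyp_parallel_set \<Omega> \<rho>) = Vol_w \<Omega> + measure lborel (tube cosh sinh ` (S \<times> {0<..\<rho>}))"
    unfolding P V parallel_set_geodesic_tube(1)[OF assms]
    by (rule measure_Union[OF D(2) t1(2) D(1) t1(1) parallel_set_geodesic_tube(2)[OF assms]])
  then show "Vol_w (hyp_parallel_set \<Omega> \<rho>) - Vol_w \<Omega> =
      (\<Sum>k=0..CARD('n). (LINT p|\<mu>. snd p * \<sigma> k p) *
        integral {0..\<rho>} (\<lambda>t. exp ((real CARD('n) - real k + 1) * t) * sinh t ^ k)) -
      (\<Sum>k=0..CARD('n). (LINT p|\<mu>. gap p * \<sigma> k p) *
        integral {0..\<rho>} (\<lambda>t. exp ((real CARD('n) - real k) * t) * sinh t ^ (k + 1)))"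
    unfolding measure_geodesic_tube[OF assms] by simp
  have sh: "sinh \<rho> \<ge> 0" using assms by simp
  have cs: "compact ((\<lambda>x. exp \<rho> *\<^sub>R x) ` fst ` \<Omega>)" by (rule compact_scaling[OF compact_projection])
  then have E: "(\<lambda>x. exp \<rho> *\<^sub>R x) ` fst ` \<Omega> \<in> sets lborel" "emeasure lborel ((\<lambda>x. exp \<rho> *\<^sub>R x) ` fst ` \<Omega>) \<noteq> \<infinity>"
    using finite_lborel[OF order_refl cs] by (simp_all add: borel_compact)
  interpret T2: tube_data \<Omega> "\<lambda>s. exp \<rho> - s" "\<lambda>s. s" "\<lambda>s. -1" "\<lambda>s. 1" "sinh \<rho>" by (rule null_tube_data)
  have t2: "tube (\<lambda>s. exp \<rho> - s) (\<lambda>s. s) ` (S \<times> {0<..sinh \<rho>}) \<in> sets lborel"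
    "emeasure lborel (tube (\<lambda>s. exp \<rho> - s) (\<lambda>s. s) ` (S \<times> {0<..sinh \<rho>})) \<noteq> \<infinity>"
    using T2.tube_image_borel[OF S_borel order_refl]
    by (simp, intro finite_lborel[OF _ T2.compact_full_tube] image_mono) auto
  have "Vol_w (hyp_parallel_set \<Omega> \<rho>) = measure lborel ((\<lambda>x. exp \<rho> *\<^sub>R x) ` fst ` \<Omega>)
      + measure lborel (tube (\<lambda>s. exp \<rho> - s) (\<lambda>s. s) ` (S \<times> {0<..sinh \<rho>}))"
    unfolding P parallel_set_null_tube(1)[OF assms]
    by (rule measure_Union[OF E(2) t2(2) E(1) t2(1) parallel_set_null_tube(2)[OF assms]])
  \<comment> \<open>Space has dimension n + 1, hence the exponent.\<close>
  also have "measure lborel ((\<lambda>x. exp \<rho> *\<^sub>R x) ` fst ` \<Omega>) = Vol_w \<Omega> * exp ((real CARD('n) + 1) * \<rho>)"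
  proof -
    have "exp \<rho> ^ DIM(real^'n option) = exp (real (CARD('n) + 1) * \<rho>)"
      by (simp only: exp_of_nat_mult[symmetric]) (simp add: card_UNIV_option algebra_simps)
    then show ?thesis
      unfolding V using measure_lborel_scale[OF compact_projection, of "exp \<rho>"] by (simp add: add.commute mult.commute)
  qed
  finally show "Vol_w (hyp_parallel_set \<Omega> \<rho>) = Vol_w \<Omega> * exp ((real CARD('n) + 1) * \<rho>) +
      (\<Sum>k=0..CARD('n). 1 / (real k + 1) * (LINT p|\<mu>. gap p * \<sigma> k p) *
        (exp ((real CARD('n) - real k) * \<rho>) * sinh \<rho> ^ (k + 1)))"
    unfolding measure_null_tube[OF sh] .
qed

end

theorem theorem6p4:
  fixes \<Omega> :: "('n::finite option) minkowski set" and n :: nat and \<rho> :: real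
  assumes "n = CARD('n)"
    and "smooth_bounded_domain \<Omega>"
    and "uniformly_h_convex \<Omega>"
    and "\<rho> \<ge> 0"
  shows "(Vol_w (hyp_parallel_set \<Omega> \<rho>) - Vol_w \<Omega> =
      (\<Sum>k=0..n.
         (LINT p|area_measure (hyp_frontier \<Omega>).
            cosh (hyp_radius p) * elem_sym k (shifted_curvatures \<Omega> p)) *
         integral {0..\<rho>} (\<lambda>t. exp ((real n - real k + 1) * t) * sinh t ^ k)) -
      (\<Sum>k=0..n.
         (LINT p|area_measure (hyp_frontier \<Omega>).
            (cosh (hyp_radius p) - support_fun \<Omega> p) * elem_sym k (shifted_curvatures \<Omega> p)) *
         integral {0..\<rho>} (\<lambda>t. exp ((real n - real k) * t) * sinh t ^ (k + 1)))) \<and>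
    (Vol_w (hyp_parallel_set \<Omega> \<rho>) =
      Vol_w \<Omega> * exp ((real n + 1) * \<rho>) +
      (\<Sum>k=0..n. 1 / (real k + 1) *
         (LINT p|area_measure (hyp_frontier \<Omega>).
            (cosh (hyp_radius p) - support_fun \<Omega> p) * elem_sym k (shifted_curvatures \<Omega> p)) *
         (exp ((real n - real k) * \<rho>) * sinh \<rho> ^ (k + 1))))"
proof -
  obtain \<delta> where "\<delta> > 0" "\<And>p i. p \<in> hyp_frontier \<Omega> \<Longrightarrow> principal_curvatures \<Omega> p i > 1 + \<delta>"
    using assms(3) unfolding uniformly_h_convex_def by blast
  then have "principal_curvatures \<Omega> p i > 1" if "p \<in> hyp_frontier \<Omega>" for p i
    using that by (smt (verit))
  then interpret h_convex_domain \<Omega>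
    using assms(2) by unfold_locales (auto simp: smooth_bounded_domain_def)
  \<comment> \<open>On the boundary, which is the whole measure space, cosh r is the time coordinate
    of the point and the support function that of the normal.\<close>
  have "(LINT p|\<mu>. cosh (hyp_radius p) * \<sigma> k p) = (LINT p|\<mu>. snd p * \<sigma> k p)"
    "(LINT p|\<mu>. (cosh (hyp_radius p) - support_fun \<Omega> p) * \<sigma> k p) = (LINT p|\<mu>. gap p * \<sigma> k p)" for k
    using normal by (auto intro!: Bochner_Integration.integral_cong
        simp: space_area cosh_hyp_radius support_fun_def lorentz_radial_field)
  then show ?thesis
    using steiner_formulas[OF assms(4)] by (simp only: assms(1))
qed

end
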